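(* Let $k$ be a field, let $E$ be a finite quiver and write $R=P(\overline{E})$, $L=L(E)$. Then the following hold: (1) Let $N$ be a left $R$-module of finite $k$-dimension with a composition series $0<N_1<N_2<\dots<N_n=N$ of length $n$. Assume that exactly $r$ composition factors are isomorphic to modules in the set $\{\operatorname{coker}\nu_i : i\in E^0\setminus\mathrm{Sink}(E)\}$. Then $L\otimes_R N$ is a left $L$-module of finite length and its length is exactly $n-r$. (2) Let $M$ be a finitely presented left $L$-module. Then there is a finitely generated projective $L$-module $P$ such that $P\le M$ and $M/P$ is a module of finite length. (3) Every finitely presented left $L$-module $M$ of finite length is isomorphic to a module of the form $L\otimes_R N$, where $N$ is a left $R$-module of finite $k$-dimension.
   Context: Modules are left modules unless stated otherwise. $E=(E^0,E^1,r,s)$ is a finite quiver with source and range maps $s,r$. The inverse quiver $\overline{E}$ has the same vertices and, for each $e\in E^1$, an arrow $\overline{e}$ with $s(\overline e)=r(e)$, $r(\overline e)=s(e)$. The path algebra $P(\overline E)$ over $k$ has basis the set of all paths in $\overline E$ (sequences of arrows $f_1\cdots f_n$ with $r(f_t)=s(f_{t+1})$, and trivial paths $p_i$, $i\in E^0$), with product given by concatenation (zero if not composable). The Leavitt path algebra $L(E)=L_k(E)$ is the $k$-algebra generated by $\{p_v: v\in E^0\}\cup\{e,\overline e: e\in E^1\}$ subject to: $p_vp_{v'}=\delta_{v,v'}p_v$ (with $\sum_v p_v=1$); $p_{s(e)}e=ep_{r(e)}=e$; $p_{r(e)}\overline e=\overline e p_{s(e)}=\overline e$; $\overline e e'=\delta_{e,e'}p_{r(e)}$;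 and $p_v=\sum_{s(e)=v}e\overline e$ for every $v\in E^0$ that is not a sink. $P(\overline E)$ is regarded as a subalgebra of $L(E)$. $\mathrm{Sink}(E)=\{i\in E^0: s^{-1}(i)=\emptyset\}$. For $i\in E^0\setminus\mathrm{Sink}(E)$ with $s^{-1}(i)=\{e^i_1,\dots,e^i_{n_i}\}$, $\nu_i\colon\bigoplus_{j=1}^{n_i}P(\overline E)p_{r(e^i_j)}\to P(\overline E)p_i$ is the left $P(\overline E)$-module map $(r_1,\dots,r_{n_i})\mapsto\sum_j r_j\overline{e}^i_j$. *)

theory Defs
  imports "HOL-Algebra.QuotRing" "HOL-Algebra.Module" "HOL-Algebra.Free_Abelian_Groups"
    "Graph_Theory.Arc_Walk"
begin

section \<open>Left modules over not necessarily commutative rings\<close>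

text \<open>
  The record \<^type>\<open>module\<close> of HOL-Algebra is reused for left modules; its fields \<open>mult\<close> and
  \<open>one\<close> play no role, and the constructions below leave them undefined. The locale
  \<^locale>\<open>module\<close> itself asks for a commutative ring of scalars and is not applicable.
\<close>

locale left_module = R?: ring R + M?: abelian_group M
  for R :: "('r, 's) ring_scheme" (structure) and M :: "('r, 'a) module" (structure) +
  assumes smult_closed:
      "a \<in> carrier R \<Longrightarrow> x \<in> carrier M \<Longrightarrow> a \<odot>\<^bsub>M\<^esub> x \<in> carrier M"
    and smult_l_distr:
      "a \<in> carrier R \<Longrightarrow> b \<in> carrier R \<Longrightarrow> x \<in> carrier M \<Longrightarrow>
       (a \<oplus> b) \<odot>\<^bsub>M\<^esub> x = a \<odot>\<^bsub>M\<^esub> x \<oplus>\<^bsub>M\<^esub> b \<odot>\<^bsub>M\<^esub> x"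
    and smult_r_distr:
      "a \<in> carrier R \<Longrightarrow> x \<in> carrier M \<Longrightarrow> y \<in> carrier M \<Longrightarrow>
       a \<odot>\<^bsub>M\<^esub> (x \<oplus>\<^bsub>M\<^esub> y) = a \<odot>\<^bsub>M\<^esub> x \<oplus>\<^bsub>M\<^esub> a \<odot>\<^bsub>M\<^esub> y"
    and smult_assoc:
      "a \<in> carrier R \<Longrightarrow> b \<in> carrier R \<Longrightarrow> x \<in> carrier M \<Longrightarrow>
       (a \<otimes> b) \<odot>\<^bsub>M\<^esub> x = a \<odot>\<^bsub>M\<^esub> (b \<odot>\<^bsub>M\<^esub> x)"
    and smult_one:
      "x \<in> carrier M \<Longrightarrow> \<one> \<odot>\<^bsub>M\<^esub> x = x"

definition mod_hom ::
  "('r, 's) ring_scheme \<Rightarrow> ('r, 'a) module \<Rightarrow> ('r, 'b) module \<Rightarrow> ('a \<Rightarrow> 'b) set" where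
  "mod_hom R M N =
     {h. h \<in> carrier M \<rightarrow> carrier N \<and>
         (\<forall>x\<in>carrier M. \<forall>y\<in>carrier M. h (x \<oplus>\<^bsub>M\<^esub> y) = h x \<oplus>\<^bsub>N\<^esub> h y) \<and>
         (\<forall>a\<in>carrier R. \<forall>x\<in>carrier M. h (a \<odot>\<^bsub>M\<^esub> x) = a \<odot>\<^bsub>N\<^esub> h x)}"

definition mod_isomorphic ::
  "('r, 's) ring_scheme \<Rightarrow> ('r, 'a) module \<Rightarrow> ('r, 'b) module \<Rightarrow> bool" where
  "mod_isomorphic R M N \<longleftrightarrow>
     (\<exists>h\<in>mod_hom R M N. bij_betw h (carrier M) (carrier N))"

definition mod_quot :: "('r, 'a) module \<Rightarrow> 'a set \<Rightarrow> ('r, 'a set) module" where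
  "mod_quot M H =
     \<lparr>carrier = a_rcosets\<^bsub>M\<^esub> H, monoid.mult = undefined, one = undefined,
      ring.zero = H, ring.add = set_add M,
      smult = (\<lambda>a C. \<Union>x\<in>C. H +>\<^bsub>M\<^esub> (a \<odot>\<^bsub>M\<^esub> x))\<rparr>"

definition regular_module :: "('r, 's) ring_scheme \<Rightarrow> ('r, 'r) module" where
  "regular_module R =
     \<lparr>carrier = carrier R, monoid.mult = undefined, one = undefined,
      ring.zero = \<zero>\<^bsub>R\<^esub>, ring.add = ring.add R, smult = monoid.mult R\<rparr>"

definition free_module :: "('r, 's) ring_scheme \<Rightarrow> nat \<Rightarrow> ('r, nat \<Rightarrow> 'r) module" where
  "free_module R n =
     \<lparr>carrier = {..<n} \<rightarrow>\<^sub>E carrier R, monoid.mult = undefined, one = undefined,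
      ring.zero = (\<lambda>i\<in>{..<n}. \<zero>\<^bsub>R\<^esub>),
      ring.add = (\<lambda>f g. \<lambda>i\<in>{..<n}. f i \<oplus>\<^bsub>R\<^esub> g i),
      smult = (\<lambda>a f. \<lambda>i\<in>{..<n}. a \<otimes>\<^bsub>R\<^esub> f i)\<rparr>"

definition fin_generated :: "('r, 's) ring_scheme \<Rightarrow> ('r, 'a) module \<Rightarrow> bool" where
  "fin_generated R M \<longleftrightarrow> left_module R M \<and>
     (\<exists>S. finite S \<and> S \<subseteq> carrier M \<and> \<Inter>{H. submodule H R M \<and> S \<subseteq> H} = carrier M)"

text \<open>There is an exact sequence \<open>R^m \<rightarrow> R^n \<rightarrow> M \<rightarrow> 0\<close>.\<close>

definition fin_presented :: "('r, 's) ring_scheme \<Rightarrow> ('r, 'a) module \<Rightarrow> bool" where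
  "fin_presented R M \<longleftrightarrow> left_module R M \<and>
     (\<exists>m n. \<exists>f \<in> mod_hom R (free_module R m) (free_module R n).
            \<exists>g \<in> mod_hom R (free_module R n) M.
        g ` carrier (free_module R n) = carrier M \<and>
        f ` carrier (free_module R m) = a_kernel (free_module R n) M g)"

text \<open>
  The lifting property. HOL does not allow quantification over types inside a definition, so the
  test modules live on the fixed types \<open>'a \<Rightarrow> 'r\<close> and \<open>'a\<close>. This loses nothing: the type
  \<open>'a \<Rightarrow> 'r\<close> holds the free module on the set \<open>carrier P\<close>, and lifting the identity of \<open>P\<close> along
  the canonical surjection from it makes \<open>P\<close> a direct summand of a free module, whence the
  lifting property against surjections between arbitrary modules.
\<close>

definition projective :: "('r, 's) ring_scheme \<Rightarrow> ('r, 'a) module \<Rightarrow> bool" where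
  "projective R P \<longleftrightarrow> left_module R P \<and>
     (\<forall>(A :: ('r, 'a \<Rightarrow> 'r) module) (B :: ('r, 'a) module). \<forall>g\<in>mod_hom R A B. \<forall>f\<in>mod_hom R P B.
        left_module R A \<longrightarrow> left_module R B \<longrightarrow> g ` carrier A = carrier B \<longrightarrow>
        (\<exists>h\<in>mod_hom R P A. \<forall>x\<in>carrier P. g (h x) = f x))"

definition simple_module :: "('r, 's) ring_scheme \<Rightarrow> ('r, 'a) module \<Rightarrow> bool" where
  "simple_module R M \<longleftrightarrow> left_module R M \<and> carrier M \<noteq> {\<zero>\<^bsub>M\<^esub>} \<and>
     (\<forall>H. submodule H R M \<longrightarrow> H = {\<zero>\<^bsub>M\<^esub>} \<or> H = carrier M)"

definition comp_factor :: "('r, 'a) module \<Rightarrow> (nat \<Rightarrow> 'a set) \<Rightarrow> nat \<Rightarrow> ('r, 'a set) module" where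
  "comp_factor M F j = mod_quot (M\<lparr>carrier := F (Suc j)\<rparr>) (F j)"

definition composition_series ::
  "('r, 's) ring_scheme \<Rightarrow> ('r, 'a) module \<Rightarrow> nat \<Rightarrow> (nat \<Rightarrow> 'a set) \<Rightarrow> bool" where
  "composition_series R M n F \<longleftrightarrow>
     F 0 = {\<zero>\<^bsub>M\<^esub>} \<and> F n = carrier M \<and>
     (\<forall>j\<le>n. submodule (F j) R M) \<and>
     (\<forall>j<n. F j \<subset> F (Suc j) \<and> simple_module R (comp_factor M F j))"

definition finite_length :: "('r, 's) ring_scheme \<Rightarrow> ('r, 'a) module \<Rightarrow> bool" where
  "finite_length R M \<longleftrightarrow> left_module R M \<and> (\<exists>n F. composition_series R M n F)"

text \<open>Well defined for modules of finite length by the Jordan--Hoelder theorem.\<close>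

definition module_length :: "('r, 's) ring_scheme \<Rightarrow> ('r, 'a) module \<Rightarrow> nat" where
  "module_length R M = (THE n. \<exists>F. composition_series R M n F)"


section \<open>Extension of scalars\<close>

text \<open>
  The tensor product \<open>B \<otimes>\<^bsub>A\<^esub> N\<close>, where \<open>B\<close> is a right \<open>A\<close>-module via a ring homomorphism
  \<open>\<phi>\<close> from \<open>A\<close> to \<open>B\<close>: the free abelian group on \<open>B \<times> N\<close> modulo the subgroup generated by the
  biadditivity and balancing relations.
\<close>

definition tensor_rels ::
  "('a, 's) ring_scheme \<Rightarrow> ('b, 't) ring_scheme \<Rightarrow> ('a \<Rightarrow> 'b) \<Rightarrow> ('a, 'n) module
     \<Rightarrow> ('b \<times> 'n \<Rightarrow>\<^sub>0 int) set" where
  "tensor_rels A B \<phi> N =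
     {frag_of (b \<oplus>\<^bsub>B\<^esub> b', x) - frag_of (b, x) - frag_of (b', x) | b b' x.
        b \<in> carrier B \<and> b' \<in> carrier B \<and> x \<in> carrier N} \<union>
     {frag_of (b, x \<oplus>\<^bsub>N\<^esub> x') - frag_of (b, x) - frag_of (b, x') | b x x'.
        b \<in> carrier B \<and> x \<in> carrier N \<and> x' \<in> carrier N} \<union>
     {frag_of (b \<otimes>\<^bsub>B\<^esub> \<phi> a, x) - frag_of (b, a \<odot>\<^bsub>N\<^esub> x) | a b x.
        a \<in> carrier A \<and> b \<in> carrier B \<and> x \<in> carrier N}"

definition tensor_ext ::
  "('a, 's) ring_scheme \<Rightarrow> ('b, 't) ring_scheme \<Rightarrow> ('a \<Rightarrow> 'b) \<Rightarrow> ('a, 'n) module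
     \<Rightarrow> ('b, ('b \<times> 'n \<Rightarrow>\<^sub>0 int) set) module" where
  "tensor_ext A B \<phi> N =
     (let F = free_Abelian_group (carrier B \<times> carrier N);
          K = generate F (tensor_rels A B \<phi> N)
      in \<lparr>carrier = carrier (F Mod K), monoid.mult = undefined, one = undefined,
          ring.zero = \<one>\<^bsub>F Mod K\<^esub>, ring.add = monoid.mult (F Mod K),
          smult = (\<lambda>b C. \<Union>z\<in>C. K #>\<^bsub>F\<^esub> frag_extend (\<lambda>(b', x). frag_of (b \<otimes>\<^bsub>B\<^esub> b', x)) z)\<rparr>)"


section \<open>Path algebras\<close>

text \<open>
  A finite quiver is a \<^locale>\<open>fin_digraph\<close> \<open>E\<close>, with source map \<open>tail E\<close> and range map
  \<open>head E\<close>. A path is a pair of its first vertex and its list of arrows, so that \<open>(v, [])\<close> is the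
  trivial path at \<open>v\<close>.
\<close>

definition paths :: "('v, 'e) pre_digraph \<Rightarrow> ('v \<times> 'e list) set" where
  "paths E = {(u, es). \<exists>v. pre_digraph.awalk E u es v}"

text \<open>
  Elements are finitely supported functions on paths. A path \<open>(v, es)\<close> factors into two paths in
  exactly \<open>length es + 1\<close> ways, whence the product formula.
\<close>

definition path_algebra :: "('v, 'e) pre_digraph \<Rightarrow> ('v \<times> 'e list \<Rightarrow> 'k::field) ring" where
  "path_algebra E =
     \<lparr>carrier = {f. finite {p. f p \<noteq> 0} \<and> {p. f p \<noteq> 0} \<subseteq> paths E},
      monoid.mult = (\<lambda>f g (v, es). \<Sum>i\<le>length es.
                f (v, take i es) * g (last (pre_digraph.awalk_verts E v (take i es)), drop i es)),
      one = (\<lambda>(v, es). if v \<in> verts E \<and> es = [] then 1 else 0),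
      ring.zero = (\<lambda>_. 0),
      ring.add = (\<lambda>f g p. f p + g p)\<rparr>"

definition path_elem :: "'p \<Rightarrow> 'p \<Rightarrow> 'k::field" where
  "path_elem p = (\<lambda>q. if q = p then 1 else 0)"

text \<open>The element \<open>c \<cdot> 1\<close> of the path algebra.\<close>

definition path_scalar :: "('v, 'e) pre_digraph \<Rightarrow> 'k::field \<Rightarrow> 'v \<times> 'e list \<Rightarrow> 'k" where
  "path_scalar E c = (\<lambda>(v, es). if v \<in> verts E \<and> es = [] then c else 0)"

text \<open>Finite dimension over the ground field, acting through the multiples of the identity.
  Every such module is isomorphic to one whose carrier lies in the type \<open>nat \<Rightarrow> 'k\<close> (tuples of
  coordinates), so existence claims about them may be made on that type.\<close>

definition fin_dim ::
  "('v, 'e) pre_digraph \<Rightarrow> ('v \<times> 'e list \<Rightarrow> 'k::field, 'n) module \<Rightarrow> bool" where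
  "fin_dim E N \<longleftrightarrow>
     (\<exists>B. finite B \<and> B \<subseteq> carrier N \<and>
        (\<forall>x\<in>carrier N. \<exists>c :: 'n \<Rightarrow> 'k. x = (\<Oplus>\<^bsub>N\<^esub>b\<in>B. path_scalar E (c b) \<odot>\<^bsub>N\<^esub> b)))"

text \<open>The arrow \<open>e\<close> of \<open>inverse_quiver E\<close> is the formal inverse of the arrow \<open>e\<close> of \<open>E\<close>.\<close>

definition inverse_quiver :: "('v, 'e) pre_digraph \<Rightarrow> ('v, 'e) pre_digraph" where
  "inverse_quiver E = \<lparr>verts = verts E, arcs = arcs E, tail = head E, head = tail E\<rparr>"

definition sinks :: "('v, 'e) pre_digraph \<Rightarrow> 'v set" where
  "sinks E = {v \<in> verts E. out_arcs E v = {}}"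


section \<open>Leavitt path algebras\<close>

datatype ('v, 'e) lpa_gen = Vert 'v | Arr 'e | Inv 'e

text \<open>The free algebra on a set is the path algebra of the quiver with one vertex whose loops are
  the elements of the set.\<close>

definition free_algebra :: "'x set \<Rightarrow> (unit \<times> 'x list \<Rightarrow> 'k::field) ring" where
  "free_algebra S =
     path_algebra \<lparr>verts = {()}, arcs = S, tail = (\<lambda>_. ()), head = (\<lambda>_. ())\<rparr>"

definition lpa_free ::
  "('v, 'e) pre_digraph \<Rightarrow> (unit \<times> ('v, 'e) lpa_gen list \<Rightarrow> 'k::field) ring" where
  "lpa_free E = free_algebra (Vert ` verts E \<union> Arr ` arcs E \<union> Inv ` arcs E)"

abbreviation lpa_letter :: "('v, 'e) lpa_gen \<Rightarrow> unit \<times> ('v, 'e) lpa_gen list \<Rightarrow> 'k::field" where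
  "lpa_letter x \<equiv> path_elem ((), [x])"

definition lpa_rels ::
  "('v, 'e) pre_digraph \<Rightarrow> (unit \<times> ('v, 'e) lpa_gen list \<Rightarrow> 'k::field) set" where
  "lpa_rels E =
     (let F = lpa_free E;
          p = (\<lambda>v. lpa_letter (Vert v));
          a = (\<lambda>e. lpa_letter (Arr e));
          b = (\<lambda>e. lpa_letter (Inv e))
      in {p v \<otimes>\<^bsub>F\<^esub> p w \<ominus>\<^bsub>F\<^esub> (if v = w then p v else \<zero>\<^bsub>F\<^esub>) | v w.
            v \<in> verts E \<and> w \<in> verts E} \<union>
         {(\<Oplus>\<^bsub>F\<^esub>v\<in>verts E. p v) \<ominus>\<^bsub>F\<^esub> \<one>\<^bsub>F\<^esub>} \<union>
         {p (tail E e) \<otimes>\<^bsub>F\<^esub> a e \<ominus>\<^bsub>F\<^esub> a e | e. e \<in> arcs E} \<union>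
         {a e \<otimes>\<^bsub>F\<^esub> p (head E e) \<ominus>\<^bsub>F\<^esub> a e | e. e \<in> arcs E} \<union>
         {p (head E e) \<otimes>\<^bsub>F\<^esub> b e \<ominus>\<^bsub>F\<^esub> b e | e. e \<in> arcs E} \<union>
         {b e \<otimes>\<^bsub>F\<^esub> p (tail E e) \<ominus>\<^bsub>F\<^esub> b e | e. e \<in> arcs E} \<union>
         {b e \<otimes>\<^bsub>F\<^esub> a e' \<ominus>\<^bsub>F\<^esub> (if e = e' then p (head E e) else \<zero>\<^bsub>F\<^esub>) | e e'.
            e \<in> arcs E \<and> e' \<in> arcs E} \<union>
         {p v \<ominus>\<^bsub>F\<^esub> (\<Oplus>\<^bsub>F\<^esub>e\<in>out_arcs E v. a e \<otimes>\<^bsub>F\<^esub> b e) | v. v \<in> verts E - sinks E})"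

definition leavitt ::
  "('v, 'e) pre_digraph \<Rightarrow> (unit \<times> ('v, 'e) lpa_gen list \<Rightarrow> 'k::field) set ring" where
  "leavitt E = lpa_free E Quot (Idl\<^bsub>lpa_free E\<^esub> (lpa_rels E))"

text \<open>
  The canonical map from \<open>path_algebra (inverse_quiver E)\<close> to \<open>leavitt E\<close> by which the former is
  regarded as a subalgebra of the latter: the linear extension of the map sending a trivial path to
  its vertex and any other path to the product of its arrows.
\<close>

definition inverse_path_word :: "'v \<times> 'e list \<Rightarrow> ('v, 'e) lpa_gen list" where
  "inverse_path_word = (\<lambda>(v, es). if es = [] then [Vert v] else map Inv es)"

definition lpa_incl ::
  "('v, 'e) pre_digraph \<Rightarrow> ('v \<times> 'e list \<Rightarrow> 'k::field)
     \<Rightarrow> (unit \<times> ('v, 'e) lpa_gen list \<Rightarrow> 'k) set" where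
  "lpa_incl E f =
     (Idl\<^bsub>lpa_free E\<^esub> (lpa_rels E)) +>\<^bsub>lpa_free E\<^esub>
       (\<lambda>q. \<Sum>p | f p \<noteq> 0. f p * path_elem ((), inverse_path_word p) q)"


section \<open>The modules \<open>coker \<nu>\<^sub>i\<close>\<close>

definition right_corner :: "('v, 'e) pre_digraph \<Rightarrow> 'v \<Rightarrow> ('v \<times> 'e list \<Rightarrow> 'k::field) set" where
  "right_corner E i =
     {f \<otimes>\<^bsub>path_algebra (inverse_quiver E)\<^esub> path_elem (i, []) | f.
        f \<in> carrier (path_algebra (inverse_quiver E))}"

text \<open>
  The direct sum over the arrows \<open>e\<close> with source \<open>i\<close> of the modules \<open>right_corner E (head E e)\<close> is
  rendered as a set of functions on those arrows. In \<open>inverse_quiver E\<close> the arrow \<open>e\<close>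
  starts at \<open>head E e\<close>.
\<close>

definition nu ::
  "('v, 'e) pre_digraph \<Rightarrow> 'v \<Rightarrow> ('e \<Rightarrow> ('v \<times> 'e list \<Rightarrow> 'k::field)) \<Rightarrow> 'v \<times> 'e list \<Rightarrow> 'k" where
  "nu E i r =
     (\<Oplus>\<^bsub>path_algebra (inverse_quiver E)\<^esub>e\<in>out_arcs E i.
        r e \<otimes>\<^bsub>path_algebra (inverse_quiver E)\<^esub> path_elem (head E e, [e]))"

definition coker_nu ::
  "('v, 'e) pre_digraph \<Rightarrow> 'v
     \<Rightarrow> ('v \<times> 'e list \<Rightarrow> 'k::field, ('v \<times> 'e list \<Rightarrow> 'k) set) module" where
  "coker_nu E i =
     mod_quot ((regular_module (path_algebra (inverse_quiver E)))\<lparr>carrier := right_corner E i\<rparr>)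
       (nu E i ` (\<Pi>\<^sub>E e\<in>out_arcs E i. right_corner E (head E e)))"

end

(*
  For an R-submodule H of an R-module N put dstep N H = {x | e^- x in H for all arrows e, and
  p_v x in H for all sinks v}, and let dcl N H be the union of its iterates. If M is an L-module,
  then dcl M H is the L-submodule generated by H. Letting words in the generators of L act from the
  right on functions on long paths shows that 1 (x) x = 0 in L (x) N forces x into dcl N 0. So a
  submodule F_j of N gives the submodule dcl F_j of L (x) N, and along a composition series these
  are equal or cover each other, being equal exactly when the factor is some coker nu_i; this is (1).

  Let M be finitely presented, with relations of degree at most d in a free R-module of rank n. A
  maximal set of monomials of degree d that is independent modulo relations and lower degrees
  generates a free R-submodule Q of R^n that embeds in M. Then P = L Q = L (x) Q is projective and
  every L-submodule of M containing P is determined by elements of degree less than d, which is (2).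
  If M has finite length, Q involves no long paths, since these contain closed paths z and the
  powers of 1 - z would give an infinite descending chain. Hence the image N of R^n in M is finite
  dimensional, and M = L (x) N, which is (3).
*)

theory Submission
  imports Defs
begin

section \<open>Left modules\<close>

text \<open>Among the defining relations of \<open>L\<close>, only \<open>p_v = \<Sum> e e^-\<close>
  fails for the right action on functions on paths, and it fails just at the trivial path of a
  non-sink. Equality in \<open>L\<close> is therefore visible only on paths beyond some threshold.
  Paths that start at a sink of \<open>E\<close> cannot be prolonged on the left, so they must count
  as long whatever their length. The threshold reappears in modules as a number of iterations: if
  all paths long for \<open>n\<close> annihilate \<open>x\<close>, then \<open>x\<close> lies in the
  \<open>n\<close>-th iterate of \<open>dstep\<close> on 0.

  Injectivity of maps out of \<open>L \<otimes> N\<close> comes from the same source: finitely many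
  applications of arrows \<open>e^-\<close> and sink vertices bring an element into the image of
  \<open>N\<close>, and in an \<open>L\<close>-module only 0 is annihilated by all of these
  operators.

  In (2) the degree \<open>d\<close> is chosen so that left division of a relation by an arrow gives
  a relation again, up to degrees below \<open>d\<close>. This carries independence from degree
  \<open>d\<close> to all higher degrees. One counting device, the jumps of a subgroup along a
  chain, gives both the invariance of the length and the finite length of
  \<open>M/P\<close>.\<close>

lemma submodule_subset: "submodule H R M \<Longrightarrow> H \<subseteq> carrier M"
  unfolding submodule_def subgroup_def by auto

lemma submodule_mem: "submodule H R M \<Longrightarrow> x \<in> H \<Longrightarrow> x \<in> carrier M"
  using submodule_subset by blast

lemma submodule_zero: "submodule H R M \<Longrightarrow> \<zero>\<^bsub>M\<^esub> \<in> H"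
  unfolding submodule_def subgroup_def by auto

lemma submodule_add: "submodule H R M \<Longrightarrow> x \<in> H \<Longrightarrow> y \<in> H \<Longrightarrow> x \<oplus>\<^bsub>M\<^esub> y \<in> H"
  unfolding submodule_def subgroup_def by auto

lemma submodule_neg: "submodule H R M \<Longrightarrow> x \<in> H \<Longrightarrow> \<ominus>\<^bsub>M\<^esub> x \<in> H"
  unfolding submodule_def subgroup_def by (auto simp: a_inv_def)

lemma submodule_minus: "submodule H R M \<Longrightarrow> x \<in> H \<Longrightarrow> y \<in> H \<Longrightarrow> x \<ominus>\<^bsub>M\<^esub> y \<in> H"
  by (simp add: a_minus_def submodule_add submodule_neg)

lemma submodule_smult: "submodule H R M \<Longrightarrow> a \<in> carrier R \<Longrightarrow> x \<in> H \<Longrightarrow> a \<odot>\<^bsub>M\<^esub> x \<in> H"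
  by (simp add: submodule.smult_closed)

lemma submodule_subgroup: "submodule H R M \<Longrightarrow> subgroup H (add_monoid M)"
  by (simp add: submodule_def)

lemmas submoduleD = submodule_zero submodule_add submodule_neg submodule_minus submodule_smult

lemma left_moduleI:
  assumes "ring R" "abelian_group M"
    and "\<And>a x. a \<in> carrier R \<Longrightarrow> x \<in> carrier M \<Longrightarrow> a \<odot>\<^bsub>M\<^esub> x \<in> carrier M"
    and "\<And>a b x. a \<in> carrier R \<Longrightarrow> b \<in> carrier R \<Longrightarrow> x \<in> carrier M \<Longrightarrow>
       (a \<oplus>\<^bsub>R\<^esub> b) \<odot>\<^bsub>M\<^esub> x = a \<odot>\<^bsub>M\<^esub> x \<oplus>\<^bsub>M\<^esub> b \<odot>\<^bsub>M\<^esub> x"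
    and "\<And>a x y. a \<in> carrier R \<Longrightarrow> x \<in> carrier M \<Longrightarrow> y \<in> carrier M \<Longrightarrow>
       a \<odot>\<^bsub>M\<^esub> (x \<oplus>\<^bsub>M\<^esub> y) = a \<odot>\<^bsub>M\<^esub> x \<oplus>\<^bsub>M\<^esub> a \<odot>\<^bsub>M\<^esub> y"
    and "\<And>a b x. a \<in> carrier R \<Longrightarrow> b \<in> carrier R \<Longrightarrow> x \<in> carrier M \<Longrightarrow>
       (a \<otimes>\<^bsub>R\<^esub> b) \<odot>\<^bsub>M\<^esub> x = a \<odot>\<^bsub>M\<^esub> (b \<odot>\<^bsub>M\<^esub> x)"
    and "\<And>x. x \<in> carrier M \<Longrightarrow> \<one>\<^bsub>R\<^esub> \<odot>\<^bsub>M\<^esub> x = x"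
  shows "left_module R M"
  using assms by (simp add: left_module_def left_module_axioms_def)

context left_module
begin

lemma left_module_self: "left_module R M"
  by (rule left_module_axioms)

lemma smult_l_zero: "x \<in> carrier M \<Longrightarrow> \<zero> \<odot>\<^bsub>M\<^esub> x = \<zero>\<^bsub>M\<^esub>"
  using smult_l_distr[of \<zero> \<zero> x] smult_closed[of \<zero> x]
  by (metis M.add.r_cancel_one' R.zero_closed R.l_zero)

lemma smult_r_zero: "a \<in> carrier R \<Longrightarrow> a \<odot>\<^bsub>M\<^esub> \<zero>\<^bsub>M\<^esub> = \<zero>\<^bsub>M\<^esub>"
  using smult_r_distr[of a "\<zero>\<^bsub>M\<^esub>" "\<zero>\<^bsub>M\<^esub>"] smult_closed[of a "\<zero>\<^bsub>M\<^esub>"]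
  by (metis M.add.r_cancel_one' M.zero_closed M.l_zero)

lemma smult_r_neg: "a \<in> carrier R \<Longrightarrow> x \<in> carrier M \<Longrightarrow> a \<odot>\<^bsub>M\<^esub> (\<ominus>\<^bsub>M\<^esub> x) = \<ominus>\<^bsub>M\<^esub> (a \<odot>\<^bsub>M\<^esub> x)"
  using smult_r_distr[of a "\<ominus>\<^bsub>M\<^esub> x" x] smult_closed[of a x] smult_closed[of a "\<ominus>\<^bsub>M\<^esub> x"]
  by (metis M.a_inv_closed M.l_neg M.minus_equality smult_r_zero)

lemma smult_l_neg: "a \<in> carrier R \<Longrightarrow> x \<in> carrier M \<Longrightarrow> (\<ominus> a) \<odot>\<^bsub>M\<^esub> x = \<ominus>\<^bsub>M\<^esub> (a \<odot>\<^bsub>M\<^esub> x)"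
  using smult_l_distr[of "\<ominus> a" a x] smult_closed[of a x] smult_closed[of "\<ominus> a" x]
  by (metis R.a_inv_closed R.l_neg M.minus_equality smult_l_zero)

lemma smult_r_diff:
  "a \<in> carrier R \<Longrightarrow> x \<in> carrier M \<Longrightarrow> y \<in> carrier M \<Longrightarrow>
    a \<odot>\<^bsub>M\<^esub> (x \<ominus>\<^bsub>M\<^esub> y) = a \<odot>\<^bsub>M\<^esub> x \<ominus>\<^bsub>M\<^esub> a \<odot>\<^bsub>M\<^esub> y"
  by (simp add: a_minus_def smult_r_distr smult_r_neg)

lemma smult_finsum_r:
  "finite A \<Longrightarrow> a \<in> carrier R \<Longrightarrow> f \<in> A \<rightarrow> carrier M \<Longrightarrow>
     a \<odot>\<^bsub>M\<^esub> (\<Oplus>\<^bsub>M\<^esub> i \<in> A. f i) = (\<Oplus>\<^bsub>M\<^esub> i \<in> A. a \<odot>\<^bsub>M\<^esub> f i)"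
  by (induct set: finite) (simp_all add: smult_r_zero Pi_def smult_r_distr smult_closed)

lemma smult_finsum_l:
  "finite A \<Longrightarrow> f \<in> A \<rightarrow> carrier R \<Longrightarrow> x \<in> carrier M \<Longrightarrow>
     (\<Oplus> i \<in> A. f i) \<odot>\<^bsub>M\<^esub> x = (\<Oplus>\<^bsub>M\<^esub> i \<in> A. f i \<odot>\<^bsub>M\<^esub> x)"
  by (induct set: finite) (simp_all add: smult_l_zero Pi_def smult_l_distr smult_closed)

lemma submoduleI:
  assumes "H \<subseteq> carrier M" "\<zero>\<^bsub>M\<^esub> \<in> H"
    and "\<And>x y. x \<in> H \<Longrightarrow> y \<in> H \<Longrightarrow> x \<oplus>\<^bsub>M\<^esub> y \<in> H"
    and sm: "\<And>a x. a \<in> carrier R \<Longrightarrow> x \<in> H \<Longrightarrow> a \<odot>\<^bsub>M\<^esub> x \<in> H"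
  shows "submodule H R M"
proof -
  have "\<ominus>\<^bsub>M\<^esub> x \<in> H" if "x \<in> H" for x
    using sm[of "\<ominus> \<one>" x] that assms(1) smult_l_neg[of \<one> x] smult_one[of x]
    by (metis R.a_inv_closed R.one_closed subsetD)
  then show ?thesis
    using assms by (simp add: submodule_def submodule_axioms_def subgroup_def a_inv_def)
qed

lemma submodule_carrier: "submodule (carrier M) R M"
  by (rule submoduleI) (auto intro: smult_closed)

lemma submodule_trivial: "submodule {\<zero>\<^bsub>M\<^esub>} R M"
  by (rule submoduleI) (auto simp: smult_r_zero)

lemma submodule_Int: "submodule H R M \<Longrightarrow> submodule K R M \<Longrightarrow> submodule (H \<inter> K) R M"
  by (rule submoduleI) (auto dest: submodule_mem intro: submoduleD)

lemma submodule_Inter: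
  assumes "\<And>H. H \<in> \<H> \<Longrightarrow> submodule H R M" "\<H> \<noteq> {}"
  shows "submodule (\<Inter>\<H>) R M"
  by (rule submoduleI)
    (use assms in \<open>auto dest: submodule_mem intro: submodule_zero[OF assms(1)]
      submodule_add[OF assms(1)] submodule_smult[OF assms(1)]\<close>)

lemma submodule_left_module:
  assumes H: "submodule H R M"
  shows "left_module R (M\<lparr>carrier := H\<rparr>)"
proof (rule left_moduleI)
  show "abelian_group (M\<lparr>carrier := H\<rparr>)"
  proof (rule abelian_groupI)
    fix x assume "x \<in> carrier (M\<lparr>carrier := H\<rparr>)"
    then show "\<exists>y\<in>carrier (M\<lparr>carrier := H\<rparr>). y \<oplus>\<^bsub>M\<lparr>carrier := H\<rparr>\<^esub> x = \<zero>\<^bsub>M\<lparr>carrier := H\<rparr>\<^esub>"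
      using submodule_neg[OF H] submodule_mem[OF H] M.l_neg by auto
  qed (use submodule_mem[OF H] submoduleD[OF H] in \<open>auto simp: M.a_ac\<close>)
qed (use submodule_mem[OF H] submoduleD[OF H] in
    \<open>auto simp: R.ring_axioms smult_l_distr smult_r_distr smult_assoc smult_one\<close>)

lemma submodule_restrict_iff:
  assumes "submodule B R M"
  shows "submodule H R (M\<lparr>carrier := B\<rparr>) \<longleftrightarrow> submodule H R M \<and> H \<subseteq> B" (is "?l \<longleftrightarrow> ?r")
proof
  interpret B: left_module R "M\<lparr>carrier := B\<rparr>" by (rule submodule_left_module[OF assms])
  assume ?l
  then show ?r
    using submodule_subset[OF \<open>?l\<close>] submodule_subset[OF assms]
      submodule_zero[OF \<open>?l\<close>] submodule_add[OF \<open>?l\<close>] submodule_smult[OF \<open>?l\<close>]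
    by (auto intro!: submoduleI)
next
  interpret B: left_module R "M\<lparr>carrier := B\<rparr>" by (rule submodule_left_module[OF assms])
  assume ?r
  then show ?l
    by (intro B.submoduleI) (auto intro: submoduleD)
qed

lemma submodule_sum:
  assumes H: "submodule H R M" and K: "submodule K R M"
  shows "submodule {x \<oplus>\<^bsub>M\<^esub> y | x y. x \<in> H \<and> y \<in> K} R M"
proof (rule submoduleI)
  note m = submodule_mem[OF H] submodule_mem[OF K]
  show "{x \<oplus>\<^bsub>M\<^esub> y | x y. x \<in> H \<and> y \<in> K} \<subseteq> carrier M"
    using m by auto
  have "\<zero>\<^bsub>M\<^esub> = \<zero>\<^bsub>M\<^esub> \<oplus>\<^bsub>M\<^esub> \<zero>\<^bsub>M\<^esub>" by simp
  then show "\<zero>\<^bsub>M\<^esub> \<in> {x \<oplus>\<^bsub>M\<^esub> y | x y. x \<in> H \<and> y \<in> K}"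
    using submodule_zero[OF H] submodule_zero[OF K] by blast
next
  fix u v assume "u \<in> {x \<oplus>\<^bsub>M\<^esub> y | x y. x \<in> H \<and> y \<in> K}" "v \<in> {x \<oplus>\<^bsub>M\<^esub> y | x y. x \<in> H \<and> y \<in> K}"
  then obtain x y x' y' where *: "x \<in> H" "y \<in> K" "x' \<in> H" "y' \<in> K"
    "u = x \<oplus>\<^bsub>M\<^esub> y" "v = x' \<oplus>\<^bsub>M\<^esub> y'" by blast
  then have "u \<oplus>\<^bsub>M\<^esub> v = (x \<oplus>\<^bsub>M\<^esub> x') \<oplus>\<^bsub>M\<^esub> (y \<oplus>\<^bsub>M\<^esub> y')"
    using submodule_mem[OF H] submodule_mem[OF K] by (simp add: M.a_ac)
  then show "u \<oplus>\<^bsub>M\<^esub> v \<in> {x \<oplus>\<^bsub>M\<^esub> y | x y. x \<in> H \<and> y \<in> K}"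
    using * submodule_add[OF H] submodule_add[OF K] by blast
next
  fix a u assume a: "a \<in> carrier R" and "u \<in> {x \<oplus>\<^bsub>M\<^esub> y | x y. x \<in> H \<and> y \<in> K}"
  then obtain x y where *: "x \<in> H" "y \<in> K" "u = x \<oplus>\<^bsub>M\<^esub> y" by blast
  then have "a \<odot>\<^bsub>M\<^esub> u = a \<odot>\<^bsub>M\<^esub> x \<oplus>\<^bsub>M\<^esub> a \<odot>\<^bsub>M\<^esub> y"
    using a submodule_mem[OF H] submodule_mem[OF K] by (simp add: smult_r_distr)
  then show "a \<odot>\<^bsub>M\<^esub> u \<in> {x \<oplus>\<^bsub>M\<^esub> y | x y. x \<in> H \<and> y \<in> K}"
    using * a submodule_smult[OF H] submodule_smult[OF K] by blast
qed

definition span :: "'a set \<Rightarrow> 'a set" where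
  "span S = \<Inter>{H. submodule H R M \<and> S \<subseteq> H}"

lemma submodule_span: "S \<subseteq> carrier M \<Longrightarrow> submodule (span S) R M"
  unfolding span_def using submodule_carrier by (intro submodule_Inter) auto

lemma span_superset: "S \<subseteq> span S"
  unfolding span_def by blast

lemma span_minimal: "submodule H R M \<Longrightarrow> S \<subseteq> H \<Longrightarrow> span S \<subseteq> H"
  unfolding span_def by blast

end

subsection \<open>Homomorphisms\<close>

lemma mod_homD:
  assumes "h \<in> mod_hom R M N"
  shows "x \<in> carrier M \<Longrightarrow> h x \<in> carrier N"
    and "x \<in> carrier M \<Longrightarrow> y \<in> carrier M \<Longrightarrow> h (x \<oplus>\<^bsub>M\<^esub> y) = h x \<oplus>\<^bsub>N\<^esub> h y"
    and "a \<in> carrier R \<Longrightarrow> x \<in> carrier M \<Longrightarrow> h (a \<odot>\<^bsub>M\<^esub> x) = a \<odot>\<^bsub>N\<^esub> h x"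
  using assms unfolding mod_hom_def by auto

lemma mod_homI:
  assumes "\<And>x. x \<in> carrier M \<Longrightarrow> h x \<in> carrier N"
    and "\<And>x y. x \<in> carrier M \<Longrightarrow> y \<in> carrier M \<Longrightarrow> h (x \<oplus>\<^bsub>M\<^esub> y) = h x \<oplus>\<^bsub>N\<^esub> h y"
    and "\<And>a x. a \<in> carrier R \<Longrightarrow> x \<in> carrier M \<Longrightarrow> h (a \<odot>\<^bsub>M\<^esub> x) = a \<odot>\<^bsub>N\<^esub> h x"
  shows "h \<in> mod_hom R M N"
  using assms unfolding mod_hom_def by auto

lemma mod_hom_comp:
  "g \<in> mod_hom R M N \<Longrightarrow> h \<in> mod_hom R N P \<Longrightarrow> (\<lambda>x. h (g x)) \<in> mod_hom R M P"
  by (rule mod_homI) (auto simp: mod_homD)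

lemma (in abelian_group) minus_eq_zero_iff:
  "x \<in> carrier G \<Longrightarrow> y \<in> carrier G \<Longrightarrow> x \<ominus> y = \<zero> \<longleftrightarrow> x = y"
  unfolding a_minus_def by (metis a_inv_closed l_neg minus_equality minus_minus r_neg)

lemma (in abelian_group) minus_self: "x \<in> carrier G \<Longrightarrow> x \<ominus> x = \<zero>"
  by (simp add: minus_eq_zero_iff)

lemma (in abelian_group) diff_add_cancel:
  "x \<in> carrier G \<Longrightarrow> y \<in> carrier G \<Longrightarrow> (x \<ominus> y) \<oplus> y = x"
  by (simp add: a_minus_def a_assoc l_neg)

lemma (in abelian_group) add_diff_cancel:
  "x \<in> carrier G \<Longrightarrow> y \<in> carrier G \<Longrightarrow> (x \<oplus> y) \<ominus> y = x"
  by (simp add: a_minus_def a_assoc r_neg)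

locale left_module_hom = M: left_module R M + N: left_module R N
  for R :: "('r, 's) ring_scheme" and M :: "('r, 'a) module" and N :: "('r, 'b) module" +
  fixes h
  assumes hom: "h \<in> mod_hom R M N"
begin

lemmas hom_closed = mod_homD(1)[OF hom]
lemmas hom_add = mod_homD(2)[OF hom]
lemmas hom_smult = mod_homD(3)[OF hom]

lemma hom_zero: "h \<zero>\<^bsub>M\<^esub> = \<zero>\<^bsub>N\<^esub>"
  by (metis M.zero_closed M.l_zero N.add.r_cancel_one' hom_add hom_closed)

lemma hom_neg: "x \<in> carrier M \<Longrightarrow> h (\<ominus>\<^bsub>M\<^esub> x) = \<ominus>\<^bsub>N\<^esub> h x"
  by (metis M.a_inv_closed M.l_neg N.minus_equality hom_add hom_closed hom_zero)

lemma hom_diff: "x \<in> carrier M \<Longrightarrow> y \<in> carrier M \<Longrightarrow> h (x \<ominus>\<^bsub>M\<^esub> y) = h x \<ominus>\<^bsub>N\<^esub> h y"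
  by (simp add: a_minus_def hom_add hom_neg hom_closed)

lemma hom_eq_iff: "x \<in> carrier M \<Longrightarrow> y \<in> carrier M \<Longrightarrow> h x = h y \<longleftrightarrow> h (x \<ominus>\<^bsub>M\<^esub> y) = \<zero>\<^bsub>N\<^esub>"
  using N.minus_eq_zero_iff[of "h x" "h y"] by (simp add: hom_diff hom_closed)

lemma submodule_image: "submodule H R M \<Longrightarrow> submodule (h ` H) R N"
proof (rule N.submoduleI)
  assume H: "submodule H R M"
  note m = submodule_mem[OF H]
  show "h ` H \<subseteq> carrier N" using hom_closed m by auto
  show "\<zero>\<^bsub>N\<^esub> \<in> h ` H" using hom_zero submodule_zero[OF H] by force
  show "x \<oplus>\<^bsub>N\<^esub> y \<in> h ` H" if xy: "x \<in> h ` H" "y \<in> h ` H" for x y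
  proof -
    obtain u v where "u \<in> H" "v \<in> H" "x = h u" "y = h v" using xy by blast
    then show ?thesis using hom_add[of u v] m submodule_add[OF H, of u v] by (metis image_eqI)
  qed
  show "a \<odot>\<^bsub>N\<^esub> x \<in> h ` H" if a: "a \<in> carrier R" "x \<in> h ` H" for a x
  proof -
    obtain u where "u \<in> H" "x = h u" using a by blast
    then show ?thesis using hom_smult[of a u] m a submodule_smult[OF H, of a u] by (metis image_eqI)
  qed
qed

lemma submodule_vimage:
  "submodule T R N \<Longrightarrow> submodule {x \<in> carrier M. h x \<in> T} R M"
  by (rule M.submoduleI) (auto simp: hom_zero hom_add hom_smult M.smult_closed intro: submoduleD)

lemma submodule_kernel: "submodule {x \<in> carrier M. h x = \<zero>\<^bsub>N\<^esub>} R M"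
  using submodule_vimage[OF N.submodule_trivial] by simp

lemma inj_on_iff_kernel:
  "inj_on h (carrier M) \<longleftrightarrow> (\<forall>x\<in>carrier M. h x = \<zero>\<^bsub>N\<^esub> \<longrightarrow> x = \<zero>\<^bsub>M\<^esub>)"
  unfolding inj_on_def
  by (metis M.minus_eq_zero_iff M.minus_closed M.zero_closed hom_eq_iff hom_zero)

end

lemma left_module_homI:
  "left_module R M \<Longrightarrow> left_module R N \<Longrightarrow> h \<in> mod_hom R M N \<Longrightarrow> left_module_hom R M N h"
  by (simp add: left_module_hom_def left_module_hom_axioms_def)

lemma mod_isomorphic_sym:
  assumes M: "left_module R M" and iso: "mod_isomorphic R M N"
  shows "mod_isomorphic R N M"
proof -
  interpret M: left_module R M by (rule M)
  obtain h where h: "h \<in> mod_hom R M N" and b: "bij_betw h (carrier M) (carrier N)"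
    using iso unfolding mod_isomorphic_def by blast
  let ?g = "inv_into (carrier M) h"
  have g: "bij_betw ?g (carrier N) (carrier M)" by (rule bij_betw_inv_into[OF b])
  have gc: "?g y \<in> carrier M" "h (?g y) = y" if "y \<in> carrier N" for y
    using b g that by (auto simp: bij_betw_inv_into_right bij_betwE)
  have gh: "?g (h x) = x" if "x \<in> carrier M" for x
    using b that by (simp add: bij_betw_inv_into_left)
  have "?g \<in> mod_hom R N M"
  proof (rule mod_homI)
    show "?g (x \<oplus>\<^bsub>N\<^esub> y) = ?g x \<oplus>\<^bsub>M\<^esub> ?g y" if "x \<in> carrier N" "y \<in> carrier N" for x y
      using gh[of "?g x \<oplus>\<^bsub>M\<^esub> ?g y"] gc[OF that(1)] gc[OF that(2)] by (simp add: mod_homD[OF h])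
    show "?g (a \<odot>\<^bsub>N\<^esub> x) = a \<odot>\<^bsub>M\<^esub> ?g x" if "a \<in> carrier R" "x \<in> carrier N" for a x
      using gh[of "a \<odot>\<^bsub>M\<^esub> ?g x"] gc[OF that(2)] that(1)
      by (simp add: mod_homD[OF h] M.smult_closed)
  qed (use gc in auto)
  then show ?thesis using g unfolding mod_isomorphic_def by blast
qed

subsection \<open>Quotients\<close>

lemma mod_quot_carrier:
  "C \<in> carrier (mod_quot M H) \<longleftrightarrow> (\<exists>x\<in>carrier M. C = H +>\<^bsub>M\<^esub> x)"
  unfolding mod_quot_def by (auto simp: A_RCOSETS_defs a_r_coset_defs)

lemma mod_quot_zero: "\<zero>\<^bsub>mod_quot M H\<^esub> = H"
  by (simp add: mod_quot_def)

lemma a_subgroup_props: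
  assumes "abelian_group M" "subgroup H (add_monoid M)"
  shows "abelian_subgroup H M"
  using assms by (intro abelian_subgroupI3) (simp_all add: additive_subgroup.intro)

lemma coset_add:
  assumes "abelian_group M" "subgroup H (add_monoid M)" "x \<in> carrier M" "y \<in> carrier M"
  shows "(H +>\<^bsub>M\<^esub> x) \<oplus>\<^bsub>mod_quot M H\<^esub> (H +>\<^bsub>M\<^esub> y) = H +>\<^bsub>M\<^esub> (x \<oplus>\<^bsub>M\<^esub> y)"
  using abelian_subgroup.a_rcos_sum[OF a_subgroup_props[OF assms(1,2)] assms(3,4)]
  by (simp add: mod_quot_def)

lemma coset_eq_iff:
  assumes "abelian_group M" "subgroup H (add_monoid M)" "x \<in> carrier M" "y \<in> carrier M"
  shows "H +>\<^bsub>M\<^esub> x = H +>\<^bsub>M\<^esub> y \<longleftrightarrow> x \<ominus>\<^bsub>M\<^esub> y \<in> H"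
proof -
  interpret abelian_group M by fact
  interpret A: abelian_subgroup H M by (rule a_subgroup_props[OF assms(1,2)])
  have "x \<in> H +>\<^bsub>M\<^esub> y \<longleftrightarrow> x \<ominus>\<^bsub>M\<^esub> y \<in> H"
    using A.a_rcos_module[OF assms(4,3)] by (simp add: a_minus_def)
  moreover have "H +>\<^bsub>M\<^esub> y = H +>\<^bsub>M\<^esub> x" if "x \<in> H +>\<^bsub>M\<^esub> y"
    using a_repr_independence'[OF that[unfolded a_r_coset_def] assms(4,2)] by (simp add: a_r_coset_def)
  ultimately show ?thesis
    using A.a_rcos_self[OF assms(3)] by metis
qed

lemma coset_zero_iff:
  assumes "abelian_group M" "subgroup H (add_monoid M)" "x \<in> carrier M"
  shows "H +>\<^bsub>M\<^esub> x = H \<longleftrightarrow> x \<in> H"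
proof -
  interpret abelian_group M by fact
  interpret A: abelian_subgroup H M by (rule a_subgroup_props[OF assms(1,2)])
  show ?thesis
    using A.a_rcos_self[OF assms(3)] a_coset_join2[OF assms(3,2)] by auto
qed

lemma mod_quot_abelian_group:
  assumes "abelian_group M" "subgroup H (add_monoid M)"
  shows "abelian_group (mod_quot M H)"
proof -
  interpret abelian_group M by fact
  note ca = coset_add[OF assms]
  have H0: "\<zero>\<^bsub>mod_quot M H\<^esub> = H +>\<^bsub>M\<^esub> \<zero>\<^bsub>M\<^esub>"
    using subgroup.subset[OF assms(2)] by (simp add: mod_quot_zero)
  show ?thesis
  proof (rule abelian_groupI)
    fix X assume "X \<in> carrier (mod_quot M H)"
    then obtain x where x: "x \<in> carrier M" "X = H +>\<^bsub>M\<^esub> x" by (auto simp: mod_quot_carrier)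
    then have "(H +>\<^bsub>M\<^esub> (\<ominus>\<^bsub>M\<^esub> x)) \<oplus>\<^bsub>mod_quot M H\<^esub> X = \<zero>\<^bsub>mod_quot M H\<^esub>"
      by (simp add: ca H0 l_neg)
    then show "\<exists>Y\<in>carrier (mod_quot M H). Y \<oplus>\<^bsub>mod_quot M H\<^esub> X = \<zero>\<^bsub>mod_quot M H\<^esub>"
      using x by (metis a_inv_closed mod_quot_carrier)
  qed (auto simp: mod_quot_carrier ca H0 a_ac intro!: bexI)
qed

text \<open>All cosets in the union that defines the product coincide. The hypotheses concern a
  single additive map preserving \<open>H\<close> and not a module, because the lemma is also
  applied to \<open>pretens\<close>, where the action is not additive in the scalar.\<close>

lemma coset_smult:
  assumes M: "abelian_group M" and H: "subgroup H (add_monoid M)" and x: "x \<in> carrier M"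
    and cl: "\<And>y. y \<in> carrier M \<Longrightarrow> a \<odot>\<^bsub>M\<^esub> y \<in> carrier M"
    and ad: "\<And>y z. y \<in> carrier M \<Longrightarrow> z \<in> carrier M \<Longrightarrow>
      a \<odot>\<^bsub>M\<^esub> (y \<oplus>\<^bsub>M\<^esub> z) = a \<odot>\<^bsub>M\<^esub> y \<oplus>\<^bsub>M\<^esub> a \<odot>\<^bsub>M\<^esub> z"
    and st: "\<And>y. y \<in> H \<Longrightarrow> a \<odot>\<^bsub>M\<^esub> y \<in> H"
  shows "a \<odot>\<^bsub>mod_quot M H\<^esub> (H +>\<^bsub>M\<^esub> x) = H +>\<^bsub>M\<^esub> (a \<odot>\<^bsub>M\<^esub> x)"
proof -
  interpret abelian_group M by fact
  interpret A: abelian_subgroup H M by (rule a_subgroup_props[OF M H])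
  have "H +>\<^bsub>M\<^esub> (a \<odot>\<^bsub>M\<^esub> y) = H +>\<^bsub>M\<^esub> (a \<odot>\<^bsub>M\<^esub> x)" if "y \<in> H +>\<^bsub>M\<^esub> x" for y
  proof -
    obtain u where u: "u \<in> H" "y = u \<oplus>\<^bsub>M\<^esub> x" using \<open>y \<in> H +>\<^bsub>M\<^esub> x\<close> by (auto simp: a_r_coset_def')
    have uc: "u \<in> carrier M" "a \<odot>\<^bsub>M\<^esub> u \<in> H" "a \<odot>\<^bsub>M\<^esub> u \<in> carrier M"
      using u A.a_subset st by auto
    have "a \<odot>\<^bsub>M\<^esub> y \<ominus>\<^bsub>M\<^esub> a \<odot>\<^bsub>M\<^esub> x = a \<odot>\<^bsub>M\<^esub> u"
      using u uc x cl[OF x] by (simp add: ad a_minus_def a_assoc r_neg)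
    then show ?thesis using uc u x by (subst coset_eq_iff[OF M H]) (auto intro: cl)
  qed
  moreover have "x \<in> H +>\<^bsub>M\<^esub> x" by (rule A.a_rcos_self[OF x])
  ultimately have "(\<Union>y\<in>H +>\<^bsub>M\<^esub> x. H +>\<^bsub>M\<^esub> (a \<odot>\<^bsub>M\<^esub> y)) = H +>\<^bsub>M\<^esub> (a \<odot>\<^bsub>M\<^esub> x)"
    by blast
  then show ?thesis by (simp add: mod_quot_def)
qed

context left_module
begin

lemma mod_quot_smult:
  assumes "submodule H R M" "a \<in> carrier R" "x \<in> carrier M"
  shows "a \<odot>\<^bsub>mod_quot M H\<^esub> (H +>\<^bsub>M\<^esub> x) = H +>\<^bsub>M\<^esub> (a \<odot>\<^bsub>M\<^esub> x)"
  by (rule coset_smult[OF M.abelian_group_axioms submodule_subgroup[OF assms(1)] assms(3)])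
    (use assms in \<open>auto simp: smult_closed smult_r_distr submodule_smult\<close>)

lemma mod_quot_left_module:
  assumes H: "submodule H R M"
  shows "left_module R (mod_quot M H)"
proof (rule left_moduleI)
  show "abelian_group (mod_quot M H)"
    by (rule mod_quot_abelian_group[OF M.abelian_group_axioms submodule_subgroup[OF H]])
qed (auto simp: mod_quot_carrier mod_quot_smult[OF H] smult_closed R.ring_axioms smult_assoc
    coset_add[OF M.abelian_group_axioms submodule_subgroup[OF H]] smult_l_distr smult_r_distr smult_one)

lemma quot_map_hom: "submodule H R M \<Longrightarrow> (\<lambda>x. H +>\<^bsub>M\<^esub> x) \<in> mod_hom R M (mod_quot M H)"
  by (rule mod_homI)
    (auto simp: mod_quot_carrier mod_quot_smult
      coset_add[OF M.abelian_group_axioms submodule_subgroup])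

lemma quot_map_surj: "(\<lambda>x. H +>\<^bsub>M\<^esub> x) ` carrier M = carrier (mod_quot M H)"
  by (auto simp: mod_quot_carrier)

lemma quot_map_eq_zero:
  "submodule H R M \<Longrightarrow> x \<in> carrier M \<Longrightarrow> H +>\<^bsub>M\<^esub> x = \<zero>\<^bsub>mod_quot M H\<^esub> \<longleftrightarrow> x \<in> H"
  by (simp add: mod_quot_zero coset_zero_iff M.abelian_group_axioms submodule_subgroup)

end

lemma first_isomorphism:
  assumes M: "left_module R M" and N: "left_module R N" and h: "h \<in> mod_hom R M N"
    and surj: "h ` carrier M = carrier N" and ker: "H = {x \<in> carrier M. h x = \<zero>\<^bsub>N\<^esub>}"
  shows "mod_isomorphic R (mod_quot M H) N"
proof -
  interpret left_module_hom R M N h by (rule left_module_homI[OF M N h])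
  have H: "submodule H R M" unfolding ker by (rule submodule_kernel)
  define g where "g = (\<lambda>C. h (SOME x. x \<in> carrier M \<and> C = H +>\<^bsub>M\<^esub> x))"
  have g: "g (H +>\<^bsub>M\<^esub> x) = h x" if x: "x \<in> carrier M" for x
  proof -
    let ?y = "SOME y. y \<in> carrier M \<and> H +>\<^bsub>M\<^esub> x = H +>\<^bsub>M\<^esub> y"
    have "?y \<in> carrier M \<and> H +>\<^bsub>M\<^esub> x = H +>\<^bsub>M\<^esub> ?y"
      by (rule someI[of _ x]) (use x in simp)
    then have "x \<ominus>\<^bsub>M\<^esub> ?y \<in> H" "?y \<in> carrier M"
      using coset_eq_iff[OF M.M.abelian_group_axioms submodule_subgroup[OF H] x] by auto
    then have "h x = h ?y" using hom_eq_iff[OF x] ker by blast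
    then show ?thesis by (simp add: g_def)
  qed
  have "g \<in> mod_hom R (mod_quot M H) N"
    by (rule mod_homI)
      (auto simp: mod_quot_carrier g hom_closed coset_add[OF M.M.abelian_group_axioms submodule_subgroup[OF H]]
        M.mod_quot_smult[OF H] hom_add hom_smult M.smult_closed)
  moreover have "bij_betw g (carrier (mod_quot M H)) (carrier N)"
    unfolding bij_betw_def
  proof
    show "inj_on g (carrier (mod_quot M H))"
    proof (rule inj_onI)
      fix C D assume "C \<in> carrier (mod_quot M H)" "D \<in> carrier (mod_quot M H)" and gg: "g C = g D"
      then obtain x y where xy: "x \<in> carrier M" "C = H +>\<^bsub>M\<^esub> x" "y \<in> carrier M" "D = H +>\<^bsub>M\<^esub> y"
        by (auto simp: mod_quot_carrier)
      have "h x = h y" using gg g xy by metis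
      then have "x \<ominus>\<^bsub>M\<^esub> y \<in> H" using xy hom_eq_iff[of x y] by (simp add: ker)
      then show "C = D"
        using xy coset_eq_iff[OF M.M.abelian_group_axioms submodule_subgroup[OF H]] by simp
    qed
    have "g ` carrier (mod_quot M H) = h ` carrier M"
      unfolding M.quot_map_surj[symmetric] image_image by (rule image_cong) (simp_all add: g)
    then show "g ` carrier (mod_quot M H) = carrier N" using surj by simp
  qed
  ultimately show ?thesis unfolding mod_isomorphic_def by blast
qed

subsection \<open>Composition series\<close>

context left_module
begin

text \<open>Simplicity of the factor \<open>B/A\<close>, phrased inside the submodule lattice of
  \<open>M\<close>, so that chains can be compared without passing to quotients.\<close>

definition covers :: "'a set \<Rightarrow> 'a set \<Rightarrow> bool" where
  "covers A B \<longleftrightarrow> submodule A R M \<and> submodule B R M \<and> A \<subset> B \<and>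
     (\<forall>H. submodule H R M \<longrightarrow> A \<subseteq> H \<longrightarrow> H \<subseteq> B \<longrightarrow> H = A \<or> H = B)"

lemma coversD:
  assumes "covers A B"
  shows "submodule A R M" "submodule B R M" "A \<subset> B"
    and "submodule H R M \<Longrightarrow> A \<subseteq> H \<Longrightarrow> H \<subseteq> B \<Longrightarrow> H = A \<or> H = B"
  using assms unfolding covers_def by blast+

text \<open>The correspondence theorem: submodules of the quotient are the images, under the
  quotient map \<open>q\<close>, of the submodules between \<open>A\<close> and
  \<open>B\<close>.\<close>

lemma simple_mod_quot_iff:
  assumes A: "submodule A R M" and B: "submodule B R M" and AB: "A \<subseteq> B"
  shows "simple_module R (mod_quot (M\<lparr>carrier := B\<rparr>) A) \<longleftrightarrow> covers A B"
proof -
  let ?B = "M\<lparr>carrier := B\<rparr>"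
  interpret B: left_module R ?B by (rule submodule_left_module[OF B])
  have AB': "submodule A R ?B" using A AB by (simp add: submodule_restrict_iff[OF B])
  let ?Q = "mod_quot ?B A"
  define q where "q = (\<lambda>x. A +>\<^bsub>?B\<^esub> x)"
  have Q: "left_module R ?Q" by (rule B.mod_quot_left_module[OF AB'])
  interpret q: left_module_hom R ?B ?Q q
    unfolding q_def by (rule left_module_homI[OF B.left_module_self Q B.quot_map_hom[OF AB']])
  have surj: "q ` B = carrier ?Q" using B.quot_map_surj[of A] by (simp add: q_def)
  have ker: "q x = \<zero>\<^bsub>?Q\<^esub> \<longleftrightarrow> x \<in> A" if "x \<in> B" for x
    using B.quot_map_eq_zero[OF AB', of x] that by (simp add: q_def)
  show ?thesis
  proof
    assume S: "simple_module R ?Q"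
    have "A \<noteq> B"
    proof
      assume "A = B"
      then have "c = \<zero>\<^bsub>?Q\<^esub>" if "c \<in> carrier ?Q" for c using that surj ker by blast
      then have "carrier ?Q = {\<zero>\<^bsub>?Q\<^esub>}" using q.N.zero_closed by blast
      then show False using S by (simp add: simple_module_def)
    qed
    moreover have "H = A \<or> H = B" if H: "submodule H R M" "A \<subseteq> H" "H \<subseteq> B" for H
    proof -
      have "submodule H R ?B" using H by (simp add: submodule_restrict_iff[OF B])
      then have "submodule (q ` H) R ?Q" by (rule q.submodule_image)
      then consider "q ` H = {\<zero>\<^bsub>?Q\<^esub>}" | "q ` H = carrier ?Q" using S by (auto simp: simple_module_def)
      then show ?thesis
      proof cases
        case 1
        then have "q x = \<zero>\<^bsub>?Q\<^esub>" if "x \<in> H" for x using that by blast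
        then have "H \<subseteq> A" using ker H(3) by blast
        then show ?thesis using H by blast
      next
        case 2
        have "b \<in> H" if b: "b \<in> B" for b
        proof -
          have "q b \<in> q ` H" using 2 surj b by blast
          then obtain x where x: "x \<in> H" "q b = q x" by blast
          then have "q (b \<ominus>\<^bsub>?B\<^esub> x) = \<zero>\<^bsub>?Q\<^esub>" using q.hom_eq_iff[of b x] b H(3) by auto
          moreover have "b \<ominus>\<^bsub>?B\<^esub> x \<in> B" using B.M.minus_closed[of b x] b x H(3) by auto
          ultimately have "b \<ominus>\<^bsub>?B\<^esub> x \<in> H" using ker H(2) by blast
          then have "(b \<ominus>\<^bsub>?B\<^esub> x) \<oplus>\<^bsub>?B\<^esub> x \<in> H" using submodule_add[OF H(1)] x by simp
          then show ?thesis using B.M.diff_add_cancel[of b x] b x H(3) by auto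
        qed
        then show ?thesis using H by blast
      qed
    qed
    ultimately show "covers A B" using A B AB unfolding covers_def by blast
  next
    assume C: "covers A B"
    then obtain b where b: "b \<in> B" "b \<notin> A" using coversD(3) by blast
    have "q b \<in> carrier ?Q" using surj b(1) by (metis imageI)
    then have "carrier ?Q \<noteq> {\<zero>\<^bsub>?Q\<^esub>}" using ker[OF b(1)] b(2) by (metis singletonD)
    moreover have "T = {\<zero>\<^bsub>?Q\<^esub>} \<or> T = carrier ?Q" if T: "submodule T R ?Q" for T
    proof -
      let ?H = "{x \<in> B. q x \<in> T}"
      have "submodule ?H R ?B" using q.submodule_vimage[OF T] by simp
      then have "submodule ?H R M" by (simp add: submodule_restrict_iff[OF B])
      moreover have "A \<subseteq> ?H"
      proof
        fix x assume x: "x \<in> A"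
        then have "q x = \<zero>\<^bsub>?Q\<^esub>" using ker AB by blast
        then show "x \<in> ?H" using x AB submodule_zero[OF T] by auto
      qed
      ultimately have cases: "?H = A \<or> ?H = B" using coversD(4)[OF C, of ?H] by blast
      have T': "T \<subseteq> q ` B" using submodule_subset[OF T] surj by simp
      show ?thesis
      proof (cases "?H = B")
        case True
        then have "q ` B \<subseteq> T" by blast
        then have "T = q ` B" using T' by (rule subset_antisym[rotated])
        then show ?thesis by (simp only: surj simp_thms)
      next
        case False
        then have HA: "?H = A" using cases by meson
        have "t = \<zero>\<^bsub>?Q\<^esub>" if "t \<in> T" for t
        proof -
          obtain x where x: "x \<in> B" "t = q x" using subsetD[OF T' \<open>t \<in> T\<close>] by (rule imageE)
          then have "x \<in> ?H" using \<open>t \<in> T\<close> by simp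
          then have "x \<in> A" unfolding HA .
          then show ?thesis using ker[OF x(1)] x(2) by simp
        qed
        then have "T \<subseteq> {\<zero>\<^bsub>?Q\<^esub>}" by (metis singletonI subsetI)
        moreover have "{\<zero>\<^bsub>?Q\<^esub>} \<subseteq> T" using submodule_zero[OF T] by (metis empty_subsetI insert_subset)
        ultimately show ?thesis by (metis subset_antisym)
      qed
    qed
    ultimately show "simple_module R ?Q" using Q unfolding simple_module_def by metis
  qed
qed

lemma composition_series_iff:
  "composition_series R M n F \<longleftrightarrow>
    F 0 = {\<zero>\<^bsub>M\<^esub>} \<and> F n = carrier M \<and> (\<forall>j<n. covers (F j) (F (Suc j)))" (is "?l \<longleftrightarrow> ?r")
proof
  assume l: ?l
  then have "covers (F j) (F (Suc j))" if "j < n" for j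
    using simple_mod_quot_iff[of "F j" "F (Suc j)"] that
    by (auto simp: composition_series_def comp_factor_def)
  then show ?r using l by (simp add: composition_series_def)
next
  assume r: ?r
  have "submodule (F j) R M" if "j \<le> n" for j
    using r that coversD(1)[of "F j" "F (Suc j)"] submodule_carrier
    by (cases "j = n") auto
  moreover have "simple_module R (comp_factor M F j)" if "j < n" for j
    using r that simple_mod_quot_iff[of "F j" "F (Suc j)"] coversD[of "F j" "F (Suc j)"]
    by (auto simp: comp_factor_def)
  ultimately show ?l using r coversD(3) by (auto simp: composition_series_def)
qed

text \<open>Repetitions are deleted, so the length of the strict chain is the number of proper steps
  of \<open>G\<close>. This is how the number \<open>n - r\<close> will arise.\<close>

lemma strict_subchain:
  assumes "\<forall>j<n. G j = G (Suc j) \<or> covers (G j) (G (Suc j))"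
  shows "\<exists>F. F 0 = G 0 \<and> F (card {j. j < n \<and> G j \<noteq> G (Suc j)}) = G n \<and>
     (\<forall>j < card {j. j < n \<and> G j \<noteq> G (Suc j)}. covers (F j) (F (Suc j)))"
  using assms
proof (induction n)
  case 0
  then show ?case by (intro exI[of _ G]) simp
next
  case (Suc n)
  let ?m = "card {j. j < n \<and> G j \<noteq> G (Suc j)}"
  obtain F where F: "F 0 = G 0" "F ?m = G n" "\<forall>j < ?m. covers (F j) (F (Suc j))"
    using Suc by auto
  show ?case
  proof (cases "G n = G (Suc n)")
    case True
    then have "{j. j < Suc n \<and> G j \<noteq> G (Suc j)} = {j. j < n \<and> G j \<noteq> G (Suc j)}"
      by (auto simp: less_Suc_eq)
    then show ?thesis using F True by auto
  next
    case False
    then have "{j. j < Suc n \<and> G j \<noteq> G (Suc j)} = insert n {j. j < n \<and> G j \<noteq> G (Suc j)}"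
      by (auto simp: less_Suc_eq)
    then have c: "card {j. j < Suc n \<and> G j \<noteq> G (Suc j)} = Suc ?m" by simp
    show ?thesis
      unfolding c using F False Suc.prems
      by (intro exI[of _ "F(Suc ?m := G (Suc n))"]) (auto simp: less_Suc_eq)
  qed
qed

end

text \<open>The steps at which \<open>A\<close> meets a new layer of the chain \<open>G\<close>. For
  a composition series their number is the length of \<open>A\<close>; for a filtration of a vector
  space by coordinates and a subspace \<open>A\<close> it is the dimension of
  \<open>A\<close>.\<close>

definition jumps :: "(nat \<Rightarrow> 'a set) \<Rightarrow> nat \<Rightarrow> 'a set \<Rightarrow> nat set" where
  "jumps G n A = {i. i < n \<and> \<not> A \<inter> G (Suc i) \<subseteq> G i}"

lemma jumps_mono: "A \<subseteq> B \<Longrightarrow> jumps G n A \<subseteq> jumps G n B"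
  unfolding jumps_def by blast

lemma finite_jumps: "finite (jumps G n A)" "card (jumps G n A) \<le> n"
proof -
  have "jumps G n A \<subseteq> {..<n}" by (auto simp: jumps_def)
  then show "finite (jumps G n A)" "card (jumps G n A) \<le> n"
    using finite_subset card_mono[of "{..<n}"] by auto
qed

text \<open>Climbing the chain, an element of \<open>B\<close> at a step without jump already lies
  one layer lower, and at a jump an element of \<open>A\<close> can be subtracted to bring it there;
  \<open>step\<close> provides that element. Subgroups are used because
  \<open>quotient_finite_length\<close> applies this to \<open>k\<close>-subspaces that need not be
  submodules over the path algebra.\<close>

lemma jumps_determine:
  assumes M: "abelian_group M" and A: "subgroup A (add_monoid M)" and B: "subgroup B (add_monoid M)"
    and AB: "A \<subseteq> B" and top: "B \<subseteq> G n" and bot: "B \<inter> G 0 \<subseteq> A"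
    and step: "\<And>i g. i \<in> jumps G n A \<Longrightarrow> g \<in> B \<inter> G (Suc i) \<Longrightarrow> \<exists>a\<in>A. g \<ominus>\<^bsub>M\<^esub> a \<in> G i"
    and J: "jumps G n B \<subseteq> jumps G n A"
  shows "A = B"
proof -
  interpret abelian_group M by (rule M)
  have "i \<le> n \<Longrightarrow> B \<inter> G i \<subseteq> A" for i
  proof (induction i)
    case 0
    then show ?case using bot by simp
  next
    case (Suc i)
    show ?case
    proof
      fix b assume b: "b \<in> B \<inter> G (Suc i)"
      show "b \<in> A"
      proof (cases "i \<in> jumps G n B")
        case False
        then show ?thesis using b Suc by (auto simp: jumps_def)
      next
        case True
        then obtain a where a: "a \<in> A" "b \<ominus>\<^bsub>M\<^esub> a \<in> G i" using J step b by blast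
        have c: "a \<in> carrier M" "b \<in> carrier M"
          using a b subgroup.subset[OF A] subgroup.subset[OF B] by auto
        have "\<ominus>\<^bsub>M\<^esub> a \<in> B"
          using a AB subgroup.m_inv_closed[OF B, of a] by (auto simp: a_inv_def)
        then have "b \<ominus>\<^bsub>M\<^esub> a \<in> B"
          using b subgroup.m_closed[OF B, of b "\<ominus>\<^bsub>M\<^esub> a"] by (simp add: a_minus_def)
        then have "b \<ominus>\<^bsub>M\<^esub> a \<in> A" using a Suc by auto
        then have "(b \<ominus>\<^bsub>M\<^esub> a) \<oplus>\<^bsub>M\<^esub> a \<in> A"
          using a subgroup.m_closed[OF A] by simp
        then show ?thesis using c by (simp add: diff_add_cancel)
      qed
    qed
  qed
  then show ?thesis using top AB by blast
qed

context left_module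
begin

text \<open>The number of jumps serves as a length function on all submodules. Its strict
  monotonicity gives the invariance of the length and later bounds descending chains.\<close>

lemma composition_rank:
  assumes F: "composition_series R M n F"
  shows "\<exists>l :: 'a set \<Rightarrow> nat. (\<forall>A. l A \<le> n) \<and>
    (\<forall>A B. submodule A R M \<longrightarrow> submodule B R M \<longrightarrow> A \<subset> B \<longrightarrow> l A < l B)"
proof (intro exI conjI allI impI)
  note F' = F[unfolded composition_series_iff]
  show "card (jumps F n A) \<le> n" for A by (rule finite_jumps)
  show "card (jumps F n A) < card (jumps F n B)"
    if A: "submodule A R M" and B: "submodule B R M" and AB: "A \<subset> B" for A B
  proof -
    have "\<not> jumps F n B \<subseteq> jumps F n A"
    proof
      assume J: "jumps F n B \<subseteq> jumps F n A"
      have "A = B"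
      proof (rule jumps_determine[OF M.abelian_group_axioms submodule_subgroup[OF A] submodule_subgroup[OF B] _ _ _ _ J])
        show "A \<subseteq> B" "B \<subseteq> F n" "B \<inter> F 0 \<subseteq> A"
          using AB submodule_subset[OF B] F' submodule_zero[OF A] by auto
        fix i g assume i: "i \<in> jumps F n A" and g: "g \<in> B \<inter> F (Suc i)"
        then have c: "covers (F i) (F (Suc i))" using F' by (auto simp: jumps_def)
        note Fs = coversD(1)[OF c] coversD(2)[OF c]
        \<comment> \<open>As \<open>i\<close> is a jump of \<open>A\<close>, the sum of
          \<open>F i\<close> and \<open>A \<inter> F (Suc i)\<close> lies strictly above
          \<open>F i\<close>. The covering relation makes it all of \<open>F (Suc i)\<close>, so
          every \<open>g\<close> there is congruent to an element of \<open>A\<close> modulo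
          \<open>F i\<close>.\<close>
        let ?S = "{x \<oplus>\<^bsub>M\<^esub> y | x y. x \<in> F i \<and> y \<in> A \<inter> F (Suc i)}"
        have AF: "submodule (A \<inter> F (Suc i)) R M" using submodule_Int[OF A Fs(2)] .
        have S: "submodule ?S R M" by (rule submodule_sum[OF Fs(1) AF])
        have 1: "F i \<subseteq> ?S"
        proof
          fix x assume "x \<in> F i"
          then have "x = x \<oplus>\<^bsub>M\<^esub> \<zero>\<^bsub>M\<^esub>" using submodule_mem[OF Fs(1)] by simp
          then show "x \<in> ?S" using \<open>x \<in> F i\<close> submodule_zero[OF AF] by blast
        qed
        have 2: "A \<inter> F (Suc i) \<subseteq> ?S"
        proof
          fix x assume x: "x \<in> A \<inter> F (Suc i)"
          then have "x = \<zero>\<^bsub>M\<^esub> \<oplus>\<^bsub>M\<^esub> x" using submodule_mem[OF AF] by simp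
          then show "x \<in> ?S" using x submodule_zero[OF Fs(1)] by blast
        qed
        have 3: "?S \<subseteq> F (Suc i)"
          using coversD(3)[OF c] submodule_add[OF Fs(2)] by blast
        have "\<not> ?S \<subseteq> F i" using 2 i by (auto simp: jumps_def)
        then have "?S = F (Suc i)" using coversD(4)[OF c S 1 3] by blast
        then obtain x a where xa: "x \<in> F i" "a \<in> A" "g = x \<oplus>\<^bsub>M\<^esub> a" using g by blast
        then have "g \<ominus>\<^bsub>M\<^esub> a \<in> F i"
          using M.add_diff_cancel[of x a] submodule_mem[OF Fs(1)] submodule_mem[OF A] by simp
        then show "\<exists>a\<in>A. g \<ominus>\<^bsub>M\<^esub> a \<in> F i" using xa by blast
      qed
      then show False using AB by blast
    qed
    then have "jumps F n A \<subset> jumps F n B" using jumps_mono[of A B F n] AB by blast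
    then show ?thesis by (simp add: psubset_card_mono finite_jumps)
  qed
qed

text \<open>The rank attached to \<open>F\<close> grows by at least one at every step of
  \<open>G\<close> and never exceeds \<open>n\<close>.\<close>

lemma composition_series_length_le:
  assumes F: "composition_series R M n F" and G: "composition_series R M m G"
  shows "m \<le> n"
proof -
  obtain l :: "'a set \<Rightarrow> nat" where l1: "\<forall>A. l A \<le> n"
    and l2: "\<forall>A B. submodule A R M \<longrightarrow> submodule B R M \<longrightarrow> A \<subset> B \<longrightarrow> l A < l B"
    using composition_rank[OF F] by (elim exE conjE)
  have "j \<le> m \<Longrightarrow> j \<le> l (G j)" for j
  proof (induction j)
    case (Suc j)
    then have c: "covers (G j) (G (Suc j))" using G by (auto simp: composition_series_iff)
    have "l (G j) < l (G (Suc j))" using l2 coversD(1-3)[OF c] by simp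
    then show ?case using Suc by simp
  qed simp
  then show ?thesis using l1 le_trans by blast
qed

lemma module_length_eq:
  assumes "composition_series R M n F"
  shows "module_length R M = n"
  unfolding module_length_def
  by (rule the_equality)
    (use assms in \<open>auto intro!: antisym composition_series_length_le\<close>)

text \<open>Among the submodules strictly above \<open>A\<close>, one of least rank covers
  \<open>A\<close>. Repeating this ends after at most \<open>n - l A\<close> steps.\<close>

lemma finite_length_of_rank:
  fixes l :: "'a set \<Rightarrow> nat"
  assumes bound: "\<And>A. submodule A R M \<Longrightarrow> l A \<le> n"
    and strict: "\<And>A B. submodule A R M \<Longrightarrow> submodule B R M \<Longrightarrow> A \<subset> B \<Longrightarrow> l A < l B"
  shows "finite_length R M"
proof -
  have "\<exists>m F. F 0 = A \<and> F m = carrier M \<and> (\<forall>j<m. covers (F j) (F (Suc j)))"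
    if "submodule A R M" for A
    using that
  proof (induction "n - l A" arbitrary: A rule: less_induct)
    case less
    note A = less.prems
    show ?case
    proof (cases "A = carrier M")
      case True
      then show ?thesis by (intro exI[of _ 0] exI[of _ "\<lambda>_. A"]) simp
    next
      case False
      let ?P = "\<lambda>B. submodule B R M \<and> A \<subset> B"
      have "?P (carrier M)" using False submodule_subset[OF A] submodule_carrier by blast
      then obtain B where B: "?P B" and min: "\<And>H. ?P H \<Longrightarrow> l B \<le> l H"
        using ex_has_least_nat[of ?P "carrier M" l] by blast
      have cov: "covers A B"
        unfolding covers_def
      proof (intro conjI allI impI)
        fix H assume H: "submodule H R M" "A \<subseteq> H" "H \<subseteq> B"
        show "H = A \<or> H = B"
        proof (rule ccontr)
          assume "\<not> (H = A \<or> H = B)"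
          then have AH: "A \<subset> H" and HB: "H \<subset> B" using H by auto
          then have "l H < l B" using strict[OF H(1)] B by simp
          moreover have "l B \<le> l H" using min[of H] H(1) AH by simp
          ultimately show False by simp
        qed
      qed (use A B in auto)
      have "n - l B < n - l A" using strict[OF A, of B] B bound[of B] by fastforce
      then obtain m F where F: "F 0 = B" "F m = carrier M" "\<forall>j<m. covers (F j) (F (Suc j))"
        using less.hyps[of B] B by blast
      show ?thesis
        using F cov
        by (intro exI[of _ "Suc m"] exI[of _ "case_nat A F"]) (auto split: nat.split)
    qed
  qed
  then show ?thesis
    using submodule_trivial left_module_self
    unfolding finite_length_def composition_series_iff by blast
qed

end

section \<open>Path algebras\<close>

text \<open>Applied to arbitrary lists of arrows, also those that are not paths. Identities for
  products therefore hold for all functions, without conditions on the support.\<close>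

definition path_end :: "('v, 'e) pre_digraph \<Rightarrow> 'v \<times> 'e list \<Rightarrow> 'v" where
  "path_end G p = last (pre_digraph.awalk_verts G (fst p) (snd p))"

lemma path_end_eq: "path_end G (u, es) = (if es = [] then u else head G (last es))"
  by (auto simp: path_end_def pre_digraph.awalk_verts_conv)

lemma path_end_simps [simp]:
  "path_end G (u, []) = u"
  "path_end G (u, e # es) = path_end G (head G e, es)"
  "path_end G (u, es @ fs) = path_end G (path_end G (u, es), fs)"
  by (auto simp: path_end_eq)

lemma cas_path_end: "pre_digraph.cas G u es v \<Longrightarrow> v = path_end G (u, es)"
  by (induct es arbitrary: u) (auto simp: pre_digraph.cas.simps)

lemma paths_iff:
  "(u, es) \<in> paths G \<longleftrightarrow> u \<in> verts G \<and> set es \<subseteq> arcs G \<and> pre_digraph.cas G u es (path_end G (u, es))"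
  unfolding paths_def pre_digraph.awalk_def using cas_path_end by fast

lemma paths_Nil [simp]: "(u, []) \<in> paths G \<longleftrightarrow> u \<in> verts G"
  by (simp add: paths_iff pre_digraph.cas.simps)

lemma paths_start: "(u, es) \<in> paths G \<Longrightarrow> u \<in> verts G"
  by (simp add: paths_iff)

lemma (in wf_digraph) paths_Cons [simp]:
  "(u, e # es) \<in> paths G \<longleftrightarrow> e \<in> arcs G \<and> u = tail G e \<and> (head G e, es) \<in> paths G"
  by (auto simp: paths_iff)

lemma (in wf_digraph) paths_append [simp]:
  "(u, es @ fs) \<in> paths G \<longleftrightarrow> (u, es) \<in> paths G \<and> (path_end G (u, es), fs) \<in> paths G"
  by (induct es arbitrary: u) (auto dest: paths_start)

lemma (in wf_digraph) path_end_in_verts: "(u, es) \<in> paths G \<Longrightarrow> path_end G (u, es) \<in> verts G"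
  by (induct es arbitrary: u) auto

text \<open>The index type is left open, so that the same monomials serve paths, words in the
  generators, and pairs of a component and a path.\<close>

definition pmono :: "'k::field \<Rightarrow> 'p \<Rightarrow> 'p \<Rightarrow> 'k" where
  "pmono c p = (\<lambda>q. if q = p then c else 0)"

lemma path_elem_pmono: "path_elem = pmono 1"
  by (auto simp: path_elem_def pmono_def fun_eq_iff)

lemma path_algebra_carrier:
  "f \<in> carrier (path_algebra G) \<longleftrightarrow> finite {p. f p \<noteq> 0} \<and> (\<forall>p. f p \<noteq> 0 \<longrightarrow> p \<in> paths G)"
  by (auto simp: path_algebra_def)

lemma path_algebra_simps:
  "\<zero>\<^bsub>path_algebra G\<^esub> = (\<lambda>_. 0)"
  "f \<oplus>\<^bsub>path_algebra G\<^esub> g = (\<lambda>p. f p + g p)"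
  by (simp_all add: path_algebra_def)

lemma path_algebra_one: "\<one>\<^bsub>path_algebra G\<^esub> = path_scalar G 1"
  by (simp add: path_algebra_def path_scalar_def)

lemma path_algebra_mult:
  "(f \<otimes>\<^bsub>path_algebra G\<^esub> g) (v, es) =
    (\<Sum>i\<le>length es. f (v, take i es) * g (path_end G (v, take i es), drop i es))"
  by (simp add: path_algebra_def path_end_def)

lemma finite_support_add:
  fixes f g :: "'p \<Rightarrow> 'k::field"
  shows "finite {p. f p \<noteq> 0} \<Longrightarrow> finite {p. g p \<noteq> 0} \<Longrightarrow> finite {p. f p + g p \<noteq> 0}"
  by (rule finite_subset[of _ "{p. f p \<noteq> 0} \<union> {p. g p \<noteq> 0}"]) auto

lemma pmono_carrier: "p \<in> paths G \<Longrightarrow> pmono c p \<in> carrier (path_algebra G)"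
  by (auto simp: path_algebra_carrier pmono_def intro: finite_subset[of _ "{p}"])

lemma path_elem_carrier: "p \<in> paths G \<Longrightarrow> path_elem p \<in> carrier (path_algebra G)"
  by (simp add: path_elem_pmono pmono_carrier)

lemma mult_pmono_left:
  "(pmono c (w, qs) \<otimes>\<^bsub>path_algebra G\<^esub> g) (u, es) =
    (if u = w \<and> take (length qs) es = qs then c * g (path_end G (w, qs), drop (length qs) es) else 0)"
proof -
  have len: "length qs \<le> length es" if "take (length qs) es = qs"
    using that by (metis length_take min.cobounded1)
  have "(pmono c (w, qs) \<otimes>\<^bsub>path_algebra G\<^esub> g) (u, es) =
    (\<Sum>i\<le>length es. if i = length qs then
      (if u = w \<and> take (length qs) es = qs then c * g (path_end G (w, qs), drop (length qs) es) else 0) else 0)"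

    unfolding path_algebra_mult by (rule sum.cong) (auto simp: pmono_def)
  also have "\<dots> = (if u = w \<and> take (length qs) es = qs then c * g (path_end G (w, qs), drop (length qs) es) else 0)"
    using len by (subst sum.delta) auto
  finally show ?thesis .
qed

lemma mult_pmono_right:
  "(g \<otimes>\<^bsub>path_algebra G\<^esub> pmono c (w, qs)) (u, es) =
    (if length qs \<le> length es \<and> drop (length es - length qs) es = qs \<and>
        path_end G (u, take (length es - length qs) es) = w
     then g (u, take (length es - length qs) es) * c else 0)"
proof -
  let ?i = "length es - length qs"
  let ?P = "length qs \<le> length es \<and> drop ?i es = qs \<and> path_end G (u, take ?i es) = w"
  have "(g \<otimes>\<^bsub>path_algebra G\<^esub> pmono c (w, qs)) (u, es) =
    (\<Sum>i\<le>length es. if i = ?i then (if ?P then g (u, take ?i es) * c else 0) else 0)"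
    unfolding path_algebra_mult
  proof (rule sum.cong[OF refl])
    fix i assume i: "i \<in> {..length es}"
    show "g (u, take i es) * pmono c (w, qs) (path_end G (u, take i es), drop i es) =
      (if i = ?i then (if ?P then g (u, take ?i es) * c else 0) else 0)"
    proof (cases "drop i es = qs")
      case True
      then have "length qs = length es - i" by (metis length_drop)
      then have "i = ?i" "length qs \<le> length es" using i by auto
      then show ?thesis using True by (simp add: pmono_def)
    next
      case False
      then show ?thesis by (auto simp: pmono_def)
    qed
  qed
  also have "\<dots> = (if ?P then g (u, take ?i es) * c else 0)"
    by (simp only: sum.delta finite_atMost atMost_iff diff_le_self if_True)
  finally show ?thesis .
qed

lemmas mult_path_left = mult_pmono_left[where c = 1, folded path_elem_pmono, simplified]
lemmas mult_path_right = mult_pmono_right[where c = 1, folded path_elem_pmono, simplified]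

lemma mult_vertex_left:
  "(path_elem (v, []) \<otimes>\<^bsub>path_algebra G\<^esub> g) (u, es) = (if u = v then g (u, es) else 0)"
  by (auto simp: mult_path_left)

lemma mult_vertex_right:
  "(g \<otimes>\<^bsub>path_algebra G\<^esub> path_elem (v, [])) (u, es) = (if path_end G (u, es) = v then g (u, es) else 0)"
  by (auto simp: mult_path_right)

lemma mult_arrow_left:
  "(path_elem (v, [e]) \<otimes>\<^bsub>path_algebra G\<^esub> g) (u, es) =
     (if u = v \<and> es \<noteq> [] \<and> hd es = e then g (head G e, tl es) else 0)"
  by (cases es) (auto simp: mult_path_left)

lemma mult_arrow_right:
  "(g \<otimes>\<^bsub>path_algebra G\<^esub> path_elem (v, [e])) (u, es) =
     (if es \<noteq> [] \<and> last es = e \<and> path_end G (u, butlast es) = v then g (u, butlast es) else 0)"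
  by (cases es rule: rev_cases) (auto simp: mult_path_right)

lemma pmono_mult:
  "pmono c p \<otimes>\<^bsub>path_algebra G\<^esub> pmono d q =
    (if path_end G p = fst q then pmono (c * d) (fst p, snd p @ snd q) else (\<lambda>_. 0))"
proof -
  obtain u es v fs where pq: "p = (u, es)" "q = (v, fs)" by (cases p, cases q)
  have "(pmono c p \<otimes>\<^bsub>path_algebra G\<^esub> pmono d q) (w, gs) =
    (if path_end G p = fst q then pmono (c * d) (fst p, snd p @ snd q) else (\<lambda>_. 0)) (w, gs)" for w gs
  proof (cases "w = u \<and> take (length es) gs = es")
    case True
    then have "gs = es @ drop (length es) gs" by (metis append_take_drop_id)
    then have "gs = es @ fs \<longleftrightarrow> drop (length es) gs = fs" by (metis same_append_eq)
    then show ?thesis using True unfolding pq mult_pmono_left by (simp add: pmono_def)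
  next
    case False
    then have "\<not> (w = u \<and> gs = es @ fs)" by auto
    then show ?thesis using False unfolding pq mult_pmono_left by (auto simp: pmono_def)
  qed
  then show ?thesis by (intro ext) (metis surj_pair)
qed

lemma path_elem_mult:
  "path_elem p \<otimes>\<^bsub>path_algebra G\<^esub> path_elem q =
    (if path_end G p = fst q then path_elem (fst p, snd p @ snd q) else (\<lambda>_. 0))"
  by (simp add: path_elem_pmono pmono_mult)

lemma mult_distrib_left:
  "(f \<otimes>\<^bsub>path_algebra G\<^esub> (\<lambda>p. g p + h p)) =
     (\<lambda>p. (f \<otimes>\<^bsub>path_algebra G\<^esub> g) p + (f \<otimes>\<^bsub>path_algebra G\<^esub> h) p)"
  by (auto simp: fun_eq_iff path_algebra_mult distrib_left sum.distrib)

lemma mult_distrib_right: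
  "((\<lambda>p. g p + h p) \<otimes>\<^bsub>path_algebra G\<^esub> f) =
     (\<lambda>p. (g \<otimes>\<^bsub>path_algebra G\<^esub> f) p + (h \<otimes>\<^bsub>path_algebra G\<^esub> f) p)"
  by (auto simp: fun_eq_iff path_algebra_mult distrib_right sum.distrib)

text \<open>Both sides are the sum over all ways of cutting the list of arrows into three pieces.
  The starting vertices of the pieces agree because \<open>path_end\<close> of a concatenation is
  computed piece by piece.\<close>

lemma path_mult_assoc:
  "(f \<otimes>\<^bsub>path_algebra G\<^esub> g) \<otimes>\<^bsub>path_algebra G\<^esub> h = f \<otimes>\<^bsub>path_algebra G\<^esub> (g \<otimes>\<^bsub>path_algebra G\<^esub> h)"
proof -
  have "((f \<otimes>\<^bsub>path_algebra G\<^esub> g) \<otimes>\<^bsub>path_algebra G\<^esub> h) (v, es) =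
    (f \<otimes>\<^bsub>path_algebra G\<^esub> (g \<otimes>\<^bsub>path_algebra G\<^esub> h)) (v, es)" for v es
  proof -
    let ?n = "length es"
    let ?t = "\<lambda>i k. f (v, take i es) * g (path_end G (v, take i es), take k (drop i es)) *
      h (path_end G (v, take (i + k) es), drop (i + k) es)"
    have "((f \<otimes>\<^bsub>path_algebra G\<^esub> g) \<otimes>\<^bsub>path_algebra G\<^esub> h) (v, es) =
      (\<Sum>k\<le>?n. \<Sum>i\<le>k. ?t i (k - i))"
      unfolding path_algebra_mult sum_distrib_right
    proof (intro sum.cong refl)
      fix k i assume "k \<in> {..?n}" "i \<in> {..k}"
      then have "i \<le> k" by simp
      then show "f (v, take i (take k es)) * g (path_end G (v, take i (take k es)), drop i (take k es)) *
          h (path_end G (v, take k es), drop k es) = ?t i (k - i)"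
        by (simp add: drop_take min_absorb1)
    qed auto
    also have "\<dots> = (\<Sum>(i, k)\<in>{(i, k). i + k \<le> ?n}. ?t i k)"
      by (rule sum.triangle_reindex_eq[symmetric])
    also have "{(i, k). i + k \<le> ?n} = (SIGMA i:{..?n}. {..?n - i})" by auto
    also have "(\<Sum>(i, k)\<in>(SIGMA i:{..?n}. {..?n - i}). ?t i k) = (\<Sum>i\<le>?n. \<Sum>k\<le>?n - i. ?t i k)"
      by (rule sum.Sigma[symmetric]) auto
    also have "\<dots> = (f \<otimes>\<^bsub>path_algebra G\<^esub> (g \<otimes>\<^bsub>path_algebra G\<^esub> h)) (v, es)"
    proof -
      have e: "path_end G (path_end G (v, take i es), take k (drop i es)) = path_end G (v, take (i + k) es)" for i k
        by (metis path_end_simps(3) take_add)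
      show ?thesis
        unfolding path_algebra_mult sum_distrib_left
        by (intro sum.cong) (auto simp: e add.commute mult.assoc)
    qed
    finally show ?thesis .
  qed
  then show ?thesis by (intro ext) (metis surj_pair)
qed

lemma path_scalar_mult:
  assumes "f \<in> carrier (path_algebra G)"
  shows "path_scalar G c \<otimes>\<^bsub>path_algebra G\<^esub> f = (\<lambda>p. c * f p)"
proof -
  have "(path_scalar G c \<otimes>\<^bsub>path_algebra G\<^esub> f) (v, es) = c * f (v, es)" for v es
  proof -
    have "(path_scalar G c \<otimes>\<^bsub>path_algebra G\<^esub> f) (v, es) =
      (\<Sum>i\<le>length es. if i = 0 then (if v \<in> verts G then c * f (v, es) else 0) else 0)"
      unfolding path_algebra_mult by (rule sum.cong) (auto simp: path_scalar_def)
    also have "\<dots> = c * f (v, es)"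
      using assms paths_start by (subst sum.delta) (fastforce simp: path_algebra_carrier)+
    finally show ?thesis .
  qed
  then show ?thesis by (intro ext) (metis surj_pair)
qed

lemma (in wf_digraph) path_mult_scalar:
  assumes "f \<in> carrier (path_algebra G)"
  shows "f \<otimes>\<^bsub>path_algebra G\<^esub> path_scalar G c = (\<lambda>p. c * f p)"
proof -
  have "(f \<otimes>\<^bsub>path_algebra G\<^esub> path_scalar G c) (v, es) = c * f (v, es)" for v es
  proof -
    have "(f \<otimes>\<^bsub>path_algebra G\<^esub> path_scalar G c) (v, es) =
      (\<Sum>i\<le>length es. if i = length es then (if path_end G (v, es) \<in> verts G then c * f (v, es) else 0) else 0)"
      unfolding path_algebra_mult by (rule sum.cong) (auto simp: path_scalar_def)
    also have "\<dots> = c * f (v, es)"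
      using assms path_end_in_verts by (subst sum.delta) (fastforce simp: path_algebra_carrier)+
    finally show ?thesis .
  qed
  then show ?thesis by (intro ext) (metis surj_pair)
qed

lemma (in fin_digraph) path_scalar_carrier: "path_scalar G c \<in> carrier (path_algebra G)"
proof -
  have "{p. path_scalar G c p \<noteq> 0} \<subseteq> verts G \<times> {[]}"
    by (auto simp: path_scalar_def split: if_splits)
  moreover have "finite (verts G \<times> {[]})" by simp
  ultimately show ?thesis
    unfolding path_algebra_carrier by (auto simp: finite_subset)
qed

lemma (in wf_digraph) path_mult_closed:
  fixes f g :: "'a \<times> 'b list \<Rightarrow> 'k::field"
  assumes f: "f \<in> carrier (path_algebra G)" and g: "g \<in> carrier (path_algebra G)"
  shows "f \<otimes>\<^bsub>path_algebra G\<^esub> g \<in> carrier (path_algebra G)"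
proof -
  let ?F = "{p. f p \<noteq> 0}" and ?G = "{p. g p \<noteq> 0}"
  have *: "\<exists>p\<in>?F. \<exists>q\<in>?G. path_end G p = fst q \<and> (v, es) = (fst p, snd p @ snd q)"
    if "(f \<otimes>\<^bsub>path_algebra G\<^esub> g) (v, es) \<noteq> 0" for v es
  proof -
    obtain i where "f (v, take i es) * g (path_end G (v, take i es), drop i es) \<noteq> 0"
      using \<open>_ \<noteq> 0\<close> unfolding path_algebra_mult by (meson sum.not_neutral_contains_not_neutral)
    then show ?thesis
      by (intro bexI[of _ "(v, take i es)"] bexI[of _ "(path_end G (v, take i es), drop i es)"]) auto
  qed
  have "{p. (f \<otimes>\<^bsub>path_algebra G\<^esub> g) p \<noteq> 0} \<subseteq> (\<lambda>(p, q). (fst p, snd p @ snd q)) ` (?F \<times> ?G)"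
    using * by force
  moreover have "finite (?F \<times> ?G)" using f g by (simp add: path_algebra_carrier)
  moreover have "p \<in> paths G" if p: "(f \<otimes>\<^bsub>path_algebra G\<^esub> g) p \<noteq> 0" for p
  proof -
    obtain v es where ves: "p = (v, es)" by (cases p)
    obtain a b where ab: "a \<in> ?F" "b \<in> ?G" "path_end G a = fst b" "(v, es) = (fst a, snd a @ snd b)"
      using *[of v es] p ves by blast
    then have "a \<in> paths G" "b \<in> paths G" using f g unfolding path_algebra_carrier by blast+
    then show ?thesis using ab ves by (cases a, cases b) auto
  qed
  ultimately show ?thesis
    unfolding path_algebra_carrier by (meson finite_imageI finite_subset)
qed

lemma (in fin_digraph) path_algebra_ring: "ring (path_algebra G :: ('a \<times> 'b list \<Rightarrow> 'k::field) ring)"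
proof (rule ringI)
  let ?A = "path_algebra G :: ('a \<times> 'b list \<Rightarrow> 'k) ring"
  show "abelian_group ?A"
  proof (rule abelian_groupI)
    fix f assume f: "f \<in> carrier ?A"
    show "\<exists>g\<in>carrier ?A. g \<oplus>\<^bsub>?A\<^esub> f = \<zero>\<^bsub>?A\<^esub>"
      using f by (intro bexI[of _ "\<lambda>p. - f p"]) (auto simp: path_algebra_carrier path_algebra_simps)
  next
    fix f g assume "f \<in> carrier ?A" "g \<in> carrier ?A"
    then show "f \<oplus>\<^bsub>?A\<^esub> g \<in> carrier ?A"
      unfolding path_algebra_carrier path_algebra_simps
      by (auto intro!: finite_support_add) (metis add.left_neutral)
  qed (auto simp: path_algebra_simps path_algebra_carrier add_ac)
  show "Group.monoid ?A"
    by (rule monoidI)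
      (auto simp: path_mult_closed path_mult_assoc path_algebra_one path_scalar_mult
        path_mult_scalar path_scalar_carrier)
qed (auto simp: path_algebra_simps mult_distrib_left mult_distrib_right)

lemma (in fin_digraph) path_algebra_finsum:
  assumes "finite A" "\<And>a. a \<in> A \<Longrightarrow> g a \<in> carrier (path_algebra G :: ('a \<times> 'b list \<Rightarrow> 'k::field) ring)"
  shows "finsum (path_algebra G) g A = (\<lambda>p. \<Sum>a\<in>A. g a p)"
proof -
  interpret ring "path_algebra G :: ('a \<times> 'b list \<Rightarrow> 'k::field) ring" by (rule path_algebra_ring)
  show ?thesis
    using assms
  proof (induction A rule: finite_induct)
    case empty
    then show ?case by (simp add: path_algebra_simps)
  next
    case (insert x A)
    then have "finsum (path_algebra G) g (insert x A) = g x \<oplus>\<^bsub>path_algebra G\<^esub> finsum (path_algebra G) g A"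
      by (intro finsum_insert) auto
    then show ?case using insert by (simp add: path_algebra_simps)
  qed
qed

lemma finite_support_induct [consumes 2, case_names zero add]:
  fixes f :: "'p \<Rightarrow> 'k::field"
  assumes "finite {p. f p \<noteq> 0}" "\<And>p. f p \<noteq> 0 \<Longrightarrow> p \<in> S"
    and zero: "P (\<lambda>_. 0)"
    and add: "\<And>f c p. finite {p. f p \<noteq> 0} \<Longrightarrow> (\<And>p. f p \<noteq> 0 \<Longrightarrow> p \<in> S) \<Longrightarrow> p \<in> S \<Longrightarrow> P f \<Longrightarrow>
      P (\<lambda>q. f q + pmono c p q)"
  shows "P f"
  using assms(1,2)
proof (induction "card {p. f p \<noteq> 0}" arbitrary: f rule: less_induct)
  case (less f)
  show ?case
  proof (cases "{p. f p \<noteq> 0} = {}")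
    case True
    then have "f = (\<lambda>_. 0)" by auto
    then show ?thesis using zero by simp
  next
    case False
    then obtain p where p: "f p \<noteq> 0" by auto
    let ?f = "f(p := 0)"
    have eq: "{q. ?f q \<noteq> 0} = {q. f q \<noteq> 0} - {p}" by auto
    have fin: "finite {q. ?f q \<noteq> 0}" using less.prems unfolding eq by simp
    have sub: "q \<in> S" if "?f q \<noteq> 0" for q using that less.prems(2)[of q] by (cases "q = p") auto
    have "card {q. ?f q \<noteq> 0} < card {q. f q \<noteq> 0}"
      unfolding eq using less.prems(1) p by (intro card_Diff1_less) auto
    then have "P ?f" using less.hyps fin sub by blast
    then have "P (\<lambda>q. ?f q + pmono (f p) p q)" using add[of ?f p "f p"] fin sub less.prems(2)[OF p] by blast
    moreover have "(\<lambda>q. ?f q + pmono (f p) p q) = f" by (auto simp: pmono_def)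
    ultimately show ?thesis by simp
  qed
qed

lemma path_algebra_induct [consumes 1, case_names zero add]:
  assumes "f \<in> carrier (path_algebra G)"
    and "P (\<lambda>_. 0)"
    and "\<And>f c p. f \<in> carrier (path_algebra G) \<Longrightarrow> p \<in> paths G \<Longrightarrow> P f \<Longrightarrow> P (\<lambda>q. f q + pmono c p q)"
  shows "P f"
proof (rule finite_support_induct[where S = "paths G"])
  show "finite {p. f p \<noteq> 0}" "\<And>p. f p \<noteq> 0 \<Longrightarrow> p \<in> paths G"
    using assms(1) unfolding path_algebra_carrier by blast+
qed (use assms(2,3) in \<open>simp_all add: path_algebra_carrier\<close>)

text \<open>Monomials are products of a scalar, a vertex and arrows. Applied to the one-vertex
  quiver of words, the same rule yields induction over the free algebra and hence over
  \<open>L\<close>.\<close>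

lemma (in fin_digraph) path_algebra_gen_induct [consumes 1, case_names scalar vertex arrow add mult]:
  assumes f: "f \<in> carrier (path_algebra G :: ('a \<times> 'b list \<Rightarrow> 'k::field) ring)"
    and scalar: "\<And>c. P (path_scalar G c)"
    and vertex: "\<And>v. v \<in> verts G \<Longrightarrow> P (path_elem (v, []))"
    and arrow: "\<And>e. e \<in> arcs G \<Longrightarrow> P (path_elem (tail G e, [e]))"
    and add: "\<And>f g. f \<in> carrier (path_algebra G) \<Longrightarrow> g \<in> carrier (path_algebra G) \<Longrightarrow> P f \<Longrightarrow> P g \<Longrightarrow>
      P (f \<oplus>\<^bsub>path_algebra G\<^esub> g)"
    and mult: "\<And>f g. f \<in> carrier (path_algebra G) \<Longrightarrow> g \<in> carrier (path_algebra G) \<Longrightarrow> P f \<Longrightarrow> P g \<Longrightarrow>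
      P (f \<otimes>\<^bsub>path_algebra G\<^esub> g)"
  shows "P f"
proof -
  have path: "P (path_elem (u, es))" if "(u, es) \<in> paths G" for u es
    using that
  proof (induction es arbitrary: u)
    case Nil
    then show ?case using vertex by simp
  next
    case (Cons e es)
    then have "P (path_elem (tail G e, [e]) \<otimes>\<^bsub>path_algebra G\<^esub> path_elem (head G e, es))"
      by (intro mult arrow Cons.IH path_elem_carrier) auto
    then show ?case using Cons.prems by (simp add: path_elem_mult)
  qed
  have mono: "P (pmono c p)" if "p \<in> paths G" for c p
  proof -
    have "P (path_scalar G c \<otimes>\<^bsub>path_algebra G\<^esub> path_elem p)"
      using that path[of "fst p" "snd p"] by (intro mult scalar path_scalar_carrier path_elem_carrier) auto
    moreover have "path_scalar G c \<otimes>\<^bsub>path_algebra G\<^esub> path_elem p = pmono c p"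
      unfolding path_scalar_mult[OF path_elem_carrier[OF that]] by (auto simp: path_elem_def pmono_def)
    ultimately show ?thesis by simp
  qed
  have zero: "P (\<lambda>_. 0)"
  proof -
    have "path_scalar G 0 = (\<lambda>_ :: 'a \<times> 'b list. 0 :: 'k)" by (auto simp: path_scalar_def fun_eq_iff)
    then show ?thesis using scalar[of 0] by simp
  qed
  show ?thesis
  proof (rule path_algebra_induct[where P = P, OF f zero])
    fix g :: "'a \<times> 'b list \<Rightarrow> 'k" and c p
    assume "g \<in> carrier (path_algebra G)" "p \<in> paths G" "P g"
    then show "P (\<lambda>q. g q + pmono c p q)" using assms(5)[of g "pmono c p"] mono[of p c]
      by (simp add: pmono_carrier path_algebra_simps)
  qed
qed

text \<open>Scalars, vertices and arrows generate the path algebra as a ring, so stability need only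
  be tested on them.\<close>

lemma (in fin_digraph) path_submoduleI:
  assumes N: "left_module (path_algebra G :: ('a \<times> 'b list \<Rightarrow> 'k::field) ring) N"
    and H: "H \<subseteq> carrier N" "\<zero>\<^bsub>N\<^esub> \<in> H" "\<And>x y. x \<in> H \<Longrightarrow> y \<in> H \<Longrightarrow> x \<oplus>\<^bsub>N\<^esub> y \<in> H"
    and "\<And>c x. x \<in> H \<Longrightarrow> path_scalar G c \<odot>\<^bsub>N\<^esub> x \<in> H"
    and "\<And>v x. v \<in> verts G \<Longrightarrow> x \<in> H \<Longrightarrow> path_elem (v, []) \<odot>\<^bsub>N\<^esub> x \<in> H"
    and "\<And>e x. e \<in> arcs G \<Longrightarrow> x \<in> H \<Longrightarrow> path_elem (tail G e, [e]) \<odot>\<^bsub>N\<^esub> x \<in> H"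
  shows "submodule H (path_algebra G) N"
proof -
  interpret left_module "path_algebra G :: ('a \<times> 'b list \<Rightarrow> 'k) ring" N by (rule N)
  show ?thesis
  proof (rule submoduleI)
    fix a x assume "a \<in> carrier (path_algebra G :: ('a \<times> 'b list \<Rightarrow> 'k) ring)" "x \<in> H"
    then have "\<forall>x\<in>H. a \<odot>\<^bsub>N\<^esub> x \<in> H"
    proof (induction a rule: path_algebra_gen_induct)
      case (add f g)
      then show ?case using H by (auto simp: smult_l_distr subset_iff)
    next
      case (mult f g)
      then show ?case using H by (auto simp: smult_assoc subset_iff)
    qed (use assms in auto)
    then show "a \<odot>\<^bsub>N\<^esub> x \<in> H" using \<open>x \<in> H\<close> by blast
  qed (use H in auto)
qed

section \<open>Leavitt path algebras\<close>

definition word_quiver :: "'x set \<Rightarrow> (unit, 'x) pre_digraph" where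
  "word_quiver S = \<lparr>verts = {()}, arcs = S, tail = (\<lambda>_. ()), head = (\<lambda>_. ())\<rparr>"

lemma word_quiver_simps [simp]:
  "verts (word_quiver S) = {()}" "arcs (word_quiver S) = S"
  "tail (word_quiver S) e = ()" "head (word_quiver S) e = ()"
  by (simp_all add: word_quiver_def)

lemma word_quiver_fin_digraph: "finite S \<Longrightarrow> fin_digraph (word_quiver S)"
  by unfold_locales auto

lemma word_quiver_paths: "finite S \<Longrightarrow> (u, w) \<in> paths (word_quiver S) \<longleftrightarrow> set w \<subseteq> S"
proof -
  assume "finite S"
  then interpret fin_digraph "word_quiver S" by (rule word_quiver_fin_digraph)
  show ?thesis by (induct w arbitrary: u) auto
qed

lemma inverse_quiver_simps [simp]:
  "verts (inverse_quiver E) = verts E" "arcs (inverse_quiver E) = arcs E"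
  "tail (inverse_quiver E) = head E" "head (inverse_quiver E) = tail E"
  by (simp_all add: inverse_quiver_def)

text \<open>\<open>K\<close> fixes the type of the ground field, which the quiver itself does not
  mention.\<close>

locale quiver = fin_digraph E for E :: "('v, 'e) pre_digraph" +
  fixes K :: "'k::field itself"
begin

abbreviation generators :: "('v, 'e) lpa_gen set" where
  "generators \<equiv> Vert ` verts E \<union> Arr ` arcs E \<union> Inv ` arcs E"

abbreviation PathAlg ("\<R>") where "\<R> \<equiv> path_algebra (inverse_quiver E) :: ('v \<times> 'e list \<Rightarrow> 'k) ring"
abbreviation FreeAlg ("\<F>") where "\<F> \<equiv> lpa_free E :: (unit \<times> ('v, 'e) lpa_gen list \<Rightarrow> 'k) ring"
abbreviation LeavittAlg ("\<L>") where "\<L> \<equiv> leavitt E :: (unit \<times> ('v, 'e) lpa_gen list \<Rightarrow> 'k) set ring"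
abbreviation rels where "rels \<equiv> lpa_rels E :: (unit \<times> ('v, 'e) lpa_gen list \<Rightarrow> 'k) set"
abbreviation incl :: "('v \<times> 'e list \<Rightarrow> 'k) \<Rightarrow> (unit \<times> ('v, 'e) lpa_gen list \<Rightarrow> 'k) set"
  where "incl \<equiv> lpa_incl E"
abbreviation vt :: "'v \<Rightarrow> 'v \<times> 'e list \<Rightarrow> 'k" where "vt v \<equiv> path_elem (v, [])"
abbreviation ar :: "'e \<Rightarrow> 'v \<times> 'e list \<Rightarrow> 'k" where "ar e \<equiv> path_elem (head E e, [e])"
abbreviation pend where "pend \<equiv> path_end (inverse_quiver E)"
abbreviation bpaths where "bpaths \<equiv> paths (inverse_quiver E)"

definition proj :: "(unit \<times> ('v, 'e) lpa_gen list \<Rightarrow> 'k) \<Rightarrow> (unit \<times> ('v, 'e) lpa_gen list \<Rightarrow> 'k) set" where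
  "proj f = Idl\<^bsub>\<F>\<^esub> rels +>\<^bsub>\<F>\<^esub> f"

definition wd :: "('v, 'e) lpa_gen list \<Rightarrow> (unit \<times> ('v, 'e) lpa_gen list \<Rightarrow> 'k) set" where
  "wd w = proj (path_elem ((), w))"

text \<open>The element \<open>c \<cdot> 1\<close> of \<open>L\<close>. The ground field acts on
  \<open>L\<close>-modules through these elements.\<close>

definition sc :: "'k \<Rightarrow> (unit \<times> ('v, 'e) lpa_gen list \<Rightarrow> 'k) set" where
  "sc c = proj (path_scalar (word_quiver generators) c)"

abbreviation Vt where "Vt v \<equiv> wd [Vert v]"
abbreviation Ar where "Ar e \<equiv> wd [Arr e]"
abbreviation In where "In e \<equiv> wd [Inv e]"

lemma finite_generators: "finite generators" by simp

lemma free_eq: "\<F> = path_algebra (word_quiver generators)"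
  by (simp add: lpa_free_def free_algebra_def word_quiver_def)

sublocale Eb: fin_digraph "inverse_quiver E"
  by unfold_locales auto

sublocale Wq: fin_digraph "word_quiver generators"
  by (rule word_quiver_fin_digraph[OF finite_generators])

sublocale R: ring \<R> by (rule Eb.path_algebra_ring)

sublocale F: ring \<F> unfolding free_eq by (rule Wq.path_algebra_ring)

lemma word_path [simp]: "((), w) \<in> paths (word_quiver generators) \<longleftrightarrow> set w \<subseteq> generators"
  by (rule word_quiver_paths[OF finite_generators])

lemma word_carrier: "set w \<subseteq> generators \<Longrightarrow> path_elem ((), w) \<in> carrier \<F>"
  unfolding free_eq by (rule path_elem_carrier) simp

lemma word_pmono_carrier: "set w \<subseteq> generators \<Longrightarrow> pmono c ((), w) \<in> carrier \<F>"
  unfolding free_eq by (rule pmono_carrier) simp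

lemma rels_carrier: "rels \<subseteq> carrier \<F>"
proof -
  have c: "lpa_letter x \<in> carrier \<F>" if "x \<in> generators" for x using that by (intro word_carrier) auto
  show ?thesis
    unfolding lpa_rels_def Let_def
    by (auto intro!: F.minus_closed F.m_closed F.finsum_closed c simp: out_arcs_def)
qed

sublocale I: ideal "Idl\<^bsub>\<F>\<^esub> rels" \<F>
  by (rule F.genideal_ideal[OF rels_carrier])

lemma leavitt_eq: "\<L> = \<F> Quot (Idl\<^bsub>\<F>\<^esub> rels)"
  by (simp add: leavitt_def)

sublocale L: ring \<L> unfolding leavitt_eq by (rule I.quotient_is_ring)

lemma proj_hom: "proj \<in> ring_hom \<F> \<L>"
  unfolding leavitt_eq using I.rcos_ring_hom by (simp add: proj_def[abs_def])

lemma proj_closed: "f \<in> carrier \<F> \<Longrightarrow> proj f \<in> carrier \<L>"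
  by (rule ring_hom_closed[OF proj_hom])

lemma proj_add: "f \<in> carrier \<F> \<Longrightarrow> g \<in> carrier \<F> \<Longrightarrow> proj (f \<oplus>\<^bsub>\<F>\<^esub> g) = proj f \<oplus>\<^bsub>\<L>\<^esub> proj g"
  by (rule ring_hom_add[OF proj_hom])

lemma proj_mult: "f \<in> carrier \<F> \<Longrightarrow> g \<in> carrier \<F> \<Longrightarrow> proj (f \<otimes>\<^bsub>\<F>\<^esub> g) = proj f \<otimes>\<^bsub>\<L>\<^esub> proj g"
  by (rule ring_hom_mult[OF proj_hom])

lemma proj_one: "proj \<one>\<^bsub>\<F>\<^esub> = \<one>\<^bsub>\<L>\<^esub>"
  by (rule ring_hom_one[OF proj_hom])

sublocale P: ring_hom_ring \<F> \<L> proj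
  using proj_hom F.ring_axioms L.ring_axioms by (intro ring_hom_ringI2) auto

lemma proj_zero: "proj \<zero>\<^bsub>\<F>\<^esub> = \<zero>\<^bsub>\<L>\<^esub>"
  by (rule P.hom_zero)

lemma proj_finsum:
  "finite A \<Longrightarrow> (\<And>a. a \<in> A \<Longrightarrow> f a \<in> carrier \<F>) \<Longrightarrow>
    proj (\<Oplus>\<^bsub>\<F>\<^esub>a\<in>A. f a) = (\<Oplus>\<^bsub>\<L>\<^esub>a\<in>A. proj (f a))"
  by (induction A rule: finite_induct) (auto simp: proj_zero proj_add proj_closed Pi_def)

lemma L_carrier: "x \<in> carrier \<L> \<longleftrightarrow> (\<exists>f\<in>carrier \<F>. x = proj f)"
  unfolding leavitt_eq proj_def by (auto simp: FactRing_def A_RCOSETS_defs a_r_coset_defs)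

lemma proj_eq_zero_iff: "f \<in> carrier \<F> \<Longrightarrow> proj f = \<zero>\<^bsub>\<L>\<^esub> \<longleftrightarrow> f \<in> Idl\<^bsub>\<F>\<^esub> rels"
  using coset_zero_iff[of \<F> "Idl\<^bsub>\<F>\<^esub> rels" f] F.is_abelian_group I.a_subgroup
  by (simp add: proj_def leavitt_eq FactRing_def)

lemma proj_eq_iff:
  assumes "f \<in> carrier \<F>" "g \<in> carrier \<F>"
  shows "proj f = proj g \<longleftrightarrow> f \<ominus>\<^bsub>\<F>\<^esub> g \<in> Idl\<^bsub>\<F>\<^esub> rels"
  using coset_eq_iff[of \<F> "Idl\<^bsub>\<F>\<^esub> rels" f g] assms F.is_abelian_group I.a_subgroup
  by (simp add: proj_def)

lemma proj_rel: "f \<ominus>\<^bsub>\<F>\<^esub> g \<in> rels \<Longrightarrow> f \<in> carrier \<F> \<Longrightarrow> g \<in> carrier \<F> \<Longrightarrow> proj f = proj g"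
  using F.genideal_self[OF rels_carrier] by (auto simp: proj_eq_iff)

lemma wd_closed [simp]: "set w \<subseteq> generators \<Longrightarrow> wd w \<in> carrier \<L>"
  by (simp add: wd_def proj_closed word_carrier)

lemma wd_append: "set w \<subseteq> generators \<Longrightarrow> set w' \<subseteq> generators \<Longrightarrow> wd (w @ w') = wd w \<otimes>\<^bsub>\<L>\<^esub> wd w'"
proof -
  assume w: "set w \<subseteq> generators" "set w' \<subseteq> generators"
  have "path_elem ((), w) \<otimes>\<^bsub>\<F>\<^esub> path_elem ((), w') = (path_elem ((), w @ w') :: _ \<Rightarrow> 'k)"
    unfolding free_eq path_elem_mult by simp
  then show ?thesis using w by (simp add: wd_def proj_mult[symmetric] word_carrier)
qed

lemma wd_Cons:
  "x \<in> generators \<Longrightarrow> set w \<subseteq> generators \<Longrightarrow> wd (x # w) = wd [x] \<otimes>\<^bsub>\<L>\<^esub> wd w"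
  using wd_append[of "[x]" w] by simp

lemma sc_closed [simp]: "sc c \<in> carrier \<L>"
  unfolding sc_def by (rule proj_closed) (simp add: free_eq Wq.path_scalar_carrier)

lemma sc_commute: "x \<in> carrier \<L> \<Longrightarrow> sc c \<otimes>\<^bsub>\<L>\<^esub> x = x \<otimes>\<^bsub>\<L>\<^esub> sc c"
proof -
  assume "x \<in> carrier \<L>"
  then obtain f where f: "f \<in> carrier \<F>" "x = proj f" using L_carrier by blast
  have s: "path_scalar (word_quiver generators) c \<in> carrier \<F>"
    by (simp add: free_eq Wq.path_scalar_carrier)
  have "path_scalar (word_quiver generators) c \<otimes>\<^bsub>\<F>\<^esub> f = f \<otimes>\<^bsub>\<F>\<^esub> path_scalar (word_quiver generators) c"
    using f(1) unfolding free_eq by (simp add: path_scalar_mult Wq.path_mult_scalar)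
  then show ?thesis using proj_mult[OF s f(1)] proj_mult[OF f(1) s] by (simp add: sc_def f(2))
qed

lemma proj_pmono: "set w \<subseteq> generators \<Longrightarrow> proj (pmono c ((), w)) = sc c \<otimes>\<^bsub>\<L>\<^esub> wd w"
proof -
  assume w: "set w \<subseteq> generators"
  have s: "path_scalar (word_quiver generators) c \<in> carrier \<F>"
    by (simp add: free_eq Wq.path_scalar_carrier)
  have "path_scalar (word_quiver generators) c \<otimes>\<^bsub>\<F>\<^esub> path_elem ((), w) = pmono c ((), w)"
    using path_scalar_mult[OF word_carrier[OF w, unfolded free_eq]]
    unfolding free_eq by (auto simp: path_elem_def pmono_def)
  then show ?thesis
    using proj_mult[OF s word_carrier[OF w]] by (simp add: sc_def wd_def)
qed

lemma sc_mult: "sc (c * d) = sc c \<otimes>\<^bsub>\<L>\<^esub> sc d"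
proof -
  have s: "path_scalar (word_quiver generators) c \<in> carrier \<F>" for c
    by (simp add: free_eq Wq.path_scalar_carrier)
  have "path_scalar (word_quiver generators) c \<otimes>\<^bsub>\<F>\<^esub> path_scalar (word_quiver generators) d =
      path_scalar (word_quiver generators) (c * d)"
    using path_scalar_mult[OF s[unfolded free_eq], of c d] unfolding free_eq
    by (auto simp: path_scalar_def fun_eq_iff)
  then show ?thesis
    using proj_mult[OF s s, of c d] by (simp add: sc_def)
qed

subsection \<open>The defining relations\<close>

lemma letters_mult:
  "x \<in> generators \<Longrightarrow> y \<in> generators \<Longrightarrow> wd [x] \<otimes>\<^bsub>\<L>\<^esub> wd [y] = proj (lpa_letter x \<otimes>\<^bsub>\<F>\<^esub> lpa_letter y)"
  by (simp add: wd_def proj_mult word_carrier)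

lemma Vt_closed [simp]: "v \<in> verts E \<Longrightarrow> Vt v \<in> carrier \<L>" by simp
lemma Ar_closed [simp]: "e \<in> arcs E \<Longrightarrow> Ar e \<in> carrier \<L>" by simp
lemma In_closed [simp]: "e \<in> arcs E \<Longrightarrow> In e \<in> carrier \<L>" by simp

lemma letter_carrier:
  "v \<in> verts E \<Longrightarrow> lpa_letter (Vert v) \<in> carrier \<F>"
  "e \<in> arcs E \<Longrightarrow> lpa_letter (Arr e) \<in> carrier \<F>"
  "e \<in> arcs E \<Longrightarrow> lpa_letter (Inv e) \<in> carrier \<F>"
  by (auto intro!: word_carrier)

lemma Vt_Vt: "v \<in> verts E \<Longrightarrow> w \<in> verts E \<Longrightarrow> Vt v \<otimes>\<^bsub>\<L>\<^esub> Vt w = (if v = w then Vt v else \<zero>\<^bsub>\<L>\<^esub>)"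
proof -
  assume vw: "v \<in> verts E" "w \<in> verts E"
  have "proj (lpa_letter (Vert v) \<otimes>\<^bsub>\<F>\<^esub> lpa_letter (Vert w)) = proj (if v = w then lpa_letter (Vert v) else \<zero>\<^bsub>\<F>\<^esub>)"
    by (rule proj_rel) (use vw letter_carrier in \<open>auto simp: lpa_rels_def Let_def\<close>)
  then show ?thesis using vw by (subst letters_mult) (auto simp: wd_def proj_zero)
qed

lemma Vt_sum: "(\<Oplus>\<^bsub>\<L>\<^esub>v\<in>verts E. Vt v) = \<one>\<^bsub>\<L>\<^esub>"
proof -
  have "proj (\<Oplus>\<^bsub>\<F>\<^esub>v\<in>verts E. lpa_letter (Vert v)) = proj \<one>\<^bsub>\<F>\<^esub>"
    by (rule proj_rel) (auto simp: lpa_rels_def Let_def intro!: F.finsum_closed letter_carrier)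
  then show ?thesis by (simp add: proj_finsum letter_carrier proj_one wd_def)
qed

lemma Vt_Ar: "e \<in> arcs E \<Longrightarrow> Vt (tail E e) \<otimes>\<^bsub>\<L>\<^esub> Ar e = Ar e"
proof -
  assume e: "e \<in> arcs E"
  have "proj (lpa_letter (Vert (tail E e)) \<otimes>\<^bsub>\<F>\<^esub> lpa_letter (Arr e)) = proj (lpa_letter (Arr e))"
    by (rule proj_rel) (use e letter_carrier in \<open>auto simp: lpa_rels_def Let_def\<close>)
  then show ?thesis using e by (subst letters_mult) (auto simp: wd_def)
qed

lemma Vt_In: "e \<in> arcs E \<Longrightarrow> Vt (head E e) \<otimes>\<^bsub>\<L>\<^esub> In e = In e"
proof -
  assume e: "e \<in> arcs E"
  have "proj (lpa_letter (Vert (head E e)) \<otimes>\<^bsub>\<F>\<^esub> lpa_letter (Inv e)) = proj (lpa_letter (Inv e))"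
    by (rule proj_rel) (use e letter_carrier in \<open>auto simp: lpa_rels_def Let_def\<close>)
  then show ?thesis using e by (subst letters_mult) (auto simp: wd_def)
qed

lemma In_Vt: "e \<in> arcs E \<Longrightarrow> In e \<otimes>\<^bsub>\<L>\<^esub> Vt (tail E e) = In e"
proof -
  assume e: "e \<in> arcs E"
  have "proj (lpa_letter (Inv e) \<otimes>\<^bsub>\<F>\<^esub> lpa_letter (Vert (tail E e))) = proj (lpa_letter (Inv e))"
    by (rule proj_rel) (use e letter_carrier in \<open>auto simp: lpa_rels_def Let_def\<close>)
  then show ?thesis using e by (subst letters_mult) (auto simp: wd_def)
qed

lemma In_Ar: "e \<in> arcs E \<Longrightarrow> e' \<in> arcs E \<Longrightarrow>
  In e \<otimes>\<^bsub>\<L>\<^esub> Ar e' = (if e = e' then Vt (head E e) else \<zero>\<^bsub>\<L>\<^esub>)"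
proof -
  assume e: "e \<in> arcs E" "e' \<in> arcs E"
  have "proj (lpa_letter (Inv e) \<otimes>\<^bsub>\<F>\<^esub> lpa_letter (Arr e')) =
      proj (if e = e' then lpa_letter (Vert (head E e)) else \<zero>\<^bsub>\<F>\<^esub>)"
    by (rule proj_rel) (use e letter_carrier in \<open>auto simp: lpa_rels_def Let_def\<close>)
  then show ?thesis using e by (subst letters_mult) (auto simp: wd_def proj_zero)
qed

lemma Vt_nonsink:
  assumes v: "v \<in> verts E - sinks E"
  shows "Vt v = (\<Oplus>\<^bsub>\<L>\<^esub>e\<in>out_arcs E v. Ar e \<otimes>\<^bsub>\<L>\<^esub> In e)"
proof -
  have o: "e \<in> arcs E" if "e \<in> out_arcs E v" for e using that by (simp add: out_arcs_def)
  have fin: "finite (out_arcs E v)" by (rule finite_subset[OF _ finite_arcs]) (use o in blast)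
  have "proj (lpa_letter (Vert v)) = proj (\<Oplus>\<^bsub>\<F>\<^esub>e\<in>out_arcs E v. lpa_letter (Arr e) \<otimes>\<^bsub>\<F>\<^esub> lpa_letter (Inv e))"
    by (rule proj_rel)
      (use v o letter_carrier in \<open>auto simp: lpa_rels_def Let_def intro!: F.finsum_closed\<close>)
  also have "\<dots> = (\<Oplus>\<^bsub>\<L>\<^esub>e\<in>out_arcs E v. proj (lpa_letter (Arr e) \<otimes>\<^bsub>\<F>\<^esub> lpa_letter (Inv e)))"
    by (rule proj_finsum[OF fin]) (use o letter_carrier in auto)
  also have "\<dots> = (\<Oplus>\<^bsub>\<L>\<^esub>e\<in>out_arcs E v. Ar e \<otimes>\<^bsub>\<L>\<^esub> In e)"
    by (rule L.finsum_cong') (use o letter_carrier in \<open>auto simp: wd_def proj_mult\<close>)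
  finally show ?thesis by (simp add: wd_def)
qed

lemma L_induct [consumes 1, case_names scalar gen add mult]:
  assumes "x \<in> carrier \<L>"
    and scalar: "\<And>c. P (sc c)"
    and gen: "\<And>y. y \<in> generators \<Longrightarrow> P (wd [y])"
    and add: "\<And>x y. x \<in> carrier \<L> \<Longrightarrow> y \<in> carrier \<L> \<Longrightarrow> P x \<Longrightarrow> P y \<Longrightarrow> P (x \<oplus>\<^bsub>\<L>\<^esub> y)"
    and mult: "\<And>x y. x \<in> carrier \<L> \<Longrightarrow> y \<in> carrier \<L> \<Longrightarrow> P x \<Longrightarrow> P y \<Longrightarrow> P (x \<otimes>\<^bsub>\<L>\<^esub> y)"
  shows "P x"
proof -
  obtain f where f: "f \<in> carrier \<F>" "x = proj f" using assms(1) L_carrier by blast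
  have "P (proj f)"
    using f(1) unfolding free_eq
  proof (induction f rule: Wq.path_algebra_gen_induct)
    case (scalar c)
    then show ?case using assms(2)[of c] by (simp add: sc_def)
  next
    case (vertex v)
    \<comment> \<open>In the quiver with one vertex the trivial path is the identity, so this case
      is that of the scalar 1.\<close>
    have "path_elem ((), []) = (path_scalar (word_quiver generators) 1 :: _ \<Rightarrow> 'k)"
      by (auto simp: path_elem_def path_scalar_def)
    then show ?case using assms(2)[of 1] by (simp add: sc_def)
  next
    case (arrow e)
    then show ?case using gen[of e] by (simp add: wd_def)
  next
    case (add f g)
    then show ?case using assms(4)[of "proj f" "proj g"]
      by (simp add: free_eq[symmetric] proj_add proj_closed)
  next
    case (mult f g)
    then show ?case using assms(5)[of "proj f" "proj g"]
      by (simp add: free_eq[symmetric] proj_mult proj_closed)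
  qed
  then show ?thesis using f by simp
qed

subsection \<open>The inclusion of the path algebra\<close>

text \<open>The representative in the free algebra by which \<open>lpa_incl\<close> is defined. It
  gets a name because the right action on path functions is evaluated on representatives.\<close>

definition wlift :: "('v \<times> 'e list \<Rightarrow> 'k) \<Rightarrow> unit \<times> ('v, 'e) lpa_gen list \<Rightarrow> 'k" where
  "wlift f = (\<lambda>q. \<Sum>p | f p \<noteq> 0. f p * path_elem ((), inverse_path_word p) q)"

lemma incl_eq: "incl f = proj (wlift f)"
  by (simp add: lpa_incl_def proj_def wlift_def)

lemma wlift_superset:
  "finite A \<Longrightarrow> {p. f p \<noteq> 0} \<subseteq> A \<Longrightarrow> wlift f q = (\<Sum>p\<in>A. f p * path_elem ((), inverse_path_word p) q)"
  unfolding wlift_def by (rule sum.mono_neutral_left) auto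

lemma wlift_add:
  assumes "finite {p. f p \<noteq> 0}" "finite {p. g p \<noteq> 0}"
  shows "wlift (\<lambda>p. f p + g p) = (\<lambda>q. wlift f q + wlift g q)"
proof
  fix q
  let ?A = "{p. f p \<noteq> 0} \<union> {p. g p \<noteq> 0}"
  have "wlift (\<lambda>p. f p + g p) q = (\<Sum>p\<in>?A. (f p + g p) * path_elem ((), inverse_path_word p) q)"
    by (rule wlift_superset) (use assms in auto)
  also have "\<dots> = (\<Sum>p\<in>?A. f p * path_elem ((), inverse_path_word p) q) + (\<Sum>p\<in>?A. g p * path_elem ((), inverse_path_word p) q)"
    by (simp add: distrib_right sum.distrib)
  also have "(\<Sum>p\<in>?A. f p * path_elem ((), inverse_path_word p) q) = wlift f q"
    by (rule wlift_superset[symmetric]) (use assms in auto)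
  also have "(\<Sum>p\<in>?A. g p * path_elem ((), inverse_path_word p) q) = wlift g q"
    by (rule wlift_superset[symmetric]) (use assms in auto)
  finally show "wlift (\<lambda>p. f p + g p) q = wlift f q + wlift g q" .
qed

lemma wlift_zero: "wlift (\<lambda>_. 0) = (\<lambda>_. 0)"
  by (simp add: wlift_def)

lemma wlift_pmono: "wlift (pmono c p) = pmono c ((), inverse_path_word p)"
proof
  fix q
  have "wlift (pmono c p) q = (\<Sum>p'\<in>{p}. pmono c p p' * path_elem ((), inverse_path_word p') q)"
    by (rule wlift_superset) (auto simp: pmono_def)
  then show "wlift (pmono c p) q = pmono c ((), inverse_path_word p) q"
    by (simp add: pmono_def path_elem_def)
qed

lemma bpaths_arcs: "(u, es) \<in> bpaths \<Longrightarrow> set es \<subseteq> arcs E"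
  by (induct es arbitrary: u) auto

lemma inverse_path_word_gens: "p \<in> bpaths \<Longrightarrow> set (inverse_path_word p) \<subseteq> generators"
proof -
  assume p: "p \<in> bpaths"
  obtain u es where ues: "p = (u, es)" by (cases p)
  then have "u \<in> verts E" "set es \<subseteq> arcs E" using p paths_start[of u es "inverse_quiver E"] bpaths_arcs[of u es] by simp_all
  then show ?thesis by (auto simp: ues inverse_path_word_def)
qed

lemma wlift_closed: "f \<in> carrier \<R> \<Longrightarrow> wlift f \<in> carrier \<F>"
proof (induction f rule: path_algebra_induct)
  case zero
  then show ?case using F.zero_closed by (simp add: wlift_zero free_eq path_algebra_simps)
next
  case (add f c p)
  then have "wlift f \<oplus>\<^bsub>\<F>\<^esub> wlift (pmono c p) \<in> carrier \<F>"
    by (intro F.a_closed) (auto simp: wlift_pmono inverse_path_word_gens word_pmono_carrier)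
  moreover have "wlift f \<oplus>\<^bsub>\<F>\<^esub> wlift (pmono c p) = wlift (\<lambda>q. f q + pmono c p q)"
    using add pmono_carrier[of p "inverse_quiver E" c]
    by (subst wlift_add) (auto simp: path_algebra_carrier free_eq path_algebra_simps)
  ultimately show ?case by simp
qed

lemma incl_closed: "f \<in> carrier \<R> \<Longrightarrow> incl f \<in> carrier \<L>"
  by (simp add: incl_eq wlift_closed proj_closed)

lemma incl_zero: "incl (\<lambda>_. 0) = \<zero>\<^bsub>\<L>\<^esub>"
  using proj_zero by (simp add: incl_eq wlift_zero free_eq path_algebra_simps)

lemma incl_add: "f \<in> carrier \<R> \<Longrightarrow> g \<in> carrier \<R> \<Longrightarrow> incl (f \<oplus>\<^bsub>\<R>\<^esub> g) = incl f \<oplus>\<^bsub>\<L>\<^esub> incl g"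
proof -
  assume f: "f \<in> carrier \<R>" and g: "g \<in> carrier \<R>"
  have "wlift (f \<oplus>\<^bsub>\<R>\<^esub> g) = wlift f \<oplus>\<^bsub>\<F>\<^esub> wlift g"
    using f g unfolding free_eq path_algebra_simps path_algebra_carrier by (intro wlift_add) blast+
  then show ?thesis using proj_add[OF wlift_closed[OF f] wlift_closed[OF g]] by (simp add: incl_eq)
qed

lemma incl_pmono: "p \<in> bpaths \<Longrightarrow> incl (pmono c p) = sc c \<otimes>\<^bsub>\<L>\<^esub> wd (inverse_path_word p)"
  by (simp add: incl_eq wlift_pmono proj_pmono inverse_path_word_gens)

text \<open>A trivial path is represented by a letter and not by the empty word, so concatenation of
  words matches concatenation of paths only after the vertex relations absorb that letter
  (\<open>start\<close>, \<open>stop\<close>). For paths that do not meet, the two vertices inserted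
  between the words annihilate each other.\<close>

lemma inverse_path_word_mult:
  assumes p: "p \<in> bpaths" and q: "q \<in> bpaths"
  shows "wd (inverse_path_word p) \<otimes>\<^bsub>\<L>\<^esub> wd (inverse_path_word q) =
    (if pend p = fst q then wd (inverse_path_word (fst p, snd p @ snd q)) else \<zero>\<^bsub>\<L>\<^esub>)"
proof -
  obtain u es v fs where pq: "p = (u, es)" "q = (v, fs)" by (cases p, cases q)
  have uv: "u \<in> verts E" "v \<in> verts E" using p q pq paths_start by fastforce+
  have start: "Vt v \<otimes>\<^bsub>\<L>\<^esub> wd (inverse_path_word q) = wd (inverse_path_word q)"
  proof (cases fs)
    case Nil
    then show ?thesis using uv pq by (simp add: inverse_path_word_def Vt_Vt)
  next
    case (Cons e gs)
    then have e: "e \<in> arcs E" "v = head E e" "set (map Inv gs) \<subseteq> generators"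
      using q pq bpaths_arcs[of "tail E e" gs] by auto
    then have "wd (inverse_path_word q) = In e \<otimes>\<^bsub>\<L>\<^esub> wd (map Inv gs)"
      using wd_Cons[of "Inv e" "map Inv gs"] by (simp add: pq Cons inverse_path_word_def)
    then show ?thesis
      using e uv by (simp add: L.m_assoc[symmetric] Vt_In del: wd_Cons)
  qed
  have stop: "wd (inverse_path_word p) \<otimes>\<^bsub>\<L>\<^esub> Vt (pend p) = wd (inverse_path_word p)"
  proof (cases es rule: rev_cases)
    case Nil
    then show ?thesis using uv pq by (simp add: inverse_path_word_def Vt_Vt)
  next
    case (snoc gs e)
    then have e: "e \<in> arcs E" "set (map Inv gs) \<subseteq> generators"
      using p pq bpaths_arcs[of u gs] by auto
    then have "wd (inverse_path_word p) = wd (map Inv gs) \<otimes>\<^bsub>\<L>\<^esub> In e"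
      using wd_append[of "map Inv gs" "[Inv e]"] by (simp add: pq snoc inverse_path_word_def)
    then show ?thesis
      using e by (simp add: pq snoc L.m_assoc In_Vt)
  qed
  have wp: "wd (inverse_path_word p) \<in> carrier \<L>" "wd (inverse_path_word q) \<in> carrier \<L>"
    using p q inverse_path_word_gens by auto
  have pv: "pend p \<in> verts E" using Eb.path_end_in_verts[of u es] p pq by simp
  show ?thesis
  proof (cases "pend p = v")
    case False
    have "wd (inverse_path_word p) \<otimes>\<^bsub>\<L>\<^esub> wd (inverse_path_word q) =
      (wd (inverse_path_word p) \<otimes>\<^bsub>\<L>\<^esub> Vt (pend p)) \<otimes>\<^bsub>\<L>\<^esub> (Vt v \<otimes>\<^bsub>\<L>\<^esub> wd (inverse_path_word q))"
      by (simp only: start stop)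
    also have "\<dots> = wd (inverse_path_word p) \<otimes>\<^bsub>\<L>\<^esub> (Vt (pend p) \<otimes>\<^bsub>\<L>\<^esub> Vt v) \<otimes>\<^bsub>\<L>\<^esub> wd (inverse_path_word q)"
      using wp pv uv by (simp add: L.m_assoc)
    also have "\<dots> = \<zero>\<^bsub>\<L>\<^esub>" using False wp pv uv by (simp add: Vt_Vt)
    finally show ?thesis using False pq by simp
  next
    case True
    show ?thesis
    proof (cases "es = []")
      case True
      then show ?thesis using start \<open>pend p = v\<close> pq by (simp add: inverse_path_word_def)
    next
      case es: False
      show ?thesis
      proof (cases "fs = []")
        case True
        then show ?thesis using stop \<open>pend p = v\<close> pq es by (simp add: inverse_path_word_def)
      next
        case False
        have "set (map Inv es) \<subseteq> generators" "set (map Inv fs) \<subseteq> generators"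
          using inverse_path_word_gens[OF p] inverse_path_word_gens[OF q] es False
          by (simp_all add: pq inverse_path_word_def)
        then show ?thesis using \<open>pend p = v\<close> es False wd_append[of "map Inv es" "map Inv fs"]
          by (simp add: pq inverse_path_word_def)
      qed
    qed
  qed
qed

lemma incl_mult_pmono:
  assumes "p \<in> bpaths" "q \<in> bpaths"
  shows "incl (pmono c p \<otimes>\<^bsub>\<R>\<^esub> pmono d q) = incl (pmono c p) \<otimes>\<^bsub>\<L>\<^esub> incl (pmono d q)"
proof -
  have wp: "wd (inverse_path_word p) \<in> carrier \<L>" "wd (inverse_path_word q) \<in> carrier \<L>"
    using assms inverse_path_word_gens by auto
  have "incl (pmono c p) \<otimes>\<^bsub>\<L>\<^esub> incl (pmono d q) =
    sc c \<otimes>\<^bsub>\<L>\<^esub> (wd (inverse_path_word p) \<otimes>\<^bsub>\<L>\<^esub> sc d) \<otimes>\<^bsub>\<L>\<^esub> wd (inverse_path_word q)"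
    using wp assms by (simp add: incl_pmono L.m_assoc)
  also have "\<dots> = sc c \<otimes>\<^bsub>\<L>\<^esub> (sc d \<otimes>\<^bsub>\<L>\<^esub> wd (inverse_path_word p)) \<otimes>\<^bsub>\<L>\<^esub> wd (inverse_path_word q)"
    by (simp only: sc_commute[OF wp(1)])
  also have "\<dots> = sc (c * d) \<otimes>\<^bsub>\<L>\<^esub> (wd (inverse_path_word p) \<otimes>\<^bsub>\<L>\<^esub> wd (inverse_path_word q))"
    using wp by (simp add: sc_mult L.m_assoc)
  also have "\<dots> = incl (pmono c p \<otimes>\<^bsub>\<R>\<^esub> pmono d q)"
  proof (cases "pend p = fst q")
    case True
    then have "(fst p, snd p @ snd q) \<in> bpaths" using assms by (cases p, cases q) auto
    then show ?thesis using True assms by (simp add: inverse_path_word_mult pmono_mult incl_pmono)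
  next
    case False
    then show ?thesis using assms by (simp add: inverse_path_word_mult pmono_mult incl_zero)
  qed
  finally show ?thesis ..
qed

lemma incl_mult:
  assumes f: "f \<in> carrier \<R>" and g: "g \<in> carrier \<R>"
  shows "incl (f \<otimes>\<^bsub>\<R>\<^esub> g) = incl f \<otimes>\<^bsub>\<L>\<^esub> incl g"
proof -
  have mono: "incl (pmono c p \<otimes>\<^bsub>\<R>\<^esub> g) = incl (pmono c p) \<otimes>\<^bsub>\<L>\<^esub> incl g" if p: "p \<in> bpaths" for c p
    using g
  proof (induction g rule: path_algebra_induct)
    case zero
    have "pmono c p \<otimes>\<^bsub>\<R>\<^esub> \<zero>\<^bsub>\<R>\<^esub> = \<zero>\<^bsub>\<R>\<^esub>" using p by (simp add: pmono_carrier)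
    then show ?case using p by (simp add: path_algebra_simps incl_zero incl_closed pmono_carrier)
  next
    case (add g d q)
    note c = pmono_carrier[OF p, of c] pmono_carrier[OF add(2), of d]
    have "(\<lambda>x. g x + pmono d q x) = g \<oplus>\<^bsub>\<R>\<^esub> pmono d q" by (simp add: path_algebra_simps)
    then show ?case using add p c
      by (simp add: R.r_distr incl_add incl_closed L.r_distr incl_mult_pmono)
  qed
  show ?thesis
    using f
  proof (induction f rule: path_algebra_induct)
    case zero
    have "\<zero>\<^bsub>\<R>\<^esub> \<otimes>\<^bsub>\<R>\<^esub> g = \<zero>\<^bsub>\<R>\<^esub>" using g by simp
    then show ?case using g by (simp add: path_algebra_simps incl_zero incl_closed)
  next
    case (add f d q)
    note c = pmono_carrier[OF add(2), of d]
    have "(\<lambda>x. f x + pmono d q x) = f \<oplus>\<^bsub>\<R>\<^esub> pmono d q" by (simp add: path_algebra_simps)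
    then show ?case using add g c mono[OF add(2)]
      by (simp add: R.l_distr incl_add incl_closed L.l_distr)
  qed
qed

lemma vt_carrier [simp]: "v \<in> verts E \<Longrightarrow> vt v \<in> carrier \<R>"
  by (rule path_elem_carrier) simp

lemma ar_carrier [simp]: "e \<in> arcs E \<Longrightarrow> ar e \<in> carrier \<R>"
  by (rule path_elem_carrier) simp

lemma rscalar_carrier [simp]: "path_scalar (inverse_quiver E) c \<in> carrier \<R>"
  by (rule Eb.path_scalar_carrier)

lemma sc_one: "sc 1 = \<one>\<^bsub>\<L>\<^esub>"
  using proj_one by (simp add: sc_def free_eq path_algebra_one)

lemma incl_vt: "v \<in> verts E \<Longrightarrow> incl (vt v) = Vt v"
  using incl_pmono[of "(v, [])" 1] by (simp add: path_elem_pmono sc_one inverse_path_word_def)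

lemma incl_ar: "e \<in> arcs E \<Longrightarrow> incl (ar e) = In e"
  using incl_pmono[of "(head E e, [e])" 1] by (simp add: path_elem_pmono sc_one inverse_path_word_def)

text \<open>A scalar of the path algebra is \<open>\<Sum> c p_v\<close>, while one of the free
  algebra is a multiple of the empty word; the relation \<open>\<Sum> p_v = 1\<close> identifies
  them.\<close>

lemma incl_scalar: "incl (path_scalar (inverse_quiver E) c) = sc c"
proof -
  have m: "pmono c (v, []) \<in> carrier \<R>" if "v \<in> verts E" for v :: 'v
    using that by (intro pmono_carrier) simp
  have ps: "path_scalar (inverse_quiver E) c = (\<Oplus>\<^bsub>\<R>\<^esub>v\<in>verts E. pmono c (v, []))"
  proof -
    have "(\<Oplus>\<^bsub>\<R>\<^esub>v\<in>verts E. pmono c (v, [])) = (\<lambda>p. \<Sum>v\<in>verts E. pmono c (v, []) p)"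
      using m by (intro Eb.path_algebra_finsum) auto
    also have "\<dots> = path_scalar (inverse_quiver E) c"
    proof (intro ext, clarify)
      fix u :: 'v and es :: "'e list"
      have "(\<Sum>v\<in>verts E. pmono c (v, []) (u, es)) = (\<Sum>v\<in>verts E. if v = u then (if es = [] then c else 0) else 0)"
        by (rule sum.cong) (auto simp: pmono_def)
      then show "(\<Sum>v\<in>verts E. pmono c (v, []) (u, es)) = path_scalar (inverse_quiver E) c (u, es)"
        by (simp add: sum.delta path_scalar_def)
    qed
    finally show ?thesis ..
  qed
  have "incl (path_scalar (inverse_quiver E) c) = incl (\<Oplus>\<^bsub>\<R>\<^esub>v\<in>verts E. pmono c (v, []))"
    by (simp only: ps)
  also have "incl (\<Oplus>\<^bsub>\<R>\<^esub>v\<in>verts E. pmono c (v, [])) = (\<Oplus>\<^bsub>\<L>\<^esub>v\<in>verts E. incl (pmono c (v, [])))"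
  proof -
    have "A \<subseteq> verts E \<Longrightarrow> incl (\<Oplus>\<^bsub>\<R>\<^esub>v\<in>A. pmono c (v, [])) = (\<Oplus>\<^bsub>\<L>\<^esub>v\<in>A. incl (pmono c (v, [])))"
      if "finite A" for A
      using that
    proof (induction A rule: finite_induct)
      case empty
      then show ?case using incl_zero by (simp add: path_algebra_simps)
    next
      case (insert v A)
      then have c: "pmono c (v, []) \<in> carrier \<R>" "(\<lambda>v. pmono c (v, [])) \<in> A \<rightarrow> carrier \<R>"
        "(\<lambda>v. incl (pmono c (v, []))) \<in> A \<rightarrow> carrier \<L>"
        using m incl_closed by (auto simp: Pi_def)
      have "incl (\<Oplus>\<^bsub>\<R>\<^esub>v\<in>insert v A. pmono c (v, [])) = incl (pmono c (v, []) \<oplus>\<^bsub>\<R>\<^esub> (\<Oplus>\<^bsub>\<R>\<^esub>v\<in>A. pmono c (v, [])))"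
        using R.finsum_insert[OF insert(1,2) c(2,1)] by simp
      also have "\<dots> = incl (pmono c (v, [])) \<oplus>\<^bsub>\<L>\<^esub> (\<Oplus>\<^bsub>\<L>\<^esub>v\<in>A. incl (pmono c (v, [])))"
        using insert.IH insert.prems incl_add[OF c(1) R.finsum_closed[OF c(2)]] by simp
      also have "\<dots> = (\<Oplus>\<^bsub>\<L>\<^esub>v\<in>insert v A. incl (pmono c (v, [])))"
        using L.finsum_insert[OF insert(1,2) c(3) incl_closed[OF c(1)]] by simp
      finally show ?case .
    qed
    then show ?thesis by simp
  qed
  also have "\<dots> = (\<Oplus>\<^bsub>\<L>\<^esub>v\<in>verts E. sc c \<otimes>\<^bsub>\<L>\<^esub> Vt v)"
    by (rule L.finsum_cong') (auto simp: incl_pmono inverse_path_word_def)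
  also have "\<dots> = sc c \<otimes>\<^bsub>\<L>\<^esub> (\<Oplus>\<^bsub>\<L>\<^esub>v\<in>verts E. Vt v)"
    by (rule L.finsum_rdistr[symmetric]) auto
  finally show ?thesis by (simp add: Vt_sum)
qed

lemma incl_hom: "incl \<in> ring_hom \<R> \<L>"
proof (rule ring_hom_memI)
  show "incl \<one>\<^bsub>\<R>\<^esub> = \<one>\<^bsub>\<L>\<^esub>" by (simp add: path_algebra_one incl_scalar sc_one)
qed (simp_all add: incl_closed incl_add incl_mult)

end

section \<open>Restriction of scalars and closed submodules\<close>

definition restrict_scalars :: "('a \<Rightarrow> 'b) \<Rightarrow> ('b, 'm) module \<Rightarrow> ('a, 'm) module" where
  "restrict_scalars \<phi> M =
     \<lparr>carrier = carrier M, monoid.mult = undefined, one = undefined,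
      ring.zero = \<zero>\<^bsub>M\<^esub>, ring.add = ring.add M, module.smult = (\<lambda>a x. \<phi> a \<odot>\<^bsub>M\<^esub> x)\<rparr>"

lemma restrict_scalars_simps [simp]:
  "carrier (restrict_scalars \<phi> M) = carrier M"
  "\<zero>\<^bsub>restrict_scalars \<phi> M\<^esub> = \<zero>\<^bsub>M\<^esub>"
  "x \<oplus>\<^bsub>restrict_scalars \<phi> M\<^esub> y = x \<oplus>\<^bsub>M\<^esub> y"
  "a \<odot>\<^bsub>restrict_scalars \<phi> M\<^esub> x = \<phi> a \<odot>\<^bsub>M\<^esub> x"
  by (simp_all add: restrict_scalars_def)

lemma restrict_scalars_a_inv [simp]: "\<ominus>\<^bsub>restrict_scalars \<phi> M\<^esub> x = \<ominus>\<^bsub>M\<^esub> x"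
  by (simp add: a_inv_def m_inv_def)

lemma restrict_scalars_a_minus [simp]: "x \<ominus>\<^bsub>restrict_scalars \<phi> M\<^esub> y = x \<ominus>\<^bsub>M\<^esub> y"
  by (simp add: a_minus_def)

lemma restrict_scalars_left_module:
  assumes "ring A" "\<phi> \<in> ring_hom A B" "left_module B M"
  shows "left_module A (restrict_scalars \<phi> M)"
proof -
  interpret left_module B M by (rule assms(3))
  show ?thesis
  proof (rule left_moduleI)
    show "abelian_group (restrict_scalars \<phi> M)"
      by (rule abelian_groupI) (auto simp: M.a_ac intro: bexI[of _ "\<ominus>\<^bsub>M\<^esub> _"] M.l_neg)
  qed (use assms(1) ring_hom_closed[OF assms(2)] ring_hom_add[OF assms(2)] ring_hom_mult[OF assms(2)]
      ring_hom_one[OF assms(2)] in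
      \<open>auto simp: smult_closed smult_l_distr smult_r_distr smult_assoc smult_one\<close>)
qed

lemma (in left_module) submodule_finsum:
  assumes "submodule U R M" "finite A" "\<And>a. a \<in> A \<Longrightarrow> f a \<in> U"
  shows "(\<Oplus>\<^bsub>M\<^esub>a\<in>A. f a) \<in> U"
  using assms(2,3)
proof (induction A rule: finite_induct)
  case (insert a A)
  then show ?case
    using submodule_mem[OF assms(1)] submodule_add[OF assms(1)] by (subst M.finsum_insert) auto
qed (simp add: submodule_zero[OF assms(1)])

lemma finite_uniform_bound:
  assumes "finite A" "\<And>a. a \<in> A \<Longrightarrow> \<exists>n. P a n" "\<And>a m n. P a m \<Longrightarrow> m \<le> n \<Longrightarrow> P a n"
  shows "\<exists>n::nat. \<forall>a\<in>A. P a n"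
  using assms(1,2)
proof (induction A rule: finite_induct)
  case (insert a A)
  obtain n where n: "\<forall>b\<in>A. P b n" using insert by blast
  obtain m where m: "P a m" using insert by blast
  have "\<forall>b\<in>insert a A. P b (max m n)"
    using n m assms(3)[OF m, of "max m n"] assms(3)[of _ n "max m n"] by simp
  then show ?case ..
qed simp

context quiver
begin

abbreviation res :: "((unit \<times> ('v, 'e) lpa_gen list \<Rightarrow> 'k) set, 'm) module \<Rightarrow> ('v \<times> 'e list \<Rightarrow> 'k, 'm) module"
  where "res M \<equiv> restrict_scalars incl M"

lemma res_left_module: "left_module \<L> M \<Longrightarrow> left_module \<R> (res M)"
  by (rule restrict_scalars_left_module[OF R.ring_axioms incl_hom])

lemma sinks_verts: "v \<in> sinks E \<Longrightarrow> v \<in> verts E"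
  by (simp add: sinks_def)

lemma finite_sinks: "finite (sinks E)"
  by (rule finite_subset[OF _ finite_verts]) (auto simp: sinks_def)

lemma tail_not_sink: "e \<in> arcs E \<Longrightarrow> tail E e \<notin> sinks E"
  by (auto simp: sinks_def out_arcs_def)

lemma ar_vt: "ar e \<otimes>\<^bsub>\<R>\<^esub> vt v = (if v = tail E e then ar e else \<zero>\<^bsub>\<R>\<^esub>)"
  by (simp add: path_elem_mult path_algebra_simps)

lemma vt_ar: "vt v \<otimes>\<^bsub>\<R>\<^esub> ar e = (if v = head E e then ar e else \<zero>\<^bsub>\<R>\<^esub>)"
  by (simp add: path_elem_mult path_algebra_simps)

lemma vt_vt: "vt v \<otimes>\<^bsub>\<R>\<^esub> vt w = (if v = w then vt v else \<zero>\<^bsub>\<R>\<^esub>)"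
  by (simp add: path_elem_mult path_algebra_simps)

lemma vt_sum: "(\<Oplus>\<^bsub>\<R>\<^esub>v\<in>verts E. vt v) = \<one>\<^bsub>\<R>\<^esub>"
proof -
  have "(\<Oplus>\<^bsub>\<R>\<^esub>v\<in>verts E. vt v) = (\<lambda>p. \<Sum>v\<in>verts E. vt v p)"
    by (intro Eb.path_algebra_finsum) auto
  also have "\<dots> = path_scalar (inverse_quiver E) 1"
  proof (intro ext, clarify)
    fix u :: 'v and es :: "'e list"
    have "(\<Sum>v\<in>verts E. vt v (u, es)) = (\<Sum>v\<in>verts E. if v = u then (if es = [] then 1 else 0) else 0)"
      by (rule sum.cong) (auto simp: path_elem_def)
    then show "(\<Sum>v\<in>verts E. vt v (u, es)) = path_scalar (inverse_quiver E) 1 (u, es)"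
      by (simp add: sum.delta path_scalar_def)
  qed
  finally show ?thesis by (simp add: path_algebra_one)
qed

lemma scalar_commute:
  "a \<in> carrier \<R> \<Longrightarrow> a \<otimes>\<^bsub>\<R>\<^esub> path_scalar (inverse_quiver E) c = path_scalar (inverse_quiver E) c \<otimes>\<^bsub>\<R>\<^esub> a"
  by (simp add: path_scalar_mult Eb.path_mult_scalar)

text \<open>
  For an \<open>L\<close>-module \<open>M\<close> and an \<open>R\<close>-submodule \<open>H\<close> of \<open>M\<close>, iterating \<open>dstep\<close> on \<open>H\<close> exhausts the
  \<open>L\<close>-submodule generated by \<open>H\<close>, since \<open>x = \<Sum>\<^sub>v p\<^sub>v x\<close> over the sinks \<open>v\<close> plus
  \<open>\<Sum>\<^sub>e e (\<bar>e x)\<close>.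
\<close>

definition dstep :: "('v \<times> 'e list \<Rightarrow> 'k, 'n) module \<Rightarrow> 'n set \<Rightarrow> 'n set" where
  "dstep N H = {x \<in> carrier N. (\<forall>e\<in>arcs E. ar e \<odot>\<^bsub>N\<^esub> x \<in> H) \<and> (\<forall>v\<in>sinks E. vt v \<odot>\<^bsub>N\<^esub> x \<in> H)}"

definition dcl :: "('v \<times> 'e list \<Rightarrow> 'k, 'n) module \<Rightarrow> 'n set \<Rightarrow> 'n set" where
  "dcl N H = (\<Union>n. (dstep N ^^ n) H)"

lemma dstepD:
  assumes "x \<in> dstep N H"
  shows "x \<in> carrier N" "e \<in> arcs E \<Longrightarrow> ar e \<odot>\<^bsub>N\<^esub> x \<in> H" "v \<in> sinks E \<Longrightarrow> vt v \<odot>\<^bsub>N\<^esub> x \<in> H"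
  using assms by (auto simp: dstep_def)

lemma dstepI:
  assumes "x \<in> carrier N" "\<And>e. e \<in> arcs E \<Longrightarrow> ar e \<odot>\<^bsub>N\<^esub> x \<in> H" "\<And>v. v \<in> sinks E \<Longrightarrow> vt v \<odot>\<^bsub>N\<^esub> x \<in> H"
  shows "x \<in> dstep N H"
  using assms by (simp add: dstep_def)

lemma dstep_mono: "H \<subseteq> H' \<Longrightarrow> dstep N H \<subseteq> dstep N H'"
  by (auto simp: dstep_def)

lemma dstep_iter_mono: "H \<subseteq> H' \<Longrightarrow> (dstep N ^^ n) H \<subseteq> (dstep N ^^ n) H'"
  by (induction n) (auto dest: dstep_mono)

lemma dcl_mono: "H \<subseteq> H' \<Longrightarrow> dcl N H \<subseteq> dcl N H'"
  unfolding dcl_def by (rule UN_mono[OF subset_refl]) (rule dstep_iter_mono)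

lemma dcl_least: "H \<subseteq> U \<Longrightarrow> dstep N U \<subseteq> U \<Longrightarrow> dcl N H \<subseteq> U"
proof -
  assume "H \<subseteq> U" "dstep N U \<subseteq> U"
  then have "(dstep N ^^ n) H \<subseteq> U" for n
  proof (induction n)
    case (Suc n)
    then show ?case using dstep_mono[OF Suc.IH, of N] \<open>dstep N U \<subseteq> U\<close> by simp
  qed simp
  then show ?thesis unfolding dcl_def by (intro UN_least)
qed

lemma dcl_superset: "H \<subseteq> dcl N H"
proof
  fix x assume "x \<in> H"
  then have "x \<in> (dstep N ^^ 0) H" by simp
  then show "x \<in> dcl N H" unfolding dcl_def by (rule UN_I[OF UNIV_I])
qed

lemma dstep_iter_subset_dcl: "(dstep N ^^ n) H \<subseteq> dcl N H"
  by (auto simp: dcl_def)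

end

locale path_module = quiver E K + N: left_module "path_algebra (inverse_quiver E)" N
  for E :: "('v, 'e) pre_digraph" and K :: "'k::field itself"
    and N :: "('v \<times> 'e list \<Rightarrow> 'k, 'n) module"
begin

lemma vt_decomposition: "x \<in> carrier N \<Longrightarrow> (\<Oplus>\<^bsub>N\<^esub>v\<in>verts E. vt v \<odot>\<^bsub>N\<^esub> x) = x"
  using N.smult_finsum_l[of "verts E" vt x] by (simp add: vt_sum N.smult_one Pi_def)

lemma path_submoduleI:
  assumes "H \<subseteq> carrier N" "\<zero>\<^bsub>N\<^esub> \<in> H" "\<And>x y. x \<in> H \<Longrightarrow> y \<in> H \<Longrightarrow> x \<oplus>\<^bsub>N\<^esub> y \<in> H"
    and "\<And>c x. x \<in> H \<Longrightarrow> path_scalar (inverse_quiver E) c \<odot>\<^bsub>N\<^esub> x \<in> H"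
    and "\<And>v x. v \<in> verts E \<Longrightarrow> x \<in> H \<Longrightarrow> vt v \<odot>\<^bsub>N\<^esub> x \<in> H"
    and "\<And>e x. e \<in> arcs E \<Longrightarrow> x \<in> H \<Longrightarrow> ar e \<odot>\<^bsub>N\<^esub> x \<in> H"
  shows "submodule H \<R> N"
  by (rule Eb.path_submoduleI[OF N.left_module_self]) (use assms in auto)

text \<open>Multiplying by a vertex before an arrow or a sink either changes nothing or gives 0,
  scalars commute with both, and an arrow takes \<open>dstep N H\<close> into \<open>H\<close>,
  which is itself closed.\<close>

lemma dstep_submodule:
  assumes H: "submodule H \<R> N"
  shows "submodule (dstep N H) \<R> N"
proof (rule path_submoduleI)
  fix c x assume x: "x \<in> dstep N H"
  note d = dstepD[OF x]
  have "a \<odot>\<^bsub>N\<^esub> (path_scalar (inverse_quiver E) c \<odot>\<^bsub>N\<^esub> x) = path_scalar (inverse_quiver E) c \<odot>\<^bsub>N\<^esub> (a \<odot>\<^bsub>N\<^esub> x)"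
    if "a \<in> carrier \<R>" for a
    using that d(1) N.smult_assoc[of a "path_scalar (inverse_quiver E) c" x]
      N.smult_assoc[of "path_scalar (inverse_quiver E) c" a x] scalar_commute[OF that, of c] by simp
  then show "path_scalar (inverse_quiver E) c \<odot>\<^bsub>N\<^esub> x \<in> dstep N H"
    using d submodule_smult[OF H] by (auto simp: dstep_def N.smult_closed sinks_verts)
next
  fix v x assume v: "v \<in> verts E" and x: "x \<in> dstep N H"
  note d = dstepD[OF x]
  have "ar e \<odot>\<^bsub>N\<^esub> (vt v \<odot>\<^bsub>N\<^esub> x) \<in> H" if "e \<in> arcs E" for e
    using that d v N.smult_assoc[of "ar e" "vt v" x, symmetric] submodule_zero[OF H]
    by (simp add: ar_vt N.smult_l_zero)
  moreover have "vt w \<odot>\<^bsub>N\<^esub> (vt v \<odot>\<^bsub>N\<^esub> x) \<in> H" if "w \<in> sinks E" for w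
    using that d v N.smult_assoc[of "vt w" "vt v" x, symmetric] submodule_zero[OF H] sinks_verts
    by (cases "w = v") (simp_all add: vt_vt N.smult_l_zero)
  ultimately show "vt v \<odot>\<^bsub>N\<^esub> x \<in> dstep N H"
    using d v by (auto simp: dstep_def N.smult_closed)
next
  fix e x assume e: "e \<in> arcs E" and x: "x \<in> dstep N H"
  then show "ar e \<odot>\<^bsub>N\<^esub> x \<in> dstep N H"
    using dstepD[OF x] submodule_smult[OF H] sinks_verts by (auto simp: dstep_def N.smult_closed)
qed (use submodule_add[OF H] submodule_zero[OF H] in
    \<open>auto simp: dstep_def N.smult_r_zero N.smult_r_distr sinks_verts\<close>)

lemma dstep_superset: "submodule H \<R> N \<Longrightarrow> H \<subseteq> dstep N H"
  using submodule_mem[of H \<R> N] submodule_smult[of H \<R> N] sinks_verts by (auto simp: dstep_def)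

lemma dstep_iter_submodule: "submodule H \<R> N \<Longrightarrow> submodule ((dstep N ^^ n) H) \<R> N"
  by (induction n) (auto intro: dstep_submodule)

lemma dstep_iter_incseq: "submodule H \<R> N \<Longrightarrow> m \<le> n \<Longrightarrow> (dstep N ^^ m) H \<subseteq> (dstep N ^^ n) H"
proof (induction n)
  case (Suc n)
  have "(dstep N ^^ n) H \<subseteq> (dstep N ^^ Suc n) H"
    using dstep_superset[OF dstep_iter_submodule[OF Suc.prems(1), of n]] by simp
  then show ?case using Suc by (cases "m = Suc n") auto
qed simp

lemma dcl_submodule:
  assumes H: "submodule H \<R> N"
  shows "submodule (dcl N H) \<R> N"
proof (rule N.submoduleI)
  note sub = dstep_iter_submodule[OF H]
  show "dcl N H \<subseteq> carrier N" using submodule_subset[OF sub] by (auto simp: dcl_def)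
  show "\<zero>\<^bsub>N\<^esub> \<in> dcl N H" using submodule_zero[OF sub] by (auto simp: dcl_def)
  show "x \<oplus>\<^bsub>N\<^esub> y \<in> dcl N H" if xy: "x \<in> dcl N H" "y \<in> dcl N H" for x y
  proof -
    obtain m n where "x \<in> (dstep N ^^ m) H" "y \<in> (dstep N ^^ n) H" using xy by (auto simp: dcl_def)
    then have "x \<in> (dstep N ^^ max m n) H" "y \<in> (dstep N ^^ max m n) H"
      using dstep_iter_incseq[OF H, of m "max m n"] dstep_iter_incseq[OF H, of n "max m n"] by auto
    then show ?thesis using submodule_add[OF sub] by (auto simp: dcl_def)
  qed
  show "a \<odot>\<^bsub>N\<^esub> x \<in> dcl N H" if "a \<in> carrier \<R>" "x \<in> dcl N H" for a x
    using that submodule_smult[OF sub] by (auto simp: dcl_def)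
qed

text \<open>There are finitely many arrows and sinks, so a common number of iterations works for all
  of them. This is where the finiteness of the quiver makes the union of the iterates
  closed.\<close>

lemma dstep_dcl:
  assumes H: "submodule H \<R> N"
  shows "dstep N (dcl N H) \<subseteq> dcl N H"
proof
  fix x assume x: "x \<in> dstep N (dcl N H)"
  have "\<exists>n. \<forall>e\<in>arcs E. ar e \<odot>\<^bsub>N\<^esub> x \<in> (dstep N ^^ n) H"
    by (rule finite_uniform_bound)
      (use dstepD(2)[OF x] dstep_iter_incseq[OF H] in \<open>auto simp: dcl_def\<close>)
  then obtain m where m: "\<And>e. e \<in> arcs E \<Longrightarrow> ar e \<odot>\<^bsub>N\<^esub> x \<in> (dstep N ^^ m) H" by blast
  have "\<exists>n. \<forall>v\<in>sinks E. vt v \<odot>\<^bsub>N\<^esub> x \<in> (dstep N ^^ n) H"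
    by (rule finite_uniform_bound[OF finite_sinks])
      (use dstepD(3)[OF x] dstep_iter_incseq[OF H] in \<open>auto simp: dcl_def\<close>)
  then obtain n where n: "\<And>v. v \<in> sinks E \<Longrightarrow> vt v \<odot>\<^bsub>N\<^esub> x \<in> (dstep N ^^ n) H" by blast
  have "x \<in> (dstep N ^^ Suc (max m n)) H"
    using m n dstepD(1)[OF x] dstep_iter_incseq[OF H, of m "max m n"] dstep_iter_incseq[OF H, of n "max m n"]
    by (auto simp: dstep_def)
  then show "x \<in> dcl N H" by (rule subsetD[OF dstep_iter_subset_dcl])
qed

lemma dcl_minimal: "submodule H \<R> N \<Longrightarrow> A \<subseteq> dcl N H \<Longrightarrow> dcl N A \<subseteq> dcl N H"
  by (rule dcl_least) (auto dest: dstep_dcl)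

end

locale path_module_hom = S: path_module E K N + T: path_module E K N'
  for E :: "('v, 'e) pre_digraph" and K :: "'k::field itself"
    and N :: "('v \<times> 'e list \<Rightarrow> 'k, 'n) module" and N' :: "('v \<times> 'e list \<Rightarrow> 'k, 'm) module" +
  fixes h
  assumes h: "h \<in> mod_hom (path_algebra (inverse_quiver E)) N N'"
begin

sublocale h: left_module_hom "path_algebra (inverse_quiver E)" N N' h
  by (rule left_module_homI[OF S.N.left_module_self T.N.left_module_self h])

lemma hom_dstep_image: "h ` S.dstep N H \<subseteq> S.dstep N' (h ` H)"
proof
  fix y assume "y \<in> h ` S.dstep N H"
  then obtain x where x: "x \<in> S.dstep N H" "y = h x" by blast
  note d = S.dstepD[OF x(1)]
  have "S.ar e \<odot>\<^bsub>N'\<^esub> y \<in> h ` H" if "e \<in> arcs E" for e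
    using that d x(2) h.hom_smult[of "S.ar e" x] by (metis S.ar_carrier image_eqI)
  moreover have "S.vt v \<odot>\<^bsub>N'\<^esub> y \<in> h ` H" if "v \<in> sinks E" for v
    using that d x(2) h.hom_smult[of "S.vt v" x] by (metis S.vt_carrier S.sinks_verts image_eqI)
  ultimately show "y \<in> S.dstep N' (h ` H)" using d x(2) h.hom_closed by (auto simp: S.dstep_def)
qed

lemma hom_dstep_iter_image: "h ` (S.dstep N ^^ n) H \<subseteq> (S.dstep N' ^^ n) (h ` H)"
proof (induction n)
  case (Suc n)
  have "h ` (S.dstep N ^^ Suc n) H \<subseteq> S.dstep N' (h ` (S.dstep N ^^ n) H)"
    using hom_dstep_image by simp
  also have "\<dots> \<subseteq> S.dstep N' ((S.dstep N' ^^ n) (h ` H))" by (rule S.dstep_mono[OF Suc])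
  finally show ?case by simp
qed simp

lemma hom_dcl_image: "h ` S.dcl N H \<subseteq> S.dcl N' (h ` H)"
  unfolding S.dcl_def image_UN by (rule UN_mono[OF subset_refl]) (rule hom_dstep_iter_image)

text \<open>Passing to \<open>h x\<close> forgets only elements of the closure of 0, which the
  closure of \<open>H\<close> contains. This settles the start of the induction, and arrows and sink
  vertices commute with \<open>h\<close>. Applied to the map from \<open>N\<close> to
  \<open>L \<otimes> N\<close>, it lets closures in the tensor product be compared in
  \<open>N\<close>.\<close>

lemma hom_dcl_reflect:
  assumes ker: "\<And>x. x \<in> carrier N \<Longrightarrow> h x = \<zero>\<^bsub>N'\<^esub> \<Longrightarrow> x \<in> S.dcl N {\<zero>\<^bsub>N\<^esub>}"
    and H: "submodule H S.PathAlg N" and x: "x \<in> carrier N" "h x \<in> S.dcl N' (h ` H)"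
  shows "x \<in> S.dcl N H"
proof -
  note sub = S.dcl_submodule[OF H]
  have "h x \<in> (S.dstep N' ^^ n) (h ` H) \<Longrightarrow> x \<in> carrier N \<Longrightarrow> x \<in> S.dcl N H" for n x
  proof (induction n arbitrary: x)
    case 0
    then obtain y where y: "y \<in> H" "h x = h y" by auto
    have yc: "y \<in> carrier N" using submodule_mem[OF H y(1)] .
    then have "x \<ominus>\<^bsub>N\<^esub> y \<in> S.dcl N {\<zero>\<^bsub>N\<^esub>}"
      using 0 y ker h.hom_eq_iff[of x y] by simp
    then have "x \<ominus>\<^bsub>N\<^esub> y \<in> S.dcl N H"
      using S.dcl_mono[of "{\<zero>\<^bsub>N\<^esub>}" H N] submodule_zero[OF H] by blast
    then have "(x \<ominus>\<^bsub>N\<^esub> y) \<oplus>\<^bsub>N\<^esub> y \<in> S.dcl N H"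
      using submodule_add[OF sub] y(1) S.dcl_superset[of H N] by blast
    then show ?case using 0 yc by (simp add: S.N.diff_add_cancel)
  next
    case (Suc n)
    then have hx: "h x \<in> S.dstep N' ((S.dstep N' ^^ n) (h ` H))" by simp
    have "x \<in> S.dstep N (S.dcl N H)"
      unfolding S.dstep_def
    proof (intro CollectI conjI ballI)
      show "x \<in> carrier N" by fact
      fix e assume e: "e \<in> arcs E"
      then have "h (S.ar e \<odot>\<^bsub>N\<^esub> x) \<in> (S.dstep N' ^^ n) (h ` H)"
        using S.dstepD(2)[OF hx e] Suc.prems h.hom_smult[of "S.ar e" x] by simp
      then show "S.ar e \<odot>\<^bsub>N\<^esub> x \<in> S.dcl N H"
        using Suc.IH Suc.prems e by (simp add: S.N.smult_closed)
    next
      fix v assume v: "v \<in> sinks E"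
      then have "h (S.vt v \<odot>\<^bsub>N\<^esub> x) \<in> (S.dstep N' ^^ n) (h ` H)"
        using S.dstepD(3)[OF hx v] Suc.prems h.hom_smult[of "S.vt v" x] S.sinks_verts by simp
      then show "S.vt v \<odot>\<^bsub>N\<^esub> x \<in> S.dcl N H"
        using Suc.IH Suc.prems v S.sinks_verts by (simp add: S.N.smult_closed)
    qed
    then show ?case using S.dstep_dcl[OF H] by blast
  qed
  then show ?thesis using x by (auto simp: S.dcl_def)
qed

end

locale leavitt_module = quiver E K + M: left_module "leavitt E" M
  for E :: "('v, 'e) pre_digraph" and K :: "'k::field itself"
    and M :: "((unit \<times> ('v, 'e) lpa_gen list \<Rightarrow> 'k) set, 'm) module"
begin

sublocale RM: path_module E K "res M"
proof (intro path_module.intro)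
  show "quiver E" by unfold_locales
  show "left_module \<R> (res M)" by (rule res_left_module[OF M.left_module_self])
qed

text \<open>The operators tested by \<open>dstep\<close> lead from \<open>e u\<close> back to
  \<open>U\<close>: \<open>f^- e u\<close> is a vertex times \<open>u\<close> or 0, and a sink
  annihilates \<open>e\<close>. Closure under \<open>dstep\<close> thus includes closure under the
  arrows \<open>e\<close>.\<close>

lemma Ar_in_dstep:
  assumes U: "submodule U \<R> (res M)" and e: "e \<in> arcs E" and u: "u \<in> U"
  shows "Ar e \<odot>\<^bsub>M\<^esub> u \<in> dstep (res M) U"
proof -
  have uc: "u \<in> carrier M" using submodule_mem[OF U u] by simp
  have z: "\<zero>\<^bsub>M\<^esub> \<in> U" using submodule_zero[OF U] by simp
  have vtu: "Vt v \<odot>\<^bsub>M\<^esub> u \<in> U" if "v \<in> verts E" for v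
    using submodule_smult[OF U vt_carrier u] that by (simp add: incl_vt)
  have "In f \<odot>\<^bsub>M\<^esub> (Ar e \<odot>\<^bsub>M\<^esub> u) \<in> U" if f: "f \<in> arcs E" for f
    using M.smult_assoc[of "In f" "Ar e" u, symmetric] f e uc z vtu[of "head E f"]
    by (cases "f = e") (simp_all add: In_Ar M.smult_l_zero)
  moreover have "Vt v \<odot>\<^bsub>M\<^esub> (Ar e \<odot>\<^bsub>M\<^esub> u) \<in> U" if v: "v \<in> sinks E" for v
  proof -
    have "v \<noteq> tail E e" "v \<in> verts E" using v tail_not_sink[OF e] sinks_verts by auto
    then have "Vt v \<otimes>\<^bsub>\<L>\<^esub> Ar e = \<zero>\<^bsub>\<L>\<^esub>"
      using e L.m_assoc[of "Vt v" "Vt (tail E e)" "Ar e"] by (simp add: Vt_Ar Vt_Vt)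
    then show ?thesis
      using M.smult_assoc[of "Vt v" "Ar e" u, symmetric] \<open>v \<in> verts E\<close> e uc z by (simp add: M.smult_l_zero)
  qed
  ultimately show ?thesis
    using e uc sinks_verts by (simp add: dstep_def incl_ar incl_vt M.smult_closed)
qed

lemma dstep_leavitt_submodule:
  assumes U: "submodule U \<L> M" and x: "x \<in> dstep (res M) U"
  shows "x \<in> U"
proof -
  note d = dstepD[OF x]
  have xc: "x \<in> carrier M" using d(1) by simp
  have "Vt v \<odot>\<^bsub>M\<^esub> x \<in> U" if v: "v \<in> verts E" for v
  proof (cases "v \<in> sinks E")
    case True
    then show ?thesis using d(3)[of v] v by (simp add: incl_vt)
  next
    case False
    have o: "e \<in> arcs E" if "e \<in> out_arcs E v" for e using that by (simp add: out_arcs_def)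
    have fin: "finite (out_arcs E v)" by (rule finite_subset[OF _ finite_arcs]) (use o in blast)
    have "Vt v \<odot>\<^bsub>M\<^esub> x = (\<Oplus>\<^bsub>M\<^esub>e\<in>out_arcs E v. (Ar e \<otimes>\<^bsub>\<L>\<^esub> In e) \<odot>\<^bsub>M\<^esub> x)"
      using M.smult_finsum_l[OF fin, of "\<lambda>e. Ar e \<otimes>\<^bsub>\<L>\<^esub> In e" x] Vt_nonsink[of v] v False xc o by auto
    also have "\<dots> \<in> U"
    proof (rule M.submodule_finsum[OF U fin])
      fix e assume e: "e \<in> out_arcs E v"
      then show "(Ar e \<otimes>\<^bsub>\<L>\<^esub> In e) \<odot>\<^bsub>M\<^esub> x \<in> U"
        using o[OF e] d(2)[of e] xc by (simp add: M.smult_assoc incl_ar submodule_smult[OF U])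
    qed
    finally show ?thesis .
  qed
  then have "(\<Oplus>\<^bsub>M\<^esub>v\<in>verts E. Vt v \<odot>\<^bsub>M\<^esub> x) \<in> U" by (intro M.submodule_finsum[OF U]) auto
  then show ?thesis
    using M.smult_finsum_l[of "verts E" Vt x] xc by (simp add: Vt_sum M.smult_one Pi_def)
qed

text \<open>Turns questions about the lattice of \<open>L\<close>-submodules into questions over the
  path algebra: the generators \<open>e\<close> are accounted for by \<open>dstep\<close>, and the
  remaining ones lie in the image of the path algebra.\<close>

lemma leavitt_submodule_iff:
  "submodule U \<L> M \<longleftrightarrow> submodule U \<R> (res M) \<and> dstep (res M) U \<subseteq> U"
proof
  assume U: "submodule U \<L> M"
  have "submodule U \<R> (res M)"
    by (rule RM.N.submoduleI)
      (use submodule_subset[OF U] submoduleD[OF U] incl_closed in auto)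
  then show "submodule U \<R> (res M) \<and> dstep (res M) U \<subseteq> U"
    using dstep_leavitt_submodule[OF U] by blast
next
  assume "submodule U \<R> (res M) \<and> dstep (res M) U \<subseteq> U"
  then have U: "submodule U \<R> (res M)" and d: "dstep (res M) U \<subseteq> U" by auto
  have Uc: "u \<in> carrier M" if "u \<in> U" for u using submodule_mem[OF U that] by simp
  show "submodule U \<L> M"
  proof (rule M.submoduleI)
    fix a x assume "a \<in> carrier \<L>" "x \<in> U"
    then have "\<forall>x\<in>U. a \<odot>\<^bsub>M\<^esub> x \<in> U"
    proof (induction a rule: L_induct)
      case (scalar c)
      then show ?case
        using submodule_smult[OF U rscalar_carrier[of c]] by (simp add: incl_scalar)
    next
      case (gen y)
      then consider (v) v where "v \<in> verts E" "y = Vert v" | (a) e where "e \<in> arcs E" "y = Arr e"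
        | (i) e where "e \<in> arcs E" "y = Inv e" by blast
      then show ?case
      proof cases
        case v
        then show ?thesis using submodule_smult[OF U vt_carrier[of v]] by (simp add: incl_vt)
      next
        case a
        then show ?thesis using Ar_in_dstep[OF U] d by blast
      next
        case i
        then show ?thesis using submodule_smult[OF U ar_carrier[of e]] by (simp add: incl_ar)
      qed
    next
      case (add x y)
      then show ?case using submodule_add[OF U] Uc by (simp add: M.smult_l_distr)
    next
      case (mult x y)
      then show ?case using Uc by (simp add: M.smult_assoc)
    qed
    then show "a \<odot>\<^bsub>M\<^esub> x \<in> U" using \<open>x \<in> U\<close> by blast
  qed (use submodule_subset[OF U] submodule_zero[OF U] submodule_add[OF U] in auto)
qed

lemma dcl_leavitt_submodule: "submodule H \<R> (res M) \<Longrightarrow> submodule (dcl (res M) H) \<L> M"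
  unfolding leavitt_submodule_iff using RM.dcl_submodule RM.dstep_dcl by blast

lemma dcl_leavitt_least: "submodule U \<L> M \<Longrightarrow> H \<subseteq> U \<Longrightarrow> dcl (res M) H \<subseteq> U"
  unfolding leavitt_submodule_iff using dcl_least by blast

text \<open>An \<open>L\<close>-submodule \<open>U\<close> between the closures is controlled by
  \<open>U \<inter> B\<close>. If this is only \<open>A\<close>, then arrows and sink vertices keep
  an element of \<open>U\<close> in \<open>U\<close> and eventually take it into \<open>B\<close>,
  hence into \<open>A\<close>; so \<open>U\<close> is the closure of \<open>A\<close>.\<close>

lemma dcl_cover:
  assumes A: "submodule A \<R> (res M)" and B: "submodule B \<R> (res M)" and AB: "A \<subseteq> B"
    and cov: "\<And>H. submodule H \<R> (res M) \<Longrightarrow> A \<subseteq> H \<Longrightarrow> H \<subseteq> B \<Longrightarrow> H = A \<or> H = B"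
  shows "dcl (res M) A = dcl (res M) B \<or> M.covers (dcl (res M) A) (dcl (res M) B)"
proof -
  let ?A = "dcl (res M) A" and ?B = "dcl (res M) B"
  have sub: "?A \<subseteq> ?B" by (rule dcl_mono[OF AB])
  have "M.covers ?A ?B" if ne: "?A \<noteq> ?B"
    unfolding M.covers_def
  proof (intro conjI allI impI)
    show "submodule ?A \<L> M" "submodule ?B \<L> M"
      using A B by (simp_all add: dcl_leavitt_submodule)
    show "?A \<subset> ?B" using sub ne by blast
    fix U assume U: "submodule U \<L> M" "?A \<subseteq> U" "U \<subseteq> ?B"
    have UR: "submodule U \<R> (res M)" and Ud: "dstep (res M) U \<subseteq> U"
      using U(1) by (simp_all add: leavitt_submodule_iff)
    have "A \<subseteq> U" using dcl_superset[of A "res M"] U(2) by blast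
    then have "U \<inter> B = A \<or> U \<inter> B = B"
      using cov[OF RM.N.submodule_Int[OF UR B]] AB by blast
    then show "U = ?A \<or> U = ?B"
    proof
      assume "U \<inter> B = B"
      then have "?B \<subseteq> U" by (intro dcl_leavitt_least[OF U(1)]) blast
      then show ?thesis using U(3) by blast
    next
      assume UB: "U \<inter> B = A"
      have "(dstep (res M) ^^ n) B \<inter> U \<subseteq> ?A" for n
      proof (induction n)
        case 0
        then show ?case using UB dcl_superset[of A "res M"] by auto
      next
        case (Suc n)
        show ?case
        proof
          fix u assume u: "u \<in> (dstep (res M) ^^ Suc n) B \<inter> U"
          then have "u \<in> dstep (res M) ((dstep (res M) ^^ n) B)" by simp
          note d = dstepD[OF this]
          have uU: "u \<in> U" using u by simp
          have "u \<in> dstep (res M) ?A"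
            unfolding dstep_def
          proof (intro CollectI conjI ballI)
            show "u \<in> carrier (res M)" by (rule d(1))
            show "ar e \<odot>\<^bsub>res M\<^esub> u \<in> ?A" if "e \<in> arcs E" for e
              using d(2)[OF that] submodule_smult[OF UR ar_carrier[OF that] uU] Suc by blast
            show "vt v \<odot>\<^bsub>res M\<^esub> u \<in> ?A" if "v \<in> sinks E" for v
              using d(3)[OF that] submodule_smult[OF UR vt_carrier[OF sinks_verts[OF that]] uU] Suc by blast
          qed
          then show "u \<in> ?A" using RM.dstep_dcl[OF A] by blast
        qed
      qed
      moreover have "\<exists>n. u \<in> (dstep (res M) ^^ n) B" if "u \<in> U" for u
        using that U(3) by (auto simp: dcl_def)
      ultimately have "U \<subseteq> ?A" by blast
      then show ?thesis using U(2) by blast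
    qed
  qed
  then show ?thesis by blast
qed

end

section \<open>The right action of the free algebra on path functions\<close>

context quiver
begin

text \<open>
  Words in the generators act from the right on functions on paths: \<open>Inv e\<close> appends the arrow
  \<open>e\<close> of the inverse quiver and \<open>Arr e\<close> removes it. On paths which are long or start at a sink of
  \<open>E\<close> this respects the relations of the Leavitt path algebra, and it extends the right regular
  action of the path algebra.
\<close>

fun ract1 :: "('v, 'e) lpa_gen \<Rightarrow> ('v \<times> 'e list \<Rightarrow> 'k) \<Rightarrow> 'v \<times> 'e list \<Rightarrow> 'k" where
  "ract1 (Vert v) y = y \<otimes>\<^bsub>\<R>\<^esub> vt v"
| "ract1 (Inv e) y = y \<otimes>\<^bsub>\<R>\<^esub> ar e"
| "ract1 (Arr e) y = (\<lambda>(u, fs). if pend (u, fs) = head E e then y (u, fs @ [e]) else 0)"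

text \<open>\<open>fold\<close> applies the first letter first, as a right action must.\<close>

definition ractw :: "('v, 'e) lpa_gen list \<Rightarrow> ('v \<times> 'e list \<Rightarrow> 'k) \<Rightarrow> 'v \<times> 'e list \<Rightarrow> 'k" where
  "ractw w = fold ract1 w"

definition ract :: "(unit \<times> ('v, 'e) lpa_gen list \<Rightarrow> 'k) \<Rightarrow> ('v \<times> 'e list \<Rightarrow> 'k) \<Rightarrow> 'v \<times> 'e list \<Rightarrow> 'k" where
  "ract l y = (\<lambda>p. \<Sum>q | l q \<noteq> 0. l q * ractw (snd q) y p)"

lemma ract1_linear: "ract1 x (\<lambda>p. a * y p + b * z p) = (\<lambda>p. a * ract1 x y p + b * ract1 x z p)"
  by (cases x) (auto simp: fun_eq_iff path_algebra_mult algebra_simps sum.distrib sum_distrib_left)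

lemma ractw_Nil [simp]: "ractw [] y = y"
  and ractw_Cons [simp]: "ractw (x # w) y = ractw w (ract1 x y)"
  and ractw_append: "ractw (w @ w') y = ractw w' (ractw w y)"
  by (simp_all add: ractw_def)

lemma ractw_linear: "ractw w (\<lambda>p. a * y p + b * z p) = (\<lambda>p. a * ractw w y p + b * ractw w z p)"
  by (induction w arbitrary: y z) (simp_all add: ract1_linear)

lemma ractw_zero: "ractw w (\<lambda>_. 0) = (\<lambda>_. 0)"
  using ractw_linear[of w 0 "\<lambda>_. 0" 0 "\<lambda>_. 0"] by simp

lemma ractw_scale: "ractw w (\<lambda>p. a * y p) = (\<lambda>p. a * ractw w y p)"
  using ractw_linear[of w a y 0 y] by simp

lemma ract_superset:
  "finite A \<Longrightarrow> {q. l q \<noteq> 0} \<subseteq> A \<Longrightarrow> ract l y p = (\<Sum>q\<in>A. l q * ractw (snd q) y p)"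
  unfolding ract_def by (rule sum.mono_neutral_left) auto

lemma ract_add_left:
  assumes "finite {p. l p \<noteq> 0}" "finite {p. m p \<noteq> 0}"
  shows "ract (\<lambda>p. l p + m p) y = (\<lambda>q. ract l y q + ract m y q)"
proof
  fix q
  let ?A = "{p. l p \<noteq> 0} \<union> {p. m p \<noteq> 0}"
  have "ract (\<lambda>p. l p + m p) y q = (\<Sum>p\<in>?A. (l p + m p) * ractw (snd p) y q)"
    by (rule ract_superset) (use assms in auto)
  also have "\<dots> = (\<Sum>p\<in>?A. l p * ractw (snd p) y q) + (\<Sum>p\<in>?A. m p * ractw (snd p) y q)"
    by (simp add: distrib_right sum.distrib)
  also have "(\<Sum>p\<in>?A. l p * ractw (snd p) y q) = ract l y q"
    by (rule ract_superset[symmetric]) (use assms in auto)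
  also have "(\<Sum>p\<in>?A. m p * ractw (snd p) y q) = ract m y q"
    by (rule ract_superset[symmetric]) (use assms in auto)
  finally show "ract (\<lambda>p. l p + m p) y q = ract l y q + ract m y q" .
qed

lemma ract_zero_left: "ract (\<lambda>_. 0) y = (\<lambda>_. 0)"
  by (simp add: ract_def)

lemma ract_pmono: "ract (pmono c ((), w)) y = (\<lambda>p. c * ractw w y p)"
proof
  fix p
  have "ract (pmono c ((), w)) y p = (\<Sum>q\<in>{((), w)}. pmono c ((), w) q * ractw (snd q) y p)"
    by (rule ract_superset) (auto simp: pmono_def)
  then show "ract (pmono c ((), w)) y p = c * ractw w y p" by (simp add: pmono_def)
qed

lemma ract_letter: "ract (lpa_letter x) y = ract1 x y"
  by (simp add: path_elem_pmono ract_pmono)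

lemma ract_linear_right: "ract l (\<lambda>p. a * y p + b * z p) = (\<lambda>p. a * ract l y p + b * ract l z p)"
  by (simp add: ract_def ractw_linear fun_eq_iff algebra_simps sum.distrib sum_distrib_left)

lemma ract_zero_right: "ract l (\<lambda>_. 0) = (\<lambda>_. 0)"
  using ract_linear_right[of l 0 "\<lambda>_. 0" 0 "\<lambda>_. 0"] by simp

lemma F_carrier_finite: "l \<in> carrier \<F> \<Longrightarrow> finite {p. l p \<noteq> 0}"
  by (simp add: free_eq path_algebra_carrier)

lemma F_simps: "\<zero>\<^bsub>\<F>\<^esub> = (\<lambda>_. 0)" "f \<oplus>\<^bsub>\<F>\<^esub> g = (\<lambda>p. f p + g p)"
  by (simp_all add: free_eq path_algebra_simps)

lemma ract_add: "l \<in> carrier \<F> \<Longrightarrow> m \<in> carrier \<F> \<Longrightarrow>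
    ract (l \<oplus>\<^bsub>\<F>\<^esub> m) y = (\<lambda>q. ract l y q + ract m y q)"
  by (simp add: F_simps ract_add_left F_carrier_finite)

lemma ract_minus:
  assumes "l \<in> carrier \<F>" "m \<in> carrier \<F>"
  shows "ract (l \<ominus>\<^bsub>\<F>\<^esub> m) y = (\<lambda>q. ract l y q - ract m y q)"
proof -
  have "ract ((l \<ominus>\<^bsub>\<F>\<^esub> m) \<oplus>\<^bsub>\<F>\<^esub> m) y = (\<lambda>q. ract (l \<ominus>\<^bsub>\<F>\<^esub> m) y q + ract m y q)"
    using assms by (intro ract_add) auto
  moreover have "(l \<ominus>\<^bsub>\<F>\<^esub> m) \<oplus>\<^bsub>\<F>\<^esub> m = l" using assms by (rule F.diff_add_cancel)
  ultimately show ?thesis by (simp add: fun_eq_iff)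
qed

lemma F_induct [consumes 1, case_names zero add]:
  assumes "l \<in> carrier \<F>" "P (\<lambda>_. 0)"
    and "\<And>l c w. l \<in> carrier \<F> \<Longrightarrow> set w \<subseteq> generators \<Longrightarrow> P l \<Longrightarrow> P (l \<oplus>\<^bsub>\<F>\<^esub> pmono c ((), w))"
  shows "P l"
proof (rule path_algebra_induct[where P = P])
  show "l \<in> carrier (path_algebra (word_quiver generators))" using assms(1) by (simp add: free_eq)
  show "P (\<lambda>q. f q + pmono c p q)"
    if "f \<in> carrier (path_algebra (word_quiver generators))" "p \<in> paths (word_quiver generators)" "P f" for f c p
    using that assms(3)[of f "snd p" c] by (cases p) (simp add: free_eq path_algebra_simps)
qed (rule assms(2))

lemma ract_mult:
  assumes l: "l \<in> carrier \<F>" and m: "m \<in> carrier \<F>"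
  shows "ract (l \<otimes>\<^bsub>\<F>\<^esub> m) y = ract m (ract l y)"
proof -
  have mono: "ract (pmono c ((), w) \<otimes>\<^bsub>\<F>\<^esub> m) y = ract m (ract (pmono c ((), w)) y)"
    if w: "set w \<subseteq> generators" for c w
    using m
  proof (induction m rule: F_induct)
    case zero
    have "pmono c ((), w) \<otimes>\<^bsub>\<F>\<^esub> \<zero>\<^bsub>\<F>\<^esub> = \<zero>\<^bsub>\<F>\<^esub>" using w by (simp add: word_pmono_carrier)
    then show ?case by (simp add: F_simps ract_zero_left)
  next
    case (add m d w')
    note cs = word_pmono_carrier[OF w, of c] word_pmono_carrier[OF add(2), of d]
    have "pmono c ((), w) \<otimes>\<^bsub>\<F>\<^esub> pmono d ((), w') = pmono (c * d) ((), w @ w')"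
      unfolding free_eq by (simp add: pmono_mult)
    then have "ract (pmono c ((), w) \<otimes>\<^bsub>\<F>\<^esub> pmono d ((), w')) y = ract (pmono d ((), w')) (ract (pmono c ((), w)) y)"
      by (simp add: ract_pmono ractw_append ractw_scale mult.assoc mult.left_commute)
    then show ?case using add cs
      by (simp add: F.r_distr ract_add)
  qed
  show ?thesis
    using l
  proof (induction l rule: F_induct)
    case zero
    have "\<zero>\<^bsub>\<F>\<^esub> \<otimes>\<^bsub>\<F>\<^esub> m = \<zero>\<^bsub>\<F>\<^esub>" using m by simp
    then show ?case by (simp add: F_simps ract_zero_left ract_zero_right)
  next
    case (add l c w)
    note cs = word_pmono_carrier[OF add(2), of c]
    have "ract m (\<lambda>q. ract l y q + ract (pmono c ((), w)) y q) =
       (\<lambda>q. ract m (ract l y) q + ract m (ract (pmono c ((), w)) y) q)"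
      using ract_linear_right[of m 1 "ract l y" 1 "ract (pmono c ((), w)) y"] by simp
    then show ?case using add cs m mono[OF add(2)]
      by (simp add: F.l_distr ract_add)
  qed
qed

lemma ract_one: "ract \<one>\<^bsub>\<F>\<^esub> y = y"
proof -
  have "\<one>\<^bsub>\<F>\<^esub> = pmono 1 ((), [])"
    by (auto simp: free_eq path_algebra_one path_scalar_def pmono_def)
  then show ?thesis by (simp add: ract_pmono)
qed

lemma ract_finsum:
  "finite A \<Longrightarrow> (\<And>a. a \<in> A \<Longrightarrow> f a \<in> carrier \<F>) \<Longrightarrow>
    ract (\<Oplus>\<^bsub>\<F>\<^esub>a\<in>A. f a) y = (\<lambda>p. \<Sum>a\<in>A. ract (f a) y p)"
proof (induction A rule: finite_induct)
  case empty
  then show ?case using ract_zero_left by (simp add: F_simps)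
next
  case (insert a A)
  then have "(\<Oplus>\<^bsub>\<F>\<^esub>a\<in>insert a A. f a) = f a \<oplus>\<^bsub>\<F>\<^esub> (\<Oplus>\<^bsub>\<F>\<^esub>a\<in>A. f a)"
    by (intro F.finsum_insert) auto
  moreover have "(\<Oplus>\<^bsub>\<F>\<^esub>a\<in>A. f a) \<in> carrier \<F>" using insert by (intro F.finsum_closed) auto
  ultimately show ?case using insert by (simp add: ract_add)
qed

lemma ractw_inverse_path:
  assumes "p \<in> bpaths" "y \<in> carrier \<R>"
  shows "ractw (inverse_path_word p) y = y \<otimes>\<^bsub>\<R>\<^esub> path_elem p"
proof -
  have path: "ractw (map Inv (e # es)) y = y \<otimes>\<^bsub>\<R>\<^esub> path_elem (u, e # es)"
    if "(u, e # es) \<in> bpaths" for u e es y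
    using that
  proof (induction es arbitrary: u e y)
    case Nil
    then show ?case by simp
  next
    case (Cons f fs)
    then have "path_elem (u, e # f # fs) = ar e \<otimes>\<^bsub>\<R>\<^esub> path_elem (tail E e, f # fs)"
      by (simp add: path_elem_mult)
    then show ?case using Cons.IH[of "tail E e" f "y \<otimes>\<^bsub>\<R>\<^esub> ar e"] Cons.prems
      by (simp add: path_mult_assoc)
  qed
  obtain u es where p: "p = (u, es)" by (cases p)
  show ?thesis
    using path[of u _ _ y] assms(1) by (cases es) (simp_all add: p inverse_path_word_def)
qed

text \<open>On the subalgebra the right action is right multiplication. Hence the balancing relation
  \<open>b a \<otimes> x = b \<otimes> a x\<close> will be respected when
  \<open>b \<otimes> x\<close> is evaluated by a path.\<close>

lemma ract_wlift:
  assumes a: "a \<in> carrier \<R>" and y: "y \<in> carrier \<R>"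
  shows "ract (wlift a) y = y \<otimes>\<^bsub>\<R>\<^esub> a"
  using a
proof (induction a rule: path_algebra_induct)
  case zero
  have "y \<otimes>\<^bsub>\<R>\<^esub> \<zero>\<^bsub>\<R>\<^esub> = \<zero>\<^bsub>\<R>\<^esub>" using y by simp
  then show ?case by (simp add: wlift_zero ract_zero_left path_algebra_simps)
next
  case (add f c p)
  have pc: "path_elem p \<in> carrier \<R>" "pmono c p \<in> carrier \<R>"
    using add(2) by (simp_all add: path_elem_carrier pmono_carrier)
  have pm: "pmono c p = path_scalar (inverse_quiver E) c \<otimes>\<^bsub>\<R>\<^esub> path_elem p"
    unfolding path_scalar_mult[OF pc(1)] by (auto simp: pmono_def path_elem_def)
  have "y \<otimes>\<^bsub>\<R>\<^esub> pmono c p = path_scalar (inverse_quiver E) c \<otimes>\<^bsub>\<R>\<^esub> (y \<otimes>\<^bsub>\<R>\<^esub> path_elem p)"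
    unfolding pm using y pc scalar_commute[OF y, of c] by (metis path_mult_assoc)
  also have "\<dots> = (\<lambda>q. c * ractw (inverse_path_word p) y q)"
    using y pc add(2) by (simp add: path_scalar_mult Eb.path_mult_closed ractw_inverse_path)
  finally have mono: "ract (wlift (pmono c p)) y = y \<otimes>\<^bsub>\<R>\<^esub> pmono c p"
    by (simp add: wlift_pmono ract_pmono)
  have "wlift (\<lambda>q. f q + pmono c p q) = (\<lambda>q. wlift f q + wlift (pmono c p) q)"
    using add pc by (intro wlift_add) (auto simp: path_algebra_carrier)
  then have "ract (wlift (\<lambda>q. f q + pmono c p q)) y = (\<lambda>q. ract (wlift f) y q + ract (wlift (pmono c p)) y q)"
    using ract_add_left[OF F_carrier_finite[OF wlift_closed[OF add(1)]] F_carrier_finite[OF wlift_closed[OF pc(2)]]]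
    by simp
  then show ?case using add mono by (simp add: mult_distrib_left)
qed

lemma ract1_closed: "y \<in> carrier \<R> \<Longrightarrow> x \<in> generators \<Longrightarrow> ract1 x y \<in> carrier \<R>"
proof (cases x)
  case (Arr e)
  assume y: "y \<in> carrier \<R>" and x: "x \<in> generators"
  have e: "e \<in> arcs E" using x Arr by auto
  have "{p. ract1 x y p \<noteq> 0} \<subseteq> (\<lambda>(u, fs). (u, butlast fs)) ` {p. y p \<noteq> 0}"
  proof
    fix p assume "p \<in> {p. ract1 x y p \<noteq> 0}"
    then obtain u fs where "p = (u, fs)" "y (u, fs @ [e]) \<noteq> 0"
      using Arr by (cases p) (auto split: if_splits)
    then show "p \<in> (\<lambda>(u, fs). (u, butlast fs)) ` {p. y p \<noteq> 0}"
      by (intro image_eqI[of _ _ "(u, fs @ [e])"]) auto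
  qed
  then have "finite {p. ract1 x y p \<noteq> 0}"
    by (rule finite_subset) (use y in \<open>simp add: path_algebra_carrier\<close>)
  moreover have "p \<in> bpaths" if p: "ract1 x y p \<noteq> 0" for p
  proof -
    obtain u fs where "p = (u, fs)" "y (u, fs @ [e]) \<noteq> 0"
      using p Arr by (cases p) (auto split: if_splits)
    moreover then have "(u, fs @ [e]) \<in> bpaths" using y unfolding path_algebra_carrier by blast
    ultimately show ?thesis by simp
  qed
  ultimately show ?thesis by (simp add: path_algebra_carrier)
qed (auto simp: Eb.path_mult_closed)

lemma ractw_closed: "y \<in> carrier \<R> \<Longrightarrow> set w \<subseteq> generators \<Longrightarrow> ractw w y \<in> carrier \<R>"
proof (induction w arbitrary: y)
  case (Cons x w)
  then show ?case using ract1_closed[of y x] by (simp add: Cons.IH)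
qed simp

lemma ract_closed: "l \<in> carrier \<F> \<Longrightarrow> y \<in> carrier \<R> \<Longrightarrow> ract l y \<in> carrier \<R>"
proof (induction l rule: F_induct)
  case zero
  then show ?case using R.zero_closed by (simp add: ract_zero_left path_algebra_simps)
next
  case (add l c w)
  have "ract (l \<oplus>\<^bsub>\<F>\<^esub> pmono c ((), w)) y = ract l y \<oplus>\<^bsub>\<R>\<^esub> path_scalar (inverse_quiver E) c \<otimes>\<^bsub>\<R>\<^esub> ractw w y"
    using add ractw_closed[of y w] by (simp add: ract_add word_pmono_carrier ract_pmono path_scalar_mult path_algebra_simps)
  then show ?case using add ractw_closed[of y w] by simp
qed

lemma ract1_path:
  assumes "q \<in> bpaths" "x \<in> generators"
  shows "ract1 x (path_elem q) = (\<lambda>_. 0) \<or>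
    (\<exists>q'\<in>bpaths. ract1 x (path_elem q) = path_elem q' \<and> fst q' = fst q \<and> length (snd q) \<le> length (snd q') + 1)"
proof (cases x)
  case (Vert v)
  then show ?thesis using assms(1) by (auto simp: path_elem_mult)
next
  case (Inv e)
  then have "e \<in> arcs E" using assms(2) by auto
  then show ?thesis using assms(1) Inv
    by (cases q) (auto simp: path_elem_mult intro!: bexI[of _ "(fst q, snd q @ [e])"])
next
  case (Arr e)
  obtain u es where q: "q = (u, es)" by (cases q)
  show ?thesis
  proof (cases es rule: rev_cases)
    case Nil
    then show ?thesis by (auto simp: Arr q fun_eq_iff path_elem_def)
  next
    case (snoc fs f)
    show ?thesis
    proof (cases "f = e")
      case True
      then have "ract1 x (path_elem q) = path_elem (u, fs)" "(u, fs) \<in> bpaths"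
        using assms(1) by (auto simp: Arr q snoc fun_eq_iff path_elem_def)
      then show ?thesis by (intro disjI2 bexI[of _ "(u, fs)"]) (auto simp: q snoc)
    next
      case False
      then show ?thesis by (auto simp: Arr q snoc fun_eq_iff path_elem_def)
    qed
  qed
qed

text \<open>A letter that does not give 0 keeps the starting vertex and removes at most one arrow.
  Hence a word of length \<open>l\<close> takes paths that are long for \<open>n + l\<close> to 0 or
  to paths that are long for \<open>n\<close>.\<close>

lemma ractw_path:
  assumes "q \<in> bpaths" "set w \<subseteq> generators"
  shows "ractw w (path_elem q) = (\<lambda>_. 0) \<or>
    (\<exists>q'\<in>bpaths. ractw w (path_elem q) = path_elem q' \<and> fst q' = fst q \<and>
      length (snd q) \<le> length (snd q') + length w)"
  using assms
proof (induction w arbitrary: q)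
  case (Cons x w)
  from ract1_path[of q x] Cons.prems
  consider "ract1 x (path_elem q) = (\<lambda>_. 0)" | q' where "q' \<in> bpaths" "ract1 x (path_elem q) = path_elem q'"
      "fst q' = fst q" "length (snd q) \<le> length (snd q') + 1" by auto
  then show ?case
  proof cases
    case 1
    then show ?thesis by (simp add: ractw_zero)
  next
    case 2
    have "ractw w (path_elem q') = (\<lambda>_. 0) \<or>
      (\<exists>q''\<in>bpaths. ractw w (path_elem q') = path_elem q'' \<and> fst q'' = fst q' \<and>
        length (snd q') \<le> length (snd q'') + length w)"
      using Cons.IH[of q'] Cons.prems 2 by simp
    then show ?thesis
    proof
      assume "ractw w (path_elem q') = (\<lambda>_. 0)"
      then show ?thesis using 2 by simp
    next
      assume "\<exists>q''\<in>bpaths. ractw w (path_elem q') = path_elem q'' \<and> fst q'' = fst q' \<and>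
        length (snd q') \<le> length (snd q'') + length w"
      then obtain q'' where "q'' \<in> bpaths" "ractw w (path_elem q') = path_elem q''" "fst q'' = fst q'"
        "length (snd q') \<le> length (snd q'') + length w" by blast
      then show ?thesis using 2 by (intro disjI2 bexI[of _ q'']) simp_all
    qed
  qed
qed auto

definition long :: "nat \<Rightarrow> 'v \<times> 'e list \<Rightarrow> bool" where
  "long n q \<longleftrightarrow> q \<in> bpaths \<and> (n \<le> length (snd q) \<or> fst q \<in> sinks E)"

lemma long_mono: "long n q \<Longrightarrow> m \<le> n \<Longrightarrow> long m q"
  by (auto simp: long_def)

text \<open>Designed to be a two-sided ideal that contains the relations, hence all that vanishes in
  \<open>L\<close>. The threshold may depend on \<open>l\<close>, since a word multiplied from the
  left shortens paths before \<open>l\<close> acts.\<close>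

definition eventually_zero :: "(unit \<times> ('v, 'e) lpa_gen list \<Rightarrow> 'k) \<Rightarrow> bool" where
  "eventually_zero l \<longleftrightarrow> (\<exists>n. \<forall>q. long n q \<longrightarrow> ract l (path_elem q) = (\<lambda>_. 0))"

lemma eventually_zero_add:
  assumes "l \<in> carrier \<F>" "m \<in> carrier \<F>" "eventually_zero l" "eventually_zero m"
  shows "eventually_zero (l \<oplus>\<^bsub>\<F>\<^esub> m)"
proof -
  obtain a b where "\<forall>q. long a q \<longrightarrow> ract l (path_elem q) = (\<lambda>_. 0)"
    "\<forall>q. long b q \<longrightarrow> ract m (path_elem q) = (\<lambda>_. 0)"
    using assms(3,4) unfolding eventually_zero_def by blast
  then have "\<forall>q. long (max a b) q \<longrightarrow> ract (l \<oplus>\<^bsub>\<F>\<^esub> m) (path_elem q) = (\<lambda>_. 0)"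
    using long_mono[of "max a b" _ a] long_mono[of "max a b" _ b] by (simp add: ract_add assms(1,2))
  then show ?thesis unfolding eventually_zero_def by blast
qed

lemma eventually_zero_mult_left:
  assumes l: "l \<in> carrier \<F>" and f: "f \<in> carrier \<F>" and ev: "eventually_zero l"
  shows "eventually_zero (f \<otimes>\<^bsub>\<F>\<^esub> l)"
  using f
proof (induction f rule: F_induct)
  case zero
  have "(\<lambda>_. 0) \<otimes>\<^bsub>\<F>\<^esub> l = (\<lambda>_. 0)" using F.l_null[OF l] by (simp add: F_simps)
  then show ?case by (simp add: eventually_zero_def ract_zero_left)
next
  case (add f c w)
  note pc = word_pmono_carrier[OF add(2), of c]
  obtain n where n: "\<forall>q. long n q \<longrightarrow> ract l (path_elem q) = (\<lambda>_. 0)"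
    using ev unfolding eventually_zero_def by blast
  have "ract (pmono c ((), w) \<otimes>\<^bsub>\<F>\<^esub> l) (path_elem q) = (\<lambda>_. 0)" if q: "long (n + length w) q" for q
  proof -
    have "ract l (ractw w (path_elem q)) = (\<lambda>_. 0)"
      using ractw_path[OF _ add(2), of q] q n
      by (auto simp: ract_zero_right long_def)
    then show ?thesis
      using ract_linear_right[of l c "ractw w (path_elem q)" 0 "\<lambda>_. 0"]
      by (simp add: ract_mult pc l ract_pmono)
  qed
  then have "eventually_zero (pmono c ((), w) \<otimes>\<^bsub>\<F>\<^esub> l)" unfolding eventually_zero_def by blast
  then show ?case using add l pc by (simp add: F.l_distr eventually_zero_add)
qed

lemma eventually_zero_mult_right:
  assumes l: "l \<in> carrier \<F>" and f: "f \<in> carrier \<F>" and ev: "eventually_zero l"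
  shows "eventually_zero (l \<otimes>\<^bsub>\<F>\<^esub> f)"
proof -
  obtain n where "\<forall>q. long n q \<longrightarrow> ract l (path_elem q) = (\<lambda>_. 0)"
    using ev unfolding eventually_zero_def by blast
  then have "\<forall>q. long n q \<longrightarrow> ract (l \<otimes>\<^bsub>\<F>\<^esub> f) (path_elem q) = (\<lambda>_. 0)"
    by (simp add: ract_mult l f ract_zero_right)
  then show ?thesis unfolding eventually_zero_def by blast
qed

lemma eventually_zero_ideal: "ideal {l \<in> carrier \<F>. eventually_zero l} \<F>"
proof (rule idealI[OF F.ring_axioms])
  show "subgroup {l \<in> carrier \<F>. eventually_zero l} (add_monoid \<F>)"
  proof (rule group.subgroupI[OF F.add.is_group])
    show "{l \<in> carrier \<F>. eventually_zero l} \<noteq> {}"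
    proof -
      have "eventually_zero \<zero>\<^bsub>\<F>\<^esub>" by (simp add: eventually_zero_def F_simps ract_zero_left)
      then show ?thesis using F.zero_closed by blast
    qed
    fix l assume l: "l \<in> {l \<in> carrier \<F>. eventually_zero l}"
    then have lc: "l \<in> carrier \<F>" and le: "eventually_zero l" by blast+
    have "(\<ominus>\<^bsub>\<F>\<^esub> \<one>\<^bsub>\<F>\<^esub>) \<otimes>\<^bsub>\<F>\<^esub> l = \<ominus>\<^bsub>\<F>\<^esub> l"
      using F.l_minus[OF F.one_closed lc] F.l_one[OF lc] by metis
    then have "eventually_zero (\<ominus>\<^bsub>\<F>\<^esub> l)"
      using eventually_zero_mult_left[OF lc F.a_inv_closed[OF F.one_closed] le] by metis
    then show "inv\<^bsub>add_monoid \<F>\<^esub> l \<in> {l \<in> carrier \<F>. eventually_zero l}"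
      using F.a_inv_closed[OF lc] unfolding a_inv_def by blast
  qed (auto simp: eventually_zero_add)
qed (auto simp: eventually_zero_mult_left eventually_zero_mult_right)

lemma path_last_tail:
  assumes "(u, fs) \<in> bpaths" "fs \<noteq> []"
  shows "pend (u, fs) = tail E (last fs)" "pend (u, butlast fs) = head E (last fs)" "last fs \<in> arcs E"
proof -
  obtain gs e where "fs = gs @ [e]" using assms(2) by (meson rev_exhaust)
  then show "pend (u, fs) = tail E (last fs)" "pend (u, butlast fs) = head E (last fs)" "last fs \<in> arcs E"
    using assms(1) by auto
qed

lemma eventually_zero_minusI:
  assumes "l \<in> carrier \<F>" "m \<in> carrier \<F>"
    and "\<And>q. long 1 q \<Longrightarrow> ract l (path_elem q) = ract m (path_elem q)"
  shows "eventually_zero (l \<ominus>\<^bsub>\<F>\<^esub> m)"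
  unfolding eventually_zero_def by (rule exI[of _ 1]) (simp add: ract_minus assms)

lemma ract_letters:
  "x \<in> generators \<Longrightarrow> y \<in> generators \<Longrightarrow> ract (lpa_letter x \<otimes>\<^bsub>\<F>\<^esub> lpa_letter y) z = ract1 y (ract1 x z)"
  by (simp add: ract_mult word_carrier ract_letter)

lemma fun_pair_eqI: "(\<And>u fs. f (u, fs) = g (u, fs)) \<Longrightarrow> f = g"
  by (intro ext) (metis surj_pair)

text \<open>Threshold 1 suffices. Only \<open>p_v = \<Sum> e e^-\<close> fails on trivial paths,
  because \<open>p_v\<close> fixes the trivial path at \<open>v\<close> while each \<open>e\<close>
  removes a last arrow that is not there. On a nontrivial path at most one summand is nonzero, that
  of its last arrow.\<close>

lemma rels_eventually_zero:
  assumes "l \<in> rels"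
  shows "eventually_zero l"
proof -
  note lc = letter_carrier
  consider
    (vv) v w where "v \<in> verts E" "w \<in> verts E"
      "l = lpa_letter (Vert v) \<otimes>\<^bsub>\<F>\<^esub> lpa_letter (Vert w) \<ominus>\<^bsub>\<F>\<^esub> (if v = w then lpa_letter (Vert v) else \<zero>\<^bsub>\<F>\<^esub>)"
  | (one) "l = (\<Oplus>\<^bsub>\<F>\<^esub>v\<in>verts E. lpa_letter (Vert v)) \<ominus>\<^bsub>\<F>\<^esub> \<one>\<^bsub>\<F>\<^esub>"
  | (va) e where "e \<in> arcs E" "l = lpa_letter (Vert (tail E e)) \<otimes>\<^bsub>\<F>\<^esub> lpa_letter (Arr e) \<ominus>\<^bsub>\<F>\<^esub> lpa_letter (Arr e)"
  | (av) e where "e \<in> arcs E" "l = lpa_letter (Arr e) \<otimes>\<^bsub>\<F>\<^esub> lpa_letter (Vert (head E e)) \<ominus>\<^bsub>\<F>\<^esub> lpa_letter (Arr e)"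
  | (vi) e where "e \<in> arcs E" "l = lpa_letter (Vert (head E e)) \<otimes>\<^bsub>\<F>\<^esub> lpa_letter (Inv e) \<ominus>\<^bsub>\<F>\<^esub> lpa_letter (Inv e)"
  | (iv) e where "e \<in> arcs E" "l = lpa_letter (Inv e) \<otimes>\<^bsub>\<F>\<^esub> lpa_letter (Vert (tail E e)) \<ominus>\<^bsub>\<F>\<^esub> lpa_letter (Inv e)"
  | (ia) e e' where "e \<in> arcs E" "e' \<in> arcs E"
      "l = lpa_letter (Inv e) \<otimes>\<^bsub>\<F>\<^esub> lpa_letter (Arr e') \<ominus>\<^bsub>\<F>\<^esub> (if e = e' then lpa_letter (Vert (head E e)) else \<zero>\<^bsub>\<F>\<^esub>)"
  | (ck) v where "v \<in> verts E - sinks E"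
      "l = lpa_letter (Vert v) \<ominus>\<^bsub>\<F>\<^esub> (\<Oplus>\<^bsub>\<F>\<^esub>e\<in>out_arcs E v. lpa_letter (Arr e) \<otimes>\<^bsub>\<F>\<^esub> lpa_letter (Inv e))"
    using assms unfolding lpa_rels_def Let_def by blast
  then show ?thesis
  proof cases
    case vv
    show ?thesis unfolding vv(3)
    proof (rule eventually_zero_minusI)
      fix q
      show "ract (lpa_letter (Vert v) \<otimes>\<^bsub>\<F>\<^esub> lpa_letter (Vert w)) (path_elem q) =
          ract (if v = w then lpa_letter (Vert v) else \<zero>\<^bsub>\<F>\<^esub>) (path_elem q)"
        using vv by (intro fun_pair_eqI) (auto simp: ract_letters ract_letter F_simps ract_zero_left mult_vertex_right)
    qed (use vv lc in auto)
  next
    case one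
    show ?thesis unfolding one
    proof (rule eventually_zero_minusI)
      fix q assume q: "long 1 q"
      have "(\<Sum>v\<in>verts E. (path_elem q \<otimes>\<^bsub>\<R>\<^esub> vt v) (u, fs)) = path_elem q (u, fs)" for u fs
      proof (cases "(u, fs) = q")
        case True
        then have "pend (u, fs) \<in> verts E" using q Eb.path_end_in_verts[of u fs] by (simp add: long_def)
        then show ?thesis by (simp add: mult_vertex_right sum.delta)
      next
        case False
        then have "path_elem q (u, fs) = (0 :: 'k)" by (simp add: path_elem_def)
        then show ?thesis by (simp add: mult_vertex_right)
      qed
      then show "ract (\<Oplus>\<^bsub>\<F>\<^esub>v\<in>verts E. lpa_letter (Vert v)) (path_elem q) = ract \<one>\<^bsub>\<F>\<^esub> (path_elem q)"
        using lc by (subst ract_finsum) (auto simp: ract_letter ract_one intro!: fun_pair_eqI)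
    qed (use lc in \<open>auto intro!: F.finsum_closed\<close>)
  next
    case va
    show ?thesis unfolding va(2)
    proof (rule eventually_zero_minusI)
      fix q
      show "ract (lpa_letter (Vert (tail E e)) \<otimes>\<^bsub>\<F>\<^esub> lpa_letter (Arr e)) (path_elem q) = ract (lpa_letter (Arr e)) (path_elem q)"
        using va by (intro fun_pair_eqI) (auto simp: ract_letters ract_letter mult_vertex_right)
    qed (use va lc in auto)
  next
    case av
    show ?thesis unfolding av(2)
    proof (rule eventually_zero_minusI)
      fix q
      show "ract (lpa_letter (Arr e) \<otimes>\<^bsub>\<F>\<^esub> lpa_letter (Vert (head E e))) (path_elem q) = ract (lpa_letter (Arr e)) (path_elem q)"
        using av by (intro fun_pair_eqI) (auto simp: ract_letters ract_letter mult_vertex_right)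
    qed (use av lc in auto)
  next
    case vi
    show ?thesis unfolding vi(2)
    proof (rule eventually_zero_minusI)
      fix q
      show "ract (lpa_letter (Vert (head E e)) \<otimes>\<^bsub>\<F>\<^esub> lpa_letter (Inv e)) (path_elem q) = ract (lpa_letter (Inv e)) (path_elem q)"
        using vi by (simp add: ract_letters ract_letter path_mult_assoc vt_ar)
    qed (use vi lc in auto)
  next
    case iv
    show ?thesis unfolding iv(2)
    proof (rule eventually_zero_minusI)
      fix q
      show "ract (lpa_letter (Inv e) \<otimes>\<^bsub>\<F>\<^esub> lpa_letter (Vert (tail E e))) (path_elem q) = ract (lpa_letter (Inv e)) (path_elem q)"
        using iv by (simp add: ract_letters ract_letter path_mult_assoc ar_vt)
    qed (use iv lc in auto)
  next
    case ia
    show ?thesis unfolding ia(3)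
    proof (rule eventually_zero_minusI)
      fix q
      show "ract (lpa_letter (Inv e) \<otimes>\<^bsub>\<F>\<^esub> lpa_letter (Arr e')) (path_elem q) =
          ract (if e = e' then lpa_letter (Vert (head E e)) else \<zero>\<^bsub>\<F>\<^esub>) (path_elem q)"
        using ia by (intro fun_pair_eqI)
          (auto simp: ract_letters ract_letter F_simps ract_zero_left mult_vertex_right mult_arrow_right)
    qed (use ia lc in auto)
  next
    case ck
    have o: "e \<in> arcs E" if "e \<in> out_arcs E v" for e using that by (simp add: out_arcs_def)
    have fin: "finite (out_arcs E v)" by (rule finite_subset[OF _ finite_arcs]) (use o in blast)
    have cl: "lpa_letter (Arr e) \<otimes>\<^bsub>\<F>\<^esub> lpa_letter (Inv e) \<in> carrier \<F>" if "e \<in> out_arcs E v" for e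
      using o[OF that] lc by auto
    show ?thesis unfolding ck(2)
    proof (rule eventually_zero_minusI)
      fix q assume q: "long 1 q"
      have "(path_elem q \<otimes>\<^bsub>\<R>\<^esub> vt v) (u, fs) =
         (\<Sum>e\<in>out_arcs E v. (ract1 (Arr e) (path_elem q) \<otimes>\<^bsub>\<R>\<^esub> ar e) (u, fs))" for u fs
      proof (cases "(u, fs) = q")
        case False
        then have pe: "path_elem q (u, fs) = (0 :: 'k)" by (simp add: path_elem_def)
        have "(ract1 (Arr e) (path_elem q) \<otimes>\<^bsub>\<R>\<^esub> ar e) (u, fs) = 0" for e
        proof (cases fs rule: rev_cases)
          case (snoc gs f)
          then show ?thesis using pe by (cases "f = e") (simp_all add: mult_arrow_right)
        qed (simp add: mult_arrow_right)
        then show ?thesis using pe by (simp add: mult_vertex_right)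
      next
        case True
        have qb: "(u, fs) \<in> bpaths" using q True by (simp add: long_def)
        show ?thesis
        proof (cases "fs = []")
          case fs: True
          \<comment> \<open>A trivial path is long for 1 only at a sink, and \<open>v\<close> is not
            one, so both sides are 0.\<close>
          then have "u \<in> sinks E" using q True by (auto simp: long_def)
          then show ?thesis using fs ck(1) by (auto simp: mult_vertex_right mult_arrow_right)
        next
          case False
          note pl = path_last_tail[OF qb False]
          have pe: "path_elem q (u, fs) = (1 :: 'k)" using True by (simp add: path_elem_def)
          have "(ract1 (Arr e) (path_elem q) \<otimes>\<^bsub>\<R>\<^esub> ar e) (u, fs) = (if e = last fs then 1 else 0)" for e
            using False pl(2) pe append_butlast_last_id[OF False]
            by (cases "e = last fs") (simp_all add: mult_arrow_right)
          then have "(\<Sum>e\<in>out_arcs E v. (ract1 (Arr e) (path_elem q) \<otimes>\<^bsub>\<R>\<^esub> ar e) (u, fs)) =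
              (if last fs \<in> out_arcs E v then 1 else 0)"
            by (simp only: sum.delta[OF fin])
          then show ?thesis using pl pe by (simp add: mult_vertex_right out_arcs_def)
        qed
      qed
      then show "ract (lpa_letter (Vert v)) (path_elem q) =
         ract (\<Oplus>\<^bsub>\<F>\<^esub>e\<in>out_arcs E v. lpa_letter (Arr e) \<otimes>\<^bsub>\<F>\<^esub> lpa_letter (Inv e)) (path_elem q)"
        using o cl by (subst ract_finsum[OF fin]) (auto simp: ract_letter ract_letters intro!: fun_pair_eqI)
    qed (use ck lc cl in \<open>auto intro!: F.finsum_closed\<close>)
  qed
qed

text \<open>This is how elements of \<open>L\<close> are shown to be nonzero: beyond every threshold
  there is a path on which a representative does not act as 0.\<close>

lemma proj_zero_eventually: "l \<in> carrier \<F> \<Longrightarrow> proj l = \<zero>\<^bsub>\<L>\<^esub> \<Longrightarrow> eventually_zero l"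
proof -
  assume "l \<in> carrier \<F>" "proj l = \<zero>\<^bsub>\<L>\<^esub>"
  then have "l \<in> Idl\<^bsub>\<F>\<^esub> rels" by (simp add: proj_eq_zero_iff)
  moreover have "Idl\<^bsub>\<F>\<^esub> rels \<subseteq> {l \<in> carrier \<F>. eventually_zero l}"
    by (rule F.genideal_minimal[OF eventually_zero_ideal])
      (use rels_carrier rels_eventually_zero in blast)
  ultimately show ?thesis by blast
qed

end

section \<open>Extension of scalars\<close>

locale scalar_extension = path_module E K N
  for E :: "('v, 'e) pre_digraph" and K :: "'k::field itself"
    and N :: "('v \<times> 'e list \<Rightarrow> 'k, 'n) module"
begin

abbreviation tens where "tens \<equiv> tensor_ext \<R> \<L> incl N"

definition fab :: "((unit \<times> ('v, 'e) lpa_gen list \<Rightarrow> 'k) set \<times> 'n \<Rightarrow>\<^sub>0 int) monoid" where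
  "fab = free_Abelian_group (carrier \<L> \<times> carrier N)"

abbreviation "trels \<equiv> tensor_rels \<R> \<L> incl N"

definition relgrp where "relgrp = generate fab trels"

definition lmul :: "(unit \<times> ('v, 'e) lpa_gen list \<Rightarrow> 'k) set \<Rightarrow>
    ((unit \<times> ('v, 'e) lpa_gen list \<Rightarrow> 'k) set \<times> 'n \<Rightarrow>\<^sub>0 int) \<Rightarrow> _" where
  "lmul b = frag_extend (\<lambda>(b', x). frag_of (b \<otimes>\<^bsub>\<L>\<^esub> b', x))"

text \<open>The free abelian group in the shape of a module, so that the tensor product becomes an
  instance of \<open>mod_quot\<close>. It is not a module over \<open>L\<close>: \<open>lmul\<close>
  is additive in the scalar only modulo \<open>relgrp\<close>.\<close>

definition pretens where
  "pretens = \<lparr>carrier = carrier fab, monoid.mult = undefined, one = undefined,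
      ring.zero = 0, ring.add = (+), module.smult = lmul\<rparr>"

lemma pretens_simps [simp]:
  "carrier pretens = carrier fab" "\<zero>\<^bsub>pretens\<^esub> = 0" "x \<oplus>\<^bsub>pretens\<^esub> y = x + y"
  "b \<odot>\<^bsub>pretens\<^esub> z = lmul b z"
  by (simp_all add: pretens_def)

lemma fab_mult [simp]: "x \<otimes>\<^bsub>fab\<^esub> y = x + y" and fab_one [simp]: "\<one>\<^bsub>fab\<^esub> = 0"
  by (simp_all add: fab_def)

lemma fab_carrier: "z \<in> carrier fab \<longleftrightarrow> Poly_Mapping.keys z \<subseteq> carrier \<L> \<times> carrier N"
  by (simp add: fab_def)

lemma fab_group: "group fab" and fab_comm_group: "comm_group fab"
  by (simp_all add: fab_def abelian_free_Abelian_group)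

lemma tens_eq: "tens = mod_quot pretens relgrp"
proof -
  have "(\<lambda>b. frag_extend (\<lambda>(b', x). frag_of (b \<otimes>\<^bsub>\<L>\<^esub> b', x))) = lmul" by (auto simp: lmul_def)
  then show ?thesis
    unfolding tensor_ext_def Let_def mod_quot_def fab_def[symmetric] relgrp_def[symmetric] lmul_def[symmetric]
    by (simp add: FactGroup_def A_RCOSETS_defs a_r_coset_defs set_add_defs r_coset_def fab_def set_mult_def RCOSETS_def fun_eq_iff)
qed

lemma pretens_abelian_group: "abelian_group pretens"
proof (rule abelian_groupI)
  fix z assume "z \<in> carrier pretens"
  then show "\<exists>y\<in>carrier pretens. y \<oplus>\<^bsub>pretens\<^esub> z = \<zero>\<^bsub>pretens\<^esub>"
    by (intro bexI[of _ "- z"]) (auto simp: fab_carrier)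
qed (use group.is_monoid[OF fab_group] in \<open>auto simp: fab_carrier dest: subsetD[OF keys_add]\<close>)

lemma pretens_minus: "x \<in> carrier fab \<Longrightarrow> y \<in> carrier fab \<Longrightarrow> x \<ominus>\<^bsub>pretens\<^esub> y = x - y"
proof -
  interpret abelian_group pretens by (rule pretens_abelian_group)
  assume "x \<in> carrier fab" "y \<in> carrier fab"
  then show ?thesis using minus_equality[of "- y" y] by (simp add: a_minus_def fab_carrier)
qed

lemma frag_of_fab: "b \<in> carrier \<L> \<Longrightarrow> x \<in> carrier N \<Longrightarrow> frag_of (b, x) \<in> carrier fab"
  by (simp add: fab_def)

lemma fab_diff: "x \<in> carrier fab \<Longrightarrow> y \<in> carrier fab \<Longrightarrow> x - y \<in> carrier fab"
  by (auto simp: fab_carrier dest: subsetD[OF keys_diff])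

lemma fab_induct [consumes 1, case_names zero diff frag]:
  assumes "z \<in> carrier fab" "P 0"
    and "\<And>x y. x \<in> carrier fab \<Longrightarrow> y \<in> carrier fab \<Longrightarrow> P x \<Longrightarrow> P y \<Longrightarrow> P (x - y)"
    and "\<And>b x. b \<in> carrier \<L> \<Longrightarrow> x \<in> carrier N \<Longrightarrow> P (frag_of (b, x))"
  shows "P z"
  using assms(1) unfolding fab_carrier
  by (rule free_Abelian_group_induct[where P = P]) (use assms(2-4) in \<open>auto simp: fab_carrier\<close>)

lemma trels_carrier: "trels \<subseteq> carrier fab"
proof
  fix r assume "r \<in> trels"
  then show "r \<in> carrier fab"
    unfolding tensor_rels_def
    by (auto intro!: fab_diff frag_of_fab simp: N.smult_closed incl_closed)
qed

lemma relgrp_subgroup: "subgroup relgrp fab"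
  unfolding relgrp_def by (rule group.generate_is_subgroup[OF fab_group trels_carrier])

lemma relgrp_add_subgroup: "subgroup relgrp (add_monoid pretens)"
proof -
  have inv: "inv\<^bsub>add_monoid pretens\<^esub> x = inv\<^bsub>fab\<^esub> x" for x by (simp add: m_inv_def)
  show ?thesis using relgrp_subgroup unfolding subgroup_def inv by simp
qed

lemma relgrp_carrier: "z \<in> relgrp \<Longrightarrow> z \<in> carrier fab"
  using subgroup.subset[OF relgrp_subgroup] by blast

lemma relgrp_rel: "r \<in> trels \<Longrightarrow> r \<in> relgrp"
  unfolding relgrp_def by (rule generate.incl)

lemma relgrp_inv: "z \<in> relgrp \<Longrightarrow> - z \<in> relgrp"
  using subgroup.m_inv_closed[OF relgrp_subgroup, of z] relgrp_carrier[of z]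
  by (simp add: fab_def)

lemma relgrp_diff: "x \<in> relgrp \<Longrightarrow> y \<in> relgrp \<Longrightarrow> x - y \<in> relgrp"
  using subgroup.m_closed[OF relgrp_subgroup, of x "- y"] relgrp_inv[of y] by simp

lemma relgrp_zero: "0 \<in> relgrp"
  using subgroup.one_closed[OF relgrp_subgroup] by simp

lemma relgrp_induct [consumes 1, case_names zero diff rel]:
  assumes "z \<in> relgrp" "P 0"
    and diff: "\<And>x y. x \<in> carrier fab \<Longrightarrow> y \<in> carrier fab \<Longrightarrow> P x \<Longrightarrow> P y \<Longrightarrow> P (x - y)"
    and rel: "\<And>r. r \<in> trels \<Longrightarrow> P r"
  shows "P z"
proof -
  have zc: "(0 :: _ \<Rightarrow>\<^sub>0 int) \<in> carrier fab" using relgrp_carrier[OF relgrp_zero] .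
  have neg: "P (- x)" if "x \<in> carrier fab" "P x" for x using diff[OF zc that(1) assms(2) that(2)] by simp
  have invf: "inv\<^bsub>fab\<^esub> x = - x" if "x \<in> carrier fab" for x using that by (simp add: fab_def)
  have "z \<in> carrier fab \<and> P z"
    using assms(1) unfolding relgrp_def
  proof (induction z rule: generate.induct)
    case one
    then show ?case using assms(2) zc by simp
  next
    case (incl h)
    then show ?case using rel trels_carrier by blast
  next
    case (inv h)
    then have "h \<in> carrier fab" "P h" using rel trels_carrier by blast+
    then show ?case using neg[of h] invf[of h] by (simp add: fab_carrier)
  next
    case (eng h1 h2)
    then have "P (h1 - (- h2))" using neg[of h2] by (intro diff) (auto simp: fab_carrier)
    then show ?case using eng fab_diff[of h1 "- h2"] by (simp add: fab_carrier)
  qed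
  then show ?thesis ..
qed

lemma lmul_diff: "lmul b (x - y) = lmul b x - lmul b y"
  by (simp add: lmul_def frag_extend_diff)

lemma lmul_add: "lmul b (x + y) = lmul b x + lmul b y"
  by (simp add: lmul_def frag_extend_add)

lemma lmul_zero [simp]: "lmul b 0 = 0"
  by (simp add: lmul_def)

lemma lmul_frag [simp]: "lmul b (frag_of (b', x)) = frag_of (b \<otimes>\<^bsub>\<L>\<^esub> b', x)"
  by (simp add: lmul_def)

lemma fab_zero: "0 \<in> carrier fab" by (simp add: fab_carrier)

lemma lmul_closed: "b \<in> carrier \<L> \<Longrightarrow> z \<in> carrier fab \<Longrightarrow> lmul b z \<in> carrier fab"
  by (rotate_tac, induction z rule: fab_induct) (auto simp: fab_zero lmul_diff fab_diff frag_of_fab)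

lemma trels_addl: "b \<in> carrier \<L> \<Longrightarrow> b' \<in> carrier \<L> \<Longrightarrow> x \<in> carrier N \<Longrightarrow>
    frag_of (b \<oplus>\<^bsub>\<L>\<^esub> b', x) - frag_of (b, x) - frag_of (b', x) \<in> relgrp"
  by (rule relgrp_rel) (auto simp: tensor_rels_def)

lemma trels_addr: "b \<in> carrier \<L> \<Longrightarrow> x \<in> carrier N \<Longrightarrow> x' \<in> carrier N \<Longrightarrow>
    frag_of (b, x \<oplus>\<^bsub>N\<^esub> x') - frag_of (b, x) - frag_of (b, x') \<in> relgrp"
  by (rule relgrp_rel) (auto simp: tensor_rels_def)

lemma trels_bal: "b \<in> carrier \<L> \<Longrightarrow> x \<in> carrier N \<Longrightarrow> a \<in> carrier \<R> \<Longrightarrow>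
    frag_of (b \<otimes>\<^bsub>\<L>\<^esub> incl a, x) - frag_of (b, a \<odot>\<^bsub>N\<^esub> x) \<in> relgrp"
  by (rule relgrp_rel) (auto simp: tensor_rels_def)

lemma trels_cases:
  assumes "r \<in> trels"
  obtains b b' x where "b \<in> carrier \<L>" "b' \<in> carrier \<L>" "x \<in> carrier N"
      "r = frag_of (b \<oplus>\<^bsub>\<L>\<^esub> b', x) - frag_of (b, x) - frag_of (b', x)"
  | b x x' where "b \<in> carrier \<L>" "x \<in> carrier N" "x' \<in> carrier N"
      "r = frag_of (b, x \<oplus>\<^bsub>N\<^esub> x') - frag_of (b, x) - frag_of (b, x')"
  | a b x where "a \<in> carrier \<R>" "b \<in> carrier \<L>" "x \<in> carrier N"
      "r = frag_of (b \<otimes>\<^bsub>\<L>\<^esub> incl a, x) - frag_of (b, a \<odot>\<^bsub>N\<^esub> x)"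
  using assms unfolding tensor_rels_def
  by (elim UnE CollectE exE conjE) ((rule that(1); assumption) | (rule that(2); assumption) | (rule that(3); assumption))+

lemma lmul_relgrp: "z \<in> relgrp \<Longrightarrow> b \<in> carrier \<L> \<Longrightarrow> lmul b z \<in> relgrp"
proof (induction z rule: relgrp_induct)
  case (rel r)
  from rel(1) show ?case
  proof (cases rule: trels_cases)
    case (1 c c' x)
    then show ?thesis using rel(2) trels_addl[of "b \<otimes>\<^bsub>\<L>\<^esub> c" "b \<otimes>\<^bsub>\<L>\<^esub> c'" x]
      by (simp add: lmul_diff L.r_distr)
  next
    case (2 c x x')
    then show ?thesis using rel(2) trels_addr[of "b \<otimes>\<^bsub>\<L>\<^esub> c" x x'] by (simp add: lmul_diff)
  next
    case (3 a c x)
    then show ?thesis using rel(2) trels_bal[of "b \<otimes>\<^bsub>\<L>\<^esub> c" x a]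
      by (simp add: lmul_diff L.m_assoc incl_closed)
  qed
qed (auto simp: relgrp_zero lmul_diff relgrp_diff)

abbreviation cls where "cls z \<equiv> relgrp +>\<^bsub>pretens\<^esub> z"

lemma tens_carrier: "t \<in> carrier tens \<longleftrightarrow> (\<exists>z\<in>carrier fab. t = cls z)"
  unfolding tens_eq mod_quot_carrier by simp

lemma cls_eq_iff: "x \<in> carrier fab \<Longrightarrow> y \<in> carrier fab \<Longrightarrow> cls x = cls y \<longleftrightarrow> x - y \<in> relgrp"
  using coset_eq_iff[OF pretens_abelian_group relgrp_add_subgroup, of x y] by (simp add: pretens_minus)

lemma cls_add: "x \<in> carrier fab \<Longrightarrow> y \<in> carrier fab \<Longrightarrow> cls x \<oplus>\<^bsub>tens\<^esub> cls y = cls (x + y)"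
  using coset_add[OF pretens_abelian_group relgrp_add_subgroup, of x y] by (simp add: tens_eq)

lemma cls_smult: "b \<in> carrier \<L> \<Longrightarrow> x \<in> carrier fab \<Longrightarrow> b \<odot>\<^bsub>tens\<^esub> cls x = cls (lmul b x)"
  using coset_smult[OF pretens_abelian_group relgrp_add_subgroup, of x b]
  by (simp add: tens_eq lmul_closed lmul_add lmul_relgrp)

lemma cls_zero_iff: "z \<in> carrier fab \<Longrightarrow> cls z = \<zero>\<^bsub>tens\<^esub> \<longleftrightarrow> z \<in> relgrp"
  using coset_zero_iff[OF pretens_abelian_group relgrp_add_subgroup, of z]
  by (simp add: tens_eq mod_quot_zero)

lemma fab_add: "x \<in> carrier fab \<Longrightarrow> y \<in> carrier fab \<Longrightarrow> x + y \<in> carrier fab"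
  by (auto simp: fab_carrier dest: subsetD[OF keys_add])

lemma tens_left_module: "left_module \<L> tens"
proof (rule left_moduleI)
  show "ring \<L>" by (rule L.ring_axioms)
  show "abelian_group tens"
    unfolding tens_eq by (rule mod_quot_abelian_group[OF pretens_abelian_group relgrp_add_subgroup])
next
  fix a t assume a: "a \<in> carrier \<L>" and "t \<in> carrier tens"
  then obtain z where z: "z \<in> carrier fab" "t = cls z" by (auto simp: tens_carrier)
  then show "a \<odot>\<^bsub>tens\<^esub> t \<in> carrier tens"
    using a lmul_closed[of a z] by (auto simp: tens_carrier cls_smult)
next
  fix a b t assume ab: "a \<in> carrier \<L>" "b \<in> carrier \<L>" and "t \<in> carrier tens"
  then obtain z where z: "z \<in> carrier fab" "t = cls z" by (auto simp: tens_carrier)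
  have "lmul (a \<oplus>\<^bsub>\<L>\<^esub> b) z - (lmul a z + lmul b z) \<in> relgrp"
    using z(1)
  proof (induction z rule: fab_induct)
    case (diff x y)
    have "(lmul (a \<oplus>\<^bsub>\<L>\<^esub> b) x - (lmul a x + lmul b x)) - (lmul (a \<oplus>\<^bsub>\<L>\<^esub> b) y - (lmul a y + lmul b y)) \<in> relgrp"
      by (rule relgrp_diff[OF diff(3,4)])
    then show ?case by (simp add: lmul_diff algebra_simps)
  next
    case (frag c x)
    then show ?case using trels_addl[of "a \<otimes>\<^bsub>\<L>\<^esub> c" "b \<otimes>\<^bsub>\<L>\<^esub> c" x] ab by (simp add: L.l_distr algebra_simps)
  qed (simp add: relgrp_zero)
  then show "(a \<oplus>\<^bsub>\<L>\<^esub> b) \<odot>\<^bsub>tens\<^esub> t = a \<odot>\<^bsub>tens\<^esub> t \<oplus>\<^bsub>tens\<^esub> b \<odot>\<^bsub>tens\<^esub> t"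
    using ab z lmul_closed by (simp add: cls_smult cls_add cls_eq_iff fab_add)
next
  fix a t t' assume a: "a \<in> carrier \<L>" and "t \<in> carrier tens" "t' \<in> carrier tens"
  then obtain z z' where z: "z \<in> carrier fab" "t = cls z" "z' \<in> carrier fab" "t' = cls z'"
    by (auto simp: tens_carrier)
  then show "a \<odot>\<^bsub>tens\<^esub> (t \<oplus>\<^bsub>tens\<^esub> t') = a \<odot>\<^bsub>tens\<^esub> t \<oplus>\<^bsub>tens\<^esub> a \<odot>\<^bsub>tens\<^esub> t'"
    using a lmul_closed by (simp add: cls_smult cls_add fab_add lmul_add)
next
  fix a b t assume ab: "a \<in> carrier \<L>" "b \<in> carrier \<L>" and "t \<in> carrier tens"
  then obtain z where z: "z \<in> carrier fab" "t = cls z" by (auto simp: tens_carrier)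
  have "lmul (a \<otimes>\<^bsub>\<L>\<^esub> b) z = lmul a (lmul b z)"
    using z(1) ab by (induction z rule: fab_induct) (simp_all add: lmul_diff L.m_assoc)
  then show "(a \<otimes>\<^bsub>\<L>\<^esub> b) \<odot>\<^bsub>tens\<^esub> t = a \<odot>\<^bsub>tens\<^esub> (b \<odot>\<^bsub>tens\<^esub> t)"
    using ab z lmul_closed by (simp add: cls_smult)
next
  fix t assume "t \<in> carrier tens"
  then obtain z where z: "z \<in> carrier fab" "t = cls z" by (auto simp: tens_carrier)
  have "lmul \<one>\<^bsub>\<L>\<^esub> z = z"
    using z(1) by (induction z rule: fab_induct) (simp_all add: lmul_diff)
  then show "\<one>\<^bsub>\<L>\<^esub> \<odot>\<^bsub>tens\<^esub> t = t" using z by (simp add: cls_smult)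
qed

definition ten where "ten b x = cls (frag_of (b, x))"

lemma ten_closed: "b \<in> carrier \<L> \<Longrightarrow> x \<in> carrier N \<Longrightarrow> ten b x \<in> carrier tens"
  using frag_of_fab by (auto simp: ten_def tens_carrier)

lemma ten_add_right: "b \<in> carrier \<L> \<Longrightarrow> x \<in> carrier N \<Longrightarrow> y \<in> carrier N \<Longrightarrow>
    ten b (x \<oplus>\<^bsub>N\<^esub> y) = ten b x \<oplus>\<^bsub>tens\<^esub> ten b y"
  using trels_addr[of b x y] by (simp add: ten_def cls_add frag_of_fab cls_eq_iff fab_add algebra_simps)

lemma ten_balance: "b \<in> carrier \<L> \<Longrightarrow> x \<in> carrier N \<Longrightarrow> a \<in> carrier \<R> \<Longrightarrow>
    ten (b \<otimes>\<^bsub>\<L>\<^esub> incl a) x = ten b (a \<odot>\<^bsub>N\<^esub> x)"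
  using trels_bal[of b x a] by (simp add: ten_def frag_of_fab cls_eq_iff N.smult_closed incl_closed)

lemma ten_smult: "b \<in> carrier \<L> \<Longrightarrow> c \<in> carrier \<L> \<Longrightarrow> x \<in> carrier N \<Longrightarrow>
    c \<odot>\<^bsub>tens\<^esub> ten b x = ten (c \<otimes>\<^bsub>\<L>\<^esub> b) x"
  by (simp add: ten_def cls_smult frag_of_fab)

sublocale TM: leavitt_module E K tens
  by (intro leavitt_module.intro tens_left_module quiver_axioms)

lemma ten_one_hom: "ten \<one>\<^bsub>\<L>\<^esub> \<in> mod_hom \<R> N (res tens)"
proof (rule mod_homI)
  fix a x assume "a \<in> carrier \<R>" "x \<in> carrier N"
  then show "ten \<one>\<^bsub>\<L>\<^esub> (a \<odot>\<^bsub>N\<^esub> x) = a \<odot>\<^bsub>res tens\<^esub> ten \<one>\<^bsub>\<L>\<^esub> x"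
    using ten_balance[of "\<one>\<^bsub>\<L>\<^esub>" x a] by (simp add: ten_smult incl_closed)
qed (simp_all add: ten_closed ten_add_right)

text \<open>Since \<open>b \<otimes> x = b (1 \<otimes> x)\<close>, the image of \<open>N\<close>
  generates the tensor product.\<close>

lemma tens_submodule_all:
  assumes U: "submodule U \<L> tens" and one: "\<And>x. x \<in> carrier N \<Longrightarrow> ten \<one>\<^bsub>\<L>\<^esub> x \<in> U"
  shows "U = carrier tens"
proof -
  have "cls z \<in> U" if "z \<in> carrier fab" for z
    using that
  proof (induction z rule: fab_induct)
    case zero
    have "cls 0 = \<zero>\<^bsub>tens\<^esub>" by (simp add: cls_zero_iff fab_zero relgrp_zero)
    then show ?case using submodule_zero[OF U] by simp
  next
    case (diff x y)
    have "cls (x - y) \<oplus>\<^bsub>tens\<^esub> cls y = cls x" using diff by (simp add: cls_add fab_diff)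
    then have "cls (x - y) = cls x \<ominus>\<^bsub>tens\<^esub> cls y"
      using TM.M.add_diff_cancel[of "cls (x - y)" "cls y"] diff fab_diff by (auto simp: tens_carrier)
    then show ?case using submodule_minus[OF U diff(3,4)] by simp
  next
    case (frag b x)
    then have "ten b x = b \<odot>\<^bsub>tens\<^esub> ten \<one>\<^bsub>\<L>\<^esub> x" by (simp add: ten_smult)
    then show ?case using submodule_smult[OF U frag(1) one[OF frag(2)]] by (simp add: ten_def)
  qed
  then show ?thesis using submodule_subset[OF U] by (auto simp: tens_carrier)
qed

sublocale TN: path_module_hom E K N "res tens" "ten \<one>\<^bsub>\<L>\<^esub>"
  by (intro path_module_hom.intro path_module_hom_axioms.intro path_module_axioms
      TM.RM.path_module_axioms ten_one_hom)

lemma tens_dcl: "dcl (res tens) (ten \<one>\<^bsub>\<L>\<^esub> ` carrier N) = carrier tens"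
  by (rule tens_submodule_all)
    (use TM.dcl_leavitt_submodule[OF TN.h.submodule_image[OF N.submodule_carrier]]
      dcl_superset[of "ten \<one>\<^bsub>\<L>\<^esub> ` carrier N" "res tens"] in auto)

lemma fab_hom_zero:
  assumes M: "abelian_group M" and h: "h \<in> hom fab (add_monoid M)"
  shows "h 0 = \<zero>\<^bsub>M\<^esub>"
    and "x \<in> carrier fab \<Longrightarrow> y \<in> carrier fab \<Longrightarrow> h (x - y) = h x \<ominus>\<^bsub>M\<^esub> h y"
    and "x \<in> carrier fab \<Longrightarrow> h x \<in> carrier M"
    and "x \<in> carrier fab \<Longrightarrow> y \<in> carrier fab \<Longrightarrow> h (x + y) = h x \<oplus>\<^bsub>M\<^esub> h y"
proof -
  interpret M: abelian_group M by (rule M)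
  have add: "h (x + y) = h x \<oplus>\<^bsub>M\<^esub> h y" if "x \<in> carrier fab" "y \<in> carrier fab" for x y
    using hom_mult[OF h that] by simp
  have cl: "h x \<in> carrier M" if "x \<in> carrier fab" for x
    using hom_in_carrier[OF h that] by simp
  show zero: "h 0 = \<zero>\<^bsub>M\<^esub>"
    using add[OF fab_zero fab_zero] cl[OF fab_zero] M.add.r_cancel_one' by (metis add_0)
  show "h (x - y) = h x \<ominus>\<^bsub>M\<^esub> h y" if xy: "x \<in> carrier fab" "y \<in> carrier fab"
    using add[OF fab_diff[OF xy] xy(2)] M.add_diff_cancel[of "h (x - y)" "h y"] cl fab_diff[OF xy] xy
    by simp
  show "x \<in> carrier fab \<Longrightarrow> h x \<in> carrier M" by (rule cl)
  show "x \<in> carrier fab \<Longrightarrow> y \<in> carrier fab \<Longrightarrow> h (x + y) = h x \<oplus>\<^bsub>M\<^esub> h y" by (rule add)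
qed

lemma fab_hom_exists:
  assumes M: "abelian_group M"
    and f: "\<And>b x. b \<in> carrier \<L> \<Longrightarrow> x \<in> carrier N \<Longrightarrow> f b x \<in> carrier M"
  shows "\<exists>h\<in>hom fab (add_monoid M). \<forall>b\<in>carrier \<L>. \<forall>x\<in>carrier N. h (frag_of (b, x)) = f b x"
proof -
  interpret M: abelian_group M by (rule M)
  have "comm_group (add_monoid M)" by (rule M.a_comm_group)
  moreover have "(\<lambda>(b, x). f b x) ` (carrier \<L> \<times> carrier N) \<subseteq> carrier (add_monoid M)" using f by auto
  ultimately have "\<exists>h. h \<in> hom (free_Abelian_group (carrier \<L> \<times> carrier N)) (add_monoid M) \<and>
      (\<forall>p\<in>carrier \<L> \<times> carrier N. h (frag_of p) = (\<lambda>(b, x). f b x) p)"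
    by (rule comm_group.free_Abelian_group_universal) (rule exI, rule conjI, assumption, rule ballI, blast)
  then obtain h where h: "h \<in> hom (free_Abelian_group (carrier \<L> \<times> carrier N)) (add_monoid M)"
      "\<forall>p\<in>carrier \<L> \<times> carrier N. h (frag_of p) = (\<lambda>(b, x). f b x) p"
    by (elim exE conjE)
  have "h \<in> hom fab (add_monoid M)" using h(1) by (simp add: fab_def)
  moreover have "\<forall>b\<in>carrier \<L>. \<forall>x\<in>carrier N. h (frag_of (b, x)) = f b x" using h(2) by auto
  ultimately show ?thesis by blast
qed

subsection \<open>The universal property\<close>

lemma tens_universal:
  assumes M: "left_module \<L> M" and \<phi>: "\<phi> \<in> mod_hom \<R> N (res M)"
  shows "\<exists>\<Phi>\<in>mod_hom \<L> tens M. \<forall>x\<in>carrier N. \<Phi> (ten \<one>\<^bsub>\<L>\<^esub> x) = \<phi> x"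
proof -
  interpret M: left_module \<L> M by (rule M)
  note \<phi>' = mod_homD[OF \<phi>, simplified]
  have "\<exists>h\<in>hom fab (add_monoid M). \<forall>b\<in>carrier \<L>. \<forall>x\<in>carrier N. h (frag_of (b, x)) = b \<odot>\<^bsub>M\<^esub> \<phi> x"
    by (rule fab_hom_exists[OF M.M.abelian_group_axioms]) (simp add: \<phi>'(1) M.smult_closed)
  then obtain h where h: "h \<in> hom fab (add_monoid M)"
    and hf0: "\<forall>b\<in>carrier \<L>. \<forall>x\<in>carrier N. h (frag_of (b, x)) = b \<odot>\<^bsub>M\<^esub> \<phi> x"
    by (elim bexE)
  have hf: "h (frag_of (b, x)) = b \<odot>\<^bsub>M\<^esub> \<phi> x" if "b \<in> carrier \<L>" "x \<in> carrier N" for b x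
    using hf0 that by simp
  note hh = fab_hom_zero[OF M.M.abelian_group_axioms h]
  have rel: "h z = \<zero>\<^bsub>M\<^esub>" if "z \<in> relgrp" for z
    using that
  proof (induction z rule: relgrp_induct)
    case zero
    then show ?case by (rule hh(1))
  next
    case (diff x y)
    then show ?case by (simp add: hh(2) M.M.minus_self)
  next
    case (rel r)
    then show ?case
    proof (cases rule: trels_cases)
      case (1 b b' x)
      then show ?thesis
        by (simp add: hh(2) fab_diff frag_of_fab hf M.smult_l_distr \<phi>' M.smult_closed a_minus_def M.M.minus_add M.M.a_ac M.M.r_neg M.M.r_neg1 M.M.r_neg2)
    next
      case (2 b x x')
      then show ?thesis
        by (simp add: hh(2) fab_diff frag_of_fab hf M.smult_r_distr \<phi>' M.smult_closed a_minus_def M.M.minus_add M.M.a_ac M.M.r_neg M.M.r_neg1 M.M.r_neg2)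
    next
      case (3 a b x)
      then show ?thesis
        by (simp add: hh(2) frag_of_fab hf M.smult_assoc \<phi>' M.smult_closed incl_closed N.smult_closed M.M.minus_self)
    qed
  qed
  define \<Phi> where "\<Phi> = (\<lambda>t. h (SOME z. z \<in> carrier fab \<and> t = cls z))"
  have \<Phi>: "\<Phi> (cls z) = h z" if z: "z \<in> carrier fab" for z
  proof -
    let ?y = "SOME y. y \<in> carrier fab \<and> cls z = cls y"
    have y: "?y \<in> carrier fab \<and> cls z = cls ?y"
      by (rule someI[of _ z]) (use z in simp)
    have "z - ?y \<in> relgrp" by (rule iffD1[OF cls_eq_iff[OF z conjunct1[OF y]] conjunct2[OF y]])
    then have "h z \<ominus>\<^bsub>M\<^esub> h ?y = \<zero>\<^bsub>M\<^esub>"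
      unfolding hh(2)[OF z conjunct1[OF y], symmetric] by (rule rel)
    then have "h z = h ?y" using M.M.minus_eq_zero_iff[of "h z" "h ?y"] hh(3) z y by simp
    then show ?thesis by (simp add: \<Phi>_def)
  qed
  have lin: "h (lmul b z) = b \<odot>\<^bsub>M\<^esub> h z" if b: "b \<in> carrier \<L>" and z: "z \<in> carrier fab" for b z
    using z
  proof (induction z rule: fab_induct)
    case zero
    then show ?case using b by (simp add: hh(1) M.smult_r_zero)
  next
    case (diff x y)
    then show ?case using b lmul_closed by (simp add: lmul_diff hh(2,3) M.smult_r_diff)
  next
    case (frag c x)
    then show ?case using b by (simp add: hf M.smult_assoc \<phi>'(1))
  qed
  have "\<Phi> \<in> mod_hom \<L> tens M"
  proof (rule mod_homI)
    fix t assume "t \<in> carrier tens"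
    then obtain z where z: "z \<in> carrier fab" "t = cls z" by (auto simp: tens_carrier)
    then show "\<Phi> t \<in> carrier M" using hh(3) by (simp add: \<Phi>)
  next
    fix t t' assume "t \<in> carrier tens" "t' \<in> carrier tens"
    then obtain z z' where z: "z \<in> carrier fab" "t = cls z" "z' \<in> carrier fab" "t' = cls z'"
      by (auto simp: tens_carrier)
    then show "\<Phi> (t \<oplus>\<^bsub>tens\<^esub> t') = \<Phi> t \<oplus>\<^bsub>M\<^esub> \<Phi> t'"
      by (simp add: cls_add \<Phi> fab_add hh(4))
  next
    fix a t assume a: "a \<in> carrier \<L>" "t \<in> carrier tens"
    then obtain z where z: "z \<in> carrier fab" "t = cls z" by (auto simp: tens_carrier)
    then show "\<Phi> (a \<odot>\<^bsub>tens\<^esub> t) = a \<odot>\<^bsub>M\<^esub> \<Phi> t"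
      using a by (simp add: cls_smult \<Phi> lmul_closed lin)
  qed
  moreover have "\<Phi> (ten \<one>\<^bsub>\<L>\<^esub> x) = \<phi> x" if "x \<in> carrier N" for x
    using that \<phi>'(1) by (simp add: ten_def \<Phi> frag_of_fab hf M.smult_one)
  ultimately show ?thesis by blast
qed

lemma tens_hom_res: "\<Phi> \<in> mod_hom \<L> A B \<Longrightarrow> \<Phi> \<in> mod_hom \<R> (res A) (res B)"
  by (rule mod_homI) (simp_all add: mod_homD incl_closed)

text \<open>An element of \<open>L \<otimes> N\<close> is brought into the image of \<open>N\<close>
  by finitely many applications of arrows and sink vertices. If \<open>\<Phi>\<close> kills it, then
  by induction the elements after one application are 0, and an \<open>L\<close>-module has no
  nonzero element annihilated by all arrows \<open>e^-\<close> and all sinks. This is the exactness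
  of extension of scalars in the form used for (2) and (3).\<close>

lemma tens_embedding:
  assumes M: "left_module \<L> M" and \<phi>: "\<phi> \<in> mod_hom \<R> N (res M)"
    and inj: "inj_on \<phi> (carrier N)"
    and \<Phi>: "\<Phi> \<in> mod_hom \<L> tens M" "\<And>x. x \<in> carrier N \<Longrightarrow> \<Phi> (ten \<one>\<^bsub>\<L>\<^esub> x) = \<phi> x"
  shows "inj_on \<Phi> (carrier tens)" "\<Phi> ` carrier tens = dcl (res M) (\<phi> ` carrier N)"
proof -
  interpret M: leavitt_module E K M by (intro leavitt_module.intro M quiver_axioms)
  interpret H: left_module_hom \<L> tens M \<Phi> by (rule left_module_homI[OF tens_left_module M \<Phi>(1)])
  interpret HR: path_module_hom E K "res tens" "res M" \<Phi>
    by (intro path_module_hom.intro path_module_hom_axioms.intro TM.RM.path_module_axioms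
        M.RM.path_module_axioms tens_hom_res[OF \<Phi>(1)])
  interpret NH: left_module_hom \<R> N "res M" \<phi>
    by (rule left_module_homI[OF N.left_module_self M.RM.N.left_module_self \<phi>])
  let ?I = "ten \<one>\<^bsub>\<L>\<^esub> ` carrier N"
  have Z: "submodule {\<zero>\<^bsub>tens\<^esub>} \<L> tens" by (rule TM.M.submodule_trivial)
  have *: "t = \<zero>\<^bsub>tens\<^esub>" if "t \<in> (dstep (res tens) ^^ n) ?I" "t \<in> carrier tens" "\<Phi> t = \<zero>\<^bsub>M\<^esub>" for n t
    using that
  proof (induction n arbitrary: t)
    case 0
    then obtain x where x: "x \<in> carrier N" "t = ten \<one>\<^bsub>\<L>\<^esub> x" by auto
    then have "\<phi> x = \<zero>\<^bsub>M\<^esub>" using \<Phi>(2) 0 by simp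
    then have "x = \<zero>\<^bsub>N\<^esub>" using inj x NH.inj_on_iff_kernel by simp
    then show ?case using x TN.h.hom_zero by simp
  next
    case (Suc n)
    then have t: "t \<in> dstep (res tens) ((dstep (res tens) ^^ n) ?I)" by simp
    note d = dstepD[OF t]
    have "t \<in> dstep (res tens) {\<zero>\<^bsub>tens\<^esub>}"
      unfolding dstep_def
    proof (intro CollectI conjI ballI)
      show "t \<in> carrier (res tens)" using Suc by simp
      fix e assume e: "e \<in> arcs E"
      then have "\<Phi> (ar e \<odot>\<^bsub>res tens\<^esub> t) = \<zero>\<^bsub>M\<^esub>"
        using Suc.prems by (simp add: H.hom_smult incl_closed M.M.smult_r_zero)
      then show "ar e \<odot>\<^bsub>res tens\<^esub> t \<in> {\<zero>\<^bsub>tens\<^esub>}"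
        using Suc.IH[OF d(2)[OF e]] Suc.prems(2) e by (simp add: TM.M.smult_closed incl_closed)
    next
      fix v assume v: "v \<in> sinks E"
      then have "\<Phi> (vt v \<odot>\<^bsub>res tens\<^esub> t) = \<zero>\<^bsub>M\<^esub>"
        using Suc.prems sinks_verts by (simp add: H.hom_smult incl_closed M.M.smult_r_zero)
      then show "vt v \<odot>\<^bsub>res tens\<^esub> t \<in> {\<zero>\<^bsub>tens\<^esub>}"
        using Suc.IH[OF d(3)[OF v]] Suc.prems(2) v sinks_verts by (simp add: TM.M.smult_closed incl_closed)
    qed
    then show ?case using TM.dstep_leavitt_submodule[OF Z] by blast
  qed
  show "inj_on \<Phi> (carrier tens)"
    unfolding H.inj_on_iff_kernel
  proof (intro ballI impI)
    fix t assume t: "t \<in> carrier tens" "\<Phi> t = \<zero>\<^bsub>M\<^esub>"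
    have "t \<in> dcl (res tens) ?I" using t(1) tens_dcl by simp
    then obtain n where "t \<in> (dstep (res tens) ^^ n) ?I" unfolding dcl_def by (elim UN_E)
    then show "t = \<zero>\<^bsub>tens\<^esub>" using * t by simp
  qed
  have im: "\<Phi> ` ?I = \<phi> ` carrier N" using \<Phi>(2) by (simp add: image_image)
  show "\<Phi> ` carrier tens = dcl (res M) (\<phi> ` carrier N)"
  proof
    show "\<Phi> ` carrier tens \<subseteq> dcl (res M) (\<phi> ` carrier N)"
      using HR.hom_dcl_image[of ?I] by (simp add: tens_dcl im)
    have "submodule (\<Phi> ` carrier tens) \<L> M"
      by (rule H.submodule_image[OF TM.M.submodule_carrier])
    moreover have "\<phi> ` carrier N \<subseteq> \<Phi> ` carrier tens"
      unfolding im[symmetric] using ten_closed by auto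
    ultimately show "dcl (res M) (\<phi> ` carrier N) \<subseteq> \<Phi> ` carrier tens"
      by (rule M.dcl_leavitt_least)
  qed
qed

subsection \<open>The kernel of the canonical map\<close>

text \<open>A path long for \<open>n\<close> followed by an arrow is long for \<open>n + 1\<close>,
  so the hypothesis passes from \<open>x\<close> to \<open>e^- x\<close> with the threshold lowered
  by one. At threshold 0 the trivial paths are long, and \<open>x = \<Sum> p_v x\<close>.\<close>

lemma long_annihilates:
  assumes "x \<in> carrier N" "\<And>q. long n q \<Longrightarrow> path_elem q \<odot>\<^bsub>N\<^esub> x = \<zero>\<^bsub>N\<^esub>"
  shows "x \<in> (dstep N ^^ n) {\<zero>\<^bsub>N\<^esub>}"
  using assms
proof (induction n arbitrary: x)
  case 0
  have "x = (\<Oplus>\<^bsub>N\<^esub>v\<in>verts E. vt v \<odot>\<^bsub>N\<^esub> x)" using vt_decomposition[OF 0(1)] by simp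
  also have "\<dots> \<in> {\<zero>\<^bsub>N\<^esub>}"
    by (rule N.submodule_finsum[OF N.submodule_trivial finite_verts]) (use 0(2) in \<open>simp add: long_def\<close>)
  finally show ?case by simp
next
  case (Suc n)
  note sm = N.smult_assoc[symmetric]
  have "ar e \<odot>\<^bsub>N\<^esub> x \<in> (dstep N ^^ n) {\<zero>\<^bsub>N\<^esub>}" if e: "e \<in> arcs E" for e
  proof (rule Suc.IH)
    show "ar e \<odot>\<^bsub>N\<^esub> x \<in> carrier N" using e Suc.prems by (simp add: N.smult_closed)
    fix q assume q: "long n q"
    then have qb: "q \<in> bpaths" by (simp add: long_def)
    then have pc: "path_elem q \<in> carrier \<R>" by (rule path_elem_carrier)
    show "path_elem q \<odot>\<^bsub>N\<^esub> (ar e \<odot>\<^bsub>N\<^esub> x) = \<zero>\<^bsub>N\<^esub>"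
    proof (cases "pend q = head E e")
      case True
      then have "long (Suc n) (fst q, snd q @ [e])"
        using q e by (cases q) (auto simp: long_def)
      then show ?thesis
        using Suc.prems e True pc by (simp add: sm path_elem_mult)
    next
      case False
      have "path_elem q \<otimes>\<^bsub>\<R>\<^esub> ar e = \<zero>\<^bsub>\<R>\<^esub>" using False by (simp add: path_elem_mult path_algebra_simps)
      then show ?thesis
        using Suc.prems(1) e pc by (simp add: sm N.smult_l_zero)
    qed
  qed
  moreover have "vt v \<odot>\<^bsub>N\<^esub> x \<in> (dstep N ^^ n) {\<zero>\<^bsub>N\<^esub>}" if v: "v \<in> sinks E" for v
  proof (rule Suc.IH)
    show "vt v \<odot>\<^bsub>N\<^esub> x \<in> carrier N" using v Suc.prems sinks_verts by (simp add: N.smult_closed)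
    fix q assume q: "long n q"
    then have qb: "q \<in> bpaths" by (simp add: long_def)
    then have pc: "path_elem q \<in> carrier \<R>" by (rule path_elem_carrier)
    have vv: "v \<in> verts E" using v sinks_verts by simp
    show "path_elem q \<odot>\<^bsub>N\<^esub> (vt v \<odot>\<^bsub>N\<^esub> x) = \<zero>\<^bsub>N\<^esub>"
    proof (cases "pend q = v")
      case True
      \<comment> \<open>The last arrow of a nontrivial path of the inverse quiver ends at the tail
        of an arrow of \<open>E\<close>, never at a sink. So \<open>q\<close> is the trivial path at
        \<open>v\<close>, which is long for every threshold.\<close>
      have sq: "snd q = []"
      proof (rule ccontr)
        assume "snd q \<noteq> []"
        then have "pend q = tail E (last (snd q))" "last (snd q) \<in> arcs E"
          using path_last_tail[of "fst q" "snd q"] qb by simp_all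
        then show False using v True tail_not_sink by metis
      qed
      then have "fst q = v" using True by (cases q) simp
      then have "long (Suc n) q" "path_elem q \<otimes>\<^bsub>\<R>\<^esub> vt v = path_elem q"
        using v qb sq True by (cases q; simp add: long_def path_elem_mult)+
      then show ?thesis
        using Suc.prems vv pc by (simp add: sm)
    next
      case False
      have "path_elem q \<otimes>\<^bsub>\<R>\<^esub> vt v = \<zero>\<^bsub>\<R>\<^esub>" using False by (simp add: path_elem_mult path_algebra_simps)
      then show ?thesis
        using Suc.prems(1) vv pc by (simp add: sm N.smult_l_zero)
    qed
  qed
  ultimately have "x \<in> dstep N ((dstep N ^^ n) {\<zero>\<^bsub>N\<^esub>})" using Suc.prems(1) by (intro dstepI)
  then show ?case by simp
qed

definition rep where "rep b = (SOME f. f \<in> carrier \<F> \<and> proj f = b)"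

lemma rep: "b \<in> carrier \<L> \<Longrightarrow> rep b \<in> carrier \<F>" "b \<in> carrier \<L> \<Longrightarrow> proj (rep b) = b"
proof -
  assume "b \<in> carrier \<L>"
  then have "\<exists>f\<in>carrier \<F>. b = proj f" by (rule iffD1[OF L_carrier])
  then have "\<exists>f. f \<in> carrier \<F> \<and> proj f = b" by (elim bexE) (rule exI, rule conjI, assumption, rule sym)
  then have "rep b \<in> carrier \<F> \<and> proj (rep b) = b" unfolding rep_def by (rule someI_ex)
  then show "rep b \<in> carrier \<F>" "proj (rep b) = b" by auto
qed

text \<open>Representatives of elements of \<open>L\<close> cannot be expected to be chosen
  additively or multiplicatively, but their action on sufficiently long paths depends only on the
  element represented.\<close>

lemma eventually_equal:
  assumes "f \<in> carrier \<F>" "g \<in> carrier \<F>" "proj f = proj g"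
  shows "\<exists>n. \<forall>q. long n q \<longrightarrow> ract f (path_elem q) = ract g (path_elem q)"
proof -
  have "proj (f \<ominus>\<^bsub>\<F>\<^esub> g) = \<zero>\<^bsub>\<L>\<^esub>"
    using assms by (simp add: proj_eq_iff proj_eq_zero_iff)
  then have "eventually_zero (f \<ominus>\<^bsub>\<F>\<^esub> g)" using assms by (intro proj_zero_eventually) auto
  then obtain n where "\<forall>q. long n q \<longrightarrow> ract (f \<ominus>\<^bsub>\<F>\<^esub> g) (path_elem q) = (\<lambda>_. 0)"
    unfolding eventually_zero_def by blast
  then show ?thesis using assms by (auto simp: ract_minus fun_eq_iff intro!: exI[of _ n])
qed

text \<open>
  Evaluating \<open>b \<otimes> x\<close> as \<open>(q b) x\<close> for a long path \<open>q\<close>, where \<open>q b\<close> lies in the path algebra, kills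
  the relations of the tensor product, so that \<open>1 \<otimes> x = 0\<close> forces \<open>q x = 0\<close>.
\<close>

lemma ten_one_kernel:
  assumes x: "x \<in> carrier N" and zero: "ten \<one>\<^bsub>\<L>\<^esub> x = \<zero>\<^bsub>tens\<^esub>"
  shows "x \<in> dcl N {\<zero>\<^bsub>N\<^esub>}"
proof -
  \<comment> \<open>\<open>\<theta> q b\<close> is the product \<open>q b\<close>, computed in the
    path algebra through a representative of \<open>b\<close>. Its independence of that choice holds
    for long \<open>q\<close>, with a threshold that depends on the representatives
    compared.\<close>
  define \<theta> where "\<theta> = (\<lambda>q b. ract (rep b) (path_elem q))"
  have \<theta>c: "\<theta> q b \<in> carrier \<R>" if "q \<in> bpaths" "b \<in> carrier \<L>" for q b
    using that by (simp add: \<theta>_def ract_closed rep path_elem_carrier)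
  have "\<forall>q. \<exists>h. q \<in> bpaths \<longrightarrow> h \<in> hom fab (add_monoid N) \<and>
      (\<forall>b\<in>carrier \<L>. \<forall>x\<in>carrier N. h (frag_of (b, x)) = \<theta> q b \<odot>\<^bsub>N\<^esub> x)"
  proof
    fix q
    show "\<exists>h. q \<in> bpaths \<longrightarrow> h \<in> hom fab (add_monoid N) \<and>
      (\<forall>b\<in>carrier \<L>. \<forall>x\<in>carrier N. h (frag_of (b, x)) = \<theta> q b \<odot>\<^bsub>N\<^esub> x)"
    proof (cases "q \<in> bpaths")
      case True
      then show ?thesis
        using fab_hom_exists[OF N.M.abelian_group_axioms, of "\<lambda>b x. \<theta> q b \<odot>\<^bsub>N\<^esub> x"]
        by (auto simp: \<theta>c N.smult_closed)
    qed simp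
  qed
  then obtain h where h0: "\<forall>q. q \<in> bpaths \<longrightarrow> h q \<in> hom fab (add_monoid N) \<and>
      (\<forall>b\<in>carrier \<L>. \<forall>x\<in>carrier N. h q (frag_of (b, x)) = \<theta> q b \<odot>\<^bsub>N\<^esub> x)"
    by (rule choice[THEN exE])
  have h: "h q \<in> hom fab (add_monoid N)" if "q \<in> bpaths" for q using h0[THEN spec, of q] that by simp
  have hf: "h q (frag_of (b, x)) = \<theta> q b \<odot>\<^bsub>N\<^esub> x"
    if "q \<in> bpaths" "b \<in> carrier \<L>" "x \<in> carrier N" for q b x using h0[THEN spec, of q] that by simp
  note hh = fab_hom_zero[OF N.M.abelian_group_axioms h]
  have lb: "q \<in> bpaths" if "long n q" for n q using that by (simp add: long_def)
  \<comment> \<open>The threshold depends on \<open>z\<close>: every relation contributes its own,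
    and a difference takes the larger one.\<close>
  have "\<exists>n. \<forall>q. long n q \<longrightarrow> h q z = \<zero>\<^bsub>N\<^esub>" if "z \<in> relgrp" for z
    using that
  proof (induction z rule: relgrp_induct)
    case zero
    then show ?case using hh(1) lb by blast
  next
    case (diff x y)
    then obtain a b where "\<forall>q. long a q \<longrightarrow> h q x = \<zero>\<^bsub>N\<^esub>" "\<forall>q. long b q \<longrightarrow> h q y = \<zero>\<^bsub>N\<^esub>" by blast
    then have "\<forall>q. long (max a b) q \<longrightarrow> h q (x - y) = \<zero>\<^bsub>N\<^esub>"
      using long_mono[of "max a b" _ a] long_mono[of "max a b" _ b] diff lb
      by (simp add: hh(2) N.M.minus_self)
    then show ?case by blast
  next
    case (rel r)
    then show ?case
    proof (cases rule: trels_cases)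
      case (1 b b' x)
      have "proj (rep (b \<oplus>\<^bsub>\<L>\<^esub> b')) = proj (rep b \<oplus>\<^bsub>\<F>\<^esub> rep b')"
        using 1 by (simp add: rep proj_add)
      then obtain n where n: "\<forall>q. long n q \<longrightarrow> \<theta> q (b \<oplus>\<^bsub>\<L>\<^esub> b') = ract (rep b \<oplus>\<^bsub>\<F>\<^esub> rep b') (path_elem q)"
        using eventually_equal[of "rep (b \<oplus>\<^bsub>\<L>\<^esub> b')" "rep b \<oplus>\<^bsub>\<F>\<^esub> rep b'"] 1 rep unfolding \<theta>_def by auto
      have "h q r = \<zero>\<^bsub>N\<^esub>" if q: "long n q" for q
      proof -
        note qb = lb[OF q]
        have e: "\<theta> q (b \<oplus>\<^bsub>\<L>\<^esub> b') = \<theta> q b \<oplus>\<^bsub>\<R>\<^esub> \<theta> q b'"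
          using n[THEN spec, THEN mp, OF q] 1 by (simp add: \<theta>_def ract_add rep path_algebra_simps)
        have "h q r = \<theta> q (b \<oplus>\<^bsub>\<L>\<^esub> b') \<odot>\<^bsub>N\<^esub> x \<ominus>\<^bsub>N\<^esub> \<theta> q b \<odot>\<^bsub>N\<^esub> x \<ominus>\<^bsub>N\<^esub> \<theta> q b' \<odot>\<^bsub>N\<^esub> x"
          using 1 qb by (simp add: hh(2) fab_diff frag_of_fab hf)
        also have "\<dots> = \<zero>\<^bsub>N\<^esub>"
          unfolding e using 1 qb \<theta>c
          by (simp add: N.smult_l_distr N.smult_closed a_minus_def N.M.a_ac N.M.r_neg N.M.r_neg1 N.M.r_neg2)
        finally show ?thesis .
      qed
      then show ?thesis by blast
    next
      case (2 b x x')
      have "h q r = \<zero>\<^bsub>N\<^esub>" if q: "long 0 q" for q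
        using 2 lb[OF q] \<theta>c
        by (simp add: hh(2) fab_diff frag_of_fab hf N.smult_r_distr N.smult_closed a_minus_def N.M.a_ac N.M.r_neg N.M.r_neg1 N.M.r_neg2)
      then show ?thesis by blast
    next
      case (3 a b x)
      have "proj (rep (b \<otimes>\<^bsub>\<L>\<^esub> incl a)) = proj (rep b \<otimes>\<^bsub>\<F>\<^esub> wlift a)"
        using 3 by (simp add: rep proj_mult incl_closed wlift_closed incl_eq[symmetric])
      then obtain n where n: "\<forall>q. long n q \<longrightarrow> \<theta> q (b \<otimes>\<^bsub>\<L>\<^esub> incl a) = ract (rep b \<otimes>\<^bsub>\<F>\<^esub> wlift a) (path_elem q)"
        using eventually_equal[of "rep (b \<otimes>\<^bsub>\<L>\<^esub> incl a)" "rep b \<otimes>\<^bsub>\<F>\<^esub> wlift a"] 3 rep incl_closed wlift_closed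
        unfolding \<theta>_def by auto
      have "h q r = \<zero>\<^bsub>N\<^esub>" if q: "long n q" for q
      proof -
        note qb = lb[OF q]
        have e: "\<theta> q (b \<otimes>\<^bsub>\<L>\<^esub> incl a) = \<theta> q b \<otimes>\<^bsub>\<R>\<^esub> a"
          using n[THEN spec, THEN mp, OF q] 3 \<theta>c[OF qb 3(2)] by (simp add: \<theta>_def ract_mult rep wlift_closed ract_wlift)
        have "h q r = \<theta> q (b \<otimes>\<^bsub>\<L>\<^esub> incl a) \<odot>\<^bsub>N\<^esub> x \<ominus>\<^bsub>N\<^esub> \<theta> q b \<odot>\<^bsub>N\<^esub> (a \<odot>\<^bsub>N\<^esub> x)"
          using 3 qb by (simp add: hh(2) frag_of_fab hf incl_closed N.smult_closed)
        then show ?thesis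
          unfolding e using 3 \<theta>c[OF qb 3(2)] by (simp add: N.smult_assoc N.smult_closed N.M.minus_self)
      qed
      then show ?thesis by blast
    qed
  qed
  moreover have "frag_of (\<one>\<^bsub>\<L>\<^esub>, x) \<in> relgrp"
    using zero x cls_zero_iff[of "frag_of (\<one>\<^bsub>\<L>\<^esub>, x)"] by (simp add: ten_def frag_of_fab)
  ultimately obtain m where m: "\<forall>q. long m q \<longrightarrow> h q (frag_of (\<one>\<^bsub>\<L>\<^esub>, x)) = \<zero>\<^bsub>N\<^esub>" by blast
  obtain n where n: "\<forall>q. long n q \<longrightarrow> \<theta> q \<one>\<^bsub>\<L>\<^esub> = path_elem q"
    using eventually_equal[of "rep \<one>\<^bsub>\<L>\<^esub>" "\<one>\<^bsub>\<F>\<^esub>"] by (auto simp: \<theta>_def rep proj_one ract_one)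
  have "path_elem q \<odot>\<^bsub>N\<^esub> x = \<zero>\<^bsub>N\<^esub>" if q: "long (max m n) q" for q
    using m[THEN spec, THEN mp, OF long_mono[OF q, of m]] n[THEN spec, THEN mp, OF long_mono[OF q, of n]]
      hf[OF lb[OF q] _ x, of "\<one>\<^bsub>\<L>\<^esub>"] by simp
  then have "x \<in> (dstep N ^^ max m n) {\<zero>\<^bsub>N\<^esub>}" by (rule long_annihilates[OF x])
  then show ?thesis by (rule subsetD[OF dstep_iter_subset_dcl])
qed

end

section \<open>The modules \<open>coker \<nu>\<^sub>i\<close> and the length of an extension of scalars\<close>

lemma regular_module_simps [simp]:
  "carrier (regular_module A) = carrier A" "\<zero>\<^bsub>regular_module A\<^esub> = \<zero>\<^bsub>A\<^esub>"
  "x \<oplus>\<^bsub>regular_module A\<^esub> y = x \<oplus>\<^bsub>A\<^esub> y" "a \<odot>\<^bsub>regular_module A\<^esub> x = a \<otimes>\<^bsub>A\<^esub> x"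
  by (simp_all add: regular_module_def)

lemma regular_left_module:
  assumes "ring A"
  shows "left_module A (regular_module A)"
proof -
  interpret ring A by (rule assms)
  show ?thesis
  proof (rule left_moduleI)
    show "abelian_group (regular_module A)"
      by (rule abelian_groupI) (auto simp: a_ac intro: bexI[of _ "\<ominus>\<^bsub>A\<^esub> _"] l_neg)
  qed (auto simp: assms l_distr r_distr m_assoc)
qed

context quiver
begin

lemma right_corner_iff:
  "f \<in> right_corner E i \<longleftrightarrow> f \<in> carrier \<R> \<and> (\<forall>u fs. f (u, fs) \<noteq> 0 \<longrightarrow> pend (u, fs) = i)"
  if i: "i \<in> verts E"
proof
  assume "f \<in> right_corner E i"
  then obtain g where "g \<in> carrier \<R>" "f = g \<otimes>\<^bsub>\<R>\<^esub> vt i" unfolding right_corner_def by blast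
  then show "f \<in> carrier \<R> \<and> (\<forall>u fs. f (u, fs) \<noteq> 0 \<longrightarrow> pend (u, fs) = i)"
    using i by (auto simp: mult_vertex_right Eb.path_mult_closed)
next
  assume f: "f \<in> carrier \<R> \<and> (\<forall>u fs. f (u, fs) \<noteq> 0 \<longrightarrow> pend (u, fs) = i)"
  then have "f = f \<otimes>\<^bsub>\<R>\<^esub> vt i" by (intro fun_pair_eqI) (auto simp: mult_vertex_right)
  then show "f \<in> right_corner E i" using f unfolding right_corner_def by blast
qed

text \<open>A nontrivial path ending at \<open>i\<close> has a unique last arrow \<open>e^-\<close>,
  where \<open>e\<close> starts at \<open>i\<close>. Hence the image misses just the trivial path,
  and \<open>coker_nu E i\<close> is the one-dimensional module at the vertex \<open>i\<close> on
  which all arrows act as 0.\<close>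

lemma nu_image:
  assumes i: "i \<in> verts E"
  shows "nu E i ` (\<Pi>\<^sub>E e\<in>out_arcs E i. right_corner E (head E e)) =
    {f \<in> right_corner E i. f (i, []) = (0 :: 'k)}" (is "?l = ?r")
proof
  have o: "e \<in> arcs E" "tail E e = i" if "e \<in> out_arcs E i" for e using that by (simp_all add: out_arcs_def)
  have fin: "finite (out_arcs E i)" by (rule finite_subset[OF _ finite_arcs]) (use o in blast)
  have nu: "nu E i r = (\<lambda>p. \<Sum>e\<in>out_arcs E i. (r e \<otimes>\<^bsub>\<R>\<^esub> ar e) p)"
    if "\<And>e. e \<in> out_arcs E i \<Longrightarrow> r e \<in> carrier \<R>" for r
  proof -
    have "r e \<otimes>\<^bsub>\<R>\<^esub> ar e \<in> carrier \<R>" if "e \<in> out_arcs E i" for e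
      by (rule Eb.path_mult_closed[OF \<open>\<And>e. e \<in> out_arcs E i \<Longrightarrow> r e \<in> carrier \<R>\<close>[OF that] ar_carrier[OF o(1)[OF that]]])
    then show ?thesis unfolding nu_def by (rule Eb.path_algebra_finsum[OF fin])
  qed
  show "?l \<subseteq> ?r"
  proof
    fix f :: "'v \<times> 'e list \<Rightarrow> 'k"
    assume "f \<in> ?l"
    then obtain r where r: "r \<in> (\<Pi>\<^sub>E e\<in>out_arcs E i. right_corner E (head E e))" "f = nu E i r" by blast
    have rc: "r e \<in> carrier \<R>" if "e \<in> out_arcs E i" for e
      using PiE_mem[OF r(1) that] o[OF that] by (simp add: right_corner_iff)
    have f: "f = (\<lambda>p. \<Sum>e\<in>out_arcs E i. (r e \<otimes>\<^bsub>\<R>\<^esub> ar e) p)" using r(2) nu rc by simp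
    have "f \<in> carrier \<R>"
    proof -
      have "nu E i r \<in> carrier \<R>"
        unfolding nu_def using Eb.path_mult_closed[OF rc ar_carrier[OF o(1)]] by (intro R.finsum_closed Pi_I)
      then show ?thesis using r(2) by simp
    qed
    moreover have "pend (u, fs) = i" if "f (u, fs) \<noteq> 0" for u fs
    proof -
      have "f (u, fs) = (\<Sum>e\<in>out_arcs E i. (r e \<otimes>\<^bsub>\<R>\<^esub> ar e) (u, fs))" by (rule fun_cong[OF f])
      then have "(\<Sum>e\<in>out_arcs E i. (r e \<otimes>\<^bsub>\<R>\<^esub> ar e) (u, fs)) \<noteq> 0" using that by simp
      then obtain e where e: "e \<in> out_arcs E i" "(r e \<otimes>\<^bsub>\<R>\<^esub> ar e) (u, fs) \<noteq> 0"
        by (rule sum.not_neutral_contains_not_neutral)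
      then have "fs \<noteq> []" "last fs = e" by (auto simp: mult_arrow_right split: if_splits)
      then show ?thesis using o[OF e(1)] by (simp add: path_end_eq)
    qed
    moreover have "f (i, []) = 0" using fun_cong[OF f, of "(i, [])"] by (simp add: mult_arrow_right)
    ultimately show "f \<in> ?r" by (simp add: right_corner_iff i)
  qed
  show "?r \<subseteq> ?l"
  proof
    fix f :: "'v \<times> 'e list \<Rightarrow> 'k"
    assume "f \<in> ?r"
    then have fc: "f \<in> carrier \<R>" and fi: "\<And>u fs. f (u, fs) \<noteq> 0 \<Longrightarrow> pend (u, fs) = i" and f0: "f (i, []) = 0"
      using i by (auto simp: right_corner_iff)
    \<comment> \<open>The preimage is found by removing the last arrow, which is the action of
      \<open>Arr e\<close>.\<close>
    define r where "r = (\<lambda>e\<in>out_arcs E i. ract1 (Arr e) f)"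
    have r1: "ract1 (Arr e) f \<in> right_corner E (head E e)" if "e \<in> out_arcs E i" for e
      using o[OF that] ract1_closed[OF fc, of "Arr e"] by (auto simp: right_corner_iff split: if_splits)
    have rc: "r e \<in> carrier \<R>" if "e \<in> out_arcs E i" for e
    proof -
      have "r e = ract1 (Arr e) f" using that by (simp only: r_def restrict_apply if_True)
      then show ?thesis using ract1_closed[OF fc, of "Arr e"] o(1)[OF that] by simp
    qed
    have "nu E i r = f"
    proof (rule fun_pair_eqI)
      fix u fs
      have eq: "nu E i r (u, fs) = (\<Sum>e\<in>out_arcs E i. (ract1 (Arr e) f \<otimes>\<^bsub>\<R>\<^esub> ar e) (u, fs))"
      proof -
        have "nu E i r = (\<lambda>p. \<Sum>e\<in>out_arcs E i. (r e \<otimes>\<^bsub>\<R>\<^esub> ar e) p)" by (rule nu) (rule rc)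
        then have "nu E i r (u, fs) = (\<Sum>e\<in>out_arcs E i. (r e \<otimes>\<^bsub>\<R>\<^esub> ar e) (u, fs))" by (rule fun_cong)
        also have "\<dots> = (\<Sum>e\<in>out_arcs E i. (ract1 (Arr e) f \<otimes>\<^bsub>\<R>\<^esub> ar e) (u, fs))"
          by (rule sum.cong[OF refl]) (simp only: r_def restrict_apply if_True)
        finally show ?thesis .
      qed
      show "nu E i r (u, fs) = f (u, fs)"
      proof (cases "fs = []")
        case True
        have "f (u, []) = 0" using f0 fi[of u "[]"] by (cases "u = i") auto
        then show ?thesis unfolding eq using True by (simp add: mult_arrow_right)
      next
        case False
        have t: "(ract1 (Arr e) f \<otimes>\<^bsub>\<R>\<^esub> ar e) (u, fs) =
            (if e = last fs then (if pend (u, butlast fs) = head E e then f (u, fs) else 0) else 0)" for e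
          using False append_butlast_last_id[OF False] by (cases "e = last fs") (simp_all add: mult_arrow_right)
        have "nu E i r (u, fs) = (if last fs \<in> out_arcs E i then
            (if pend (u, butlast fs) = head E (last fs) then f (u, fs) else 0) else 0)"
          unfolding eq t by (rule sum.delta[OF fin])
        also have "\<dots> = f (u, fs)"
        proof (cases "f (u, fs) = 0")
          case nz: False
          then have "(u, fs) \<in> bpaths" using fc unfolding path_algebra_carrier by blast
          then show ?thesis using path_last_tail[of u fs] False fi[OF nz] by (simp add: out_arcs_def)
        qed simp
        finally show ?thesis .
      qed
    qed
    moreover have "r \<in> (\<Pi>\<^sub>E e\<in>out_arcs E i. right_corner E (head E e))"
      using r1 by (simp add: r_def)
    ultimately show "f \<in> ?l" by blast
  qed
qed

abbreviation corner_module where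
  "corner_module i \<equiv> (regular_module \<R>)\<lparr>carrier := right_corner E i\<rparr>"

lemma corner_submodule: "i \<in> verts E \<Longrightarrow> submodule (right_corner E i) \<R> (regular_module \<R>)"
proof -
  assume i: "i \<in> verts E"
  interpret RM: left_module \<R> "regular_module \<R>" by (rule regular_left_module[OF R.ring_axioms])
  have sm: "a \<otimes>\<^bsub>\<R>\<^esub> (g \<otimes>\<^bsub>\<R>\<^esub> vt i) \<in> right_corner E i" if "a \<in> carrier \<R>" "g \<in> carrier \<R>" for a g
    using that unfolding right_corner_def path_mult_assoc[symmetric] by (auto simp: Eb.path_mult_closed)
  show ?thesis
  proof (rule RM.submoduleI)
    show "\<zero>\<^bsub>regular_module \<R>\<^esub> \<in> right_corner E i"
      using R.zero_closed i by (simp add: right_corner_iff path_algebra_simps)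
    show "f \<oplus>\<^bsub>regular_module \<R>\<^esub> g \<in> right_corner E i" if fg: "f \<in> right_corner E i" "g \<in> right_corner E i" for f g
    proof -
      have "f \<oplus>\<^bsub>\<R>\<^esub> g \<in> carrier \<R>" using fg i by (intro R.a_closed) (simp_all add: right_corner_iff)
      moreover have "pend (u, fs) = i" if "f (u, fs) + g (u, fs) \<noteq> 0" for u fs
      proof -
        have "f (u, fs) \<noteq> 0 \<or> g (u, fs) \<noteq> 0" using that by auto
        then show ?thesis using fg i by (auto simp: right_corner_iff)
      qed
      ultimately show ?thesis using i by (simp add: right_corner_iff path_algebra_simps)
    qed
    show "a \<odot>\<^bsub>regular_module \<R>\<^esub> f \<in> right_corner E i" if "a \<in> carrier \<R>" "f \<in> right_corner E i" for a f
      using that sm by (auto simp: right_corner_def)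
  qed (use i in \<open>auto simp: right_corner_iff\<close>)
qed

lemma corner_left_module: "i \<in> verts E \<Longrightarrow> left_module \<R> (corner_module i)"
  using left_module.submodule_left_module[OF regular_left_module[OF R.ring_axioms] corner_submodule] .

lemma corner_kernel_submodule:
  assumes i: "i \<in> verts E"
  shows "submodule {f \<in> right_corner E i. f (i, []) = (0 :: 'k)} \<R> (corner_module i)"
proof -
  interpret C: left_module \<R> "corner_module i" by (rule corner_left_module[OF i])
  have "(a \<otimes>\<^bsub>\<R>\<^esub> f) (i, []) = 0" if "f (i, []) = 0" for a f :: "'v \<times> 'e list \<Rightarrow> 'k"
    using that by (simp add: path_algebra_mult)
  then show ?thesis
    using submodule_zero[OF corner_submodule[OF i]] submodule_add[OF corner_submodule[OF i]]
      submodule_smult[OF corner_submodule[OF i]]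
    by (intro C.submoduleI) (auto simp: path_algebra_simps)
qed

lemma coker_nu_eq: "i \<in> verts E \<Longrightarrow> coker_nu E i = mod_quot (corner_module i) {f \<in> right_corner E i. f (i, []) = (0 :: 'k)}"
  by (simp add: coker_nu_def nu_image)

end

section \<open>Composition factors isomorphic to a cokernel of some \<open>nu E i\<close>\<close>

context path_module
begin

lemma scalar_inverse:
  assumes "c \<noteq> 0" "z \<in> carrier N"
  shows "path_scalar (inverse_quiver E) (inverse c) \<odot>\<^bsub>N\<^esub> (path_scalar (inverse_quiver E) c \<odot>\<^bsub>N\<^esub> z) = z"
proof -
  have "path_scalar (inverse_quiver E) (inverse c) \<otimes>\<^bsub>\<R>\<^esub> path_scalar (inverse_quiver E) c = \<one>\<^bsub>\<R>\<^esub>"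
    unfolding path_scalar_mult[OF rscalar_carrier] path_algebra_one
    using assms(1) by (auto simp: path_scalar_def fun_eq_iff)
  then show ?thesis using assms(2) by (simp add: N.smult_assoc[symmetric] N.smult_one)
qed

text \<open>Some \<open>z = p_i y\<close> lies outside \<open>A\<close>, and all arrows take
  \<open>z\<close> into \<open>A\<close>, so modulo \<open>A\<close> an element \<open>r\<close> of
  the path algebra acts on \<open>z\<close> by its coefficient at the trivial path \<open>i\<close>.
  Hence \<open>r \<mapsto> r z\<close> maps \<open>R p_i\<close> onto \<open>B/A\<close> with the
  image of \<open>nu E i\<close> as its kernel.\<close>

lemma simple_vertex_factor:
  assumes cov: "N.covers A B" and y: "y \<in> B" "y \<notin> A" "y \<in> dstep N A"
  shows "\<exists>i\<in>verts E - sinks E. mod_isomorphic \<R> (mod_quot (N\<lparr>carrier := B\<rparr>) A) (coker_nu E i)"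
proof -
  note A = N.coversD(1)[OF cov] and B = N.coversD(2)[OF cov]
  have AB: "A \<subseteq> B" using N.coversD(3)[OF cov] by blast
  have yc: "y \<in> carrier N" using submodule_mem[OF B y(1)] .
  have "\<exists>i\<in>verts E. vt i \<odot>\<^bsub>N\<^esub> y \<notin> A"
  proof (rule ccontr)
    assume "\<not> ?thesis"
    then have "(\<Oplus>\<^bsub>N\<^esub>v\<in>verts E. vt v \<odot>\<^bsub>N\<^esub> y) \<in> A" by (intro N.submodule_finsum[OF A finite_verts]) blast
    then show False using vt_decomposition[OF yc] y(2) by simp
  qed
  then obtain i where i: "i \<in> verts E" "vt i \<odot>\<^bsub>N\<^esub> y \<notin> A" by blast
  have nonsink: "i \<notin> sinks E" using dstepD(3)[OF y(3)] i(2) by blast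
  define z where "z = vt i \<odot>\<^bsub>N\<^esub> y"
  have z: "z \<in> B" "z \<notin> A" "z \<in> carrier N"
    using submodule_smult[OF B vt_carrier[OF i(1)] y(1)] i yc by (simp_all add: z_def N.smult_closed)
  have vz: "vt v \<odot>\<^bsub>N\<^esub> z = (if v = i then z else \<zero>\<^bsub>N\<^esub>)" if "v \<in> verts E" for v
    using that i yc N.smult_assoc[of "vt v" "vt i" y, symmetric]
    by (cases "v = i") (simp_all add: z_def vt_vt N.smult_l_zero)
  have az: "ar e \<odot>\<^bsub>N\<^esub> z \<in> A" if e: "e \<in> arcs E" for e
    using e i yc N.smult_assoc[of "ar e" "vt i" y, symmetric] dstepD(2)[OF y(3) e] submodule_zero[OF A]
    by (cases "i = tail E e") (simp_all add: z_def ar_vt N.smult_l_zero)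
  let ?s = "path_scalar (inverse_quiver E)"
  have "\<exists>a\<in>A. r \<odot>\<^bsub>N\<^esub> z = ?s (r (i, [])) \<odot>\<^bsub>N\<^esub> z \<oplus>\<^bsub>N\<^esub> a" if "r \<in> carrier \<R>" for r
    using that
  proof (induction r rule: path_algebra_induct)
    case zero
    have "?s 0 = \<zero>\<^bsub>\<R>\<^esub>" by (auto simp: path_scalar_def path_algebra_simps)
    moreover have "(\<lambda>_. 0) = \<zero>\<^bsub>\<R>\<^esub>" by (simp add: path_algebra_simps)
    ultimately show ?case
      using submodule_zero[OF A] z(3) by (intro bexI[of _ "\<zero>\<^bsub>N\<^esub>"]) (simp_all add: N.smult_l_zero)
  next
    case (add r c p)
    then obtain a where a: "a \<in> A" "r \<odot>\<^bsub>N\<^esub> z = ?s (r (i, [])) \<odot>\<^bsub>N\<^esub> z \<oplus>\<^bsub>N\<^esub> a" by blast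
    have ac: "a \<in> carrier N" using submodule_mem[OF A a(1)] .
    obtain u fs where p: "p = (u, fs)" by (cases p)
    have pc: "path_elem p \<in> carrier \<R>" "pmono c p \<in> carrier \<R>"
      using add(2) by (simp_all add: path_elem_carrier pmono_carrier)
    have pm: "pmono c p = ?s c \<otimes>\<^bsub>\<R>\<^esub> path_elem p"
      unfolding path_scalar_mult[OF pc(1)] by (auto simp: pmono_def path_elem_def)
    have "\<exists>b\<in>A. pmono c p \<odot>\<^bsub>N\<^esub> z = ?s (pmono c p (i, [])) \<odot>\<^bsub>N\<^esub> z \<oplus>\<^bsub>N\<^esub> b"
    proof (cases "p = (i, [])")
      case True
      then have "path_elem p \<odot>\<^bsub>N\<^esub> z = z" using vz[OF i(1)] by simp
      then have "pmono c p \<odot>\<^bsub>N\<^esub> z = ?s c \<odot>\<^bsub>N\<^esub> z"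
        unfolding pm using N.smult_assoc[OF rscalar_carrier pc(1) z(3)] by simp
      then show ?thesis
        using True submodule_zero[OF A] z(3) by (intro bexI[of _ "\<zero>\<^bsub>N\<^esub>"]) (simp_all add: pmono_def N.smult_closed)
    next
      case False
      then have p0: "pmono c p (i, []) = 0" by (auto simp: pmono_def)
      have s0: "?s 0 = \<zero>\<^bsub>\<R>\<^esub>" by (auto simp: path_scalar_def path_algebra_simps)
      have "path_elem p \<odot>\<^bsub>N\<^esub> z \<in> A"
      proof (cases fs rule: rev_cases)
        case Nil
        then show ?thesis using False add(2) p vz[of u] submodule_zero[OF A] by simp
      next
        case (snoc gs e)
        then have "path_elem p = path_elem (u, gs) \<otimes>\<^bsub>\<R>\<^esub> ar e" "(u, gs) \<in> bpaths" "e \<in> arcs E"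
          using add(2) p by (auto simp: path_elem_mult)
        moreover have "path_elem (u, gs) \<in> carrier \<R>" using \<open>(u, gs) \<in> bpaths\<close> by (rule path_elem_carrier)
        ultimately show ?thesis
          using z(3) submodule_smult[OF A _ az[of e]] by (simp add: N.smult_assoc)
      qed
      then have "pmono c p \<odot>\<^bsub>N\<^esub> z \<in> A"
        using pc z(3) submodule_smult[OF A rscalar_carrier] by (simp add: pm N.smult_assoc)
      then show ?thesis
        using z(3) pc by (intro bexI[of _ "pmono c p \<odot>\<^bsub>N\<^esub> z"]) (simp_all add: p0 s0 N.smult_l_zero N.smult_closed)
    qed
    then obtain b where b: "b \<in> A" "pmono c p \<odot>\<^bsub>N\<^esub> z = ?s (pmono c p (i, [])) \<odot>\<^bsub>N\<^esub> z \<oplus>\<^bsub>N\<^esub> b" by blast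
    have bc: "b \<in> carrier N" using submodule_mem[OF A b(1)] .
    have sadd: "?s (r (i, []) + pmono c p (i, [])) = ?s (r (i, [])) \<oplus>\<^bsub>\<R>\<^esub> ?s (pmono c p (i, []))"
      by (auto simp: path_scalar_def path_algebra_simps)
    have radd: "(\<lambda>q. r q + pmono c p q) = r \<oplus>\<^bsub>\<R>\<^esub> pmono c p" by (simp add: path_algebra_simps)
    have "(\<lambda>q. r q + pmono c p q) \<odot>\<^bsub>N\<^esub> z =
        ?s (r (i, []) + pmono c p (i, [])) \<odot>\<^bsub>N\<^esub> z \<oplus>\<^bsub>N\<^esub> (a \<oplus>\<^bsub>N\<^esub> b)"
      unfolding radd sadd using add(1) pc z(3) ac bc
      by (simp add: N.smult_l_distr a(2) b(2) N.smult_closed N.M.a_ac)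
    then show ?case using submodule_add[OF A a(1) b(1)] by blast
  qed note rz = this
  have kz: "r \<odot>\<^bsub>N\<^esub> z \<in> A \<longleftrightarrow> r (i, []) = 0" if r: "r \<in> carrier \<R>" for r
  proof -
    obtain a where a: "a \<in> A" "r \<odot>\<^bsub>N\<^esub> z = ?s (r (i, [])) \<odot>\<^bsub>N\<^esub> z \<oplus>\<^bsub>N\<^esub> a" using rz[OF r] by blast
    have ac: "a \<in> carrier N" using submodule_mem[OF A a(1)] .
    show ?thesis
    proof
      assume "r (i, []) = 0"
      moreover have "?s 0 = \<zero>\<^bsub>\<R>\<^esub>" by (auto simp: path_scalar_def path_algebra_simps)
      ultimately show "r \<odot>\<^bsub>N\<^esub> z \<in> A" using a ac z(3) by (simp add: N.smult_l_zero)
    next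
      assume "r \<odot>\<^bsub>N\<^esub> z \<in> A"
      then have "r \<odot>\<^bsub>N\<^esub> z \<ominus>\<^bsub>N\<^esub> a \<in> A" using submodule_minus[OF A _ a(1)] by simp
      then have sA: "?s (r (i, [])) \<odot>\<^bsub>N\<^esub> z \<in> A"
        using a(2) ac z(3) N.M.add_diff_cancel by (simp add: N.smult_closed)
      show "r (i, []) = 0"
      proof (rule ccontr)
        assume "r (i, []) \<noteq> 0"
        then have "z \<in> A"
          using scalar_inverse[of "r (i, [])" z] z(3) submodule_smult[OF A rscalar_carrier sA] by metis
        then show False using z(2) by simp
      qed
    qed
  qed
  let ?B = "N\<lparr>carrier := B\<rparr>" and ?Q = "mod_quot (N\<lparr>carrier := B\<rparr>) A"
  interpret B: left_module \<R> ?B by (rule N.submodule_left_module[OF B])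
  have AB': "submodule A \<R> ?B" using A AB by (simp add: N.submodule_restrict_iff[OF B])
  have Q: "left_module \<R> ?Q" by (rule B.mod_quot_left_module[OF AB'])
  let ?C = "corner_module i"
  have cc: "r \<in> carrier \<R>" if "r \<in> right_corner E i" for r using that i by (simp add: right_corner_iff)
  have "(\<lambda>r. r \<odot>\<^bsub>N\<^esub> z) \<in> mod_hom \<R> ?C ?B"
    by (rule mod_homI) (use cc z submodule_smult[OF B] in \<open>simp_all add: N.smult_l_distr N.smult_assoc\<close>)
  then have h: "(\<lambda>r. A +>\<^bsub>?B\<^esub> (r \<odot>\<^bsub>N\<^esub> z)) \<in> mod_hom \<R> ?C ?Q"
    by (rule mod_hom_comp[OF _ B.quot_map_hom[OF AB']])
  have surj: "(\<lambda>r. A +>\<^bsub>?B\<^esub> (r \<odot>\<^bsub>N\<^esub> z)) ` carrier ?C = carrier ?Q"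
  proof
    show "(\<lambda>r. A +>\<^bsub>?B\<^esub> (r \<odot>\<^bsub>N\<^esub> z)) ` carrier ?C \<subseteq> carrier ?Q"
      using mod_homD(1)[OF h] by (intro image_subsetI)
    have "submodule ((\<lambda>r. r \<odot>\<^bsub>N\<^esub> z) ` carrier \<R>) \<R> N"
    proof -
      have "(\<lambda>r. r \<odot>\<^bsub>N\<^esub> z) \<in> mod_hom \<R> (regular_module \<R>) N"
        by (rule mod_homI) (use z in \<open>simp_all add: N.smult_closed N.smult_l_distr N.smult_assoc\<close>)
      then interpret left_module_hom \<R> "regular_module \<R>" N "\<lambda>r. r \<odot>\<^bsub>N\<^esub> z"
        by (rule left_module_homI[OF regular_left_module[OF R.ring_axioms] N.left_module_self])
      show ?thesis using submodule_image[OF M.submodule_carrier] by simp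
    qed
    note Z = this
    \<comment> \<open>\<open>A + R z\<close> lies strictly above \<open>A\<close>, so it is
      \<open>B\<close> because \<open>B\<close> covers \<open>A\<close>.\<close>
    let ?H = "{x \<oplus>\<^bsub>N\<^esub> y | x y. x \<in> A \<and> y \<in> (\<lambda>r. r \<odot>\<^bsub>N\<^esub> z) ` carrier \<R>}"
    have H: "submodule ?H \<R> N" by (rule N.submodule_sum[OF A Z])
    have AH: "A \<subseteq> ?H"
    proof
      fix a assume a: "a \<in> A"
      then have "a = a \<oplus>\<^bsub>N\<^esub> \<zero>\<^bsub>N\<^esub>" using submodule_mem[OF A] by simp
      then show "a \<in> ?H" using a submodule_zero[OF Z] by blast
    qed
    have zH: "z \<in> ?H"
    proof -
      have "z = \<zero>\<^bsub>N\<^esub> \<oplus>\<^bsub>N\<^esub> \<one>\<^bsub>\<R>\<^esub> \<odot>\<^bsub>N\<^esub> z" using z by (simp add: N.smult_one)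
      then show ?thesis using submodule_zero[OF A] R.one_closed by blast
    qed
    have "?H \<subseteq> B" using AB submodule_add[OF B] submodule_smult[OF B _ z(1)] by blast
    then have HB: "?H = B" using N.coversD(4)[OF cov H AH] zH z(2) by blast
    show "carrier ?Q \<subseteq> (\<lambda>r. A +>\<^bsub>?B\<^esub> (r \<odot>\<^bsub>N\<^esub> z)) ` carrier ?C"
    proof
      fix c assume "c \<in> carrier ?Q"
      then obtain b where b: "b \<in> B" "c = A +>\<^bsub>?B\<^esub> b" by (auto simp: mod_quot_carrier)
      then obtain a r where ar: "a \<in> A" "r \<in> carrier \<R>" "b = a \<oplus>\<^bsub>N\<^esub> r \<odot>\<^bsub>N\<^esub> z" using HB by blast
      \<comment> \<open>As \<open>p_i z = z\<close>, passing from \<open>r\<close> to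
        \<open>r p_i\<close> moves \<open>r\<close> into the corner without changing
        \<open>r z\<close>.\<close>
      let ?r = "r \<otimes>\<^bsub>\<R>\<^esub> vt i"
      have rr: "?r \<in> right_corner E i" using ar(2) unfolding right_corner_def by blast
      have rz': "?r \<odot>\<^bsub>N\<^esub> z = r \<odot>\<^bsub>N\<^esub> z" using ar(2) i z vz by (simp add: N.smult_assoc)
      have rB: "r \<odot>\<^bsub>N\<^esub> z \<in> B" by (rule submodule_smult[OF B ar(2) z(1)])
      have aB: "a \<in> B" using ar(1) AB by blast
      have "A +>\<^bsub>?B\<^esub> b = (A +>\<^bsub>?B\<^esub> a) \<oplus>\<^bsub>?Q\<^esub> (A +>\<^bsub>?B\<^esub> (r \<odot>\<^bsub>N\<^esub> z))"
        using coset_add[OF B.M.abelian_group_axioms submodule_subgroup[OF AB'], of a "r \<odot>\<^bsub>N\<^esub> z"] aB rB ar(3)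
        by simp
      also have "A +>\<^bsub>?B\<^esub> a = \<zero>\<^bsub>?Q\<^esub>" using B.quot_map_eq_zero[OF AB', of a] aB ar(1) by simp
      also have "\<zero>\<^bsub>?Q\<^esub> \<oplus>\<^bsub>?Q\<^esub> (A +>\<^bsub>?B\<^esub> (r \<odot>\<^bsub>N\<^esub> z)) = A +>\<^bsub>?B\<^esub> (r \<odot>\<^bsub>N\<^esub> z)"
      proof -
        interpret Q: left_module \<R> ?Q by (rule Q)
        have "A +>\<^bsub>?B\<^esub> (r \<odot>\<^bsub>N\<^esub> z) \<in> carrier ?Q"
          unfolding mod_quot_carrier by (rule bexI[of _ "r \<odot>\<^bsub>N\<^esub> z"]) (use rB in simp_all)
        then show ?thesis by simp
      qed
      finally show "c \<in> (\<lambda>r. A +>\<^bsub>?B\<^esub> (r \<odot>\<^bsub>N\<^esub> z)) ` carrier ?C"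
        using b(2) rz' by (intro image_eqI[of _ _ ?r]) (simp_all add: rr)
    qed
  qed
  have ker: "{f \<in> right_corner E i. f (i, []) = 0} = {r \<in> carrier ?C. A +>\<^bsub>?B\<^esub> (r \<odot>\<^bsub>N\<^esub> z) = \<zero>\<^bsub>?Q\<^esub>}"
  proof (rule Collect_cong)
    fix r
    have "A +>\<^bsub>?B\<^esub> (r \<odot>\<^bsub>N\<^esub> z) = \<zero>\<^bsub>?Q\<^esub> \<longleftrightarrow> r (i, []) = 0" if "r \<in> right_corner E i"
      using B.quot_map_eq_zero[OF AB', of "r \<odot>\<^bsub>N\<^esub> z"] submodule_smult[OF B cc[OF that] z(1)] kz[OF cc[OF that]] by simp
    then show "(r \<in> right_corner E i \<and> r (i, []) = 0) = (r \<in> carrier ?C \<and> A +>\<^bsub>?B\<^esub> (r \<odot>\<^bsub>N\<^esub> z) = \<zero>\<^bsub>?Q\<^esub>)"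
      by auto
  qed
  have "mod_isomorphic \<R> (coker_nu E i) ?Q"
    unfolding coker_nu_eq[OF i(1)]
    by (rule first_isomorphism[OF corner_left_module[OF i(1)] Q h surj ker])
  moreover have "left_module \<R> (coker_nu E i)"
    unfolding coker_nu_eq[OF i(1)]
    by (rule left_module.mod_quot_left_module[OF corner_left_module[OF i(1)] corner_kernel_submodule[OF i(1)]])
  ultimately have "mod_isomorphic \<R> ?Q (coker_nu E i)" by (rule mod_isomorphic_sym[rotated])
  then show ?thesis using i(1) nonsink by (intro bexI[of _ i]) simp_all
qed

text \<open>If \<open>B\<close> lies in the closure of \<open>A\<close>, some element of
  \<open>B\<close> outside \<open>A\<close> lies already in \<open>dstep N A\<close>, since
  otherwise induction over the iterates gives \<open>B \<subseteq> A\<close>. Conversely, all arrows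
  and all sinks annihilate \<open>coker_nu E i\<close> for a non-sink \<open>i\<close>, so a single
  step takes \<open>B\<close> into \<open>A\<close>.\<close>

lemma coker_nu_factor:
  assumes cov: "N.covers A B"
  shows "(\<exists>i\<in>verts E - sinks E. mod_isomorphic \<R> (mod_quot (N\<lparr>carrier := B\<rparr>) A) (coker_nu E i)) \<longleftrightarrow> B \<subseteq> dcl N A"
proof
  note A = N.coversD(1)[OF cov] and B = N.coversD(2)[OF cov]
  have AB: "A \<subset> B" using N.coversD(3)[OF cov] .
  {
    assume sub: "B \<subseteq> dcl N A"
    have "\<exists>y\<in>B. y \<notin> A \<and> y \<in> dstep N A"
    proof (rule ccontr)
      assume "\<not> ?thesis"
      then have no: "y \<in> A" if "y \<in> B" "y \<in> dstep N A" for y using that by blast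
      have "(dstep N ^^ n) A \<inter> B \<subseteq> A" for n
      proof (induction n)
        case (Suc n)
        show ?case
        proof
          fix y assume "y \<in> (dstep N ^^ Suc n) A \<inter> B"
          then have y: "y \<in> dstep N ((dstep N ^^ n) A)" "y \<in> B" by simp_all
          note d = dstepD[OF y(1)]
          have "y \<in> dstep N A"
          proof (rule dstepI[OF d(1)])
            show "ar e \<odot>\<^bsub>N\<^esub> y \<in> A" if "e \<in> arcs E" for e
              using d(2)[OF that] submodule_smult[OF B ar_carrier[OF that] y(2)] Suc by blast
            show "vt v \<odot>\<^bsub>N\<^esub> y \<in> A" if "v \<in> sinks E" for v
              using d(3)[OF that] submodule_smult[OF B vt_carrier[OF sinks_verts[OF that]] y(2)] Suc by blast
          qed
          then show "y \<in> A" using no y(2) by blast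
        qed
      qed simp
      moreover have "\<exists>n. b \<in> (dstep N ^^ n) A" if "b \<in> B" for b using that sub by (auto simp: dcl_def)
      ultimately have "B \<subseteq> A" by blast
      then show False using AB by blast
    qed
    then show "\<exists>i\<in>verts E - sinks E. mod_isomorphic \<R> (mod_quot (N\<lparr>carrier := B\<rparr>) A) (coker_nu E i)"
      using simple_vertex_factor[OF cov] by blast
  next
    assume "\<exists>i\<in>verts E - sinks E. mod_isomorphic \<R> (mod_quot (N\<lparr>carrier := B\<rparr>) A) (coker_nu E i)"
    then obtain i where i: "i \<in> verts E" "i \<notin> sinks E"
      and iso: "mod_isomorphic \<R> (mod_quot (N\<lparr>carrier := B\<rparr>) A) (coker_nu E i)" by blast
    let ?B = "N\<lparr>carrier := B\<rparr>" and ?Q = "mod_quot (N\<lparr>carrier := B\<rparr>) A"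
    let ?K = "{f \<in> right_corner E i. f (i, []) = (0 :: 'k)}"
    interpret B: left_module \<R> ?B by (rule N.submodule_left_module[OF B])
    interpret C: left_module \<R> "corner_module i" by (rule corner_left_module[OF i(1)])
    have AB': "submodule A \<R> ?B" using A AB by (simp add: N.submodule_restrict_iff[OF B] psubset_imp_subset)
    have Q: "left_module \<R> ?Q" by (rule B.mod_quot_left_module[OF AB'])
    note K = corner_kernel_submodule[OF i(1)]
    obtain h where h: "h \<in> mod_hom \<R> ?Q (coker_nu E i)" and bij: "bij_betw h (carrier ?Q) (carrier (coker_nu E i))"
      using iso unfolding mod_isomorphic_def by (elim bexE)
    interpret H: left_module_hom \<R> ?Q "coker_nu E i" h
      by (rule left_module_homI[OF Q _ h]) (unfold coker_nu_eq[OF i(1)], rule C.mod_quot_left_module[OF K])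
    \<comment> \<open>The condition on \<open>a\<close> makes it annihilate
      \<open>coker_nu E i\<close>; arrows and the vertices other than \<open>i\<close> satisfy
      it.\<close>
    have key: "a \<odot>\<^bsub>N\<^esub> x \<in> A"
      if x: "x \<in> B" and a: "a \<in> carrier \<R>" and az: "\<And>f. (a \<otimes>\<^bsub>\<R>\<^esub> f) (i, []) = 0" for a x
    proof -
      have qx: "A +>\<^bsub>?B\<^esub> x \<in> carrier ?Q" unfolding mod_quot_carrier by (rule bexI[of _ x]) (use x in simp_all)
      have "h (A +>\<^bsub>?B\<^esub> x) \<in> carrier (coker_nu E i)" by (rule H.hom_closed[OF qx])
      then obtain f where f: "f \<in> right_corner E i" "h (A +>\<^bsub>?B\<^esub> x) = ?K +>\<^bsub>corner_module i\<^esub> f"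
        unfolding coker_nu_eq[OF i(1)] mod_quot_carrier by (elim bexE) simp
      have af: "a \<otimes>\<^bsub>\<R>\<^esub> f \<in> ?K"
        using C.smult_closed[OF a, of f] f(1) az by simp
      have ax: "a \<odot>\<^bsub>N\<^esub> x \<in> B" by (rule submodule_smult[OF B a x])
      have "h (A +>\<^bsub>?B\<^esub> (a \<odot>\<^bsub>N\<^esub> x)) = h (a \<odot>\<^bsub>?Q\<^esub> (A +>\<^bsub>?B\<^esub> x))"
        using B.mod_quot_smult[OF AB' a, of x] x by simp
      also have "\<dots> = a \<odot>\<^bsub>coker_nu E i\<^esub> (?K +>\<^bsub>corner_module i\<^esub> f)"
        using H.hom_smult[OF a qx] f(2) by simp
      also have "\<dots> = ?K +>\<^bsub>corner_module i\<^esub> (a \<otimes>\<^bsub>\<R>\<^esub> f)"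
        unfolding coker_nu_eq[OF i(1)] using C.mod_quot_smult[OF K a, of f] f(1) by simp
      also have "\<dots> = \<zero>\<^bsub>coker_nu E i\<^esub>"
        unfolding coker_nu_eq[OF i(1)] using C.quot_map_eq_zero[OF K, of "a \<otimes>\<^bsub>\<R>\<^esub> f"] af by simp
      finally have h0: "h (A +>\<^bsub>?B\<^esub> (a \<odot>\<^bsub>N\<^esub> x)) = \<zero>\<^bsub>coker_nu E i\<^esub>" .
      have qax: "A +>\<^bsub>?B\<^esub> (a \<odot>\<^bsub>N\<^esub> x) \<in> carrier ?Q"
        unfolding mod_quot_carrier by (rule bexI[of _ "a \<odot>\<^bsub>N\<^esub> x"]) (use ax in simp_all)
      have "inj_on h (carrier ?Q)" using bij by (simp add: bij_betw_def)
      then have "A +>\<^bsub>?B\<^esub> (a \<odot>\<^bsub>N\<^esub> x) = \<zero>\<^bsub>?Q\<^esub>" using h0 qax H.inj_on_iff_kernel by simp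
      then show ?thesis using B.quot_map_eq_zero[OF AB', of "a \<odot>\<^bsub>N\<^esub> x"] ax by simp
    qed
    have "x \<in> dstep N A" if x: "x \<in> B" for x
    proof (rule dstepI)
      show "x \<in> carrier N" by (rule submodule_mem[OF B x])
      show "ar e \<odot>\<^bsub>N\<^esub> x \<in> A" if "e \<in> arcs E" for e
        by (rule key[OF x ar_carrier[OF that]]) (simp add: mult_arrow_left)
      show "vt v \<odot>\<^bsub>N\<^esub> x \<in> A" if v: "v \<in> sinks E" for v
        using v i by (intro key[OF x vt_carrier[OF sinks_verts[OF v]]]) (auto simp: mult_vertex_left)
    qed
    then have "B \<subseteq> (dstep N ^^ 1) A" by auto
    then show "B \<subseteq> dcl N A" using dstep_iter_subset_dcl by (rule subset_trans)
  }
qed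

end

section \<open>The length of the tensor product\<close>

context scalar_extension
begin

theorem tens_length:
  assumes F: "composition_series \<R> N n F"
    and r: "card {j. j < n \<and> (\<exists>i\<in>verts E - sinks E. mod_isomorphic \<R> (comp_factor N F j) (coker_nu E i))} = r"
  shows "finite_length \<L> tens \<and> module_length \<L> tens = n - r"
proof -
  note F' = F[unfolded N.composition_series_iff]
  have cov: "N.covers (F j) (F (Suc j))" if "j < n" for j using F' that by blast
  have Fs: "submodule (F j) \<R> N" if "j \<le> n" for j using F that by (simp add: composition_series_def)
  define \<iota> where "\<iota> = ten \<one>\<^bsub>\<L>\<^esub>"
  note \<iota>_sub = TN.h.submodule_image[folded \<iota>_def]
  define G where "G j = dcl (res tens) (\<iota> ` F j)" for j
  \<comment> \<open>\<open>\<iota>\<close> need not be injective, so the images of neighbouring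
    terms may coincide. A submodule between them is compared with the series \<open>F\<close>
    through its preimage.\<close>
  have weak: "G j = G (Suc j) \<or> TM.M.covers (G j) (G (Suc j))" if j: "j < n" for j
    unfolding G_def
  proof (rule TM.dcl_cover)
    have Fj: "submodule (F j) \<R> N" "submodule (F (Suc j)) \<R> N" using Fs j by simp_all
    then show "submodule (\<iota> ` F j) \<R> (res tens)" "submodule (\<iota> ` F (Suc j)) \<R> (res tens)"
      by (simp_all add: \<iota>_sub)
    show "\<iota> ` F j \<subseteq> \<iota> ` F (Suc j)" using N.coversD(3)[OF cov[OF j]] by blast
    fix H assume H: "submodule H \<R> (res tens)" "\<iota> ` F j \<subseteq> H" "H \<subseteq> \<iota> ` F (Suc j)"
    let ?K = "{x \<in> carrier N. \<iota> x \<in> H} \<inter> F (Suc j)"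
    have K: "submodule ?K \<R> N"
      using N.submodule_Int[OF TN.h.submodule_vimage[OF H(1), folded \<iota>_def] Fj(2)] .
    have "F j \<subseteq> ?K" using H(2) N.coversD(3)[OF cov[OF j]] submodule_subset[OF Fj(1)] by blast
    then have "?K = F j \<or> ?K = F (Suc j)" using N.coversD(4)[OF cov[OF j] K] by simp
    moreover have "H \<subseteq> \<iota> ` ?K"
    proof
      fix y assume y: "y \<in> H"
      then obtain x where "x \<in> F (Suc j)" "y = \<iota> x" using H(3) by auto
      then show "y \<in> \<iota> ` ?K" using y submodule_mem[OF Fj(2)] by (intro image_eqI[of _ _ x]) auto
    qed
    ultimately show "H = \<iota> ` F j \<or> H = \<iota> ` F (Suc j)"
    proof (elim disjE)
      assume "?K = F j" "H \<subseteq> \<iota> ` ?K"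
      then have "H \<subseteq> \<iota> ` F j" by simp
      then show ?thesis using H(2) by (intro disjI1 subset_antisym)
    next
      assume "?K = F (Suc j)"
      then have "\<iota> ` F (Suc j) \<subseteq> H" by blast
      then show ?thesis using H(3) by (intro disjI2 subset_antisym)
    qed
  qed
  \<comment> \<open>From left to right this rests on the kernel of \<open>\<iota>\<close> lying in
    the closure of 0; from right to left, on closures being mapped into closures.\<close>
  have eq: "G j = G (Suc j) \<longleftrightarrow> F (Suc j) \<subseteq> dcl N (F j)" if j: "j < n" for j
  proof
    have Fj: "submodule (F j) \<R> N" "submodule (F (Suc j)) \<R> N" using Fs j by simp_all
    assume G: "G j = G (Suc j)"
    show "F (Suc j) \<subseteq> dcl N (F j)"
    proof
      fix x assume x: "x \<in> F (Suc j)"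
      then have "\<iota> x \<in> \<iota> ` F (Suc j)" by (rule imageI)
      then have "\<iota> x \<in> G (Suc j)" unfolding G_def by (rule subsetD[OF dcl_superset])
      then have "\<iota> x \<in> dcl (res tens) (\<iota> ` F j)" unfolding G[symmetric] by (simp only: G_def)
      then show "x \<in> dcl N (F j)"
        using TN.hom_dcl_reflect[OF _ Fj(1) submodule_mem[OF Fj(2) x]] ten_one_kernel by (simp add: \<iota>_def)
    qed
  next
    have Fj: "submodule (F j) \<R> N" "submodule (F (Suc j)) \<R> N" using Fs j by simp_all
    assume "F (Suc j) \<subseteq> dcl N (F j)"
    then have "\<iota> ` F (Suc j) \<subseteq> \<iota> ` dcl N (F j)" by (rule image_mono)
    also have "\<dots> \<subseteq> G j" unfolding G_def using TN.hom_dcl_image[folded \<iota>_def] .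
    finally have "G (Suc j) \<subseteq> G j"
      unfolding G_def by (intro TM.RM.dcl_minimal \<iota>_sub Fj)
    moreover have "G j \<subseteq> G (Suc j)"
      unfolding G_def using N.coversD(3)[OF cov[OF j]] by (intro dcl_mono image_mono) blast
    ultimately show "G j = G (Suc j)" by (rule subset_antisym[rotated])
  qed
  let ?m = "card {j. j < n \<and> G j \<noteq> G (Suc j)}"
  obtain G' where G': "G' 0 = G 0" "G' ?m = G n" "\<forall>j<?m. TM.M.covers (G' j) (G' (Suc j))"
    using TM.M.strict_subchain[of n G] weak by blast
  have "G 0 = {\<zero>\<^bsub>tens\<^esub>}"
  proof
    have "\<iota> ` F 0 = {\<zero>\<^bsub>tens\<^esub>}" using F' TN.h.hom_zero by (simp add: \<iota>_def)
    then show "G 0 \<subseteq> {\<zero>\<^bsub>tens\<^esub>}"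
      unfolding G_def by (intro TM.dcl_leavitt_least TM.M.submodule_trivial) simp
    show "{\<zero>\<^bsub>tens\<^esub>} \<subseteq> G 0"
      unfolding G_def \<open>\<iota> ` F 0 = {\<zero>\<^bsub>tens\<^esub>}\<close> by (rule dcl_superset)
  qed
  moreover have "G n = carrier tens" using F' tens_dcl by (simp add: G_def \<iota>_def)
  ultimately have cs: "composition_series \<L> tens ?m G'"
    unfolding TM.M.composition_series_iff using G' by simp
  have "{j. j < n \<and> (\<exists>i\<in>verts E - sinks E. mod_isomorphic \<R> (comp_factor N F j) (coker_nu E i))} =
      {j. j < n \<and> G j = G (Suc j)}"
    using coker_nu_factor[OF cov] eq unfolding comp_factor_def by (intro Collect_cong conj_cong refl) simp
  then have rG: "r = card {j. j < n \<and> G j = G (Suc j)}" using r by simp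
  have U: "{..<n} = {j. j < n \<and> G j = G (Suc j)} \<union> {j. j < n \<and> G j \<noteq> G (Suc j)}" by auto
  have "card {..<n} = card {j. j < n \<and> G j = G (Suc j)} + ?m"
    unfolding U by (rule card_Un_disjoint) auto
  then have "?m = n - r" using rG by simp
  then show ?thesis
    using cs TM.M.module_length_eq[OF cs] tens_left_module unfolding finite_length_def by auto
qed

end

section \<open>Finitely presented modules\<close>

lemma free_module_simps [simp]:
  "carrier (free_module A n) = {..<n} \<rightarrow>\<^sub>E carrier A"
  "\<zero>\<^bsub>free_module A n\<^esub> = (\<lambda>i\<in>{..<n}. \<zero>\<^bsub>A\<^esub>)"
  "x \<oplus>\<^bsub>free_module A n\<^esub> y = (\<lambda>i\<in>{..<n}. x i \<oplus>\<^bsub>A\<^esub> y i)"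
  "a \<odot>\<^bsub>free_module A n\<^esub> x = (\<lambda>i\<in>{..<n}. a \<otimes>\<^bsub>A\<^esub> x i)"
  by (simp_all add: free_module_def)

lemma free_left_module:
  assumes "ring A"
  shows "left_module A (free_module A n)"
proof -
  interpret ring A by (rule assms)
  have mem: "x i \<in> carrier A" if "x \<in> {..<n} \<rightarrow>\<^sub>E carrier A" "i < n" for x i
    using PiE_mem[OF that(1)] that(2) by simp
  have ext: "x = y" if "x \<in> extensional {..<n}" "y \<in> extensional {..<n}" "\<And>i. i < n \<Longrightarrow> x i = y i" for x y :: "nat \<Rightarrow> 'a"
    by (rule extensionalityI[OF that(1,2)]) (use that(3) in simp)
  have pe: "x \<in> extensional {..<n}" if "x \<in> {..<n} \<rightarrow>\<^sub>E carrier A" for x using that by (simp add: PiE_def)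
  show ?thesis
  proof (rule left_moduleI)
    show "abelian_group (free_module A n)"
    proof (rule abelian_groupI)
      fix x assume "x \<in> carrier (free_module A n)"
      then have x: "x \<in> {..<n} \<rightarrow>\<^sub>E carrier A" by simp
      show "\<exists>y\<in>carrier (free_module A n). y \<oplus>\<^bsub>free_module A n\<^esub> x = \<zero>\<^bsub>free_module A n\<^esub>"
        by (rule bexI[of _ "\<lambda>i\<in>{..<n}. \<ominus>\<^bsub>A\<^esub> x i"])
          (use mem[OF x] in \<open>auto simp: l_neg intro!: restrict_ext\<close>)
    next
      fix x y assume "x \<in> carrier (free_module A n)" "y \<in> carrier (free_module A n)"
      then have xy: "x \<in> {..<n} \<rightarrow>\<^sub>E carrier A" "y \<in> {..<n} \<rightarrow>\<^sub>E carrier A" by simp_all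
      show "x \<oplus>\<^bsub>free_module A n\<^esub> y \<in> carrier (free_module A n)"
        by (simp add: mem[OF xy(1)] mem[OF xy(2)])
      show "x \<oplus>\<^bsub>free_module A n\<^esub> y = y \<oplus>\<^bsub>free_module A n\<^esub> x"
        unfolding free_module_simps by (rule restrict_ext) (simp add: mem[OF xy(1)] mem[OF xy(2)] a_comm)
      fix z assume "z \<in> carrier (free_module A n)"
      then have z: "z \<in> {..<n} \<rightarrow>\<^sub>E carrier A" by simp
      show "x \<oplus>\<^bsub>free_module A n\<^esub> y \<oplus>\<^bsub>free_module A n\<^esub> z = x \<oplus>\<^bsub>free_module A n\<^esub> (y \<oplus>\<^bsub>free_module A n\<^esub> z)"
        unfolding free_module_simps
        by (rule restrict_ext) (simp add: mem[OF xy(1)] mem[OF xy(2)] mem[OF z] a_assoc)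
    next
      fix x assume "x \<in> carrier (free_module A n)"
      then have x: "x \<in> {..<n} \<rightarrow>\<^sub>E carrier A" by simp
      show "\<zero>\<^bsub>free_module A n\<^esub> \<oplus>\<^bsub>free_module A n\<^esub> x = x"
        by (rule ext[OF _ pe[OF x]]) (simp_all add: mem[OF x])
    qed simp
  next
    fix a x assume a: "a \<in> carrier A" and "x \<in> carrier (free_module A n)"
    then have x: "x \<in> {..<n} \<rightarrow>\<^sub>E carrier A" by simp
    show "a \<odot>\<^bsub>free_module A n\<^esub> x \<in> carrier (free_module A n)" by (simp add: a mem[OF x])
    fix b assume b: "b \<in> carrier A"
    show "(a \<oplus>\<^bsub>A\<^esub> b) \<odot>\<^bsub>free_module A n\<^esub> x = a \<odot>\<^bsub>free_module A n\<^esub> x \<oplus>\<^bsub>free_module A n\<^esub> b \<odot>\<^bsub>free_module A n\<^esub> x"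
      unfolding free_module_simps by (rule restrict_ext) (simp add: a b mem[OF x] l_distr)
    show "(a \<otimes>\<^bsub>A\<^esub> b) \<odot>\<^bsub>free_module A n\<^esub> x = a \<odot>\<^bsub>free_module A n\<^esub> (b \<odot>\<^bsub>free_module A n\<^esub> x)"
      unfolding free_module_simps by (rule restrict_ext) (simp add: a b mem[OF x] m_assoc)
  next
    fix x assume "x \<in> carrier (free_module A n)"
    then have x: "x \<in> {..<n} \<rightarrow>\<^sub>E carrier A" by simp
    show "\<one>\<^bsub>A\<^esub> \<odot>\<^bsub>free_module A n\<^esub> x = x" by (rule ext[OF _ pe[OF x]]) (simp_all add: mem[OF x])
  next
    fix a x y assume a: "a \<in> carrier A" and "x \<in> carrier (free_module A n)" "y \<in> carrier (free_module A n)"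
    then have xy: "x \<in> {..<n} \<rightarrow>\<^sub>E carrier A" "y \<in> {..<n} \<rightarrow>\<^sub>E carrier A" by simp_all
    show "a \<odot>\<^bsub>free_module A n\<^esub> (x \<oplus>\<^bsub>free_module A n\<^esub> y) = a \<odot>\<^bsub>free_module A n\<^esub> x \<oplus>\<^bsub>free_module A n\<^esub> a \<odot>\<^bsub>free_module A n\<^esub> y"
      unfolding free_module_simps by (rule restrict_ext) (simp add: a mem[OF xy(1)] mem[OF xy(2)] r_distr)
  qed (rule ring_axioms)
qed

lemma free_module_generated:
  assumes "ring A" and U: "submodule U A (free_module A m)"
    and basis: "\<And>i. i < m \<Longrightarrow> (\<lambda>j\<in>{..<m}. if j = i then \<one>\<^bsub>A\<^esub> else \<zero>\<^bsub>A\<^esub>) \<in> U"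
  shows "U = carrier (free_module A m)"
proof
  interpret ring A by (rule assms)
  show "U \<subseteq> carrier (free_module A m)" by (rule submodule_subset[OF U])
  show "carrier (free_module A m) \<subseteq> U"
  proof
    fix y assume "y \<in> carrier (free_module A m)"
    then have y: "y \<in> {..<m} \<rightarrow>\<^sub>E carrier A" by simp
    have mem: "y i \<in> carrier A" if "i < m" for i using PiE_mem[OF y] that by simp
    have "k \<le> m \<Longrightarrow> (\<lambda>j\<in>{..<m}. if j < k then y j else \<zero>\<^bsub>A\<^esub>) \<in> U" for k
    proof (induction k)
      case 0
      then show ?case using submodule_zero[OF U] by (simp add: restrict_def)
    next
      case (Suc k)
      let ?b = "\<lambda>j\<in>{..<m}. if j = k then \<one>\<^bsub>A\<^esub> else \<zero>\<^bsub>A\<^esub>"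
      have "(\<lambda>j\<in>{..<m}. if j < k then y j else \<zero>\<^bsub>A\<^esub>) \<oplus>\<^bsub>free_module A m\<^esub> y k \<odot>\<^bsub>free_module A m\<^esub> ?b \<in> U"
        using Suc.prems by (intro submodule_add[OF U] submodule_smult[OF U] Suc.IH basis mem) simp_all
      also have "(\<lambda>j\<in>{..<m}. if j < k then y j else \<zero>\<^bsub>A\<^esub>) \<oplus>\<^bsub>free_module A m\<^esub> y k \<odot>\<^bsub>free_module A m\<^esub> ?b =
          (\<lambda>j\<in>{..<m}. if j < Suc k then y j else \<zero>\<^bsub>A\<^esub>)"
        using Suc.prems mem by (auto simp: fun_eq_iff less_Suc_eq)
      finally show ?case .
    qed
    from this[of m] have "(\<lambda>j\<in>{..<m}. if j < m then y j else \<zero>\<^bsub>A\<^esub>) \<in> U" by simp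
    moreover have "(\<lambda>j\<in>{..<m}. if j < m then y j else \<zero>\<^bsub>A\<^esub>) = y"
      using y by (intro extensionalityI[of _ "{..<m}"]) (auto simp: PiE_def)
    ultimately show "y \<in> U" by simp
  qed
qed

section \<open>Finitely many elements that control membership in an iterated closure\<close>

context path_module
begin

text \<open>\<open>T\<close> consists of the elements of \<open>H\<close> obtained from
  \<open>x\<close> by \<open>s\<close> successive applications of arrows or sink vertices. They are
  multiples of \<open>x\<close>, so they lie in every submodule containing \<open>x\<close>. This
  serves to clear denominators: \<open>x\<close> will be a relation over \<open>L\<close>, and
  \<open>T\<close> gives finitely many relations over the path algebra.\<close>

lemma dstep_iter_finite_witness:
  assumes "x \<in> (dstep N ^^ s) H"
  shows "\<exists>T. finite T \<and> T \<subseteq> H \<and> (\<forall>V. submodule V \<R> N \<longrightarrow> x \<in> V \<longrightarrow> T \<subseteq> V) \<and>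
    (\<forall>H'. T \<subseteq> H' \<longrightarrow> x \<in> (dstep N ^^ s) H')"
  using assms
proof (induction s arbitrary: x)
  case 0
  then show ?case by (intro exI[of _ "{x}"]) auto
next
  case (Suc s)
  let ?W = "\<lambda>x T. finite T \<and> T \<subseteq> H \<and> (\<forall>V. submodule V \<R> N \<longrightarrow> x \<in> V \<longrightarrow> T \<subseteq> V) \<and>
    (\<forall>H'. T \<subseteq> H' \<longrightarrow> x \<in> (dstep N ^^ s) H')"
  have x: "x \<in> dstep N ((dstep N ^^ s) H)" using Suc.prems by simp
  note d = dstepD[OF x]
  have "\<forall>e\<in>arcs E. \<exists>T. ?W (ar e \<odot>\<^bsub>N\<^esub> x) T" by (intro ballI Suc.IH d(2))
  then obtain TA where TA: "\<forall>e\<in>arcs E. ?W (ar e \<odot>\<^bsub>N\<^esub> x) (TA e)" by (rule bchoice[THEN exE])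
  have "\<forall>v\<in>sinks E. \<exists>T. ?W (vt v \<odot>\<^bsub>N\<^esub> x) T" by (intro ballI Suc.IH d(3))
  then obtain TV where TV: "\<forall>v\<in>sinks E. ?W (vt v \<odot>\<^bsub>N\<^esub> x) (TV v)" by (rule bchoice[THEN exE])
  have A: "finite (TA e)" "TA e \<subseteq> H" "submodule V \<R> N \<Longrightarrow> ar e \<odot>\<^bsub>N\<^esub> x \<in> V \<Longrightarrow> TA e \<subseteq> V"
      "TA e \<subseteq> H' \<Longrightarrow> ar e \<odot>\<^bsub>N\<^esub> x \<in> (dstep N ^^ s) H'" if "e \<in> arcs E" for e V H'
    using TA[THEN bspec, OF that] by simp_all
  have B: "finite (TV v)" "TV v \<subseteq> H" "submodule V \<R> N \<Longrightarrow> vt v \<odot>\<^bsub>N\<^esub> x \<in> V \<Longrightarrow> TV v \<subseteq> V"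
      "TV v \<subseteq> H' \<Longrightarrow> vt v \<odot>\<^bsub>N\<^esub> x \<in> (dstep N ^^ s) H'" if "v \<in> sinks E" for v V H'
    using TV[THEN bspec, OF that] by simp_all
  let ?T = "(\<Union>e\<in>arcs E. TA e) \<union> (\<Union>v\<in>sinks E. TV v)"
  have "finite ?T" using A(1) B(1) finite_sinks by simp
  moreover have "?T \<subseteq> H" by (intro Un_least UN_least A(2) B(2))
  moreover have "?T \<subseteq> V" if V: "submodule V \<R> N" "x \<in> V" for V
    by (intro Un_least UN_least A(3) B(3) submodule_smult[OF V(1)] ar_carrier vt_carrier sinks_verts V)
  moreover have "x \<in> (dstep N ^^ Suc s) H'" if "?T \<subseteq> H'" for H'
  proof -
    have "TA e \<subseteq> H'" if "e \<in> arcs E" for e      by (rule order_trans[OF UN_upper[OF that, of TA] order_trans[OF Un_upper1 \<open>?T \<subseteq> H'\<close>]])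
    moreover have "TV v \<subseteq> H'" if "v \<in> sinks E" for v      by (rule order_trans[OF UN_upper[OF that, of TV] order_trans[OF Un_upper2 \<open>?T \<subseteq> H'\<close>]])
    ultimately have "x \<in> dstep N ((dstep N ^^ s) H')"
      by (intro dstepI[OF d(1)] A(4) B(4))
    then show ?thesis by simp
  qed
  ultimately show ?case by (intro exI[of _ ?T] conjI allI impI)
qed

end

context quiver
begin

text \<open>Arrows are put in front until the required length is reached. The only obstruction is
  that the path already starts at a sink, and then it is long anyway.\<close>

lemma long_path_exists: "u \<in> verts E \<Longrightarrow> \<exists>q. long m q \<and> pend q = u"
proof (induction m)
  case 0
  then show ?case by (intro exI[of _ "(u, [])"]) (simp add: long_def)
next
  case (Suc m)
  then obtain v fs where q: "long m (v, fs)" "pend (v, fs) = u" by auto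
  have vv: "v \<in> verts E" using q paths_start[of v fs "inverse_quiver E"] by (simp add: long_def)
  show ?case
  proof (cases "v \<in> sinks E")
    case True
    then show ?thesis using q by (intro exI[of _ "(v, fs)"]) (simp add: long_def)
  next
    case False
    then obtain e where e: "e \<in> arcs E" "tail E e = v" using vv by (auto simp: sinks_def out_arcs_def)
    then show ?thesis using q False by (intro exI[of _ "(head E e, e # fs)"]) (simp add: long_def)
  qed
qed

text \<open>For a long path \<open>q\<close> ending at \<open>u\<close>, the coefficients of
  \<open>f\<close> at paths from \<open>u\<close> reappear in \<open>q f\<close> at these paths
  prolonged by \<open>q\<close>. So a nonzero \<open>f\<close> does not act as 0 on some path beyond
  any threshold. This is the injectivity of the path algebra into \<open>L\<close>.\<close>

lemma incl_eq_zero: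
  assumes f: "f \<in> carrier \<R>" and z: "incl f = \<zero>\<^bsub>\<L>\<^esub>"
  shows "f = (\<lambda>_. 0)"
proof (rule fun_pair_eqI, rule ccontr)
  fix u fs assume nz: "f (u, fs) \<noteq> 0"
  then have "(u, fs) \<in> bpaths" using f unfolding path_algebra_carrier by blast
  then have u: "u \<in> verts E" using paths_start[of u fs "inverse_quiver E"] by simp
  have "eventually_zero (wlift f)" using z by (intro proj_zero_eventually wlift_closed f) (simp add: incl_eq)
  then obtain m where m: "\<forall>q. long m q \<longrightarrow> ract (wlift f) (path_elem q) = (\<lambda>_. 0)"
    unfolding eventually_zero_def by (elim exE)
  obtain v gs where q: "long m (v, gs)" "pend (v, gs) = u" using long_path_exists[OF u, of m] by auto
  have "path_elem (v, gs) \<in> carrier \<R>" using q by (intro path_elem_carrier) (simp add: long_def)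
  then have "path_elem (v, gs) \<otimes>\<^bsub>\<R>\<^esub> f = (\<lambda>_. 0)"
    using m[THEN spec, THEN mp, OF q(1)] by (simp add: ract_wlift[OF f])
  then have "(path_elem (v, gs) \<otimes>\<^bsub>\<R>\<^esub> f) (v, gs @ fs) = 0" by simp
  then show False using nz q(2) by (simp add: mult_path_left)
qed

subsection \<open>Free modules of finite rank over the path algebra\<close>

text \<open>
  A tuple \<open>(y\<^sub>0, \<dots>, y\<^sub>n\<^sub>-\<^sub>1)\<close> over the path algebra is encoded as the function sending \<open>(j, p)\<close> to
  the coefficient of the path \<open>p\<close> in \<open>y\<^sub>j\<close>.
\<close>

definition frmod :: "nat \<Rightarrow> ('v \<times> 'e list \<Rightarrow> 'k, nat \<times> 'v \<times> 'e list \<Rightarrow> 'k) module" where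
  "frmod n =
     \<lparr>carrier = {y. finite {x. y x \<noteq> 0} \<and> {x. y x \<noteq> 0} \<subseteq> {..<n} \<times> bpaths},
      monoid.mult = undefined, one = undefined, ring.zero = (\<lambda>_. 0), ring.add = (\<lambda>y z x. y x + z x),
      module.smult = (\<lambda>r y (j, p). (r \<otimes>\<^bsub>\<R>\<^esub> (\<lambda>q. y (j, q))) p)\<rparr>"

lemma frmod_simps:
  "\<zero>\<^bsub>frmod n\<^esub> = (\<lambda>_. 0)" "y \<oplus>\<^bsub>frmod n\<^esub> z = (\<lambda>x. y x + z x)"
  "r \<odot>\<^bsub>frmod n\<^esub> y = (\<lambda>(j, p). (r \<otimes>\<^bsub>\<R>\<^esub> (\<lambda>q. y (j, q))) p)"
  by (simp_all add: frmod_def)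

lemma frmod_carrier:
  "y \<in> carrier (frmod n) \<longleftrightarrow> finite {x. y x \<noteq> 0} \<and> (\<forall>j u fs. y (j, u, fs) \<noteq> 0 \<longrightarrow> j < n \<and> (u, fs) \<in> bpaths)"
  by (auto simp: frmod_def)

lemma frmod_component: "y \<in> carrier (frmod n) \<Longrightarrow> (\<lambda>q. y (j, q)) \<in> carrier \<R>"
proof -
  assume y: "y \<in> carrier (frmod n)"
  have "{q. y (j, q) \<noteq> 0} \<subseteq> snd ` {x. y x \<noteq> 0}" by force
  then have "finite {q. y (j, q) \<noteq> 0}" by (rule finite_subset) (use y in \<open>simp add: frmod_carrier\<close>)
  then show ?thesis using y by (auto simp: path_algebra_carrier frmod_carrier)
qed

lemma frmod_carrierI:
  assumes "\<And>j. j < n \<Longrightarrow> (\<lambda>q. y (j, q)) \<in> carrier \<R>" "\<And>j q. \<not> j < n \<Longrightarrow> y (j, q) = 0"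
  shows "y \<in> carrier (frmod n)"
proof -
  have "{x. y x \<noteq> 0} \<subseteq> (SIGMA j:{..<n}. {q. y (j, q) \<noteq> 0})" using assms(2) by force
  moreover have "finite (SIGMA j:{..<n}. {q. y (j, q) \<noteq> 0})"
    using assms(1) by (intro finite_SigmaI) (auto simp: path_algebra_carrier)
  ultimately have "finite {x. y x \<noteq> 0}" by (rule finite_subset)
  moreover have "j < n \<and> (u, fs) \<in> bpaths" if "y (j, u, fs) \<noteq> 0" for j u fs
  proof -
    have "j < n" using that assms(2) by blast
    then show ?thesis using that assms(1)[of j] unfolding path_algebra_carrier by blast
  qed
  ultimately show ?thesis unfolding frmod_carrier by blast
qed

lemma frmod_add_closed: "y \<in> carrier (frmod n) \<Longrightarrow> z \<in> carrier (frmod n) \<Longrightarrow> (\<lambda>x. y x + z x) \<in> carrier (frmod n)"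
proof -
  assume y: "y \<in> carrier (frmod n)" and z: "z \<in> carrier (frmod n)"
  have "y x \<noteq> 0 \<or> z x \<noteq> 0" if "y x + z x \<noteq> 0" for x using that by auto
  then show ?thesis using y z finite_support_add[of y z] unfolding frmod_carrier by blast
qed

lemma frmod_scale_closed: "y \<in> carrier (frmod n) \<Longrightarrow> (\<lambda>x. c * y x) \<in> carrier (frmod n)"
  unfolding frmod_carrier by (auto intro: finite_subset[of _ "{x. y x \<noteq> 0}"])

lemma frmod_diff_closed: "y \<in> carrier (frmod n) \<Longrightarrow> z \<in> carrier (frmod n) \<Longrightarrow> (\<lambda>x. y x - z x) \<in> carrier (frmod n)"
  using frmod_add_closed[of y n "\<lambda>x. (-1) * z x"] frmod_scale_closed[of z n "-1"] by simp

lemma frmod_smult_closed: "r \<in> carrier \<R> \<Longrightarrow> y \<in> carrier (frmod n) \<Longrightarrow> r \<odot>\<^bsub>frmod n\<^esub> y \<in> carrier (frmod n)"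
proof (rule frmod_carrierI)
  assume r: "r \<in> carrier \<R>" and y: "y \<in> carrier (frmod n)"
  show "(\<lambda>q. (r \<odot>\<^bsub>frmod n\<^esub> y) (j, q)) \<in> carrier \<R>" for j
    using Eb.path_mult_closed[OF r frmod_component[OF y, of j]] by (simp add: frmod_simps)
  show "(r \<odot>\<^bsub>frmod n\<^esub> y) (j, q) = 0" if "\<not> j < n" for j q
  proof -
    have "(\<lambda>q. y (j, q)) = (\<lambda>_. 0)"
    proof
      fix q show "y (j, q) = 0" using y that unfolding frmod_carrier by (cases q) blast
    qed
    then show ?thesis using R.r_null[OF r] by (simp add: frmod_simps path_algebra_simps)
  qed
qed

lemma frmod_left_module: "left_module \<R> (frmod n)"
proof (rule left_moduleI)
  show "ring \<R>" by (rule R.ring_axioms)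
  show "abelian_group (frmod n)"
  proof (rule abelian_groupI)
    fix y assume "y \<in> carrier (frmod n)"
    then show "\<exists>z\<in>carrier (frmod n). z \<oplus>\<^bsub>frmod n\<^esub> y = \<zero>\<^bsub>frmod n\<^esub>"
      using frmod_scale_closed[of y n "-1"] by (intro bexI[of _ "\<lambda>x. (-1) * y x"]) (simp_all add: frmod_simps)
  next
    show "\<zero>\<^bsub>frmod n\<^esub> \<in> carrier (frmod n)" by (simp add: frmod_simps frmod_carrier)
  qed (simp_all add: frmod_simps frmod_add_closed add_ac)
next
  fix a y assume ay: "a \<in> carrier \<R>" "y \<in> carrier (frmod n)"
  then show "a \<odot>\<^bsub>frmod n\<^esub> y \<in> carrier (frmod n)" by (rule frmod_smult_closed)
next
  fix a b y assume "a \<in> carrier \<R>" "b \<in> carrier \<R>" "y \<in> carrier (frmod n)"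
  then show "(a \<oplus>\<^bsub>\<R>\<^esub> b) \<odot>\<^bsub>frmod n\<^esub> y = a \<odot>\<^bsub>frmod n\<^esub> y \<oplus>\<^bsub>frmod n\<^esub> b \<odot>\<^bsub>frmod n\<^esub> y"
    by (auto simp: frmod_simps fun_eq_iff path_algebra_simps mult_distrib_right)
next
  fix a y z assume "a \<in> carrier \<R>" "y \<in> carrier (frmod n)" "z \<in> carrier (frmod n)"
  then show "a \<odot>\<^bsub>frmod n\<^esub> (y \<oplus>\<^bsub>frmod n\<^esub> z) = a \<odot>\<^bsub>frmod n\<^esub> y \<oplus>\<^bsub>frmod n\<^esub> a \<odot>\<^bsub>frmod n\<^esub> z"
    by (auto simp: frmod_simps fun_eq_iff mult_distrib_left)
next
  fix a b y assume "a \<in> carrier \<R>" "b \<in> carrier \<R>" "y \<in> carrier (frmod n)"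
  then show "(a \<otimes>\<^bsub>\<R>\<^esub> b) \<odot>\<^bsub>frmod n\<^esub> y = a \<odot>\<^bsub>frmod n\<^esub> (b \<odot>\<^bsub>frmod n\<^esub> y)"
    by (simp add: frmod_simps path_mult_assoc)
next
  fix y assume y: "y \<in> carrier (frmod n)"
  show "\<one>\<^bsub>\<R>\<^esub> \<odot>\<^bsub>frmod n\<^esub> y = y"
    using R.l_one[OF frmod_component[OF y]] by (auto simp: frmod_simps fun_eq_iff)
qed

sublocale Fr: path_module E K "frmod n" for n
  by (intro path_module.intro frmod_left_module quiver_axioms)

lemma frmod_minus: "y \<in> carrier (frmod n) \<Longrightarrow> z \<in> carrier (frmod n) \<Longrightarrow> y \<ominus>\<^bsub>frmod n\<^esub> z = (\<lambda>x. y x - z x)"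
  using Fr.N.add_diff_cancel[of "\<lambda>x. y x - z x" n z] frmod_diff_closed[of y n z] by (simp add: frmod_simps)

lemma frmod_vt: "(vt v \<odot>\<^bsub>frmod n\<^esub> y) (j, u, fs) = (if u = v then y (j, u, fs) else 0)"
  by (simp add: frmod_simps mult_vertex_left)

lemma frmod_ar: "(ar e \<odot>\<^bsub>frmod n\<^esub> y) (j, u, fs) =
    (if u = head E e \<and> fs \<noteq> [] \<and> hd fs = e then y (j, tail E e, tl fs) else 0)"
  by (simp add: frmod_simps mult_arrow_left)

lemma frmod_scalar: "y \<in> carrier (frmod n) \<Longrightarrow> path_scalar (inverse_quiver E) c \<odot>\<^bsub>frmod n\<^esub> y = (\<lambda>x. c * y x)"
  by (auto simp: frmod_simps fun_eq_iff path_scalar_mult[OF frmod_component])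

text \<open>A term of \<open>y\<close> starting at a non-sink survives left multiplication by some
  arrow, and one starting at a sink survives that vertex. Left multiplication by an arrow or a
  vertex causes no cancellation between terms.\<close>

lemma frmod_dstep_zero:
  assumes "y \<in> dstep (frmod n) {\<zero>\<^bsub>frmod n\<^esub>}"
  shows "y = \<zero>\<^bsub>frmod n\<^esub>"
proof (rule ccontr)
  assume "y \<noteq> \<zero>\<^bsub>frmod n\<^esub>"
  then obtain j u fs where nz: "y (j, u, fs) \<noteq> 0" by (auto simp: frmod_simps fun_eq_iff)
  note d = dstepD[OF assms]
  have "(u, fs) \<in> bpaths" using d(1) nz unfolding frmod_carrier by blast
  then have u: "u \<in> verts E" using paths_start[of u fs "inverse_quiver E"] by simp
  show False
  proof (cases "u \<in> sinks E")
    case True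
    then have "vt u \<odot>\<^bsub>frmod n\<^esub> y = (\<lambda>_. 0)" using d(3) by (simp add: frmod_simps(1))
    then have "(vt u \<odot>\<^bsub>frmod n\<^esub> y) (j, u, fs) = 0" by simp
    then show False using nz by (simp add: frmod_vt)
  next
    case False
    then obtain e where e: "e \<in> arcs E" "tail E e = u" using u by (auto simp: sinks_def out_arcs_def)
    then have "ar e \<odot>\<^bsub>frmod n\<^esub> y = (\<lambda>_. 0)" using d(2) by (simp add: frmod_simps(1))
    then have "(ar e \<odot>\<^bsub>frmod n\<^esub> y) (j, head E e, e # fs) = 0" by simp
    then show False using nz e by (simp add: frmod_ar)
  qed
qed

definition fremb :: "nat \<Rightarrow> (nat \<times> 'v \<times> 'e list \<Rightarrow> 'k) \<Rightarrow> nat \<Rightarrow> (unit \<times> ('v, 'e) lpa_gen list \<Rightarrow> 'k) set" where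
  "fremb n y = (\<lambda>j\<in>{..<n}. incl (\<lambda>q. y (j, q)))"

lemma fremb_hom: "fremb n \<in> mod_hom \<R> (frmod n) (res (free_module \<L> n))"
proof (rule mod_homI)
  fix y assume "y \<in> carrier (frmod n)"
  then show "fremb n y \<in> carrier (res (free_module \<L> n))"
    by (simp add: fremb_def incl_closed frmod_component)
next
  fix y z assume yz: "y \<in> carrier (frmod n)" "z \<in> carrier (frmod n)"
  have "incl (\<lambda>q. y (j, q) + z (j, q)) = incl (\<lambda>q. y (j, q)) \<oplus>\<^bsub>\<L>\<^esub> incl (\<lambda>q. z (j, q))" for j
    using incl_add[OF frmod_component[OF yz(1)] frmod_component[OF yz(2)]] by (simp add: path_algebra_simps)
  then show "fremb n (y \<oplus>\<^bsub>frmod n\<^esub> z) = fremb n y \<oplus>\<^bsub>res (free_module \<L> n)\<^esub> fremb n z"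
    by (auto simp: fremb_def frmod_simps intro!: restrict_ext)
next
  fix a y assume ay: "a \<in> carrier \<R>" "y \<in> carrier (frmod n)"
  have "incl (\<lambda>q. (a \<otimes>\<^bsub>\<R>\<^esub> (\<lambda>q. y (j, q))) q) = incl a \<otimes>\<^bsub>\<L>\<^esub> incl (\<lambda>q. y (j, q))" for j
    using incl_mult[OF ay(1) frmod_component[OF ay(2)]] by simp
  then show "fremb n (a \<odot>\<^bsub>frmod n\<^esub> y) = a \<odot>\<^bsub>res (free_module \<L> n)\<^esub> fremb n y"
    by (auto simp: fremb_def frmod_simps intro!: restrict_ext)
qed

lemma fremb_kernel:
  assumes y: "y \<in> carrier (frmod n)" and z: "fremb n y = \<zero>\<^bsub>free_module \<L> n\<^esub>"
  shows "y = \<zero>\<^bsub>frmod n\<^esub>"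
proof -
  have "y (j, q) = 0" for j q
  proof (cases "j < n")
    case True
    then have "incl (\<lambda>q. y (j, q)) = \<zero>\<^bsub>\<L>\<^esub>" using fun_cong[OF z, of j] by (simp add: fremb_def)
    then have "(\<lambda>q. y (j, q)) = (\<lambda>_. 0)" by (rule incl_eq_zero[OF frmod_component[OF y]])
    then show ?thesis by (rule fun_cong)
  next
    case False
    then show ?thesis using y unfolding frmod_carrier by (cases q) blast
  qed
  then show ?thesis by (auto simp: frmod_simps fun_eq_iff)
qed

end

section \<open>From a presentation over \<open>L\<close> to data over the path algebra\<close>

context leavitt_module
begin

text \<open>Arrows and sink vertices keep an element of \<open>U\<close> in \<open>U\<close> and
  finally take it into \<open>H\<close>. Hence an \<open>L\<close>-submodule is determined by its
  part in a generating submodule over the path algebra.\<close>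

lemma leavitt_submodule_from_generators:
  assumes H: "submodule H \<R> (res M)" and gen: "dcl (res M) H = carrier M" and U: "submodule U \<L> M"
  shows "U \<subseteq> dcl (res M) (U \<inter> H)"
proof -
  have UR: "submodule U \<R> (res M)" using U by (simp add: leavitt_submodule_iff)
  note UH = RM.N.submodule_Int[OF UR H]
  have "(dstep (res M) ^^ n) H \<inter> U \<subseteq> dcl (res M) (U \<inter> H)" for n
  proof (induction n)
    case 0
    then show ?case using dcl_superset[of "U \<inter> H" "res M"] by auto
  next
    case (Suc n)
    show ?case
    proof
      fix u assume "u \<in> (dstep (res M) ^^ Suc n) H \<inter> U"
      then have u: "u \<in> dstep (res M) ((dstep (res M) ^^ n) H)" "u \<in> U" by simp_all
      note d = dstepD[OF u(1)]
      have "u \<in> dstep (res M) (dcl (res M) (U \<inter> H))"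
      proof (rule dstepI[OF d(1)])
        show "ar e \<odot>\<^bsub>res M\<^esub> u \<in> dcl (res M) (U \<inter> H)" if "e \<in> arcs E" for e
          using d(2)[OF that] submodule_smult[OF UR ar_carrier[OF that] u(2)] Suc by blast
        show "vt v \<odot>\<^bsub>res M\<^esub> u \<in> dcl (res M) (U \<inter> H)" if "v \<in> sinks E" for v
          using d(3)[OF that] submodule_smult[OF UR vt_carrier[OF sinks_verts[OF that]] u(2)] Suc by blast
      qed
      then show "u \<in> dcl (res M) (U \<inter> H)" using RM.dstep_dcl[OF UH] by blast
    qed
  qed
  moreover have "\<exists>n. u \<in> (dstep (res M) ^^ n) H" if "u \<in> U" for u
    using that submodule_mem[OF U] gen[symmetric] by (auto simp: dcl_def)
  ultimately show ?thesis by blast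
qed

text \<open>The relations over \<open>L\<close> are replaced by finitely many over the path algebra.
  These describe the kernel of \<open>\<pi>\<close> only up to closure, just as \<open>M\<close> is
  only the closure of the image of \<open>\<pi>\<close>.\<close>

lemma fin_presented_data:
  assumes fp: "fin_presented \<L> M"
  shows "\<exists>n \<pi> ks. \<pi> \<in> mod_hom \<R> (frmod n) (res M) \<and> finite ks \<and> ks \<subseteq> carrier (frmod n) \<and>
     dcl (res M) (\<pi> ` carrier (frmod n)) = carrier M \<and>
     (\<forall>k\<in>ks. \<pi> k = \<zero>\<^bsub>M\<^esub>) \<and>
     (\<forall>y\<in>carrier (frmod n). \<pi> y = \<zero>\<^bsub>M\<^esub> \<longrightarrow> y \<in> dcl (frmod n) (left_module.span \<R> (frmod n) ks))"
proof -
  obtain m n f g where f: "f \<in> mod_hom \<L> (free_module \<L> m) (free_module \<L> n)"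
    and g: "g \<in> mod_hom \<L> (free_module \<L> n) M"
    and gs: "g ` carrier (free_module \<L> n) = carrier M"
    and fg: "f ` carrier (free_module \<L> m) = a_kernel (free_module \<L> n) M g"
    using fp unfolding fin_presented_def by (elim conjE exE bexE)
  let ?Lm = "free_module \<L> m" and ?Ln = "free_module \<L> n"
  have fl: "left_module \<L> (free_module \<L> k)" for k by (rule free_left_module[OF L.ring_axioms])
  interpret LN: leavitt_module E K ?Ln by (intro leavitt_module.intro fl quiver_axioms)
  interpret LM: left_module \<L> ?Lm by (rule fl)
  interpret f: left_module_hom \<L> ?Lm ?Ln f by (rule left_module_homI[OF fl fl f])
  interpret g: left_module_hom \<L> ?Ln M g by (rule left_module_homI[OF fl M.left_module_self g])
  interpret e: path_module_hom E K "frmod n" "res ?Ln" "fremb n"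
    by (intro path_module_hom.intro path_module_hom_axioms.intro Fr.path_module_axioms
        LN.RM.path_module_axioms fremb_hom)
  have ker: "x \<in> f ` carrier ?Lm \<longleftrightarrow> x \<in> carrier ?Ln \<and> g x = \<zero>\<^bsub>M\<^esub>" for x
    unfolding fg by (simp add: a_kernel_def')
  define \<pi> where "\<pi> y = g (fremb n y)" for y
  have ge: "g \<in> mod_hom \<R> (res ?Ln) (res M)"
    by (rule mod_homI) (simp_all only: restrict_scalars_simps g.hom_closed g.hom_add g.hom_smult incl_closed)
  have \<pi>: "\<pi> \<in> mod_hom \<R> (frmod n) (res M)"
    unfolding \<pi>_def[abs_def] by (rule mod_hom_comp[OF fremb_hom ge])
  interpret p: path_module_hom E K "frmod n" "res M" \<pi>
    by (intro path_module_hom.intro path_module_hom_axioms.intro Fr.path_module_axioms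
        RM.path_module_axioms \<pi>)
  let ?F = "carrier (frmod n)"
  have F: "submodule ?F \<R> (frmod n)" by (rule Fr.N.submodule_carrier)
  have basis: "(\<lambda>j\<in>{..<n}. if j = i then \<one>\<^bsub>\<L>\<^esub> else \<zero>\<^bsub>\<L>\<^esub>) \<in> fremb n ` ?F" if i: "i < n" for i
  proof -
    let ?y = "\<lambda>(j, q). if j = i then \<one>\<^bsub>\<R>\<^esub> q else 0"
    have yF: "?y \<in> ?F"
    proof (rule frmod_carrierI)
      show "(\<lambda>q. ?y (j, q)) \<in> carrier \<R>" for j
        using R.one_closed R.zero_closed by (cases "j = i") (simp_all add: path_algebra_simps)
    qed (use i in auto)
    have "incl (\<lambda>q. ?y (j, q)) = (if j = i then \<one>\<^bsub>\<L>\<^esub> else \<zero>\<^bsub>\<L>\<^esub>)" for j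
      using ring_hom_one[OF incl_hom] incl_zero by (cases "j = i") simp_all
    then have fy: "fremb n ?y = (\<lambda>j\<in>{..<n}. if j = i then \<one>\<^bsub>\<L>\<^esub> else \<zero>\<^bsub>\<L>\<^esub>)"
      by (simp add: fremb_def)
    show ?thesis unfolding fy[symmetric] by (rule imageI[OF yF])
  qed
  have eF: "submodule (fremb n ` ?F) \<R> (res ?Ln)" by (rule e.h.submodule_image[OF F])
  have genL: "U = carrier ?Ln" if U: "submodule U \<L> ?Ln" "fremb n ` ?F \<subseteq> U" for U
    by (rule free_module_generated[OF L.ring_axioms U(1)]) (use U(2) basis in blast)
  have dL: "dcl (res ?Ln) (fremb n ` ?F) = carrier ?Ln"
    by (rule genL[OF LN.dcl_leavitt_submodule[OF eF] dcl_superset])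
  have gen: "dcl (res M) (\<pi> ` ?F) = carrier M"
  proof
    note pF = p.h.submodule_image[OF F]
    note S = dcl_leavitt_submodule[OF pF]
    show "dcl (res M) (\<pi> ` ?F) \<subseteq> carrier M" by (rule submodule_subset[OF S])
    have "fremb n ` ?F \<subseteq> {x \<in> carrier ?Ln. g x \<in> dcl (res M) (\<pi> ` ?F)}"
      using submodule_mem[OF eF] dcl_superset[of "\<pi> ` ?F" "res M"] by (auto simp: \<pi>_def)
    then have "{x \<in> carrier ?Ln. g x \<in> dcl (res M) (\<pi> ` ?F)} = carrier ?Ln"
      by (rule genL[OF g.submodule_vimage[OF S]])
    then have "g ` carrier ?Ln \<subseteq> dcl (res M) (\<pi> ` ?F)" by blast
    then show "carrier M \<subseteq> dcl (res M) (\<pi> ` ?F)" unfolding gs .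
  qed
  define b where "b i = (\<lambda>j\<in>{..<m}. if j = i then \<one>\<^bsub>\<L>\<^esub> else \<zero>\<^bsub>\<L>\<^esub>)" for i
  have bc: "b i \<in> carrier ?Lm" for i by (simp add: b_def)
  let ?V = "f ` carrier ?Lm"
  have V: "submodule ?V \<R> (res ?Ln)"
    using f.submodule_image[OF LM.submodule_carrier] by (simp only: LN.leavitt_submodule_iff)
  \<comment> \<open>The denominators of the relation \<open>f (b i)\<close> are cleared:
    \<open>T\<close> consists of multiples of it that come from the free module over the path
    algebra. They are again relations, and they recover \<open>f (b i)\<close> by closure.\<close>
  have "\<exists>T. finite T \<and> T \<subseteq> fremb n ` ?F \<and> T \<subseteq> ?V \<and> (\<forall>H. T \<subseteq> H \<longrightarrow> f (b i) \<in> dcl (res ?Ln) H)" for i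
  proof -
    have "f (b i) \<in> dcl (res ?Ln) (fremb n ` ?F)" unfolding dL by (rule f.hom_closed[OF bc])
    then obtain s where s: "f (b i) \<in> (dstep (res ?Ln) ^^ s) (fremb n ` ?F)"
      unfolding dcl_def by (elim UN_E)
    have fV: "f (b i) \<in> ?V" by (rule imageI[OF bc])
    from LN.RM.dstep_iter_finite_witness[OF s] obtain T where T: "finite T" "T \<subseteq> fremb n ` ?F"
        "\<forall>V. submodule V \<R> (res ?Ln) \<longrightarrow> f (b i) \<in> V \<longrightarrow> T \<subseteq> V"
        "\<forall>H. T \<subseteq> H \<longrightarrow> f (b i) \<in> (dstep (res ?Ln) ^^ s) H"
      by (elim exE conjE)
    have "f (b i) \<in> dcl (res ?Ln) H" if "T \<subseteq> H" for H
      using T(4)[THEN spec, THEN mp, OF that] dstep_iter_subset_dcl by (rule rev_subsetD)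
    then show ?thesis using T(1,2) T(3)[THEN spec, THEN mp, THEN mp, OF V fV] by (intro exI[of _ T] conjI allI impI)
  qed
  then have "\<forall>i. \<exists>T. finite T \<and> T \<subseteq> fremb n ` ?F \<and> T \<subseteq> ?V \<and> (\<forall>H. T \<subseteq> H \<longrightarrow> f (b i) \<in> dcl (res ?Ln) H)"
    by (rule allI)
  then obtain T where TT: "\<forall>i. finite (T i) \<and> T i \<subseteq> fremb n ` ?F \<and> T i \<subseteq> ?V \<and>
      (\<forall>H. T i \<subseteq> H \<longrightarrow> f (b i) \<in> dcl (res ?Ln) H)"
    by (rule choice[THEN exE])
  note T = TT[THEN spec, THEN conjunct1] TT[THEN spec, THEN conjunct2, THEN conjunct1]
    TT[THEN spec, THEN conjunct2, THEN conjunct2, THEN conjunct1]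
    TT[THEN spec, THEN conjunct2, THEN conjunct2, THEN conjunct2, THEN spec, THEN mp]
  have "finite (\<Union>i<m. T i)" by (rule finite_UN_I[OF finite_lessThan T(1)])
  moreover have "(\<Union>i<m. T i) \<subseteq> fremb n ` ?F" by (rule UN_least[OF T(2)])
  ultimately obtain ks where ks: "ks \<subseteq> ?F" "finite ks" "(\<Union>i<m. T i) = fremb n ` ks"
    by (rule finite_subset_image[THEN exE]) (elim conjE, assumption)
  let ?K = "left_module.span \<R> (frmod n) ks"
  have K: "submodule ?K \<R> (frmod n)" by (rule Fr.N.submodule_span[OF ks(1)])
  have ksK: "ks \<subseteq> ?K" by (rule Fr.N.span_superset)
  have "\<pi> k = \<zero>\<^bsub>M\<^esub>" if "k \<in> ks" for k
  proof -
    have "fremb n k \<in> (\<Union>i<m. T i)" unfolding ks(3) using that by (rule imageI)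
    then have "fremb n k \<in> ?V" using T(3) by blast
    then show ?thesis unfolding ker \<pi>_def by simp
  qed
  moreover have "y \<in> dcl (frmod n) ?K" if y: "y \<in> ?F" "\<pi> y = \<zero>\<^bsub>M\<^esub>" for y
  proof -
    \<comment> \<open>\<open>?D\<close> is an \<open>L\<close>-submodule containing the images of
      the basis vectors under \<open>f\<close>, so it contains all relations over
      \<open>L\<close>.\<close>
    let ?D = "dcl (res ?Ln) (fremb n ` ?K)"
    have D: "submodule ?D \<L> ?Ln" by (rule LN.dcl_leavitt_submodule[OF e.h.submodule_image[OF K]])
    have "f (b i) \<in> ?D" if "i < m" for i
    proof (rule T(4))
      have "T i \<subseteq> fremb n ` ks" using ks(3) that by blast
      then show "T i \<subseteq> fremb n ` ?K" using ksK by blast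
    qed
    then have all: "{x \<in> carrier ?Lm. f x \<in> ?D} = carrier ?Lm"
      using bc by (intro free_module_generated[OF L.ring_axioms f.submodule_vimage[OF D]]) (simp add: b_def)
    have "fremb n y \<in> ?V"
      unfolding ker using y(2) e.h.hom_closed[OF y(1)] by (simp add: \<pi>_def)
    then obtain x where x: "x \<in> carrier ?Lm" "fremb n y = f x" by (rule imageE)
    have "x \<in> {x \<in> carrier ?Lm. f x \<in> ?D}" unfolding all by (rule x(1))
    then have "fremb n y \<in> ?D" unfolding x(2) by simp
    moreover have "x \<in> dcl (frmod n) {\<zero>\<^bsub>frmod n\<^esub>}"
      if "x \<in> ?F" "fremb n x = \<zero>\<^bsub>res ?Ln\<^esub>" for x
      using fremb_kernel[of x n] that dcl_superset[of "{\<zero>\<^bsub>frmod n\<^esub>}" "frmod n"] by simp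
    ultimately show ?thesis using e.hom_dcl_reflect[OF _ K y(1)] by simp
  qed
  ultimately show ?thesis
    using \<pi> ks(1,2) gen by (intro exI[of _ n] exI[of _ \<pi>] exI[of _ ks] conjI ballI impI)
qed

end

lemma (in left_module) submodule_cyclic:
  assumes x: "x \<in> carrier M"
  shows "submodule {a \<odot>\<^bsub>M\<^esub> x | a. a \<in> carrier R} R M"
proof (rule submoduleI)
  show "{a \<odot>\<^bsub>M\<^esub> x | a. a \<in> carrier R} \<subseteq> carrier M" using smult_closed[OF _ x] by auto
  show "\<zero>\<^bsub>M\<^esub> \<in> {a \<odot>\<^bsub>M\<^esub> x | a. a \<in> carrier R}"
    using smult_l_zero[OF x] by (intro CollectI exI[of _ "\<zero>\<^bsub>R\<^esub>"]) simp
next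
  fix y z assume "y \<in> {a \<odot>\<^bsub>M\<^esub> x | a. a \<in> carrier R}" "z \<in> {a \<odot>\<^bsub>M\<^esub> x | a. a \<in> carrier R}"
  then obtain a b where "a \<in> carrier R" "b \<in> carrier R" "y = a \<odot>\<^bsub>M\<^esub> x" "z = b \<odot>\<^bsub>M\<^esub> x" by auto
  then show "y \<oplus>\<^bsub>M\<^esub> z \<in> {a \<odot>\<^bsub>M\<^esub> x | a. a \<in> carrier R}"
    using smult_l_distr[OF _ _ x, of a b] by (intro CollectI exI[of _ "a \<oplus>\<^bsub>R\<^esub> b"]) simp
next
  fix b y assume b: "b \<in> carrier R" and "y \<in> {a \<odot>\<^bsub>M\<^esub> x | a. a \<in> carrier R}"
  then obtain a where "a \<in> carrier R" "y = a \<odot>\<^bsub>M\<^esub> x" by auto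
  then show "b \<odot>\<^bsub>M\<^esub> y \<in> {a \<odot>\<^bsub>M\<^esub> x | a. a \<in> carrier R}"
    using smult_assoc[OF b _ x, of a] b by (intro CollectI exI[of _ "b \<otimes>\<^bsub>R\<^esub> a"]) simp
qed

lemma submodule_equalizer:
  assumes g: "left_module_hom R M N g" and h: "left_module_hom R M N h"
  shows "submodule {x \<in> carrier M. g x = h x} R M"
proof -
  interpret g: left_module_hom R M N g by (rule g)
  interpret h: left_module_hom R M N h by (rule h)
  show ?thesis
    by (rule g.M.submoduleI) (auto simp: g.hom_zero h.hom_zero g.hom_add h.hom_add g.hom_smult h.hom_smult
        intro: g.M.smult_closed)
qed

lemma path_mult_zero_right: "f \<otimes>\<^bsub>path_algebra G\<^esub> (\<lambda>_. 0) = (\<lambda>_. 0)"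
  by (auto simp: fun_eq_iff path_algebra_mult)

text \<open>Congruence modulo terms of degree below \<open>m\<close>.\<close>

definition agree :: "nat \<Rightarrow> (nat \<times> 'v \<times> 'e list \<Rightarrow> 'k) \<Rightarrow> (nat \<times> 'v \<times> 'e list \<Rightarrow> 'k) \<Rightarrow> bool" where
  "agree m y z \<longleftrightarrow> (\<forall>j u fs. m \<le> length fs \<longrightarrow> y (j, u, fs) = z (j, u, fs))"

lemma agreeD: "agree m y z \<Longrightarrow> m \<le> length fs \<Longrightarrow> y (j, u, fs) = z (j, u, fs)"
  by (simp add: agree_def)

lemma agreeI: "(\<And>j u fs. m \<le> length fs \<Longrightarrow> y (j, u, fs) = z (j, u, fs)) \<Longrightarrow> agree m y z"
  by (simp add: agree_def)

lemma finite_support_restrict: "finite {x. y x \<noteq> 0} \<Longrightarrow> finite {x. (if P x then y x else 0) \<noteq> 0}"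
  by (rule finite_subset[of _ "{x. y x \<noteq> 0}"]) auto

section \<open>Monomials and degrees in free modules over the path algebra\<close>

context quiver
begin

lemma pmono_frmod: "j < n \<Longrightarrow> (u, fs) \<in> bpaths \<Longrightarrow> pmono c (j, u, fs) \<in> carrier (frmod n)"
  unfolding frmod_carrier pmono_def
  by (intro conjI finite_subset[of "{x. (if x = (j, u, fs) then c else 0) \<noteq> 0}" "{(j, u, fs)}"])
    (auto split: if_splits)

lemma frmod_supportD: "y \<in> carrier (frmod n) \<Longrightarrow> y (j, u, fs) \<noteq> 0 \<Longrightarrow> j < n"
    "y \<in> carrier (frmod n) \<Longrightarrow> y (j, u, fs) \<noteq> 0 \<Longrightarrow> (u, fs) \<in> bpaths"
  unfolding frmod_carrier by blast+

lemma frmod_restrict: "y \<in> carrier (frmod n) \<Longrightarrow> (\<lambda>x. if P x then y x else 0) \<in> carrier (frmod n)"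
proof -
  assume y: "y \<in> carrier (frmod n)"
  then have "finite {x. (if P x then y x else 0) \<noteq> 0}"
    unfolding frmod_carrier by (intro finite_support_restrict) (elim conjE)
  moreover have "j < n \<and> (u, fs) \<in> bpaths" if "(if P (j, u, fs) then y (j, u, fs) else 0) \<noteq> 0" for j u fs
  proof -
    have "y (j, u, fs) \<noteq> 0" using that by (simp split: if_splits)
    then show ?thesis using frmod_supportD[OF y] by simp
  qed
  ultimately show ?thesis unfolding frmod_carrier by simp
qed

lemma frmod_uminus: "y \<in> carrier (frmod n) \<Longrightarrow> \<ominus>\<^bsub>frmod n\<^esub> y = (\<lambda>x. - y x)"
  using frmod_scale_closed[of y n "-1"]
  by (intro Fr.N.minus_equality) (simp_all add: frmod_simps)

lemma frmod_path_pmono: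
  "path_elem (u, fs) \<odot>\<^bsub>frmod n\<^esub> pmono c (j, v, gs) =
    (if pend (u, fs) = v then pmono c (j, u, fs @ gs) else (\<lambda>_. 0))"
proof
  fix x :: "nat \<times> 'v \<times> 'e list"
  obtain i q where x: "x = (i, q)" by (cases x) auto
  have "(\<lambda>q. pmono c (j, v, gs) (i, q)) = (if i = j then pmono c (v, gs) else (\<lambda>_. 0))"
    by (auto simp: pmono_def fun_eq_iff)
  then show "(path_elem (u, fs) \<odot>\<^bsub>frmod n\<^esub> pmono c (j, v, gs)) x =
      (if pend (u, fs) = v then pmono c (j, u, fs @ gs) else (\<lambda>_. 0)) x"
    unfolding x frmod_simps path_elem_pmono
    by (cases "i = j") (auto simp: pmono_mult path_mult_zero_right, auto simp: pmono_def)
qed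

lemma frmod_smult_pmono:
  "(r \<odot>\<^bsub>frmod n\<^esub> pmono 1 (j, w, ts)) (i, u, gs @ ts) = (if i = j \<and> pend (u, gs) = w then r (u, gs) else 0)"
proof -
  have "(\<lambda>q. pmono 1 (j, w, ts) (i, q) :: 'k) = (if i = j then pmono 1 (w, ts) else (\<lambda>_. 0))"
    by (auto simp: pmono_def fun_eq_iff)
  then have "(r \<odot>\<^bsub>frmod n\<^esub> pmono 1 (j, w, ts)) (i, u, gs @ ts) =
      (r \<otimes>\<^bsub>\<R>\<^esub> (if i = j then pmono 1 (w, ts) else (\<lambda>_. 0))) (u, gs @ ts)"
    by (simp add: frmod_simps(3))
  then show ?thesis
    by (cases "i = j") (simp_all add: mult_pmono_right path_mult_zero_right)
qed

lemma frmod_support_mem: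
  assumes U: "submodule U \<R> (frmod n)" and y: "y \<in> carrier (frmod n)"
    and mono: "\<And>j u fs. y (j, u, fs) \<noteq> 0 \<Longrightarrow> pmono 1 (j, u, fs) \<in> U"
  shows "y \<in> U"
proof -
  show ?thesis
  proof (rule finite_support_induct[where f = y and S = "{x. pmono 1 x \<in> U}" and P = "\<lambda>y. y \<in> U"])
    show "finite {x. y x \<noteq> 0}" using y unfolding frmod_carrier by (elim conjE)
    show "x \<in> {x. pmono 1 x \<in> U}" if "y x \<noteq> 0" for x using that mono by (cases x) auto
    show "(\<lambda>_. 0) \<in> U" using submodule_zero[OF U] by (simp add: frmod_simps)
  next
    fix f c p assume "p \<in> {x. pmono 1 x \<in> U}" and f: "f \<in> U"
    then have p: "pmono 1 p \<in> U" by simp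
    have "path_scalar (inverse_quiver E) c \<odot>\<^bsub>frmod n\<^esub> pmono 1 p = pmono c p"
      unfolding frmod_scalar[OF submodule_mem[OF U p]] by (auto simp: pmono_def)
    then have "pmono c p \<in> U" using submodule_smult[OF U rscalar_carrier p, of c] by simp
    then show "(\<lambda>q. f q + pmono c p q) \<in> U" using submodule_add[OF U f] by (simp add: frmod_simps)
  qed
qed

definition monomials :: "nat \<Rightarrow> nat \<Rightarrow> (nat \<times> 'v \<times> 'e list) set" where
  "monomials n m = {(j, u, fs). j < n \<and> (u, fs) \<in> bpaths \<and> length fs < m}"

lemma finite_monomials: "finite (monomials n m)"
proof (rule finite_subset)
  show "monomials n m \<subseteq> {..<n} \<times> verts E \<times> {fs. set fs \<subseteq> arcs E \<and> length fs \<le> m}"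
    by (auto simp: monomials_def paths_iff inverse_quiver_def)
  show "finite ({..<n} \<times> verts E \<times> {fs. set fs \<subseteq> arcs E \<and> length fs \<le> m})"
    by (intro finite_cartesian_product finite_lists_length_le) simp_all
qed

text \<open>Left division by the arrow: terms beginning with \<open>e\<close> lose it, all others
  are dropped. The maps for all \<open>e\<close> together determine the terms of positive
  degree.\<close>

definition delta :: "'e \<Rightarrow> (nat \<times> 'v \<times> 'e list \<Rightarrow> 'k) \<Rightarrow> nat \<times> 'v \<times> 'e list \<Rightarrow> 'k" where
  "delta e y = (\<lambda>(j, u, fs). if u = tail E e then y (j, head E e, e # fs) else 0)"

lemma delta_app: "delta e y (j, u, fs) = (if u = tail E e then y (j, head E e, e # fs) else 0)"
  by (simp add: delta_def)

lemma delta_add: "delta e (x \<oplus>\<^bsub>frmod n\<^esub> y) q = delta e x q + delta e y q"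
  by (cases q) (simp add: delta_app frmod_simps)

lemma delta_closed:
  assumes y: "y \<in> carrier (frmod n)"
  shows "delta e y \<in> carrier (frmod n)"
proof -
  have "{x. delta e y x \<noteq> 0} \<subseteq> (\<lambda>(j, u, fs). (j, tail E e, tl fs)) ` {x. y x \<noteq> 0}"
  proof
    fix x assume "x \<in> {x. delta e y x \<noteq> 0}"
    moreover obtain j u fs where x: "x = (j, u, fs)" by (cases x) auto
    ultimately have "u = tail E e" "y (j, head E e, e # fs) \<noteq> 0" by (auto simp: delta_app split: if_splits)
    then show "x \<in> (\<lambda>(j, u, fs). (j, tail E e, tl fs)) ` {x. y x \<noteq> 0}"
      unfolding x by (intro image_eqI[of _ _ "(j, head E e, e # fs)"]) auto
  qed
  then have "finite {x. delta e y x \<noteq> 0}"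
    by (rule finite_subset) (use y in \<open>simp add: frmod_carrier\<close>)
  moreover have "j < n \<and> (u, fs) \<in> bpaths" if "delta e y (j, u, fs) \<noteq> 0" for j u fs
  proof -
    have nz: "y (j, head E e, e # fs) \<noteq> 0" "u = tail E e" using that by (simp_all add: delta_app split: if_splits)
    then show ?thesis using frmod_supportD[OF y nz(1)] by simp
  qed
  ultimately show ?thesis unfolding frmod_carrier by simp
qed

end

text \<open>\<open>\<pi>\<close> and \<open>ks\<close> are the data of
  \<open>fin_presented_data\<close>, and \<open>d\<close> bounds the degrees of the relations. As
  \<open>d\<close> is positive, a path of length \<open>d\<close> has a first arrow, from which its
  starting vertex is read off; this is why monomials of degree \<open>d\<close> are coded below by
  their arrows alone.\<close>

locale presented_module = leavitt_module E K M
  for E :: "('v, 'e) pre_digraph" and K :: "'k::field itself"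
    and M :: "((unit \<times> ('v, 'e) lpa_gen list \<Rightarrow> 'k) set, 'm) module" +
  fixes n :: nat and \<pi> :: "(nat \<times> 'v \<times> 'e list \<Rightarrow> 'k) \<Rightarrow> 'm"
    and ks :: "(nat \<times> 'v \<times> 'e list \<Rightarrow> 'k) set" and d :: nat
  assumes pi: "\<pi> \<in> mod_hom \<R> (frmod n) (res M)"
    and generated: "dcl (res M) (\<pi> ` carrier (frmod n)) = carrier M"
    and ks: "ks \<subseteq> carrier (frmod n)"
    and pi_ks: "\<And>k. k \<in> ks \<Longrightarrow> \<pi> k = \<zero>\<^bsub>M\<^esub>"
    and kernel: "\<And>y. y \<in> carrier (frmod n) \<Longrightarrow> \<pi> y = \<zero>\<^bsub>M\<^esub> \<Longrightarrow>
      y \<in> dcl (frmod n) (left_module.span \<R> (frmod n) ks)"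
    and d_pos: "0 < d"
    and ks_degree: "\<And>k j u fs. k \<in> ks \<Longrightarrow> k (j, u, fs) \<noteq> 0 \<Longrightarrow> length fs \<le> d"
begin

abbreviation "Fn \<equiv> frmod n"
abbreviation "K0 \<equiv> left_module.span \<R> (frmod n) ks"

sublocale pi: path_module_hom E K "frmod n" "res M" \<pi>
  by (intro path_module_hom.intro path_module_hom_axioms.intro Fr.path_module_axioms RM.path_module_axioms pi)

lemma K0: "submodule K0 \<R> Fn" by (rule Fr.N.submodule_span[OF ks])

lemma pi_K0: "k \<in> K0 \<Longrightarrow> \<pi> k = \<zero>\<^bsub>M\<^esub>"
proof -
  have "K0 \<subseteq> {y \<in> carrier Fn. \<pi> y = \<zero>\<^bsub>res M\<^esub>}"
    using ks pi_ks by (intro Fr.N.span_minimal pi.h.submodule_kernel) auto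
  then show "k \<in> K0 \<Longrightarrow> \<pi> k = \<zero>\<^bsub>M\<^esub>" by auto
qed

text \<open>
  Up to degrees below \<open>d\<close>, the submodule \<open>K0\<close> is stable under left division by an arrow, since the
  generators have degree at most \<open>d\<close>.
\<close>

lemma delta_K0:
  assumes y: "y \<in> K0" and e: "e \<in> arcs E"
  shows "\<exists>k\<in>K0. agree d (delta e y) k"
proof -
  define S where "S = {y \<in> K0. \<forall>e\<in>arcs E. \<exists>k\<in>K0. agree d (delta e y) k}"
  have SI: "y \<in> S" if "y \<in> K0" "\<And>e. e \<in> arcs E \<Longrightarrow> \<exists>k\<in>K0. agree d (delta e y) k" for y
    using that by (simp add: S_def)
  have SD: "y \<in> K0" "e \<in> arcs E \<Longrightarrow> \<exists>k\<in>K0. agree d (delta e y) k" if "y \<in> S" for y e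
    using that by (simp_all add: S_def)
  have z: "(\<lambda>_. 0) \<in> K0" using submodule_zero[OF K0] by (simp add: frmod_simps)
  have S: "submodule S \<R> Fn"
  proof (rule Fr.path_submoduleI)
    show "S \<subseteq> carrier Fn" using SD(1) submodule_mem[OF K0] by blast
    show "\<zero>\<^bsub>Fn\<^esub> \<in> S"
    proof (rule SI[OF submodule_zero[OF K0]])
      show "\<exists>k\<in>K0. agree d (delta e \<zero>\<^bsub>Fn\<^esub>) k" for e
        by (rule bexI[OF _ z]) (simp add: agree_def delta_app frmod_simps)
    qed
  next
    fix x y assume xy: "x \<in> S" "y \<in> S"
    show "x \<oplus>\<^bsub>Fn\<^esub> y \<in> S"
    proof (rule SI[OF submodule_add[OF K0 SD(1)[OF xy(1)] SD(1)[OF xy(2)]]])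
      fix e assume e: "e \<in> arcs E"
      obtain k where k: "k \<in> K0" "agree d (delta e x) k" using SD(2)[OF xy(1) e] by (rule bexE)
      obtain k' where k': "k' \<in> K0" "agree d (delta e y) k'" using SD(2)[OF xy(2) e] by (rule bexE)
      show "\<exists>k\<in>K0. agree d (delta e (x \<oplus>\<^bsub>Fn\<^esub> y)) k"
        by (rule bexI[OF _ submodule_add[OF K0 k(1) k'(1)]])
          (rule agreeI, simp only: delta_add agreeD[OF k(2)] agreeD[OF k'(2)], simp add: frmod_simps)
    qed
  next
    fix c x assume x: "x \<in> S"
    note xc = submodule_mem[OF K0 SD(1)[OF x]]
    show "path_scalar (inverse_quiver E) c \<odot>\<^bsub>Fn\<^esub> x \<in> S"
    proof (rule SI[OF submodule_smult[OF K0 rscalar_carrier SD(1)[OF x]]])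
      fix e assume e: "e \<in> arcs E"
      obtain k where k: "k \<in> K0" "agree d (delta e x) k" using SD(2)[OF x e] by (rule bexE)
      show "\<exists>k\<in>K0. agree d (delta e (path_scalar (inverse_quiver E) c \<odot>\<^bsub>Fn\<^esub> x)) k"
        by (rule bexI[OF _ submodule_smult[OF K0 rscalar_carrier[of c] k(1)]])
          (rule agreeI, simp add: frmod_scalar[OF xc] frmod_scalar[OF submodule_mem[OF K0 k(1)]]
            agreeD[OF k(2), symmetric] delta_app)
    qed
  next
    fix v x assume v: "v \<in> verts E" and x: "x \<in> S"
    show "vt v \<odot>\<^bsub>Fn\<^esub> x \<in> S"
    proof (rule SI[OF submodule_smult[OF K0 vt_carrier[OF v] SD(1)[OF x]]])
      fix e assume e: "e \<in> arcs E"
      obtain k where k: "k \<in> K0" "agree d (delta e x) k" using SD(2)[OF x e] by (rule bexE)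
      show "\<exists>k\<in>K0. agree d (delta e (vt v \<odot>\<^bsub>Fn\<^esub> x)) k"
      proof (cases "head E e = v")
        case True
        then have "delta e (vt v \<odot>\<^bsub>Fn\<^esub> x) = delta e x" by (auto simp: delta_def frmod_vt fun_eq_iff)
        then show ?thesis using k by (intro bexI[OF _ k(1)]) simp
      next
        case False
        then show ?thesis by (intro bexI[OF _ z]) (simp add: agree_def delta_app frmod_vt)
      qed
    qed
  next
    fix f x assume f: "f \<in> arcs E" and x: "x \<in> S"
    show "ar f \<odot>\<^bsub>Fn\<^esub> x \<in> S"
    proof (rule SI[OF submodule_smult[OF K0 ar_carrier[OF f] SD(1)[OF x]]])
      fix e assume e: "e \<in> arcs E"
      show "\<exists>k\<in>K0. agree d (delta e (ar f \<odot>\<^bsub>Fn\<^esub> x)) k"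
      \<comment> \<open>Dividing a multiple by the arrow that was just multiplied gives a vertex
        times \<open>x\<close>, which lies in \<open>K0\<close> exactly; dividing by another arrow
        gives 0.\<close>
      proof (cases "e = f")
        case True
        have "delta e (ar f \<odot>\<^bsub>Fn\<^esub> x) = vt (tail E e) \<odot>\<^bsub>Fn\<^esub> x"
          using True by (auto simp: delta_def frmod_vt frmod_ar fun_eq_iff)
        moreover have "vt (tail E e) \<odot>\<^bsub>Fn\<^esub> x \<in> K0"
          by (rule submodule_smult[OF K0 vt_carrier[OF tail_in_verts[OF e]] SD(1)[OF x]])
        ultimately show ?thesis by (intro bexI[of _ "vt (tail E e) \<odot>\<^bsub>Fn\<^esub> x"]) (simp_all add: agree_def)
      next
        case False
        then show ?thesis by (intro bexI[OF _ z]) (simp add: agree_def delta_app frmod_ar)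
      qed
    qed
  qed
  have "ks \<subseteq> S"
  proof
    fix k assume k: "k \<in> ks"
    show "k \<in> S"
    proof (rule SI)
      show "k \<in> K0" using Fr.N.span_superset k by (rule subsetD)
      \<comment> \<open>Division lowers the degree of a generator below \<open>d\<close>, where
        \<open>agree d\<close> no longer looks.\<close>
      have "k (j, u, e # fs) = 0" if "d \<le> length fs" for j u e fs
        using ks_degree[OF k, of j u "e # fs"] that by (cases "k (j, u, e # fs) = 0") simp_all
      then show "\<exists>k'\<in>K0. agree d (delta e k) k'" for e
        by (intro bexI[OF _ z]) (simp add: agree_def delta_app)
    qed
  qed
  then have "K0 \<subseteq> S" by (rule Fr.N.span_minimal[OF S])
  then show ?thesis using SD(2) y e by blast
qed

definition tops :: "(nat \<times> 'e list) set" where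
  "tops = {(j, fs). j < n \<and> (head E (hd fs), fs) \<in> bpaths \<and> length fs = d}"

text \<open>\<open>y\<close> runs over the linear combinations of the monomials in \<open>C\<close>;
  a function with support in degree \<open>d\<close> and in \<open>C\<close> takes the place of an
  indexed sum.\<close>

definition independent :: "(nat \<times> 'e list) set \<Rightarrow> bool" where
  "independent C \<longleftrightarrow> (\<forall>y\<in>carrier Fn. (\<forall>j u fs. y (j, u, fs) \<noteq> 0 \<longrightarrow> length fs = d \<and> (j, fs) \<in> C) \<longrightarrow>
     (\<exists>k\<in>K0. agree d y k) \<longrightarrow> y = (\<lambda>_. 0))"

text \<open>
  The pairs in \<open>CC\<close> stand for the monomials of a maximal set in degree \<open>d\<close> that is independent
  modulo \<open>K0\<close> and lower degrees; \<open>QQ\<close> is the free submodule which these monomials generate. It meets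
  \<open>K0\<close> trivially, and \<open>QQ + K0\<close> has finite codimension.
\<close>

definition "CC = (SOME C. C \<subseteq> tops \<and> independent C \<and> (\<forall>C'. C' \<subseteq> tops \<longrightarrow> independent C' \<longrightarrow> C \<subseteq> C' \<longrightarrow> C = C'))"

lemma bpaths_hd: "(u, fs) \<in> bpaths \<Longrightarrow> fs \<noteq> [] \<Longrightarrow> u = head E (hd fs)"
  by (cases fs) simp_all

lemma finite_tops: "finite tops"
proof (rule finite_subset)
  show "tops \<subseteq> (\<lambda>(j, u, fs). (j, fs)) ` monomials n (Suc d)"
    by (auto simp: tops_def monomials_def image_iff)
qed (simp add: finite_monomials)

lemma CC: "CC \<subseteq> tops" "independent CC"
    "C' \<subseteq> tops \<Longrightarrow> independent C' \<Longrightarrow> CC \<subseteq> C' \<Longrightarrow> CC = C'"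
proof -
  let ?A = "{C. C \<subseteq> tops \<and> independent C}"
  have "finite ?A" by (rule finite_subset[of _ "Pow tops"]) (use finite_tops in auto)
  moreover have "{} \<in> ?A" by (auto simp: independent_def fun_eq_iff)
  then have "?A \<noteq> {}" by blast
  ultimately have "\<exists>C\<in>?A. \<forall>C'\<in>?A. C \<le> C' \<longrightarrow> C = C'" by (rule finite_has_maximal)
  then obtain C where C: "C \<in> ?A" "\<forall>C'\<in>?A. C \<le> C' \<longrightarrow> C = C'" by (rule bexE)
  have "C = C'" if "C' \<subseteq> tops" "independent C'" "C \<subseteq> C'" for C'
    by (rule C(2)[THEN bspec, THEN mp]) (use that in simp_all)
  then have "\<exists>C. C \<subseteq> tops \<and> independent C \<and> (\<forall>C'. C' \<subseteq> tops \<longrightarrow> independent C' \<longrightarrow> C \<subseteq> C' \<longrightarrow> C = C')"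
    using C(1) by (intro exI[of _ C]) simp
  from someI_ex[OF this, folded CC_def]
  show "CC \<subseteq> tops" "independent CC" "C' \<subseteq> tops \<Longrightarrow> independent C' \<Longrightarrow> CC \<subseteq> C' \<Longrightarrow> CC = C'"
    by simp_all
qed

lemma finite_CC: "finite CC" by (rule finite_subset[OF CC(1) finite_tops])

text \<open>Membership is read off from the support: a path of length at least \<open>d\<close> has
  exactly one final segment of length \<open>d\<close>. This uniqueness is what makes the monomials
  in \<open>CC\<close> free generators, up to their starting vertices.\<close>

definition QQ where
  "QQ = {y \<in> carrier Fn. \<forall>j u fs. y (j, u, fs) \<noteq> 0 \<longrightarrow> d \<le> length fs \<and> (j, drop (length fs - d) fs) \<in> CC}"

lemma QQ_carrier: "y \<in> QQ \<Longrightarrow> y \<in> carrier Fn" by (simp add: QQ_def)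

lemma QQD: "y \<in> QQ \<Longrightarrow> y (j, u, fs) \<noteq> 0 \<Longrightarrow> d \<le> length fs"
    "y \<in> QQ \<Longrightarrow> y (j, u, fs) \<noteq> 0 \<Longrightarrow> (j, drop (length fs - d) fs) \<in> CC"
  unfolding QQ_def by blast+

lemma QQI:
  "y \<in> carrier Fn \<Longrightarrow> (\<And>j u fs. y (j, u, fs) \<noteq> 0 \<Longrightarrow> d \<le> length fs \<and> (j, drop (length fs - d) fs) \<in> CC) \<Longrightarrow> y \<in> QQ"
  unfolding QQ_def by blast

lemma QQ: "submodule QQ \<R> Fn"
proof (rule Fr.path_submoduleI)
  show "QQ \<subseteq> carrier Fn" using QQ_carrier by blast
  show "\<zero>\<^bsub>Fn\<^esub> \<in> QQ" by (rule QQI) (simp_all add: frmod_simps(1) del: Fr.N.M.zero_closed, simp add: frmod_carrier)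
next
  fix x y assume xy: "x \<in> QQ" "y \<in> QQ"
  show "x \<oplus>\<^bsub>Fn\<^esub> y \<in> QQ"
  proof (rule QQI)
    show "x \<oplus>\<^bsub>Fn\<^esub> y \<in> carrier Fn" using xy by (intro Fr.N.a_closed QQ_carrier)
    fix j u fs assume "(x \<oplus>\<^bsub>Fn\<^esub> y) (j, u, fs) \<noteq> 0"
    then have "x (j, u, fs) \<noteq> 0 \<or> y (j, u, fs) \<noteq> 0" by (auto simp: frmod_simps)
    then show "d \<le> length fs \<and> (j, drop (length fs - d) fs) \<in> CC"
      using QQD[OF xy(1)] QQD[OF xy(2)] by blast
  qed
next
  fix c x assume x: "x \<in> QQ"
  show "path_scalar (inverse_quiver E) c \<odot>\<^bsub>Fn\<^esub> x \<in> QQ"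
  proof (rule QQI)
    show "path_scalar (inverse_quiver E) c \<odot>\<^bsub>Fn\<^esub> x \<in> carrier Fn"
      using x by (intro Fr.N.smult_closed QQ_carrier rscalar_carrier)
    fix j u fs assume "(path_scalar (inverse_quiver E) c \<odot>\<^bsub>Fn\<^esub> x) (j, u, fs) \<noteq> 0"
    then have "x (j, u, fs) \<noteq> 0" by (auto simp: frmod_scalar[OF QQ_carrier[OF x]])
    then show "d \<le> length fs \<and> (j, drop (length fs - d) fs) \<in> CC" using QQD[OF x] by blast
  qed
next
  fix v x assume v: "v \<in> verts E" and x: "x \<in> QQ"
  show "vt v \<odot>\<^bsub>Fn\<^esub> x \<in> QQ"
  proof (rule QQI)
    show "vt v \<odot>\<^bsub>Fn\<^esub> x \<in> carrier Fn" using x v by (intro Fr.N.smult_closed QQ_carrier vt_carrier)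
    fix j u fs assume "(vt v \<odot>\<^bsub>Fn\<^esub> x) (j, u, fs) \<noteq> 0"
    then have "x (j, u, fs) \<noteq> 0" by (simp add: frmod_vt split: if_splits)
    then show "d \<le> length fs \<and> (j, drop (length fs - d) fs) \<in> CC" using QQD[OF x] by blast
  qed
next
  fix f x assume f: "f \<in> arcs E" and x: "x \<in> QQ"
  show "ar f \<odot>\<^bsub>Fn\<^esub> x \<in> QQ"
  proof (rule QQI)
    show "ar f \<odot>\<^bsub>Fn\<^esub> x \<in> carrier Fn" using x f by (intro Fr.N.smult_closed QQ_carrier ar_carrier)
    fix j u fs assume "(ar f \<odot>\<^bsub>Fn\<^esub> x) (j, u, fs) \<noteq> 0"
    then have nz: "x (j, tail E f, tl fs) \<noteq> 0" "fs \<noteq> []" by (simp_all add: frmod_ar split: if_splits)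
    then obtain g gs where fs: "fs = g # gs" by (cases fs) auto
    show "d \<le> length fs \<and> (j, drop (length fs - d) fs) \<in> CC"
      using QQD[OF x nz(1)] unfolding fs by (simp add: Suc_diff_le)
  qed
qed

text \<open>The exchange argument: if \<open>(j, fs)\<close> is not in \<open>CC\<close>, maximality
  yields a dependence relation, and it can be solved for this monomial.\<close>

lemma tops_decomposition:
  assumes x: "(j, fs) \<in> tops"
  shows "\<exists>q\<in>QQ. \<exists>k\<in>K0. agree d (pmono 1 (j, head E (hd fs), fs)) (\<lambda>x. q x + k x)"
proof (cases "(j, fs) \<in> CC")
  case True
  have p: "j < n" "(head E (hd fs), fs) \<in> bpaths" "length fs = d" using x by (simp_all add: tops_def)
  have "pmono 1 (j, head E (hd fs), fs) \<in> QQ"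
    by (rule QQI[OF pmono_frmod[OF p(1,2)]]) (use True p(3) in \<open>auto simp: pmono_def split: if_splits\<close>)
  then show ?thesis
    by (rule bexI[rotated], intro bexI[OF _ submodule_zero[OF K0]]) (simp add: agree_def frmod_simps)
next
  case False
  let ?C = "insert (j, fs) CC" and ?x = "(j, head E (hd fs), fs)"
  have "?C \<subseteq> tops" using x CC(1) by simp
  then have "\<not> independent ?C" using CC(3)[of ?C] False by blast
  then obtain y k where y: "y \<in> carrier Fn" "\<And>j' u' fs'. y (j', u', fs') \<noteq> 0 \<Longrightarrow> length fs' = d \<and> (j', fs') \<in> ?C"
      and k: "k \<in> K0" "agree d y k" and nz: "y \<noteq> (\<lambda>_. 0)"
    unfolding independent_def by blast
  have hd_eq: "u' = head E (hd fs)" if "y (j, u', fs) \<noteq> 0" for u'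
    using bpaths_hd[OF frmod_supportD(2)[OF y(1) that]] y(2)[OF that] d_pos by auto
  define c where "c = y ?x"
  \<comment> \<open>A relation without the new monomial would contradict the independence of
    \<open>CC\<close>.\<close>
  have c: "c \<noteq> 0"
  proof
    assume c0: "c = 0"
    have "length fs' = d \<and> (j', fs') \<in> CC" if nz': "y (j', u', fs') \<noteq> 0" for j' u' fs'
    proof -
      have "(j', fs') \<noteq> (j, fs)" using nz' hd_eq[of u'] c0 by (auto simp: c_def)
      then show ?thesis using y(2)[OF nz'] by blast
    qed
    then show False using CC(2)[unfolded independent_def, THEN bspec, OF y(1)] k nz by blast
  qed
  define z where "z = (\<lambda>x. - inverse c * (if x \<noteq> ?x then y x else 0))"
  have "z \<in> carrier Fn" unfolding z_def by (intro frmod_scale_closed frmod_restrict y(1))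
  then have zQ: "z \<in> QQ"
  proof (rule QQI)
    fix j' u' fs' assume "z (j', u', fs') \<noteq> 0"
    then have nz': "(j', u', fs') \<noteq> ?x" "y (j', u', fs') \<noteq> 0" by (auto simp: z_def split: if_splits)
    have "(j', fs') \<noteq> (j, fs)" using nz' hd_eq[of u'] by auto
    then show "d \<le> length fs' \<and> (j', drop (length fs' - d) fs') \<in> CC"
      using y(2)[OF nz'(2)] by auto
  qed
  let ?k = "path_scalar (inverse_quiver E) (inverse c) \<odot>\<^bsub>Fn\<^esub> k"
  have kK: "?k \<in> K0" by (rule submodule_smult[OF K0 rscalar_carrier k(1)])
  have "agree d (pmono 1 ?x) (\<lambda>x. z x + ?k x)"
    using k(2) c by (auto simp: agree_def frmod_scalar[OF submodule_mem[OF K0 k(1)]] z_def pmono_def c_def)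
  then show ?thesis using zQ kK by blast
qed

text \<open>The sum of \<open>QQ\<close>, \<open>K0\<close> and the terms of degree below
  \<open>d\<close> is stable under arrows: an arrow raises the low terms to degree at most
  \<open>d\<close>, where the monomials decompose by \<open>tops_decomposition\<close>. Being a
  submodule that contains the monomials of degree 0, it is the whole free module.\<close>

lemma decomposition:
  assumes "y \<in> carrier Fn"
  shows "\<exists>q\<in>QQ. \<exists>k\<in>K0. agree d y (\<lambda>x. q x + k x)"
proof -
  define S where "S = {y \<in> carrier Fn. \<exists>q\<in>QQ. \<exists>k\<in>K0. agree d y (\<lambda>x. q x + k x)}"
  have SI: "y \<in> S" if "y \<in> carrier Fn" "q \<in> QQ" "k \<in> K0" "agree d y (\<lambda>x. q x + k x)" for y q k
    unfolding S_def using that by blast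
  have SE: "\<exists>q k. y \<in> carrier Fn \<and> q \<in> QQ \<and> k \<in> K0 \<and> agree d y (\<lambda>x. q x + k x)" if "y \<in> S" for y
    using that unfolding S_def by blast
  have low: "y \<in> S" if "y \<in> carrier Fn" "\<And>j u fs. y (j, u, fs) \<noteq> 0 \<Longrightarrow> length fs < d" for y
  proof (rule SI[OF that(1) submodule_zero[OF QQ] submodule_zero[OF K0]])
    have "y (j, u, fs) = 0" if "d \<le> length fs" for j u fs
      using \<open>\<And>j u fs. y (j, u, fs) \<noteq> 0 \<Longrightarrow> length fs < d\<close>[of j u fs] that by (cases "y (j, u, fs) = 0") simp_all
    then show "agree d y (\<lambda>x. \<zero>\<^bsub>Fn\<^esub> x + \<zero>\<^bsub>Fn\<^esub> x)" by (simp add: agree_def frmod_simps)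
  qed
  have add: "(\<lambda>x. y x + z x) \<in> S" if yz: "y \<in> S" "z \<in> S" for y z
  proof -
    obtain q k where y: "y \<in> carrier Fn" "q \<in> QQ" "k \<in> K0" "agree d y (\<lambda>x. q x + k x)"
      using SE[OF yz(1)] by (elim exE conjE)
    obtain q' k' where z: "z \<in> carrier Fn" "q' \<in> QQ" "k' \<in> K0" "agree d z (\<lambda>x. q' x + k' x)"
      using SE[OF yz(2)] by (elim exE conjE)
    show ?thesis
      by (rule SI[OF frmod_add_closed[OF y(1) z(1)] submodule_add[OF QQ y(2) z(2)] submodule_add[OF K0 y(3) z(3)]])
        (use y(4) z(4) in \<open>simp add: agree_def frmod_simps add_ac\<close>)
  qed
  have scale: "(\<lambda>x. c * y x) \<in> S" if y: "y \<in> S" for y c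
  proof -
    obtain q k where y: "y \<in> carrier Fn" "q \<in> QQ" "k \<in> K0" "agree d y (\<lambda>x. q x + k x)"
      using SE[OF y] by (elim exE conjE)
    show ?thesis
      by (rule SI[OF frmod_scale_closed[OF y(1)] submodule_smult[OF QQ rscalar_carrier[of c] y(2)]
            submodule_smult[OF K0 rscalar_carrier[of c] y(3)]])
        (use y(4) in \<open>simp add: agree_def frmod_scalar[OF QQ_carrier[OF y(2)]]
          frmod_scalar[OF submodule_mem[OF K0 y(3)]] distrib_left\<close>)
  qed
  have mono: "pmono 1 (j, u, fs) \<in> S" if "j < n" "(u, fs) \<in> bpaths" "length fs \<le> d" for j u fs
  proof (cases "length fs = d")
    case True
    then have u: "u = head E (hd fs)" using bpaths_hd[OF that(2)] d_pos by auto
    then have "(j, fs) \<in> tops" using that True by (simp add: tops_def)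
    then show ?thesis using pmono_frmod[OF that(1,2)] tops_decomposition unfolding S_def u by blast
  next
    case False
    then show ?thesis using that by (intro low pmono_frmod) (auto simp: pmono_def split: if_splits)
  qed
  have low': "y \<in> S" if y: "y \<in> carrier Fn" "\<And>j u fs. y (j, u, fs) \<noteq> 0 \<Longrightarrow> length fs \<le> d" for y
  proof -
    show ?thesis
    proof (rule finite_support_induct[where f = y and S = "{x. pmono 1 x \<in> S}" and P = "\<lambda>y. y \<in> S"])
      show "finite {x. y x \<noteq> 0}" using y(1) unfolding frmod_carrier by (elim conjE)
      show "x \<in> {x. pmono 1 x \<in> S}" if "y x \<noteq> 0" for x
      proof -
        obtain j u fs where x: "x = (j, u, fs)" by (cases x) auto
        show ?thesis using that mono frmod_supportD[OF y(1)] y(2) unfolding x by simp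
      qed
      show "(\<lambda>_. 0) \<in> S" by (rule low) (simp_all add: frmod_carrier)
    next
      fix f c p assume "p \<in> {x. pmono 1 x \<in> S}" and f: "f \<in> S"
      then have "(\<lambda>x. c * pmono 1 p x) \<in> S" by (intro scale) simp
      moreover have "(\<lambda>x. c * pmono 1 p x) = pmono c p" by (auto simp: pmono_def)
      ultimately have "pmono c p \<in> S" by simp
      then show "(\<lambda>q. f q + pmono c p q) \<in> S" by (rule add[OF f])
    qed
  qed
  have S: "submodule S \<R> Fn"
  proof (rule Fr.path_submoduleI)
    show "S \<subseteq> carrier Fn" unfolding S_def by blast
    show "\<zero>\<^bsub>Fn\<^esub> \<in> S" unfolding frmod_simps by (rule low) (simp_all add: frmod_carrier)
    show "x \<oplus>\<^bsub>Fn\<^esub> y \<in> S" if "x \<in> S" "y \<in> S" for x y unfolding frmod_simps by (rule add[OF that])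
    show "path_scalar (inverse_quiver E) c \<odot>\<^bsub>Fn\<^esub> x \<in> S" if "x \<in> S" for c x
    proof -
      have "x \<in> carrier Fn" using that unfolding S_def by blast
      then show ?thesis using scale[OF that] by (simp add: frmod_scalar)
    qed
    show "vt v \<odot>\<^bsub>Fn\<^esub> x \<in> S" if v: "v \<in> verts E" and x: "x \<in> S" for v x
    proof -
      obtain q k where y: "x \<in> carrier Fn" "q \<in> QQ" "k \<in> K0" "agree d x (\<lambda>x. q x + k x)"
        using SE[OF x] by (elim exE conjE)
      show ?thesis
        by (rule SI[OF Fr.N.smult_closed[OF vt_carrier[OF v] y(1)] submodule_smult[OF QQ vt_carrier[OF v] y(2)]
              submodule_smult[OF K0 vt_carrier[OF v] y(3)]])
          (use y(4) in \<open>simp add: agree_def frmod_vt\<close>)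
    qed
    show "ar f \<odot>\<^bsub>Fn\<^esub> x \<in> S" if f: "f \<in> arcs E" and x: "x \<in> S" for f x
    proof -
      obtain q k where y: "x \<in> carrier Fn" "q \<in> QQ" "k \<in> K0" "agree d x (\<lambda>x. q x + k x)"
        using SE[OF x] by (elim exE conjE)
      note kc = submodule_mem[OF K0 y(3)] and fc = ar_carrier[OF f]
      let ?r = "\<lambda>x'. x x' - (q x' + k x')"
      have r: "?r \<in> carrier Fn" by (intro frmod_diff_closed frmod_add_closed y(1) QQ_carrier[OF y(2)] kc)
      have 1: "ar f \<odot>\<^bsub>Fn\<^esub> ?r \<in> S"
      proof (rule low'[OF Fr.N.smult_closed[OF fc r]])
        fix j u fs assume "(ar f \<odot>\<^bsub>Fn\<^esub> ?r) (j, u, fs) \<noteq> 0"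
        then have "x (j, tail E f, tl fs) \<noteq> q (j, tail E f, tl fs) + k (j, tail E f, tl fs)"
          by (auto simp: frmod_ar split: if_splits)
        then have "\<not> d \<le> length (tl fs)" using agreeD[OF y(4), of "tl fs" j "tail E f"] by blast
        then show "length fs \<le> d" by (cases fs) auto
      qed
      have 2: "ar f \<odot>\<^bsub>Fn\<^esub> q \<in> S"
        by (rule SI[OF Fr.N.smult_closed[OF fc QQ_carrier[OF y(2)]] submodule_smult[OF QQ fc y(2)] submodule_zero[OF K0]])
          (simp add: agree_def frmod_simps(1))
      have 3: "ar f \<odot>\<^bsub>Fn\<^esub> k \<in> S"
        by (rule SI[OF Fr.N.smult_closed[OF fc kc] submodule_zero[OF QQ] submodule_smult[OF K0 fc y(3)]])
          (simp add: agree_def frmod_simps(1))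
      have "(\<lambda>x'. (ar f \<odot>\<^bsub>Fn\<^esub> ?r) x' + ((ar f \<odot>\<^bsub>Fn\<^esub> q) x' + (ar f \<odot>\<^bsub>Fn\<^esub> k) x')) \<in> S" by (intro add 1 2 3)
      also have "(\<lambda>x'. (ar f \<odot>\<^bsub>Fn\<^esub> ?r) x' + ((ar f \<odot>\<^bsub>Fn\<^esub> q) x' + (ar f \<odot>\<^bsub>Fn\<^esub> k) x')) = ar f \<odot>\<^bsub>Fn\<^esub> x"
        by (auto simp: fun_eq_iff frmod_ar)
      finally show ?thesis .
    qed
  qed
  have "y \<in> S"
  proof (rule frmod_support_mem[OF S assms])
    fix j u fs assume nz: "y (j, u, fs) \<noteq> 0"
    note p = frmod_supportD[OF assms nz]
    have "pend (u, fs) \<in> verts E" using Eb.path_end_in_verts[OF p(2)] by simp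
    then have "pmono 1 (j, pend (u, fs), []) \<in> S" using p(1) by (intro mono) simp_all
    then have "path_elem (u, fs) \<odot>\<^bsub>Fn\<^esub> pmono 1 (j, pend (u, fs), []) \<in> S"
      by (rule submodule_smult[OF S path_elem_carrier[OF p(2)]])
    then show "pmono 1 (j, u, fs) \<in> S" by (simp add: frmod_path_pmono)
  qed
  then show ?thesis unfolding S_def by blast
qed

text \<open>Dividing by each arrow lowers \<open>m\<close> by one and replaces \<open>k\<close> by
  another element of \<open>K0\<close>, up to degrees below \<open>d\<close>; at
  \<open>m = 0\<close> the claim is the independence of \<open>CC\<close>. In positive degree
  \<open>y\<close> vanishes if all its quotients do.\<close>

lemma QQ_homogeneous:
  assumes "y \<in> QQ" "\<And>j u fs. y (j, u, fs) \<noteq> 0 \<Longrightarrow> length fs = d + m" "k \<in> K0" "agree (d + m) y k"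
  shows "y = (\<lambda>_. 0)"
  using assms
proof (induction m arbitrary: y k)
  case 0
  have "length fs = d \<and> (j, fs) \<in> CC" if "y (j, u, fs) \<noteq> 0" for j u fs
    using QQD[OF 0(1) that] 0(2)[OF that] by simp
  then show ?case using CC(2)[unfolded independent_def, THEN bspec, OF QQ_carrier[OF 0(1)]] 0(3,4) by simp blast
next
  case (Suc m)
  have dz: "delta e y = (\<lambda>_. 0)" if e: "e \<in> arcs E" for e
  proof -
    obtain k' where k': "k' \<in> K0" "agree d (delta e k) k'" using delta_K0[OF Suc.prems(3) e] by (rule bexE)
    show ?thesis
    proof (rule Suc.IH[OF _ _ k'(1)])
      have nz: "y (j, head E e, e # fs) \<noteq> 0" "length fs = d + m" if "delta e y (j, u, fs) \<noteq> 0" for j u fs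
      proof -
        show a: "y (j, head E e, e # fs) \<noteq> 0" using that by (simp add: delta_app split: if_splits)
        show "length fs = d + m" using Suc.prems(2)[OF a] by simp
      qed
      show "delta e y \<in> QQ"
      proof (rule QQI[OF delta_closed[OF QQ_carrier[OF Suc.prems(1)]]])
        fix j u fs assume "delta e y (j, u, fs) \<noteq> 0"
        note a = nz[OF this]
        show "d \<le> length fs \<and> (j, drop (length fs - d) fs) \<in> CC"
          using QQD(2)[OF Suc.prems(1) a(1)] a(2) by simp
      qed
      show "length fs = d + m" if "delta e y (j, u, fs) \<noteq> 0" for j u fs by (rule nz(2)[OF that])
      show "agree (d + m) (delta e y) k'"
      proof (rule agreeI)
        fix j u and fs :: "'e list" assume l: "d + m \<le> length fs"
        have "delta e y (j, u, fs) = delta e k (j, u, fs)"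
          using agreeD[OF Suc.prems(4), of "e # fs"] l by (simp add: delta_app)
        also have "\<dots> = k' (j, u, fs)" using agreeD[OF k'(2)] l by simp
        finally show "delta e y (j, u, fs) = k' (j, u, fs)" .
      qed
    qed
  qed
  show ?case
  proof (rule ext, rule ccontr)
    fix x assume nz: "y x \<noteq> 0"
    obtain j u fs where x: "x = (j, u, fs)" by (cases x) auto
    obtain e gs where fs: "fs = e # gs" using Suc.prems(2) nz unfolding x by (cases fs) force+
    have "(u, e # gs) \<in> bpaths"
      by (rule frmod_supportD(2)[OF QQ_carrier[OF Suc.prems(1)] nz[unfolded x fs]])
    then have "e \<in> arcs E" "u = head E e" by simp_all
    then show False using fun_cong[OF dz, of e "(j, tail E e, gs)"] nz unfolding x fs by (simp add: delta_app)
  qed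
qed

text \<open>The component of highest degree lies in \<open>QQ\<close> as well, and it agrees with
  \<open>y\<close> from that degree on, so the homogeneous case applies with \<open>y\<close> as the
  element of \<open>K0\<close>.\<close>

lemma QQ_K0:
  assumes y: "y \<in> QQ" "y \<in> K0"
  shows "y = (\<lambda>_. 0)"
proof (rule ccontr)
  assume "y \<noteq> (\<lambda>_. 0)"
  then have ne: "{x. y x \<noteq> 0} \<noteq> {}" by auto
  have fin: "finite {x. y x \<noteq> 0}" using QQ_carrier[OF y(1)] unfolding frmod_carrier by (elim conjE)
  let ?L = "(\<lambda>(j, u, fs). length fs) ` {x. y x \<noteq> 0}"
  define t where "t = Max ?L"
  have "t \<in> ?L" unfolding t_def using ne fin by (intro Max_in) simp_all
  then obtain j u fs where x: "y (j, u, fs) \<noteq> 0" "length fs = t" by auto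
  have le: "length fs' \<le> t" if "y (j', u', fs') \<noteq> 0" for j' u' fs'
    unfolding t_def using fin that by (intro Max_ge) (auto simp: image_iff)
  have dt: "d \<le> t" using QQD(1)[OF y(1) x(1)] x(2) by simp
  define z where "z = (\<lambda>x. if length (snd (snd x)) = t then y x else 0)"
  have "z \<in> QQ"
    unfolding z_def by (rule QQI[OF frmod_restrict[OF QQ_carrier[OF y(1)]]]) (use QQD[OF y(1)] in \<open>auto split: if_splits\<close>)
  moreover have "length fs' = d + (t - d)" if "z (j', u', fs') \<noteq> 0" for j' u' fs'
    using that dt by (simp add: z_def split: if_splits)
  moreover have "z (j', u', fs') = y (j', u', fs')" if "t \<le> length fs'" for j' u' fs'
    using that le[of j' u' fs'] by (auto simp: z_def)
  then have "agree (d + (t - d)) z y" using dt by (simp add: agree_def)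
  ultimately have "z = (\<lambda>_. 0)" using y(2) by (intro QQ_homogeneous[of z "t - d" y]) simp_all
  from fun_cong[OF this, of "(j, u, fs)"] show False using x by (simp add: z_def)
qed

text \<open>Arrows and sink vertices keep \<open>y\<close> in \<open>QQ\<close> and lower the number
  of iterations, so by induction they annihilate \<open>y\<close>; in a free module over the path
  algebra only 0 is annihilated by all of them.\<close>

lemma QQ_dcl_K0:
  assumes "y \<in> QQ" "y \<in> dcl Fn K0"
  shows "y = (\<lambda>_. 0)"
proof -
  have "y \<in> (dstep Fn ^^ m) K0 \<Longrightarrow> y \<in> QQ \<Longrightarrow> y = (\<lambda>_. 0)" for m y
  proof (induction m arbitrary: y)
    case 0
    then show ?case using QQ_K0 by simp
  next
    case (Suc m)
    then have y: "y \<in> dstep Fn ((dstep Fn ^^ m) K0)" by simp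
    note d = dstepD[OF y]
    have "y \<in> dstep Fn {\<zero>\<^bsub>Fn\<^esub>}"
    proof (rule dstepI[OF d(1)])
      show "ar e \<odot>\<^bsub>Fn\<^esub> y \<in> {\<zero>\<^bsub>Fn\<^esub>}" if "e \<in> arcs E" for e
        using Suc.IH[OF d(2)[OF that] submodule_smult[OF QQ ar_carrier[OF that] Suc.prems(2)]]
        by (simp add: frmod_simps(1))
      show "vt v \<odot>\<^bsub>Fn\<^esub> y \<in> {\<zero>\<^bsub>Fn\<^esub>}" if "v \<in> sinks E" for v
        using Suc.IH[OF d(3)[OF that] submodule_smult[OF QQ vt_carrier[OF sinks_verts[OF that]] Suc.prems(2)]]
        by (simp add: frmod_simps(1))
    qed
    then have "y = \<zero>\<^bsub>Fn\<^esub>" by (rule frmod_dstep_zero)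
    then show ?case by (simp add: frmod_simps)
  qed
  then show ?thesis using assms unfolding dcl_def by blast
qed

lemma pi_inj_QQ: "inj_on \<pi> QQ"
proof (rule inj_onI)
  fix x y assume xy: "x \<in> QQ" "y \<in> QQ" "\<pi> x = \<pi> y"
  have c: "x \<in> carrier Fn" "y \<in> carrier Fn" using xy QQ_carrier by blast+
  have mQ: "x \<ominus>\<^bsub>Fn\<^esub> y \<in> QQ"
    by (rule submodule_minus[OF QQ xy(1,2)])
  have "\<pi> (x \<ominus>\<^bsub>Fn\<^esub> y) = \<zero>\<^bsub>M\<^esub>" using pi.h.hom_eq_iff[OF c] xy(3) by simp
  then have "x \<ominus>\<^bsub>Fn\<^esub> y = (\<lambda>_. 0)" using c by (intro QQ_dcl_K0[OF mQ] kernel Fr.N.minus_closed)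
  then show "x = y" using c by (simp add: frmod_minus fun_eq_iff)
qed

text \<open>A path in the support is cut in front of its last \<open>d\<close> arrows, which form a
  monomial of \<open>CC\<close>.\<close>

lemma QQ_generated:
  assumes U: "submodule U \<R> Fn" and C: "\<And>j fs. (j, fs) \<in> CC \<Longrightarrow> pmono 1 (j, head E (hd fs), fs) \<in> U"
  shows "QQ \<subseteq> U"
proof
  fix y assume y: "y \<in> QQ"
  show "y \<in> U"
  proof (rule frmod_support_mem[OF U QQ_carrier[OF y]])
    fix j u fs assume nz: "y (j, u, fs) \<noteq> 0"
    let ?g = "take (length fs - d) fs" and ?c = "drop (length fs - d) fs"
    have l: "d \<le> length fs" and c: "(j, ?c) \<in> CC" using QQD[OF y nz] by simp_all
    have "(u, ?g @ ?c) \<in> bpaths" using frmod_supportD(2)[OF QQ_carrier[OF y] nz] by simp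
    then have p: "(u, ?g) \<in> bpaths" "(pend (u, ?g), ?c) \<in> bpaths" unfolding Eb.paths_append by simp_all
    have "length ?c = d" using l by simp
    then have "?c \<noteq> []" using d_pos by (cases ?c) simp_all
    then have "pend (u, ?g) = head E (hd ?c)" by (rule bpaths_hd[OF p(2)])
    then have "path_elem (u, ?g) \<odot>\<^bsub>Fn\<^esub> pmono 1 (j, head E (hd ?c), ?c) = pmono 1 (j, u, ?g @ ?c)"
      unfolding frmod_path_pmono by (rule if_P)
    moreover have "path_elem (u, ?g) \<odot>\<^bsub>Fn\<^esub> pmono 1 (j, head E (hd ?c), ?c) \<in> U"
      by (rule submodule_smult[OF U path_elem_carrier[OF p(1)] C[OF c]])
    ultimately show "pmono 1 (j, u, fs) \<in> U" by simp
  qed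
qed

end

lemma mod_hom_restrict: "h \<in> mod_hom R M N \<Longrightarrow> H \<subseteq> carrier M \<Longrightarrow> h \<in> mod_hom R (M\<lparr>carrier := H\<rparr>) N"
  by (rule mod_homI) (auto simp: mod_homD subset_iff)

lemma mod_hom_corestrict: "h \<in> mod_hom R M N \<Longrightarrow> h ` carrier M \<subseteq> K \<Longrightarrow> h \<in> mod_hom R M (N\<lparr>carrier := K\<rparr>)"
  by (auto simp: mod_hom_def)

lemma mod_hom_extend: "h \<in> mod_hom R M (N\<lparr>carrier := K\<rparr>) \<Longrightarrow> K \<subseteq> carrier N \<Longrightarrow> h \<in> mod_hom R M N"
  by (auto simp: mod_hom_def)

section \<open>The projective submodule and the quotient by it\<close>

context presented_module
begin

definition "PP = dcl (res M) (\<pi> ` QQ)"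

lemma PP: "submodule PP \<L> M"
  unfolding PP_def by (rule dcl_leavitt_submodule[OF pi.h.submodule_image[OF QQ]])

lemma pi_QQ_PP: "y \<in> QQ \<Longrightarrow> \<pi> y \<in> PP"
  using dcl_superset[of "\<pi> ` QQ" "res M"] unfolding PP_def by blast

lemma CC_top: "(j, fs) \<in> CC \<Longrightarrow> j < n" "(j, fs) \<in> CC \<Longrightarrow> (head E (hd fs), fs) \<in> bpaths" "(j, fs) \<in> CC \<Longrightarrow> length fs = d"
  using CC(1) unfolding tops_def by blast+

lemma CC_QQ: "(j, fs) \<in> CC \<Longrightarrow> pmono 1 (j, head E (hd fs), fs) \<in> QQ"
  by (rule QQI[OF pmono_frmod[OF CC_top(1,2)]]) (auto simp: pmono_def CC_top(3) split: if_splits)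

text \<open>The generators are the images of the monomials in \<open>CC\<close>. An
  \<open>L\<close>-submodule containing them pulls back to a submodule of the free module that
  contains \<open>QQ\<close>, so it contains the closure \<open>PP\<close>.\<close>

lemma PP_fin_generated: "fin_generated \<L> (M\<lparr>carrier := PP\<rparr>)"
proof -
  let ?g = "\<lambda>(j, fs). \<pi> (pmono 1 (j, head E (hd fs), fs))"
  let ?S = "?g ` CC"
  have S: "?S \<subseteq> PP" using pi_QQ_PP[OF CC_QQ] by auto
  have gen: "PP \<subseteq> H" if H: "submodule H \<L> (M\<lparr>carrier := PP\<rparr>)" "?S \<subseteq> H" for H
  proof -
    have HM: "submodule H \<L> M" using H(1) unfolding M.submodule_restrict_iff[OF PP] by (rule conjunct1)
    then have HR: "submodule H \<R> (res M)" by (simp add: leavitt_submodule_iff)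
    have "QQ \<subseteq> {y \<in> carrier Fn. \<pi> y \<in> H}"
    proof (rule QQ_generated[OF pi.h.submodule_vimage[OF HR]])
      fix j fs assume c: "(j, fs) \<in> CC"
      have "?g (j, fs) \<in> H" by (rule subsetD[OF H(2) imageI[OF c]])
      then show "pmono 1 (j, head E (hd fs), fs) \<in> {y \<in> carrier Fn. \<pi> y \<in> H}"
        using QQ_carrier[OF CC_QQ[OF c]] by simp
    qed
    then have "\<pi> ` QQ \<subseteq> H" by blast
    then show ?thesis unfolding PP_def by (rule dcl_leavitt_least[OF HM])
  qed
  have PPs: "submodule PP \<L> (M\<lparr>carrier := PP\<rparr>)" using PP by (simp add: M.submodule_restrict_iff)
  show ?thesis unfolding fin_generated_def
  proof (intro conjI exI[of _ ?S])
    show "left_module \<L> (M\<lparr>carrier := PP\<rparr>)" by (rule M.submodule_left_module[OF PP])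
    show "finite ?S" using finite_CC by (rule finite_imageI)
    show "?S \<subseteq> carrier (M\<lparr>carrier := PP\<rparr>)" using S by simp
    have "\<Inter>{H. submodule H \<L> (M\<lparr>carrier := PP\<rparr>) \<and> ?S \<subseteq> H} \<subseteq> PP"
      by (rule Inter_lower) (simp only: mem_Collect_eq PPs S simp_thms)
    moreover have "PP \<subseteq> \<Inter>{H. submodule H \<L> (M\<lparr>carrier := PP\<rparr>) \<and> ?S \<subseteq> H}"
      by (rule Inter_greatest) (simp only: mem_Collect_eq gen)
    ultimately show "\<Inter>{H. submodule H \<L> (M\<lparr>carrier := PP\<rparr>) \<and> ?S \<subseteq> H} = carrier (M\<lparr>carrier := PP\<rparr>)"
      by simp
  qed
qed

text \<open>For \<open>c\<close> in \<open>CC\<close>, the coordinate of \<open>y\<close> in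
  \<open>QQ\<close> at this basis monomial.\<close>

definition rho :: "nat \<times> 'e list \<Rightarrow> (nat \<times> 'v \<times> 'e list \<Rightarrow> 'k) \<Rightarrow> 'v \<times> 'e list \<Rightarrow> 'k" where
  "rho c y = (\<lambda>(u, gs). y (fst c, u, gs @ snd c))"

lemma rho_closed:
  assumes y: "y \<in> carrier Fn"
  shows "rho c y \<in> carrier \<R>"
proof -
  have "{p. rho c y p \<noteq> 0} \<subseteq> (\<lambda>(j, u, fs). (u, take (length fs - length (snd c)) fs)) ` {x. y x \<noteq> 0}"
  proof
    fix p assume "p \<in> {p. rho c y p \<noteq> 0}"
    moreover obtain u gs where p: "p = (u, gs)" by (cases p)
    ultimately have "y (fst c, u, gs @ snd c) \<noteq> 0" by (simp add: rho_def)
    then show "p \<in> (\<lambda>(j, u, fs). (u, take (length fs - length (snd c)) fs)) ` {x. y x \<noteq> 0}"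
      unfolding p by (intro image_eqI[of _ _ "(fst c, u, gs @ snd c)"]) auto
  qed
  then have "finite {p. rho c y p \<noteq> 0}"
    by (rule finite_subset) (use y in \<open>simp add: frmod_carrier\<close>)
  moreover have "(u, gs) \<in> bpaths" if "rho c y (u, gs) \<noteq> 0" for u gs
    using frmod_supportD(2)[OF y, of "fst c" u "gs @ snd c"] that by (simp add: rho_def)
  ultimately show ?thesis unfolding path_algebra_carrier by auto
qed

lemma rho_add: "rho c (x \<oplus>\<^bsub>Fn\<^esub> y) = rho c x \<oplus>\<^bsub>\<R>\<^esub> rho c y"
  by (auto simp: rho_def frmod_simps path_algebra_simps)

text \<open>A cut inside the final segment \<open>snd c\<close> would leave a term of
  \<open>y\<close> shorter than \<open>d\<close>, and elements of \<open>QQ\<close> have none. So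
  only cuts in front of that segment contribute.\<close>

lemma rho_smult:
  assumes y: "y \<in> QQ" and c: "length (snd c) = d"
  shows "rho c (r \<odot>\<^bsub>Fn\<^esub> y) = r \<otimes>\<^bsub>\<R>\<^esub> rho c y"
proof
  fix p :: "'v \<times> 'e list"
  obtain u gs where p: "p = (u, gs)" by (cases p)
  let ?f = "\<lambda>i. r (u, take i (gs @ snd c)) * y (fst c, pend (u, take i (gs @ snd c)), drop i (gs @ snd c))"
  have "rho c (r \<odot>\<^bsub>Fn\<^esub> y) p = (\<Sum>i\<le>length (gs @ snd c). ?f i)"
    unfolding p rho_def frmod_simps by (simp add: path_algebra_mult del: take_append drop_append)
  also have "\<dots> = (\<Sum>i\<le>length gs. ?f i)"
  proof (rule sum.mono_neutral_right)
    show "\<forall>i\<in>{..length (gs @ snd c)} - {..length gs}. ?f i = 0"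
    proof
      fix i assume "i \<in> {..length (gs @ snd c)} - {..length gs}"
      then have "\<not> d \<le> length (drop i (gs @ snd c))" using c d_pos by auto
      then have "y (fst c, pend (u, take i (gs @ snd c)), drop i (gs @ snd c)) = 0" using QQD(1)[OF y] by blast
      then show "?f i = 0" by simp
    qed
  qed auto
  also have "\<dots> = (\<Sum>i\<le>length gs. r (u, take i gs) * rho c y (pend (u, take i gs), drop i gs))"
    by (rule sum.cong) (auto simp: rho_def)
  finally show "rho c (r \<odot>\<^bsub>Fn\<^esub> y) p = (r \<otimes>\<^bsub>\<R>\<^esub> rho c y) p"
    unfolding p path_algebra_mult .
qed

lemma rho_CC:
  assumes c: "(j, fs) \<in> CC" and c': "c' \<in> CC"
  shows "rho c' (pmono 1 (j, head E (hd fs), fs)) = (if (j, fs) = c' then vt (head E (hd fs)) else (\<lambda>_. 0))"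
proof -
  obtain j' cs where [simp]: "c' = (j', cs)" by (cases c')
  have "length cs = length fs" using CC_top(3)[OF c] CC_top(3)[of j' cs] c' by simp
  then have "gs @ cs = fs \<longleftrightarrow> gs = [] \<and> fs = cs" for gs by auto
  then show ?thesis by (auto simp: rho_def pmono_def path_elem_def fun_eq_iff)
qed

text \<open>\<open>QQ\<close> is a direct sum of modules \<open>R p_v\<close>, one for each monomial
  in \<open>CC\<close>, with \<open>v\<close> its starting vertex. The monomial is fixed by
  \<open>p_v\<close>, so its image has to be; this is why the vertex is applied to the arbitrary
  element \<open>a (j, fs)\<close>.\<close>

lemma QQ_free:
  assumes A: "left_module \<R> A" and a: "\<And>c. c \<in> CC \<Longrightarrow> a c \<in> carrier A"
  shows "\<exists>h\<in>mod_hom \<R> (Fn\<lparr>carrier := QQ\<rparr>) A. \<forall>j fs. (j, fs) \<in> CC \<longrightarrow>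
    h (pmono 1 (j, head E (hd fs), fs)) = vt (head E (hd fs)) \<odot>\<^bsub>A\<^esub> a (j, fs)"
proof -
  interpret A: left_module \<R> A by (rule A)
  define h where "h y = (\<Oplus>\<^bsub>A\<^esub>c\<in>CC. rho c y \<odot>\<^bsub>A\<^esub> a c)" for y
  have cl: "(\<lambda>c. rho c y \<odot>\<^bsub>A\<^esub> a c) \<in> CC \<rightarrow> carrier A" if "y \<in> carrier Fn" for y
    using rho_closed[OF that] a by (auto intro: A.smult_closed)
  have len: "length (snd c) = d" if "c \<in> CC" for c using CC_top(3)[of "fst c" "snd c"] that by simp
  have "h \<in> mod_hom \<R> (Fn\<lparr>carrier := QQ\<rparr>) A"
  proof (rule mod_homI)
    fix y assume "y \<in> carrier (Fn\<lparr>carrier := QQ\<rparr>)"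
    then have y: "y \<in> carrier Fn" using QQ_carrier by simp
    show "h y \<in> carrier A" unfolding h_def by (rule A.finsum_closed[OF cl[OF y]])
  next
    fix x y assume "x \<in> carrier (Fn\<lparr>carrier := QQ\<rparr>)" "y \<in> carrier (Fn\<lparr>carrier := QQ\<rparr>)"
    then have xy: "x \<in> carrier Fn" "y \<in> carrier Fn" using QQ_carrier by simp_all
    have "h (x \<oplus>\<^bsub>Fn\<^esub> y) = (\<Oplus>\<^bsub>A\<^esub>c\<in>CC. rho c x \<odot>\<^bsub>A\<^esub> a c \<oplus>\<^bsub>A\<^esub> rho c y \<odot>\<^bsub>A\<^esub> a c)"
      unfolding h_def by (rule A.finsum_cong')
        (use cl[OF xy(1)] cl[OF xy(2)] rho_closed xy a in \<open>auto simp: rho_add A.smult_l_distr intro!: A.a_closed A.smult_closed\<close>)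
    also have "\<dots> = h x \<oplus>\<^bsub>A\<^esub> h y" unfolding h_def by (rule A.finsum_addf[OF cl[OF xy(1)] cl[OF xy(2)]])
    finally show "h (x \<oplus>\<^bsub>Fn\<lparr>carrier := QQ\<rparr>\<^esub> y) = h x \<oplus>\<^bsub>A\<^esub> h y" by simp
  next
    fix r y assume r: "r \<in> carrier \<R>" and "y \<in> carrier (Fn\<lparr>carrier := QQ\<rparr>)"
    then have yQ: "y \<in> QQ" and y: "y \<in> carrier Fn" using QQ_carrier by simp_all
    have "h (r \<odot>\<^bsub>Fn\<^esub> y) = (\<Oplus>\<^bsub>A\<^esub>c\<in>CC. r \<odot>\<^bsub>A\<^esub> (rho c y \<odot>\<^bsub>A\<^esub> a c))"
      unfolding h_def by (rule A.finsum_cong')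
        (use cl[OF y] rho_closed[OF y] r a len in \<open>auto simp: rho_smult[OF yQ] A.smult_assoc intro!: A.smult_closed\<close>)
    also have "\<dots> = r \<odot>\<^bsub>A\<^esub> h y" unfolding h_def by (rule A.smult_finsum_r[OF finite_CC r cl[OF y], symmetric])
    finally show "h (r \<odot>\<^bsub>Fn\<lparr>carrier := QQ\<rparr>\<^esub> y) = r \<odot>\<^bsub>A\<^esub> h y" by simp
  qed
  moreover have "h (pmono 1 (j, head E (hd fs), fs)) = vt (head E (hd fs)) \<odot>\<^bsub>A\<^esub> a (j, fs)" if c: "(j, fs) \<in> CC" for j fs
  proof -
    let ?v = "vt (head E (hd fs))"
    have v: "?v \<in> carrier \<R>" using paths_start[OF CC_top(2)[OF c]] by (intro vt_carrier) simp
    then have va: "(\<lambda>c. ?v \<odot>\<^bsub>A\<^esub> a c) \<in> CC \<rightarrow> carrier A" using a by (auto intro: A.smult_closed)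
    have "h (pmono 1 (j, head E (hd fs), fs)) = (\<Oplus>\<^bsub>A\<^esub>c\<in>CC. if (j, fs) = c then ?v \<odot>\<^bsub>A\<^esub> a c else \<zero>\<^bsub>A\<^esub>)"
      unfolding h_def
    proof (rule A.finsum_cong')
      show "rho c' (pmono 1 (j, head E (hd fs), fs)) \<odot>\<^bsub>A\<^esub> a c' = (if (j, fs) = c' then ?v \<odot>\<^bsub>A\<^esub> a c' else \<zero>\<^bsub>A\<^esub>)"
        if c': "c' \<in> CC" for c'
        using A.smult_l_zero[OF a[OF c']] unfolding rho_CC[OF c c'] by (simp add: path_algebra_simps)
    qed (use va in auto)
    also have "\<dots> = ?v \<odot>\<^bsub>A\<^esub> a (j, fs)" by (rule A.finsum_singleton[OF c finite_CC va])
    finally show ?thesis .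
  qed
  ultimately show ?thesis by (intro bexI[of _ h] allI impI)
qed

text \<open>Preimages under \<open>g\<close> are chosen on the basis of \<open>QQ\<close> and
  extended to a map on \<open>QQ\<close>, then to one on \<open>L \<otimes> QQ\<close>, which
  \<open>tens_embedding\<close> identifies with \<open>PP\<close>.\<close>

lemma PP_lift:
  assumes A: "left_module \<L> A" and B: "left_module \<L> B" and g: "g \<in> mod_hom \<L> A B"
    and gs: "g ` carrier A = carrier B" and f: "f \<in> mod_hom \<L> (M\<lparr>carrier := PP\<rparr>) B"
  shows "\<exists>h\<in>mod_hom \<L> (M\<lparr>carrier := PP\<rparr>) A. \<forall>x\<in>PP. g (h x) = f x"
proof -
  let ?N = "Fn\<lparr>carrier := QQ\<rparr>" and ?P = "M\<lparr>carrier := PP\<rparr>"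
  let ?m = "\<lambda>c. pmono 1 (fst c, head E (hd (snd c)), snd c) :: nat \<times> 'v \<times> 'e list \<Rightarrow> 'k"
  have Nl: "left_module \<R> ?N" by (rule Fr.N.submodule_left_module[OF QQ])
  interpret S: scalar_extension E K ?N by (intro scalar_extension.intro path_module.intro Nl quiver_axioms)
  have Pl: "left_module \<L> ?P" by (rule M.submodule_left_module[OF PP])
  interpret f: left_module_hom \<L> ?P B f by (rule left_module_homI[OF Pl B f])
  have "\<exists>a. \<forall>c\<in>CC. a c \<in> carrier A \<and> g (a c) = f (\<pi> (?m c))"
  proof (rule bchoice, rule ballI)
    fix c assume c: "c \<in> CC"
    have "\<pi> (?m c) \<in> carrier ?P" using pi_QQ_PP[OF CC_QQ[of "fst c" "snd c"]] c by simp
    then have "f (\<pi> (?m c)) \<in> g ` carrier A" unfolding gs by (rule f.hom_closed)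
    then show "\<exists>a. a \<in> carrier A \<and> g a = f (\<pi> (?m c))" by auto
  qed
  then obtain a where a: "\<forall>c\<in>CC. a c \<in> carrier A \<and> g (a c) = f (\<pi> (?m c))" by (rule exE)
  have ac: "a c \<in> carrier (res A)" if "c \<in> CC" for c using a[THEN bspec, OF that] by simp
  from QQ_free[OF res_left_module[OF A], of a, OF ac] obtain h0
    where h0: "h0 \<in> mod_hom \<R> ?N (res A)"
      and h0m: "\<forall>j fs. (j, fs) \<in> CC \<longrightarrow> h0 (pmono 1 (j, head E (hd fs), fs)) = vt (head E (hd fs)) \<odot>\<^bsub>res A\<^esub> a (j, fs)"
    by (rule bexE)
  have piN: "\<pi> \<in> mod_hom \<R> ?N (res M)" by (rule mod_hom_restrict[OF pi submodule_subset[OF QQ]])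
  obtain \<Psi> where \<Psi>: "\<Psi> \<in> mod_hom \<L> S.tens A" "\<forall>x\<in>carrier ?N. \<Psi> (S.ten \<one>\<^bsub>\<L>\<^esub> x) = h0 x"
    using S.tens_universal[OF A h0] by (rule bexE)
  obtain \<Phi> where \<Phi>: "\<Phi> \<in> mod_hom \<L> S.tens M" "\<forall>x\<in>carrier ?N. \<Phi> (S.ten \<one>\<^bsub>\<L>\<^esub> x) = \<pi> x"
    using S.tens_universal[OF M.left_module_self piN] by (rule bexE)
  have inj: "inj_on \<pi> (carrier ?N)" using pi_inj_QQ by simp
  have emb: "inj_on \<Phi> (carrier S.tens)" "\<Phi> ` carrier S.tens = PP"
    using S.tens_embedding[OF M.left_module_self piN inj \<Phi>(1)] \<Phi>(2) by (simp_all add: PP_def)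
  have \<Phi>P: "\<Phi> \<in> mod_hom \<L> S.tens ?P" by (rule mod_hom_corestrict[OF \<Phi>(1)]) (simp add: emb(2))
  have gR: "g \<in> mod_hom \<R> (res A) (res B)" by (rule S.tens_hom_res[OF g])
  have fR: "f \<in> mod_hom \<R> (res ?P) (res B)" by (rule S.tens_hom_res[OF f])
  have piP: "\<pi> \<in> mod_hom \<R> ?N (res ?P)"
    using piN pi_QQ_PP by (auto simp: mod_hom_def)
  note Bl = res_left_module[OF B]
  interpret gh: left_module_hom \<R> ?N "res B" "\<lambda>x. g (h0 x)"
    by (rule left_module_homI[OF Nl Bl mod_hom_comp[OF h0 gR]])
  interpret fp: left_module_hom \<R> ?N "res B" "\<lambda>x. f (\<pi> x)"
    by (rule left_module_homI[OF Nl Bl mod_hom_comp[OF piP fR]])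
  interpret gR: left_module_hom \<R> "res A" "res B" g
    by (rule left_module_homI[OF res_left_module[OF A] Bl gR])
  \<comment> \<open>Two maps that agree on the generators agree on \<open>QQ\<close>. The same
    argument over \<open>L\<close> is used below for the extensions \<open>\<Psi>\<close> and
    \<open>\<Phi>\<close>.\<close>
  let ?U = "{x \<in> carrier ?N. g (h0 x) = f (\<pi> x)}"
  have "submodule ?U \<R> ?N"
    by (rule submodule_equalizer[OF gh.left_module_hom_axioms fp.left_module_hom_axioms])
  then have "submodule ?U \<R> Fn" unfolding Fr.N.submodule_restrict_iff[OF QQ] by (rule conjunct1)
  then have "QQ \<subseteq> ?U"
  proof (rule QQ_generated)
    fix j fs assume c: "(j, fs) \<in> CC"
    let ?x = "pmono 1 (j, head E (hd fs), fs) :: nat \<times> 'v \<times> 'e list \<Rightarrow> 'k" and ?v = "vt (head E (hd fs))"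
    have v: "?v \<in> carrier \<R>" using paths_start[OF CC_top(2)[OF c]] by (intro vt_carrier) simp
    have x: "?x \<in> carrier ?N" using CC_QQ[OF c] by simp
    \<comment> \<open>The generator is fixed by its starting vertex, so the factor \<open>?v\<close>
      in the values of \<open>h0\<close> can be absorbed.\<close>
    have vx: "?v \<odot>\<^bsub>?N\<^esub> ?x = ?x" by (simp add: frmod_path_pmono)
    have "g (h0 ?x) = g (?v \<odot>\<^bsub>res A\<^esub> a (j, fs))" using h0m[THEN spec, THEN spec, THEN mp, OF c] by (rule arg_cong)
    also have "\<dots> = ?v \<odot>\<^bsub>res B\<^esub> g (a (j, fs))" by (rule gR.hom_smult[OF v ac[OF c]])
    also have "\<dots> = ?v \<odot>\<^bsub>res B\<^esub> f (\<pi> ?x)" using a[THEN bspec, OF c] by simp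
    also have "\<dots> = f (\<pi> (?v \<odot>\<^bsub>?N\<^esub> ?x))" by (rule fp.hom_smult[OF v x, symmetric])
    finally show "?x \<in> ?U" unfolding vx using x by simp
  qed
  have eq: "g (\<Psi> t) = f (\<Phi> t)" if t: "t \<in> carrier S.tens" for t
  proof -
    let ?V = "{t \<in> carrier S.tens. g (\<Psi> t) = f (\<Phi> t)}"
    have "submodule ?V \<L> S.tens"
      by (rule submodule_equalizer[OF left_module_homI[OF S.tens_left_module B mod_hom_comp[OF \<Psi>(1) g]]
            left_module_homI[OF S.tens_left_module B mod_hom_comp[OF \<Phi>P f]]])
    then have "?V = carrier S.tens"
    proof (rule S.tens_submodule_all)
      fix x assume x: "x \<in> carrier ?N"
      then have "x \<in> ?U" using \<open>QQ \<subseteq> ?U\<close> by (simp add: subset_iff)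
      then show "S.ten \<one>\<^bsub>\<L>\<^esub> x \<in> ?V"
        using \<Psi>(2)[THEN bspec, OF x] \<Phi>(2)[THEN bspec, OF x] S.ten_closed[OF L.one_closed x] by simp
    qed
    then show ?thesis using t by blast
  qed
  define h where "h x = \<Psi> (inv_into (carrier S.tens) \<Phi> x)" for x
  have h: "h (\<Phi> t) = \<Psi> t" if "t \<in> carrier S.tens" for t
    unfolding h_def by (simp add: inv_into_f_f[OF emb(1) that])
  have PE: "\<exists>t. t \<in> carrier S.tens \<and> x = \<Phi> t" if "x \<in> PP" for x
    using that emb(2)[symmetric] by auto
  interpret ps: left_module_hom \<L> S.tens A \<Psi> by (rule left_module_homI[OF S.tens_left_module A \<Psi>(1)])
  interpret ph: left_module_hom \<L> S.tens M \<Phi> by (rule left_module_homI[OF S.tens_left_module M.left_module_self \<Phi>(1)])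
  have "h \<in> mod_hom \<L> ?P A"
  proof (rule mod_homI)
    fix x assume "x \<in> carrier ?P"
    then obtain t where "t \<in> carrier S.tens" "x = \<Phi> t" using PE[of x] by auto
    then show "h x \<in> carrier A" by (simp add: h ps.hom_closed)
  next
    fix x y assume "x \<in> carrier ?P" "y \<in> carrier ?P"
    then obtain t s where ts: "t \<in> carrier S.tens" "x = \<Phi> t" "s \<in> carrier S.tens" "y = \<Phi> s"
      using PE[of x] PE[of y] by auto
    then have "x \<oplus>\<^bsub>?P\<^esub> y = \<Phi> (t \<oplus>\<^bsub>S.tens\<^esub> s)" by (simp add: ph.hom_add)
    then show "h (x \<oplus>\<^bsub>?P\<^esub> y) = h x \<oplus>\<^bsub>A\<^esub> h y"
      using ts by (simp add: h ps.hom_add S.TM.M.a_closed)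
  next
    fix b x assume b: "b \<in> carrier \<L>" and "x \<in> carrier ?P"
    then obtain t where t: "t \<in> carrier S.tens" "x = \<Phi> t" using PE[of x] by auto
    then have "b \<odot>\<^bsub>?P\<^esub> x = \<Phi> (b \<odot>\<^bsub>S.tens\<^esub> t)" using b by (simp add: ph.hom_smult)
    then show "h (b \<odot>\<^bsub>?P\<^esub> x) = b \<odot>\<^bsub>A\<^esub> h x"
      using t b by (simp add: h ps.hom_smult S.TM.M.smult_closed)
  qed
  moreover have "g (h x) = f x" if x: "x \<in> PP" for x
    using PE[OF x] eq h by (elim exE conjE) simp
  ultimately show ?thesis by (intro bexI[of _ h] ballI)
qed

lemma PP_projective: "projective \<L> (M\<lparr>carrier := PP\<rparr>)"
  unfolding projective_def
proof (intro conjI allI ballI impI)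
  show "left_module \<L> (M\<lparr>carrier := PP\<rparr>)" by (rule M.submodule_left_module[OF PP])
  fix A :: "((unit \<times> ('v, 'e) lpa_gen list \<Rightarrow> 'k) set, 'm \<Rightarrow> (unit \<times> ('v, 'e) lpa_gen list \<Rightarrow> 'k) set) module"
    and B :: "((unit \<times> ('v, 'e) lpa_gen list \<Rightarrow> 'k) set, 'm) module" and g f
  assume "g \<in> mod_hom \<L> A B" "f \<in> mod_hom \<L> (M\<lparr>carrier := PP\<rparr>) B" "left_module \<L> A" "left_module \<L> B"
    "g ` carrier A = carrier B"
  then show "\<exists>h\<in>mod_hom \<L> (M\<lparr>carrier := PP\<rparr>) A. \<forall>x\<in>carrier (M\<lparr>carrier := PP\<rparr>). g (h x) = f x"
    using PP_lift[of A B g f] by simp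
qed

text \<open>An \<open>L\<close>-submodule of \<open>M/P\<close> is determined by the elements of
  degree below \<open>d\<close> that \<open>\<pi>\<close> maps into its preimage. They form a
  subspace of a finite-dimensional space, and its dimension, counted by jumps, is a bounded strict
  rank.\<close>

lemma quotient_finite_length: "finite_length \<L> (mod_quot M PP)"
proof -
  let ?Q = "mod_quot M PP" and ?t = "\<lambda>x. PP +>\<^bsub>M\<^esub> x"
  have Ql: "left_module \<L> ?Q" by (rule M.mod_quot_left_module[OF PP])
  interpret t: left_module_hom \<L> M ?Q ?t by (rule left_module_homI[OF M.left_module_self Ql M.quot_map_hom[OF PP]])
  obtain xs where xs: "set xs = monomials n d" using finite_list[OF finite_monomials] by (rule exE)
  define b where "b = length xs"
  \<comment> \<open>The coordinate filtration for an enumeration of the monomials of degree below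
    \<open>d\<close>; \<open>G b\<close> consists of all elements of degree below
    \<open>d\<close>.\<close>
  define G where "G i = {y \<in> carrier Fn. \<forall>x. y x \<noteq> 0 \<longrightarrow> x \<in> set (take i xs)}" for i
  define UU where "UU T = {x \<in> carrier M. ?t x \<in> T}" for T
  define V where "V T = {y \<in> carrier Fn. \<pi> y \<in> UU T}" for T
  define A where "A T = G b \<inter> V T" for T
  have GI: "y \<in> G i" if "y \<in> carrier Fn" "\<And>x. y x \<noteq> 0 \<Longrightarrow> x \<in> set (take i xs)" for y i
    using that by (simp add: G_def)
  have GD: "y \<in> carrier Fn" "y x \<noteq> 0 \<Longrightarrow> x \<in> set (take i xs)" if "y \<in> G i" for y x i
    using that unfolding G_def by blast+
  have Gs: "subgroup (G i) (add_monoid Fn)" for i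
  proof (rule Fr.N.add.subgroupI)
    show "G i \<subseteq> carrier Fn" using GD(1) by blast
    have "(\<lambda>_. 0) \<in> G i" by (rule GI) (simp_all add: frmod_carrier)
    then show "G i \<noteq> {}" by blast
    show "\<ominus>\<^bsub>Fn\<^esub> y \<in> G i" if y: "y \<in> G i" for y
      using Fr.N.a_inv_closed[OF GD(1)[OF y]] GD(2)[OF y] by (intro GI) (simp_all add: frmod_uminus[OF GD(1)[OF y]])
    show "y \<oplus>\<^bsub>Fn\<^esub> z \<in> G i" if y: "y \<in> G i" and z: "z \<in> G i" for y z
    proof (rule GI[OF Fr.N.a_closed[OF GD(1)[OF y] GD(1)[OF z]]])
      fix x assume "(y \<oplus>\<^bsub>Fn\<^esub> z) x \<noteq> 0"
      then have "y x \<noteq> 0 \<or> z x \<noteq> 0" by (auto simp: frmod_simps)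
      then show "x \<in> set (take i xs)" using GD(2)[OF y] GD(2)[OF z] by blast
    qed
  qed
  have UL: "submodule (UU T) \<L> M" if "submodule T \<L> ?Q" for T
    unfolding UU_def by (rule t.submodule_vimage[OF that])
  have VR: "submodule (V T) \<R> Fn" if "submodule T \<L> ?Q" for T
    unfolding V_def using UL[OF that] by (intro pi.h.submodule_vimage) (simp add: leavitt_submodule_iff)
  have As: "subgroup (A T) (add_monoid Fn)" if "submodule T \<L> ?Q" for T
    unfolding A_def by (rule Fr.N.add.subgroups_Inter_pair[OF Gs submodule_subgroup[OF VR[OF that]]])
  have PU: "x \<in> UU T" if T: "submodule T \<L> ?Q" and x: "x \<in> PP" for T x
    using M.quot_map_eq_zero[OF PP submodule_mem[OF PP x]] x submodule_mem[OF PP x] submodule_zero[OF T]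
    by (simp add: UU_def)
  show ?thesis
  proof (rule left_module.finite_length_of_rank[OF Ql, where l = "\<lambda>T. card (jumps G b (A T))" and n = b])
    show "card (jumps G b (A T)) \<le> b" for T by (rule finite_jumps(2))
    fix T T' assume T: "submodule T \<L> ?Q" and T': "submodule T' \<L> ?Q" and TT: "T \<subset> T'"
    have sub: "A T \<subseteq> A T'" using TT unfolding A_def V_def UU_def by blast
    note Jm = jumps_mono[OF sub, of G b]
    show "card (jumps G b (A T)) < card (jumps G b (A T'))"
    proof (rule ccontr)
      assume "\<not> card (jumps G b (A T)) < card (jumps G b (A T'))"
      then have J: "jumps G b (A T) = jumps G b (A T')"
        by (intro card_seteq[OF finite_jumps(1) Jm]) simp
      have "A T = A T'"
      proof (rule jumps_determine[OF Fr.N.M.abelian_group_axioms As[OF T] As[OF T'] sub])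
        show "A T' \<subseteq> G b" unfolding A_def by (rule Int_lower1)
        show "A T' \<inter> G 0 \<subseteq> A T"
        proof
          fix y assume "y \<in> A T' \<inter> G 0"
          then have "y x = 0" for x using GD(2)[of y 0 x] by auto
          then have "y = \<zero>\<^bsub>Fn\<^esub>" by (auto simp: frmod_simps)
          then show "y \<in> A T" using subgroup.one_closed[OF As[OF T]] by simp
        qed
        show "jumps G b (A T') \<subseteq> jumps G b (A T)" using J by simp
        fix i g assume i: "i \<in> jumps G b (A T)" and g: "g \<in> A T' \<inter> G (Suc i)"
        have ib: "i < b" using i by (simp add: jumps_def)
        have "\<not> A T \<inter> G (Suc i) \<subseteq> G i" using i by (simp add: jumps_def)
        then obtain y where y: "y \<in> A T" "y \<in> G (Suc i)" "y \<notin> G i" by blast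
        have tk: "set (take (Suc i) xs) = insert (xs ! i) (set (take i xs))"
          using ib by (simp add: take_Suc_conv_app_nth b_def)
        have nz: "y (xs ! i) \<noteq> 0"
        proof
          assume z: "y (xs ! i) = 0"
          have "y \<in> G i"
          proof (rule GI[OF GD(1)[OF y(2)]])
            fix x assume "y x \<noteq> 0"
            then show "x \<in> set (take i xs)" using GD(2)[OF y(2), of x] z unfolding tk by auto
          qed
          then show False using y(3) by simp
        qed
        \<comment> \<open>The multiple of \<open>y\<close> that has the same coefficient as
          \<open>g\<close> at the monomial \<open>xs ! i\<close>, so that the difference drops to
          layer \<open>i\<close>.\<close>
        define a where "a = path_scalar (inverse_quiver E) (g (xs ! i) / y (xs ! i)) \<odot>\<^bsub>Fn\<^esub> y"
        have gc: "g \<in> carrier Fn" "g \<in> G (Suc i)" using g GD(1) by auto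
        have yV: "y \<in> V T" "y \<in> G b" using y(1) by (simp_all add: A_def)
        have ac: "a \<in> carrier Fn" unfolding a_def by (rule Fr.N.smult_closed[OF rscalar_carrier GD(1)[OF y(2)]])
        have ax: "a x = g (xs ! i) / y (xs ! i) * y x" for x
          unfolding a_def frmod_scalar[OF GD(1)[OF y(2)]] by simp
        have "a \<in> G b" by (rule GI[OF ac]) (use GD(2)[OF yV(2)] in \<open>auto simp: ax\<close>)
        moreover have "a \<in> V T" unfolding a_def by (rule submodule_smult[OF VR[OF T] rscalar_carrier yV(1)])
        ultimately have "a \<in> A T" by (simp add: A_def)
        moreover have "g \<ominus>\<^bsub>Fn\<^esub> a \<in> G i"
        proof (rule GI[OF Fr.N.minus_closed[OF gc(1) ac]])
          fix x assume x: "(g \<ominus>\<^bsub>Fn\<^esub> a) x \<noteq> 0"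
          then have "x \<noteq> xs ! i" using nz by (auto simp: frmod_minus[OF gc(1) ac] ax)
          moreover have "g x \<noteq> 0 \<or> y x \<noteq> 0" using x by (auto simp: frmod_minus[OF gc(1) ac] ax)
          then have "x \<in> set (take (Suc i) xs)" using GD(2)[OF gc(2)] GD(2)[OF y(2)] by blast
          ultimately show "x \<in> set (take i xs)" unfolding tk by simp
        qed
        ultimately show "\<exists>a\<in>A T. g \<ominus>\<^bsub>Fn\<^esub> a \<in> G i" by (intro bexI[of _ a])
      qed
      \<comment> \<open>An element is congruent modulo \<open>QQ\<close> and \<open>K0\<close> to
        one of degree below \<open>d\<close>, and the images of \<open>QQ\<close> and
        \<open>K0\<close> lie in the preimage of every submodule of the quotient. In degrees below
        \<open>d\<close> the submodules \<open>T\<close> and \<open>T'\<close> are not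
        distinguished.\<close>
      have "UU T' \<inter> \<pi> ` carrier Fn \<subseteq> UU T"
      proof
        fix u assume "u \<in> UU T' \<inter> \<pi> ` carrier Fn"
        then obtain y where y: "y \<in> carrier Fn" "u = \<pi> y" "y \<in> V T'" unfolding V_def by blast
        obtain q where q: "q \<in> QQ" "\<exists>k\<in>K0. agree d y (\<lambda>x. q x + k x)" using decomposition[OF y(1)] by (rule bexE)
        obtain k where k: "k \<in> K0" "agree d y (\<lambda>x. q x + k x)" using q(2) by (rule bexE)
        have kc: "k \<in> carrier Fn" and qc: "q \<in> carrier Fn" by (rule submodule_mem[OF K0 k(1)], rule QQ_carrier[OF q(1)])
        have inV: "q \<oplus>\<^bsub>Fn\<^esub> k \<in> V S" if S: "submodule S \<L> ?Q" for S
        proof (rule submodule_add[OF VR[OF S]])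
          show "q \<in> V S" using qc PU[OF S pi_QQ_PP[OF q(1)]] by (simp add: V_def)
          show "k \<in> V S" using kc pi_K0[OF k(1)] submodule_zero[OF UL[OF S]] by (simp add: V_def)
        qed
        have qk: "q \<oplus>\<^bsub>Fn\<^esub> k \<in> carrier Fn" by (rule Fr.N.a_closed[OF qc kc])
        let ?r = "y \<ominus>\<^bsub>Fn\<^esub> (q \<oplus>\<^bsub>Fn\<^esub> k)"
        have rc: "?r \<in> carrier Fn" by (rule Fr.N.minus_closed[OF y(1) qk])
        have "?r \<in> G b"
        proof (rule GI[OF rc])
          fix x assume nz: "?r x \<noteq> 0"
          obtain j v fs where x: "x = (j, v, fs)" by (cases x) auto
          have "y x - (q \<oplus>\<^bsub>Fn\<^esub> k) x \<noteq> 0" using nz unfolding frmod_minus[OF y(1) qk] .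
          then have "y x \<noteq> q x + k x" by (simp add: frmod_simps(2))
          then have "\<not> d \<le> length fs" using agreeD[OF k(2)] unfolding x by blast
          then have "x \<in> monomials n d"
            using frmod_supportD[OF rc nz[unfolded x]] by (simp add: x monomials_def)
          then show "x \<in> set (take b xs)" by (simp add: b_def xs)
        qed
        moreover have "?r \<in> V T'" by (rule submodule_minus[OF VR[OF T'] y(3) inV[OF T']])
        ultimately have "?r \<in> A T" unfolding \<open>A T = A T'\<close> by (simp add: A_def)
        then have "?r \<in> V T" by (simp add: A_def)
        then have "?r \<oplus>\<^bsub>Fn\<^esub> (q \<oplus>\<^bsub>Fn\<^esub> k) \<in> V T" by (rule submodule_add[OF VR[OF T] _ inV[OF T]])
        then have "y \<in> V T" using Fr.N.M.diff_add_cancel[OF y(1) qk] by simp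
        then show "u \<in> UU T" using y(2) by (simp add: V_def)
      qed
      then have "dcl (res M) (UU T' \<inter> \<pi> ` carrier Fn) \<subseteq> UU T" by (rule dcl_leavitt_least[OF UL[OF T]])
      moreover have "UU T' \<subseteq> dcl (res M) (UU T' \<inter> \<pi> ` carrier Fn)"
        by (rule leavitt_submodule_from_generators[OF pi.h.submodule_image[OF Fr.N.submodule_carrier] generated UL[OF T']])
      ultimately have UU: "UU T' \<subseteq> UU T" by (rule order_trans[rotated])
      have "T' \<subseteq> T"
      proof
        fix s assume s: "s \<in> T'"
        have "s \<in> ?t ` carrier M" unfolding M.quot_map_surj by (rule submodule_mem[OF T' s])
        then obtain x where x: "x \<in> carrier M" "s = ?t x" by (rule imageE)
        then have "x \<in> UU T'" using s by (simp add: UU_def)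
        then have "x \<in> UU T" by (rule subsetD[OF UU])
        then show "s \<in> T" using x(2) by (simp add: UU_def)
      qed
      then show False using TT by blast
    qed
  qed
qed

end

text \<open>Carries a module over to another type along a mere injection of its carrier. The third
  claim prescribes the type \<open>nat \<Rightarrow> 'k\<close> for the finite-dimensional
  module.\<close>

definition transport :: "('a \<Rightarrow> 'b) \<Rightarrow> ('r, 'a) module \<Rightarrow> ('r, 'b) module" where
  "transport \<phi> M =
     \<lparr>carrier = \<phi> ` carrier M, monoid.mult = undefined, one = undefined, ring.zero = \<phi> \<zero>\<^bsub>M\<^esub>,
      ring.add = (\<lambda>x y. \<phi> (inv_into (carrier M) \<phi> x \<oplus>\<^bsub>M\<^esub> inv_into (carrier M) \<phi> y)),
      module.smult = (\<lambda>a x. \<phi> (a \<odot>\<^bsub>M\<^esub> inv_into (carrier M) \<phi> x))\<rparr>"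

lemma transport_module:
  assumes M: "left_module R M" and inj: "inj_on \<phi> (carrier M)"
  shows "left_module R (transport \<phi> M)" "\<phi> \<in> mod_hom R M (transport \<phi> M)"
    "inv_into (carrier M) \<phi> \<in> mod_hom R (transport \<phi> M) M"
proof -
  interpret M: left_module R M by (rule M)
  have s: "inv_into (carrier M) \<phi> (\<phi> x) = x" if "x \<in> carrier M" for x by (rule inv_into_f_f[OF inj that])
  have c: "carrier (transport \<phi> M) = \<phi> ` carrier M" by (simp add: transport_def)
  have z: "\<zero>\<^bsub>transport \<phi> M\<^esub> = \<phi> \<zero>\<^bsub>M\<^esub>" by (simp add: transport_def)
  have a: "\<phi> x \<oplus>\<^bsub>transport \<phi> M\<^esub> \<phi> y = \<phi> (x \<oplus>\<^bsub>M\<^esub> y)" if "x \<in> carrier M" "y \<in> carrier M" for x y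
    using that by (simp add: transport_def s)
  have m: "r \<odot>\<^bsub>transport \<phi> M\<^esub> \<phi> x = \<phi> (r \<odot>\<^bsub>M\<^esub> x)" if "x \<in> carrier M" for r x
    using that by (simp add: transport_def s)
  show "left_module R (transport \<phi> M)"
  proof (rule left_moduleI)
    show "abelian_group (transport \<phi> M)"
    proof (rule abelian_groupI)
      fix x assume "x \<in> carrier (transport \<phi> M)"
      then obtain y where "y \<in> carrier M" "x = \<phi> y" unfolding c by (elim imageE)
      then show "\<exists>y\<in>carrier (transport \<phi> M). y \<oplus>\<^bsub>transport \<phi> M\<^esub> x = \<zero>\<^bsub>transport \<phi> M\<^esub>"
        unfolding c z by (intro bexI[of _ "\<phi> (\<ominus>\<^bsub>M\<^esub> y)"]) (simp_all add: a M.l_neg)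
    qed (auto simp: c z a M.a_ac)
  qed (auto simp: c a m M.R.ring_axioms M.smult_closed M.smult_l_distr M.smult_r_distr M.smult_assoc M.smult_one)
  show "\<phi> \<in> mod_hom R M (transport \<phi> M)" by (rule mod_homI) (auto simp: c a m)
  show "inv_into (carrier M) \<phi> \<in> mod_hom R (transport \<phi> M) M"
    by (rule mod_homI) (auto simp: c a m s M.smult_closed)
qed

context path_module
begin

text \<open>The last arrow of the path acts first, and each arrow removes one application of
  \<open>dstep\<close>.\<close>

lemma path_dstep_iter:
  assumes H: "submodule H \<R> N"
  shows "(u, es) \<in> bpaths \<Longrightarrow> x \<in> (dstep N ^^ length es) H \<Longrightarrow> path_elem (u, es) \<odot>\<^bsub>N\<^esub> x \<in> H"
proof (induction es arbitrary: x rule: rev_induct)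
  case Nil
  then show ?case using submodule_smult[OF H vt_carrier, of u x] by simp
next
  case (snoc e es)
  have p: "(u, es) \<in> bpaths" "e \<in> arcs E" "pend (u, es) = head E e" using snoc.prems(1) by simp_all
  have x: "x \<in> dstep N ((dstep N ^^ length es) H)" using snoc.prems(2) by simp
  have "path_elem (u, es) \<odot>\<^bsub>N\<^esub> (ar e \<odot>\<^bsub>N\<^esub> x) \<in> H" by (rule snoc.IH[OF p(1) dstepD(2)[OF x p(2)]])
  also have "path_elem (u, es) \<odot>\<^bsub>N\<^esub> (ar e \<odot>\<^bsub>N\<^esub> x) = (path_elem (u, es) \<otimes>\<^bsub>\<R>\<^esub> ar e) \<odot>\<^bsub>N\<^esub> x"
    by (rule N.smult_assoc[OF path_elem_carrier[OF p(1)] ar_carrier[OF p(2)] dstepD(1)[OF x], symmetric])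
  also have "path_elem (u, es) \<otimes>\<^bsub>\<R>\<^esub> ar e = (path_elem (u, es @ [e]) :: 'v \<times> 'e list \<Rightarrow> 'k)"
    using p(3) by (simp add: path_elem_mult)
  finally show ?case .
qed

lemma path_scalar_add:
  "path_scalar (inverse_quiver E) (a + b) = path_scalar (inverse_quiver E) a \<oplus>\<^bsub>\<R>\<^esub> path_scalar (inverse_quiver E) b"
  by (auto simp: path_scalar_def path_algebra_simps)

lemma combination_add:
  fixes c :: "'n \<Rightarrow> 'k"
  assumes B: "finite B" "B \<subseteq> carrier N" and b: "b \<in> B"
  shows "(\<Oplus>\<^bsub>N\<^esub>x\<in>B. path_scalar (inverse_quiver E) (c x) \<odot>\<^bsub>N\<^esub> x) \<oplus>\<^bsub>N\<^esub> path_scalar (inverse_quiver E) a \<odot>\<^bsub>N\<^esub> b =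
    (\<Oplus>\<^bsub>N\<^esub>x\<in>B. path_scalar (inverse_quiver E) ((c(b := c b + a)) x) \<odot>\<^bsub>N\<^esub> x)"
proof -
  let ?f = "\<lambda>c x. path_scalar (inverse_quiver E) (c x :: 'k) \<odot>\<^bsub>N\<^esub> x"
  have fc: "?f c x \<in> carrier N" if "x \<in> B" for c x
    using B(2) that by (intro N.smult_closed rscalar_carrier) blast
  have split: "(\<Oplus>\<^bsub>N\<^esub>x\<in>B. ?f c x) = ?f c b \<oplus>\<^bsub>N\<^esub> (\<Oplus>\<^bsub>N\<^esub>x\<in>B - {b}. ?f c x)" for c
    using N.finsum_insert[of "B - {b}" b "?f c"] B(1) b fc by (simp add: insert_absorb Pi_iff)
  have rest: "(\<Oplus>\<^bsub>N\<^esub>x\<in>B - {b}. ?f (c(b := c b + a)) x) = (\<Oplus>\<^bsub>N\<^esub>x\<in>B - {b}. ?f c x)"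
    by (rule N.finsum_cong') (use fc in auto)
  have rc: "(\<Oplus>\<^bsub>N\<^esub>x\<in>B - {b}. ?f c x) \<in> carrier N" by (rule N.finsum_closed) (use fc in auto)
  have bc: "b \<in> carrier N" using B(2) b by blast
  have "?f (c(b := c b + a)) b = ?f c b \<oplus>\<^bsub>N\<^esub> path_scalar (inverse_quiver E) a \<odot>\<^bsub>N\<^esub> b"
    using bc by (simp add: path_scalar_add N.smult_l_distr)
  then show ?thesis
    unfolding split[of c] split[of "c(b := c b + a)"] rest
    using rc fc[OF b, of c] N.smult_closed[OF rscalar_carrier bc, of a] by (simp add: N.a_ac)
qed

lemma combination_zero:
  assumes B: "finite B" "B \<subseteq> carrier N"
  shows "(\<Oplus>\<^bsub>N\<^esub>x\<in>B. path_scalar (inverse_quiver E) 0 \<odot>\<^bsub>N\<^esub> x) = \<zero>\<^bsub>N\<^esub>"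
proof -
  have z: "path_scalar (inverse_quiver E) 0 = \<zero>\<^bsub>\<R>\<^esub>" by (auto simp: path_scalar_def path_algebra_simps)
  have "(\<Oplus>\<^bsub>N\<^esub>x\<in>B. path_scalar (inverse_quiver E) 0 \<odot>\<^bsub>N\<^esub> x) = (\<Oplus>\<^bsub>N\<^esub>x\<in>B. \<zero>\<^bsub>N\<^esub>)"
    by (rule N.finsum_cong') (use B(2) N.smult_l_zero in \<open>auto simp: z\<close>)
  then show ?thesis by simp
qed

end

section \<open>Presented modules of finite length\<close>

context presented_module
begin

text \<open>
  For the closed path \<open>z\<close>, the powers of \<open>\<sigma> = p\<^sub>w - z\<close> applied to a monomial of \<open>QQ\<close> generate a
  strictly descending chain of submodules: otherwise \<open>z^m = r \<sigma>\<close> modulo an element without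
  coefficients at the powers of \<open>z\<close>, and then \<open>r\<close> has coefficient 1 at \<open>z^i\<close> for all \<open>i \<ge> m\<close>.
\<close>

lemma cycle_not_finite_length:
  assumes fl: "finite_length \<L> M" and z: "(w, z) \<in> bpaths" "pend (w, z) = w" "z \<noteq> []"
    and y0: "pmono 1 (j, w, ts) \<in> QQ"
  shows False
proof -
  let ?y0 = "pmono 1 (j, w, ts) :: nat \<times> 'v \<times> 'e list \<Rightarrow> 'k"
  define zp where "zp i = concat (replicate i z)" for i
  have zp0: "zp 0 = []" by (simp add: zp_def)
  have "z @ concat (replicate i z) = concat (replicate i z) @ z" for i by (induction i) simp_all
  then have zpS: "zp (Suc i) = zp i @ z" for i by (simp add: zp_def)
  have zl: "length (zp i) = i * length z" for i by (induction i) (simp_all add: zp0 zpS)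
  have zp: "(w, zp i) \<in> bpaths \<and> pend (w, zp i) = w" for i
    by (induction i) (use z paths_start[OF z(1)] in \<open>simp_all add: zp0 zpS\<close>)
  have zinj: "zp i = zp i' \<longleftrightarrow> i = i'" for i i'
  proof
    assume "zp i = zp i'"
    then have "i * length z = i' * length z" by (simp only: zl[symmetric])
    then show "i = i'" using z(3) by simp
  qed simp
  have wv: "w \<in> verts E" using paths_start[OF z(1)] by simp
  define \<sigma> where "\<sigma> = (\<lambda>p. vt w p + pmono (- 1) (w, z) p :: 'k)"
  have \<sigma>: "\<sigma> \<in> carrier \<R>"
    using R.a_closed[OF vt_carrier[OF wv] pmono_carrier[OF z(1), of "- 1"]] by (simp add: \<sigma>_def path_algebra_simps)
  \<comment> \<open>On the coefficients at the powers of \<open>z\<close>, right multiplication by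
    \<open>\<sigma>\<close> is the backward difference, which is injective. This is the reason for
    \<open>cancel\<close>.\<close>
  have k1: "(x \<otimes>\<^bsub>\<R>\<^esub> \<sigma>) (w, zp i) = x (w, zp i) - (case i of 0 \<Rightarrow> 0 | Suc i' \<Rightarrow> x (w, zp i'))" for x :: "'v \<times> 'e list \<Rightarrow> 'k" and i
    unfolding \<sigma>_def mult_distrib_left mult_vertex_right mult_pmono_right
    using z zp by (cases i) (simp_all add: zp0 zpS)
  \<comment> \<open>\<open>s t\<close> is the power \<open>\<sigma>^t\<close>, with
    \<open>p_w\<close> in place of the identity.\<close>
  define s where "s t = ((\<lambda>r. \<sigma> \<otimes>\<^bsub>\<R>\<^esub> r) ^^ t) (vt w)" for t
  have s0: "s 0 = vt w" and sS: "s (Suc t) = \<sigma> \<otimes>\<^bsub>\<R>\<^esub> s t" for t by (simp_all add: s_def)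
  have sc: "s t \<in> carrier \<R>" for t
    by (induction t) (simp_all add: s0 sS wv Eb.path_mult_closed[OF \<sigma>])
  have cancel: "\<forall>i. x (w, zp i) = y (w, zp i)" if "\<forall>i. (x \<otimes>\<^bsub>\<R>\<^esub> s t) (w, zp i) = (y \<otimes>\<^bsub>\<R>\<^esub> s t) (w, zp i)" for x y t
    using that
  proof (induction t arbitrary: x y)
    case 0
    then show ?case using zp by (simp add: s0 mult_vertex_right)
  next
    case (Suc t)
    then have "\<forall>i. ((x \<otimes>\<^bsub>\<R>\<^esub> \<sigma>) \<otimes>\<^bsub>\<R>\<^esub> s t) (w, zp i) = ((y \<otimes>\<^bsub>\<R>\<^esub> \<sigma>) \<otimes>\<^bsub>\<R>\<^esub> s t) (w, zp i)"
      by (simp add: sS path_mult_assoc)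
    then have e: "\<forall>i. (x \<otimes>\<^bsub>\<R>\<^esub> \<sigma>) (w, zp i) = (y \<otimes>\<^bsub>\<R>\<^esub> \<sigma>) (w, zp i)" by (rule Suc.IH)
    have "x (w, zp i) = y (w, zp i)" for i
      using e[THEN spec, of i]
    proof (induction i)
      case 0
      then show ?case by (simp add: k1)
    next
      case (Suc i)
      have "x (w, zp i) = y (w, zp i)" by (rule Suc.IH[OF e[THEN spec]])
      then show ?case using Suc.prems by (simp add: k1)
    qed
    then show ?case by (rule allI)
  qed
  define om where "om t = s t \<odot>\<^bsub>Fn\<^esub> ?y0" for t
  define W where "W t = {r \<odot>\<^bsub>Fn\<^esub> om t | r. r \<in> carrier \<R>}" for t
  define U where "U t = dcl (res M) (\<pi> ` W t)" for t
  note y0c = QQ_carrier[OF y0]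
  have omQ: "om t \<in> QQ" for t unfolding om_def by (rule submodule_smult[OF QQ sc y0])
  note omc = QQ_carrier[OF omQ]
  have Ws: "submodule (W t) \<R> Fn" for t unfolding W_def by (rule Fr.N.submodule_cyclic[OF omc])
  have WI: "r \<odot>\<^bsub>Fn\<^esub> om t \<in> W t" if "r \<in> carrier \<R>" for r t using that by (auto simp: W_def)
  have omS: "om (Suc t) = \<sigma> \<odot>\<^bsub>Fn\<^esub> om t" for t
    unfolding om_def sS by (rule Fr.N.smult_assoc[OF \<sigma> sc y0c])
  have Wdec: "W (Suc t) \<subseteq> W t" for t
  proof
    fix x assume "x \<in> W (Suc t)"
    then obtain r where r: "r \<in> carrier \<R>" "x = r \<odot>\<^bsub>Fn\<^esub> om (Suc t)" by (auto simp: W_def)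
    show "x \<in> W t" unfolding r(2) omS by (rule submodule_smult[OF Ws r(1) WI[OF \<sigma>]])
  qed
  have Us: "submodule (U t) \<L> M" for t
    unfolding U_def by (rule dcl_leavitt_submodule[OF pi.h.submodule_image[OF Ws]])
  have strict: "U (Suc t) \<subset> U t" for t
  proof
    show "U (Suc t) \<subseteq> U t" unfolding U_def by (intro dcl_mono image_mono Wdec)
    show "U (Suc t) \<noteq> U t"
    proof
      assume eq: "U (Suc t) = U t"
      let ?H = "\<pi> ` W (Suc t)"
      have HR: "submodule ?H \<R> (res M)" by (rule pi.h.submodule_image[OF Ws])
      have "\<one>\<^bsub>\<R>\<^esub> \<odot>\<^bsub>Fn\<^esub> om t \<in> W t" by (rule WI[OF R.one_closed])
      then have "om t \<in> W t" unfolding Fr.N.smult_one[OF omc] .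
      then have "\<pi> (om t) \<in> U (Suc t)"
        unfolding eq using dcl_superset[of "\<pi> ` W t" "res M"] by (auto simp: U_def)
      then obtain m where m: "\<pi> (om t) \<in> (dstep (res M) ^^ m) ?H" unfolding U_def dcl_def by (elim UN_E)
      \<comment> \<open>The \<open>m\<close>-th power of \<open>z\<close> has length at least
        \<open>m\<close>, so it multiplies an element of the \<open>m\<close>-th iterate into
        \<open>?H\<close>. This moves the equation into \<open>\<pi>\<close> applied to
        \<open>QQ\<close>, where \<open>\<pi>\<close> is injective and can be cancelled.\<close>
      let ?q = "path_elem (w, zp m) :: 'v \<times> 'e list \<Rightarrow> 'k"
      have "m \<le> length (zp m)" using z(3) by (simp add: zl Suc_leI)
      then have "\<pi> (om t) \<in> (dstep (res M) ^^ length (zp m)) ?H"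
        using RM.dstep_iter_incseq[OF HR] m by blast
      moreover have qb: "(w, zp m) \<in> bpaths" using zp by simp
      ultimately have "?q \<odot>\<^bsub>res M\<^esub> \<pi> (om t) \<in> ?H" by (intro RM.path_dstep_iter[OF HR])
      moreover have qc: "?q \<in> carrier \<R>" by (rule path_elem_carrier[OF qb])
      ultimately have "\<pi> (?q \<odot>\<^bsub>Fn\<^esub> om t) \<in> ?H" using pi.h.hom_smult[OF qc omc] by simp
      then obtain x where x: "x \<in> W (Suc t)" "\<pi> (?q \<odot>\<^bsub>Fn\<^esub> om t) = \<pi> x" by (elim imageE)
      obtain r where r: "r \<in> carrier \<R>" "x = r \<odot>\<^bsub>Fn\<^esub> om (Suc t)" using x(1) by (auto simp: W_def)
      have "?q \<odot>\<^bsub>Fn\<^esub> om t = r \<odot>\<^bsub>Fn\<^esub> om (Suc t)"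
        by (rule inj_onD[OF pi_inj_QQ, OF x(2)[unfolded r(2)]])
          (intro submodule_smult[OF QQ] qc r(1) omQ)+
      also have "r \<odot>\<^bsub>Fn\<^esub> om (Suc t) = (r \<otimes>\<^bsub>\<R>\<^esub> \<sigma>) \<odot>\<^bsub>Fn\<^esub> om t"
        unfolding omS by (rule Fr.N.smult_assoc[OF r(1) \<sigma> omc, symmetric])
      finally have "(?q \<otimes>\<^bsub>\<R>\<^esub> s t) \<odot>\<^bsub>Fn\<^esub> ?y0 = ((r \<otimes>\<^bsub>\<R>\<^esub> \<sigma>) \<otimes>\<^bsub>\<R>\<^esub> s t) \<odot>\<^bsub>Fn\<^esub> ?y0"
        unfolding om_def Fr.N.smult_assoc[OF qc sc y0c] Fr.N.smult_assoc[OF Eb.path_mult_closed[OF r(1) \<sigma>] sc y0c] .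
      then have ev: "((?q \<otimes>\<^bsub>\<R>\<^esub> s t) \<odot>\<^bsub>Fn\<^esub> ?y0) (j, w, zp i @ ts) =
          (((r \<otimes>\<^bsub>\<R>\<^esub> \<sigma>) \<otimes>\<^bsub>\<R>\<^esub> s t) \<odot>\<^bsub>Fn\<^esub> ?y0) (j, w, zp i @ ts)" for i
        by (rule fun_cong)
      have "\<forall>i. (?q \<otimes>\<^bsub>\<R>\<^esub> s t) (w, zp i) = ((r \<otimes>\<^bsub>\<R>\<^esub> \<sigma>) \<otimes>\<^bsub>\<R>\<^esub> s t) (w, zp i)"
        using ev zp unfolding frmod_smult_pmono by simp
      then have qr: "?q (w, zp i) = (r \<otimes>\<^bsub>\<R>\<^esub> \<sigma>) (w, zp i)" for i by (rule cancel[THEN spec])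
      \<comment> \<open>The differences of the coefficients of \<open>r\<close> along the powers of
        \<open>z\<close> are 1 at \<open>m\<close> and 0 elsewhere.\<close>
      have rv: "r (w, zp i) = (if m \<le> i then 1 else 0)" for i
      proof (induction i)
        case 0
        then show ?case using qr[of 0] by (simp add: k1 path_elem_def zinj split: if_splits)
      next
        case (Suc i)
        then show ?case using qr[of "Suc i"]
          by (cases "m = Suc i") (auto simp: k1 path_elem_def zinj split: if_splits)
      qed
      have "(\<lambda>i. (w, zp i)) ` {m..} \<subseteq> {p. r p \<noteq> 0}" using rv by auto
      moreover have "finite {p. r p \<noteq> 0}" using r(1) by (simp add: path_algebra_carrier)
      ultimately have "finite ((\<lambda>i. (w, zp i)) ` {m..})" by (rule finite_subset)
      then have "finite {m..}" by (rule finite_imageD) (simp add: inj_on_def zinj)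
      then show False using infinite_Ici by blast
    qed
  qed
  obtain N F where "composition_series \<L> M N F" using fl unfolding finite_length_def by (elim conjE exE)
  from M.composition_rank[OF this] obtain l :: "'m set \<Rightarrow> nat"
    where l: "\<forall>A. l A \<le> N" "\<forall>A B. submodule A \<L> M \<longrightarrow> submodule B \<L> M \<longrightarrow> A \<subset> B \<longrightarrow> l A < l B"
    by (elim exE conjE)
  \<comment> \<open>The rank drops at every step of the descending chain, but it starts at no more
    than \<open>N\<close>.\<close>
  have "l (U t) + t \<le> l (U 0)" for t
  proof (induction t)
    case (Suc t)
    have "l (U (Suc t)) < l (U t)"
      by (rule l(2)[THEN spec, THEN spec, THEN mp, THEN mp, THEN mp, OF Us Us strict])
    then show ?case using Suc by simp
  qed simp
  from this[of "Suc N"] show False using l(1)[THEN spec, of "U 0"] by simp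
qed

text \<open>Among the first \<open>card (verts E) + 1\<close> arrows two start at the same vertex,
  which yields a closed path. The \<open>d\<close> final arrows that decide membership in
  \<open>QQ\<close> lie behind it, so the monomial following the closed path is in \<open>QQ\<close>
  and \<open>cycle_not_finite_length\<close> applies.\<close>

lemma QQ_bounded:
  assumes fl: "finite_length \<L> M" and y: "y \<in> QQ" and nz: "y (j, u, fs) \<noteq> 0"
  shows "length fs < card (verts E) + d + 1"
proof (rule ccontr)
  assume "\<not> length fs < card (verts E) + d + 1"
  then have len: "card (verts E) + d + 1 \<le> length fs" by simp
  note jn = frmod_supportD(1)[OF QQ_carrier[OF y] nz] and p = frmod_supportD(2)[OF QQ_carrier[OF y] nz]
  let ?f = "\<lambda>i. head E (fs ! i)"
  have "set fs \<subseteq> arcs E" using p by (auto simp: paths_iff inverse_quiver_def)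
  then have "?f ` {..card (verts E)} \<subseteq> verts E" using len by (auto intro!: head_in_verts simp: subset_iff)
  then have "card (?f ` {..card (verts E)}) \<le> card (verts E)" by (intro card_mono) simp_all
  then have "\<not> inj_on ?f {..card (verts E)}" by (intro pigeonhole) simp
  then obtain a b where ab: "a \<le> card (verts E)" "b \<le> card (verts E)" "a \<noteq> b" "?f a = ?f b"
    unfolding inj_on_def by auto
  obtain i i' where i: "i < i'" "i' \<le> card (verts E)" "?f i = ?f i'"
  proof (cases "a < b")
    case True
    then show ?thesis using that[of a b] ab by simp
  next
    case False
    then show ?thesis using that[of b a] ab by simp
  qed
  let ?w = "?f i" and ?z = "drop i (take i' fs)" and ?t = "drop i' fs"
  have ne: "?z \<noteq> []" "?t \<noteq> []" "hd ?z = fs ! i" "hd ?t = fs ! i'"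
    using i len by (simp_all add: hd_drop_conv_nth)
  have "take i fs @ ?z @ ?t = fs"
    using i(1) by (metis append.assoc append_take_drop_id min.absorb1 order_less_imp_le take_take)
  then have "(u, take i fs @ ?z @ ?t) \<in> bpaths" using p by simp
  then have pz: "(pend (u, take i fs), ?z) \<in> bpaths" and pt: "(pend (pend (u, take i fs), ?z), ?t) \<in> bpaths"
    unfolding Eb.paths_append by simp_all
  have w: "pend (u, take i fs) = ?w" using bpaths_hd[OF pz ne(1)] ne(3) by simp
  have wz: "pend (?w, ?z) = ?w" using bpaths_hd[OF pt ne(2)] ne(4) i(3) w by simp
  have dl: "drop (length ?t - d) ?t = drop (length fs - d) fs" using i len by simp
  have "pmono 1 (j, ?w, ?t) \<in> QQ"
  proof (rule QQI)
    show "pmono 1 (j, ?w, ?t) \<in> carrier Fn" by (rule pmono_frmod[OF jn]) (use pt w wz in simp)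
    fix j' u' fs' assume "(pmono 1 (j, ?w, ?t) :: _ \<Rightarrow> 'k) (j', u', fs') \<noteq> 0"
    then have e: "j' = j" "fs' = ?t" by (simp_all add: pmono_def split: if_splits)
    have "d \<le> length ?t" using i len by simp
    then show "d \<le> length fs' \<and> (j', drop (length fs' - d) fs') \<in> CC"
      using QQD(2)[OF y nz] unfolding e dl by simp
  qed
  then show False using cycle_not_finite_length[OF fl _ wz ne(1)] pz w by simp
qed

text \<open>As \<open>QQ\<close> is bounded, every element of the free module is congruent modulo
  \<open>K0\<close> to one of degree below \<open>D\<close>. So the image \<open>?V\<close> of the
  free module in \<open>M\<close> is spanned by the images of finitely many monomials. Since
  \<open>M\<close> is the closure of \<open>?V\<close>, it is isomorphic to
  \<open>L \<otimes> ?V\<close> by \<open>tens_embedding\<close>.\<close>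

lemma tensor_presentation:
  assumes fl: "finite_length \<L> M"
  shows "\<exists>N :: ('v \<times> 'e list \<Rightarrow> 'k, nat \<Rightarrow> 'k) module.
    left_module \<R> N \<and> fin_dim (inverse_quiver E) N \<and> mod_isomorphic \<L> M (tensor_ext \<R> \<L> incl N)"
proof -
  define D where "D = card (verts E) + d + 1"
  obtain xs where xs: "set xs = monomials n D" using finite_list[OF finite_monomials] by (rule exE)
  let ?V = "\<pi> ` carrier Fn"
  have V: "submodule ?V \<R> (res M)" by (rule pi.h.submodule_image[OF Fr.N.submodule_carrier])
  have "\<exists>y. y \<in> carrier Fn \<and> (\<forall>x. y x \<noteq> 0 \<longrightarrow> x \<in> set xs) \<and> \<pi> y = v" if v: "v \<in> ?V" for v
  proof -
    from v obtain y where y: "v = \<pi> y" "y \<in> carrier Fn" by (rule imageE)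
    note y = y(2,1)
    obtain q where q: "q \<in> QQ" "\<exists>k\<in>K0. agree d y (\<lambda>x. q x + k x)" using decomposition[OF y(1)] by (rule bexE)
    obtain k where k: "k \<in> K0" "agree d y (\<lambda>x. q x + k x)" using q(2) by (rule bexE)
    have kc: "k \<in> carrier Fn" by (rule submodule_mem[OF K0 k(1)])
    have yk: "y \<ominus>\<^bsub>Fn\<^esub> k \<in> carrier Fn" by (rule Fr.N.minus_closed[OF y(1) kc])
    have "x \<in> set xs" if nz: "(y \<ominus>\<^bsub>Fn\<^esub> k) x \<noteq> 0" for x
    proof -
      obtain j u fs where x: "x = (j, u, fs)" by (cases x) auto
      have "length fs < D"
      proof (rule ccontr)
        assume l: "\<not> length fs < D"
        then have "y x = q x + k x" using agreeD[OF k(2), of fs j u] by (simp add: x D_def)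
        then have "q (j, u, fs) \<noteq> 0" using nz by (simp add: frmod_minus[OF y(1) kc] x)
        then show False using QQ_bounded[OF fl q(1)] l by (simp add: D_def)
      qed
      then show ?thesis using frmod_supportD[OF yk nz[unfolded x]] by (simp add: xs x monomials_def)
    qed
    moreover have "\<pi> (y \<ominus>\<^bsub>Fn\<^esub> k) = v"
      using pi.h.hom_diff[OF y(1) kc] pi_K0[OF k(1)] y(2) pi.h.hom_closed[OF y(1)] by (simp add: a_minus_def)
    ultimately show ?thesis using yk by (intro exI[of _ "y \<ominus>\<^bsub>Fn\<^esub> k"]) simp
  qed
  then have "\<forall>v\<in>?V. \<exists>y. y \<in> carrier Fn \<and> (\<forall>x. y x \<noteq> 0 \<longrightarrow> x \<in> set xs) \<and> \<pi> y = v" by (rule ballI)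
  then obtain lift where lift: "\<forall>v\<in>?V. lift v \<in> carrier Fn \<and> (\<forall>x. lift v x \<noteq> 0 \<longrightarrow> x \<in> set xs) \<and> \<pi> (lift v) = v"
    by (rule bchoice[THEN exE])
  \<comment> \<open>The lifts are chosen without regard to linearity, so \<open>\<phi>\<close> is
    just an injection into coefficient vectors; the module structure is transported along
    it.\<close>
  define \<phi> where "\<phi> v = (\<lambda>i. if i < length xs then lift v (xs ! i) else 0)" for v
  have inj: "inj_on \<phi> ?V"
  proof (rule inj_onI)
    fix v v' assume v: "v \<in> ?V" "v' \<in> ?V" "\<phi> v = \<phi> v'"
    note lv = lift[THEN bspec, OF v(1)] and lv' = lift[THEN bspec, OF v(2)]
    have "lift v x = lift v' x" for x
    proof (cases "x \<in> set xs")
      case True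
      then obtain i where i: "i < length xs" "x = xs ! i" unfolding in_set_conv_nth by (elim exE conjE) simp
      then show ?thesis using fun_cong[OF v(3), of i] by (simp add: \<phi>_def)
    next
      case False
      then have "lift v x = 0" "lift v' x = 0" using lv lv' by (cases x, blast)+
      then show ?thesis by simp
    qed
    then have "lift v = lift v'" by (rule ext)
    then have "\<pi> (lift v) = \<pi> (lift v')" by (rule arg_cong)
    then show "v = v'"
      unfolding lv[THEN conjunct2, THEN conjunct2] lv'[THEN conjunct2, THEN conjunct2] .
  qed
  let ?M1 = "(res M)\<lparr>carrier := ?V\<rparr>"
  let ?N = "transport \<phi> ?M1"
  have M1: "left_module \<R> ?M1" by (rule RM.N.submodule_left_module[OF V])
  have inj1: "inj_on \<phi> (carrier ?M1)" using inj by simp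
  note N = transport_module[OF M1 inj1]
  let ?s = "inv_into (carrier ?M1) \<phi>"
  interpret S: scalar_extension E K ?N by (intro scalar_extension.intro path_module.intro N(1) quiver_axioms)
  have sV: "?s ` carrier ?N = ?V"
    using inj by (simp add: transport_def image_image cong: image_cong)
  have s: "?s \<in> mod_hom \<R> ?N (res M)"
    by (rule mod_hom_extend[OF N(3)]) (rule submodule_subset[OF V])
  have sinj: "inj_on ?s (carrier ?N)" by (simp add: transport_def inj_on_inv_into)
  obtain \<Phi> where \<Phi>: "\<Phi> \<in> mod_hom \<L> S.tens M" "\<forall>x\<in>carrier ?N. \<Phi> (S.ten \<one>\<^bsub>\<L>\<^esub> x) = ?s x"
    using S.tens_universal[OF M.left_module_self s] by (rule bexE)
  have "inj_on \<Phi> (carrier S.tens)" "\<Phi> ` carrier S.tens = carrier M"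
    using S.tens_embedding[OF M.left_module_self s sinj \<Phi>(1)] \<Phi>(2) unfolding sV generated by simp_all
  then have "mod_isomorphic \<L> S.tens M"
    unfolding mod_isomorphic_def bij_betw_def using \<Phi>(1) by (intro bexI[of _ \<Phi>] conjI)
  then have iso: "mod_isomorphic \<L> M S.tens" by (rule mod_isomorphic_sym[OF S.tens_left_module])
  have piV: "\<pi> \<in> mod_hom \<R> Fn ?M1" by (rule mod_hom_corestrict[OF pi]) simp
  define \<chi> where "\<chi> y = \<phi> (\<pi> y)" for y
  have chi: "\<chi> \<in> mod_hom \<R> Fn ?N" unfolding \<chi>_def[abs_def] by (rule mod_hom_comp[OF piV N(2)])
  interpret chi: left_module_hom \<R> Fn ?N \<chi>
    by (rule left_module_homI[OF Fr.N.left_module_self N(1) chi])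
  let ?b = "\<lambda>x. \<chi> (pmono 1 x)"
  let ?B = "?b ` set xs"
  have mc: "pmono c x \<in> carrier Fn" if "x \<in> set xs" for c x
    using that pmono_frmod unfolding xs monomials_def by (cases x) simp
  have B: "finite ?B" "?B \<subseteq> carrier ?N" using mc chi.hom_closed by auto
  \<comment> \<open>Different monomials may have the same image in \<open>?B\<close>. Changing one
    coefficient at a time lets their contributions accumulate.\<close>
  have comb: "f \<in> carrier Fn \<and> (\<exists>c. \<chi> f = (\<Oplus>\<^bsub>?N\<^esub>b\<in>?B. path_scalar (inverse_quiver E) (c b :: 'k) \<odot>\<^bsub>?N\<^esub> b))"
    if "f \<in> carrier Fn" "\<And>x. f x \<noteq> 0 \<Longrightarrow> x \<in> set xs" for f
  proof (rule finite_support_induct[where f = f and S = "set xs"])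
    show "finite {x. f x \<noteq> 0}" using that(1) unfolding frmod_carrier by (elim conjE)
    show "x \<in> set xs" if "f x \<noteq> 0" for x by (rule \<open>\<And>x. f x \<noteq> 0 \<Longrightarrow> x \<in> set xs\<close>[OF that])
    show "(\<lambda>_. 0) \<in> carrier Fn \<and> (\<exists>c. \<chi> (\<lambda>_. 0) = (\<Oplus>\<^bsub>?N\<^esub>b\<in>?B. path_scalar (inverse_quiver E) (c b :: 'k) \<odot>\<^bsub>?N\<^esub> b))"
      using S.combination_zero[OF B] chi.hom_zero Fr.N.zero_closed[of n]
      by (intro conjI exI[of _ "\<lambda>_. 0"]) (simp_all add: frmod_simps(1))
  next
    fix f c p assume p: "p \<in> set xs"
      and IH: "f \<in> carrier Fn \<and> (\<exists>c. \<chi> f = (\<Oplus>\<^bsub>?N\<^esub>b\<in>?B. path_scalar (inverse_quiver E) (c b :: 'k) \<odot>\<^bsub>?N\<^esub> b))"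
    then obtain c' where f: "f \<in> carrier Fn"
      and c': "\<chi> f = (\<Oplus>\<^bsub>?N\<^esub>b\<in>?B. path_scalar (inverse_quiver E) (c' b :: 'k) \<odot>\<^bsub>?N\<^esub> b)" by (elim conjE exE)
    let ?p = "path_scalar (inverse_quiver E) c :: 'v \<times> 'e list \<Rightarrow> 'k"
    have "?p \<odot>\<^bsub>Fn\<^esub> pmono 1 p = pmono c p" unfolding frmod_scalar[OF mc[OF p]] by (auto simp: pmono_def)
    then have "(\<lambda>q. f q + pmono c p q) = f \<oplus>\<^bsub>Fn\<^esub> ?p \<odot>\<^bsub>Fn\<^esub> pmono 1 p" by (simp add: frmod_simps(2))
    moreover have pc: "?p \<odot>\<^bsub>Fn\<^esub> pmono 1 p \<in> carrier Fn" by (rule Fr.N.smult_closed[OF rscalar_carrier mc[OF p]])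
    ultimately have e: "\<chi> (\<lambda>q. f q + pmono c p q) = \<chi> f \<oplus>\<^bsub>?N\<^esub> ?p \<odot>\<^bsub>?N\<^esub> ?b p"
      using chi.hom_add[OF f pc] chi.hom_smult[OF rscalar_carrier mc[OF p]] by simp
    show "(\<lambda>q. f q + pmono c p q) \<in> carrier Fn \<and>
        (\<exists>c'. \<chi> (\<lambda>q. f q + pmono c p q) = (\<Oplus>\<^bsub>?N\<^esub>b\<in>?B. path_scalar (inverse_quiver E) (c' b :: 'k) \<odot>\<^bsub>?N\<^esub> b))"
      unfolding e c' S.combination_add[OF B imageI[OF p]]
      by (intro conjI frmod_add_closed[OF f mc[OF p]] exI, rule refl)
  qed
  have "fin_dim (inverse_quiver E) ?N"
    unfolding fin_dim_def
  proof (intro exI[of _ ?B] conjI ballI B)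
    fix x assume "x \<in> carrier ?N"
    then obtain v where v: "v \<in> ?V" "x = \<phi> v" by (auto simp: transport_def)
    note lv = lift[THEN bspec, OF v(1)]
    have "x = \<chi> (lift v)" unfolding \<chi>_def lv[THEN conjunct2, THEN conjunct2] by (rule v(2))
    moreover have "\<exists>c. \<chi> (lift v) = (\<Oplus>\<^bsub>?N\<^esub>b\<in>?B. path_scalar (inverse_quiver E) (c b :: 'k) \<odot>\<^bsub>?N\<^esub> b)"
      using comb[of "lift v"] lv by blast
    ultimately show "\<exists>c. x = (\<Oplus>\<^bsub>?N\<^esub>b\<in>?B. path_scalar (inverse_quiver E) (c b :: 'k) \<odot>\<^bsub>?N\<^esub> b)" by simp
  qed
  then show ?thesis using N(1) iso by (intro exI[of _ ?N] conjI)
qed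

end

lemma (in leavitt_module) presentation_exists:
  assumes fp: "fin_presented \<L> M"
  shows "\<exists>n \<pi> ks d. presented_module E M n \<pi> ks d"
proof -
  obtain n \<pi> ks where pi: "\<pi> \<in> mod_hom \<R> (frmod n) (res M)" "finite ks" "ks \<subseteq> carrier (frmod n)"
     "dcl (res M) (\<pi> ` carrier (frmod n)) = carrier M"
     "\<forall>k\<in>ks. \<pi> k = \<zero>\<^bsub>M\<^esub>"
     "\<forall>y\<in>carrier (frmod n). \<pi> y = \<zero>\<^bsub>M\<^esub> \<longrightarrow> y \<in> dcl (frmod n) (left_module.span \<R> (frmod n) ks)"
    using fin_presented_data[OF fp] by (elim exE conjE)
  have "finite (\<Union>k\<in>ks. (\<lambda>(j, u, fs). length fs) ` {x. k x \<noteq> 0})"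
    using pi(2,3) by (intro finite_UN_I finite_imageI) (auto simp: frmod_carrier)
  then obtain d where d: "\<forall>l\<in>(\<Union>k\<in>ks. (\<lambda>(j, u, fs). length fs) ` {x. k x \<noteq> 0}). l \<le> d"
    unfolding finite_nat_set_iff_bounded_le by (rule exE)
  \<comment> \<open>The successor makes the bound positive, as \<open>d_pos\<close> demands.\<close>
  have "length fs \<le> Suc d" if "k \<in> ks" "k (j, u, fs) \<noteq> 0" for k j u fs
  proof -
    have "length fs \<in> (\<lambda>(j, u, fs). length fs) ` {x. k x \<noteq> 0}"
      using that(2) by (intro image_eqI[of _ _ "(j, u, fs)"]) simp_all
    then show ?thesis using d that(1) by fastforce
  qed
  then have "presented_module E M n \<pi> ks (Suc d)"
    using pi by (intro presented_module.intro leavitt_module_axioms presented_module_axioms.intro) simp_all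
  then show ?thesis by (intro exI)
qed

theorem proposition5p9:
  fixes E :: "('v, 'e) pre_digraph"
    and R :: "('v \<times> 'e list \<Rightarrow> 'k::field) ring"
    and L :: "(unit \<times> ('v, 'e) lpa_gen list \<Rightarrow> 'k) set ring"
  assumes "fin_digraph E"
    and "R = path_algebra (inverse_quiver E)"
    and "L = leavitt E"
  shows
    "(\<forall>(N :: ('v \<times> 'e list \<Rightarrow> 'k, 'n) module) n F r.
        left_module R N \<and> fin_dim (inverse_quiver E) N \<and> composition_series R N n F \<and>
        card {j. j < n \<and> (\<exists>i \<in> verts E - sinks E.
                mod_isomorphic R (comp_factor N F j) (coker_nu E i))} = r \<longrightarrow>
        finite_length L (tensor_ext R L (lpa_incl E) N) \<and>
        module_length L (tensor_ext R L (lpa_incl E) N) = n - r)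
     \<and>
     (\<forall>M :: ((unit \<times> ('v, 'e) lpa_gen list \<Rightarrow> 'k) set, 'm) module.
        fin_presented L M \<longrightarrow>
        (\<exists>P. submodule P L M \<and> fin_generated L (M\<lparr>carrier := P\<rparr>) \<and>
             projective L (M\<lparr>carrier := P\<rparr>) \<and> finite_length L (mod_quot M P)))
     \<and>
     (\<forall>M :: ((unit \<times> ('v, 'e) lpa_gen list \<Rightarrow> 'k) set, 'm) module.
        fin_presented L M \<and> finite_length L M \<longrightarrow>
        (\<exists>N :: ('v \<times> 'e list \<Rightarrow> 'k, nat \<Rightarrow> 'k) module.
             left_module R N \<and> fin_dim (inverse_quiver E) N \<and>
             mod_isomorphic L M (tensor_ext R L (lpa_incl E) N)))"
proof -
  interpret quiver E "TYPE('k)" by (intro quiver.intro assms(1))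
  show ?thesis
    unfolding assms(2,3)
  proof (intro conjI allI impI; (elim conjE)?)
    fix N :: "('v \<times> 'e list \<Rightarrow> 'k, 'n) module" and n F r
    assume N: "left_module \<R> N" and cs: "composition_series \<R> N n F"
      and r: "card {j. j < n \<and> (\<exists>i\<in>verts E - sinks E. mod_isomorphic \<R> (comp_factor N F j) (coker_nu E i))} = r"
    interpret scalar_extension E "TYPE('k)" N
      by (intro scalar_extension.intro path_module.intro N quiver_axioms)
    show "finite_length \<L> tens" "module_length \<L> tens = n - r"
      using tens_length[OF cs r] by simp_all
  next
    fix M :: "((unit \<times> ('v, 'e) lpa_gen list \<Rightarrow> 'k) set, 'm) module"
    assume fp: "fin_presented \<L> M"
    then have M: "left_module \<L> M" by (simp add: fin_presented_def)
    interpret leavitt_module E "TYPE('k)" M by (intro leavitt_module.intro M quiver_axioms)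
    from presentation_exists[OF fp] obtain n \<pi> ks d where "presented_module E M n \<pi> ks d" by (elim exE)
    then interpret presented_module E "TYPE('k)" M n \<pi> ks d .
    show "\<exists>P. submodule P \<L> M \<and> fin_generated \<L> (M\<lparr>carrier := P\<rparr>) \<and>
        projective \<L> (M\<lparr>carrier := P\<rparr>) \<and> finite_length \<L> (mod_quot M P)"
      by (intro exI[of _ PP] conjI PP PP_fin_generated PP_projective quotient_finite_length)
  next
    fix M :: "((unit \<times> ('v, 'e) lpa_gen list \<Rightarrow> 'k) set, 'm) module"
    assume fp: "fin_presented \<L> M" and fl: "finite_length \<L> M"
    from fp have M: "left_module \<L> M" by (simp add: fin_presented_def)
    interpret leavitt_module E "TYPE('k)" M by (intro leavitt_module.intro M quiver_axioms)
    from presentation_exists[OF fp] obtain n \<pi> ks d where "presented_module E M n \<pi> ks d" by (elim exE)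
    then interpret presented_module E "TYPE('k)" M n \<pi> ks d .
    show "\<exists>N :: ('v \<times> 'e list \<Rightarrow> 'k, nat \<Rightarrow> 'k) module. left_module \<R> N \<and>
        fin_dim (inverse_quiver E) N \<and> mod_isomorphic \<L> M (tensor_ext \<R> \<L> incl N)"
      by (rule tensor_presentation[OF fl])
  qed
qed

end
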